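(* Let $(C,\Delta_C)$ and $(A,\Delta_A)$ be quantum groups obtained from modular multiplicative unitaries $\mathbb W^C\in\mathcal U(\mathcal H_C\otimes\mathcal H_C)$ and $\mathbb W^A\in\mathcal U(\mathcal H_A\otimes\mathcal H_A)$. A unitary $\mathbb V\in\mathcal U(\mathcal H_C\otimes\mathcal H_A)$ comes from a bicharacter $V\in\mathcal U\mathcal M(\hat C\otimes A)$ (that is, is the image of such a $V$ under the representation of $\hat C\otimes A$ on $\mathcal H_C\otimes\mathcal H_A$; the bicharacter $V$ is then necessarily unique) if and only if $$\mathbb V_{23}\mathbb W^C_{12}=\mathbb W^C_{12}\mathbb V_{13}\mathbb V_{23}\quad\text{in }\mathcal U(\mathcal H_C\otimes\mathcal H_C\otimes\mathcal H_A),$$ $$\mathbb W^A_{23}\mathbb V_{12}=\mathbb V_{12}\mathbb V_{13}\mathbb W^A_{23}\quad\text{in }\mathcal U(\mathcal H_C\otimes\mathcal H_A\otimes\mathcal H_A).$$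
   Context: Tensor products of $C^*$-algebras are spatial; $\mathcal M(A)$ is the multiplier algebra, $\mathcal U\mathcal M(A)$ its unitary group, $\mathcal U(\mathcal H)$ the unitary group on $\mathcal H$; leg numbering notation is used. A unitary $\mathbb W$ on $\mathcal H\otimes\mathcal H$ is multiplicative if $\mathbb W_{23}\mathbb W_{12}=\mathbb W_{12}\mathbb W_{13}\mathbb W_{23}$. It is modular if there are positive self-adjoint operators $\hat Q,Q$ on $\mathcal H$ with trivial kernels and a unitary $\widetilde{\mathbb W}$ on $\overline{\mathcal H}\otimes\mathcal H$ ($\overline{\mathcal H}$ the complex-conjugate Hilbert space) such that $\mathbb W^*(\hat Q\otimes Q)\mathbb W=\hat Q\otimes Q$ and $(x\otimes y\mid\mathbb W\mid z\otimes u)=(\overline z\otimes Qy\mid\widetilde{\mathbb W}\mid\overline x\otimes Q^{-1}u)$ for all $x,z\in\mathcal H$, $y\in\mathrm{dom}(Q)$, $u\in\mathrm{dom}(Q^{-1})$, where $(x\mid T\mid y):=(x\mid Ty)$. The quantum group obtained from a modular multiplicative unitary $\mathbb W^C$ on $\mathcal H_C\otimes\mathcal H_C$ is $(C,\Delta_C)$, where $C\subseteq\mathbb B(\mathcal H_C)$ is the norm closure of $\{(\omega\otimes\mathrm{id})(\mathbb W^C):\omega\in\mathbb B(\mathcal H_C)_*\}$ and $\Delta_C(x)=\mathbb W^C(x\otimes1)(\mathbb W^C)^*$; its dual is $(\hat C,\Delta_{\hat C})$, where $\hat C\subseteq\mathbb B(\mathcal H_C)$ is the norm closure of $\{(\mathrm{id}\otimes\omega)((\mathbb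 W^C)^* ):\omega\in\mathbb B(\mathcal H_C)_*\}$ and $\Delta_{\hat C}(y)=\Sigma(\mathbb W^C)^*(1\otimes y)\mathbb W^C\Sigma$ with $\Sigma$ the coordinate flip. (It is known that $C,\hat C$ are nondegenerate $C^*$-algebras, $\Delta_C,\Delta_{\hat C}$ are comultiplications and $\mathbb W^C\in\mathcal U\mathcal M(\hat C\otimes C)$.) Similarly for $A$. A bicharacter from $C$ to $A$ is a unitary $V\in\mathcal U\mathcal M(\hat C\otimes A)$ with $(\Delta_{\hat C}\otimes\mathrm{id}_A)V=V_{23}V_{13}$ in $\mathcal U\mathcal M(\hat C\otimes\hat C\otimes A)$ and $(\mathrm{id}_{\hat C}\otimes\Delta_A)V=V_{12}V_{13}$ in $\mathcal U\mathcal M(\hat C\otimes A\otimes A)$. *)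

theory Defs
  imports "HOL-Analysis.Analysis"
begin

section \<open>Complex Hilbert spaces\<close>

class scaleC =
  fixes scaleC :: "complex \<Rightarrow> 'a \<Rightarrow> 'a"  (infixr "*\<^sub>C" 75)

class cinner =
  fixes cinner :: "'a \<Rightarrow> 'a \<Rightarrow> complex"

text \<open>A complex Hilbert space is a complete real inner product space together with a compatible
  complex structure. The complex inner product is linear in its \<^emph>\<open>second\<close> argument.\<close>

class chilbert_space = real_inner + banach + scaleC + cinner +
  assumes scaleC_add_right: "c *\<^sub>C (x + y) = c *\<^sub>C x + c *\<^sub>C y"
    and scaleC_add_left: "(c + d) *\<^sub>C x = c *\<^sub>C x + d *\<^sub>C x"
    and scaleC_scaleC: "c *\<^sub>C d *\<^sub>C x = (c * d) *\<^sub>C x"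
    and scaleR_scaleC: "r *\<^sub>R x = complex_of_real r *\<^sub>C x"
    and cinner_add_right: "cinner x (y + z) = cinner x y + cinner x z"
    and cinner_scaleC_right: "cinner x (c *\<^sub>C y) = c * cinner x y"
    and cinner_commute: "cinner x y = cnj (cinner y x)"
    and inner_eq_Re_cinner: "inner x y = Re (cinner x y)"
begin

lemma scaleC_one [simp]: "1 *\<^sub>C x = x"
  by (metis scaleR_scaleC scaleR_one of_real_1)

lemma cinner_add_left: "cinner (x + y) z = cinner x z + cinner y z"
  by (metis cinner_add_right cinner_commute complex_cnj_add)

lemma cinner_scaleC_left: "cinner (c *\<^sub>C x) y = cnj c * cinner x y"
  by (metis cinner_scaleC_right cinner_commute complex_cnj_mult)

lemma cinner_zero_right [simp]: "cinner x 0 = 0"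
  using cinner_add_right[of x 0 0] by simp

lemma cinner_zero_left [simp]: "cinner 0 x = 0"
  using cinner_add_left[of 0 0 x] by simp

lemma cinner_self: "cinner x x = complex_of_real ((norm x)\<^sup>2)"
proof -
  have "Im (cinner x x) = 0"
    using cinner_commute[of x x] by (simp add: complex_eq_iff)
  moreover have "Re (cinner x x) = (norm x)\<^sup>2"
    by (simp add: inner_eq_Re_cinner[symmetric] power2_norm_eq_inner)
  ultimately show ?thesis by (simp add: complex_eq_iff)
qed

lemma cinner_diff_right: "cinner x (y - z) = cinner x y - cinner x z"
  using cinner_add_right[of x "y - z" z] by simp

lemma cinner_diff_left: "cinner (x - y) z = cinner x z - cinner y z"
  using cinner_add_left[of "x - y" y z] by simp

lemma cinner_scaleR_right: "cinner x (r *\<^sub>R y) = complex_of_real r * cinner x y"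
  by (simp add: scaleR_scaleC cinner_scaleC_right)

lemma cinner_scaleR_left: "cinner (r *\<^sub>R x) y = complex_of_real r * cinner x y"
  by (simp add: scaleR_scaleC cinner_scaleC_left)

lemma cinner_sum_right: "cinner x (sum f A) = (\<Sum>i\<in>A. cinner x (f i))"
  by (induction A rule: infinite_finite_induct) (auto simp: cinner_add_right)

lemma cinner_sum_left: "cinner (sum f A) x = (\<Sum>i\<in>A. cinner (f i) x)"
  by (induction A rule: infinite_finite_induct) (auto simp: cinner_add_left)

lemma norm_scaleC: "norm (c *\<^sub>C x) = cmod c * norm x"
proof -
  have "complex_of_real ((norm (c *\<^sub>C x))\<^sup>2) = cnj c * (c * cinner x x)"
    by (simp only: cinner_self[symmetric] cinner_scaleC_left cinner_scaleC_right mult.left_commute)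
  also have "\<dots> = (c * cnj c) * cinner x x"
    by (simp only: mult.assoc mult.left_commute)
  also have "c * cnj c = complex_of_real ((cmod c)\<^sup>2)"
    using complex_norm_square[of c] by simp
  also have "complex_of_real ((cmod c)\<^sup>2) * cinner x x = complex_of_real ((cmod c * norm x)\<^sup>2)"
    by (simp add: cinner_self power_mult_distrib)
  finally have "complex_of_real ((norm (c *\<^sub>C x))\<^sup>2) = complex_of_real ((cmod c * norm x)\<^sup>2)" .
  then have "(norm (c *\<^sub>C x))\<^sup>2 = (cmod c * norm x)\<^sup>2"
    using of_real_eq_iff by blast
  then show ?thesis by (simp add: power2_eq_iff_nonneg)
qed

lemma cmod_cinner_le: "cmod (cinner x y) \<le> norm x * norm y"
proof -
  obtain c where c: "cmod c = 1" "complex_of_real (cmod (cinner x y)) = c * cinner x y"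
  proof (cases "cinner x y = 0")
    case True
    show ?thesis by (rule that[of 1]) (simp_all add: True)
  next
    case False
    show ?thesis
      by (rule that[of "complex_of_real (cmod (cinner x y)) / cinner x y"])
        (use False in \<open>auto simp: norm_divide\<close>)
  qed
  have "cmod (cinner x y) = Re (c * cinner x y)"
    using c by (metis Re_complex_of_real)
  also have "\<dots> = inner x (c *\<^sub>C y)"
    by (simp add: inner_eq_Re_cinner cinner_scaleC_right)
  also have "\<dots> \<le> norm x * norm (c *\<^sub>C y)"
    by (rule norm_cauchy_schwarz)
  finally show ?thesis using c by (simp add: norm_scaleC)
qed

end

lemma bounded_linear_cinner_right:
  fixes x :: "'a::chilbert_space"
  shows "bounded_linear (cinner x)"
  by (rule bounded_linear_intro[where K = "norm x"])
    (simp_all add: cinner_add_right cinner_scaleR_right scaleR_conv_of_real cmod_cinner_le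
      mult.commute[of "norm _" "norm x"])

lemma bounded_linear_cinner_left:
  fixes x :: "'a::chilbert_space"
  shows "bounded_linear (\<lambda>y. cinner y x)"
  by (rule bounded_linear_intro[where K = "norm x"])
    (simp_all add: cinner_add_left cinner_scaleR_left scaleR_conv_of_real cmod_cinner_le)


section \<open>Orthonormal bases\<close>

definition is_onb :: "'a::chilbert_space set \<Rightarrow> bool" where
  "is_onb B \<longleftrightarrow> (\<forall>e\<in>B. \<forall>f\<in>B. cinner e f = (if e = f then 1 else 0)) \<and>
     (\<forall>x. (\<forall>e\<in>B. cinner e x = 0) \<longrightarrow> x = 0)"

lemma ex_onb: "\<exists>B::'a::chilbert_space set. is_onb B"
proof -
  define ON where "ON = {B::'a set. \<forall>e\<in>B. \<forall>f\<in>B. cinner e f = (if e = f then 1 else 0)}"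
  have "\<exists>M\<in>ON. \<forall>X\<in>ON. M \<subseteq> X \<longrightarrow> X = M"
  proof (rule subset_Zorn')
    fix C assume C: "subset.chain ON C"
    show "\<Union>C \<in> ON"
      unfolding ON_def
    proof (intro CollectI ballI)
      fix e f assume "e \<in> \<Union>C" "f \<in> \<Union>C"
      then obtain X Y where XY: "X \<in> C" "e \<in> X" "Y \<in> C" "f \<in> Y" by blast
      moreover have "X \<subseteq> Y \<or> Y \<subseteq> X" "X \<in> ON" "Y \<in> ON"
        using C XY by (auto simp: subset_chain_def)
      ultimately show "cinner e f = (if e = f then 1 else 0)"
        unfolding ON_def by blast
    qed
  qed
  then obtain M where M: "M \<in> ON" "\<And>X. X \<in> ON \<Longrightarrow> M \<subseteq> X \<Longrightarrow> X = M" by blast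
  have "x = 0" if x: "\<forall>e\<in>M. cinner e x = 0" for x
  proof (rule ccontr)
    assume "x \<noteq> 0"
    define u where "u = (1 / norm x) *\<^sub>R x"
    have u1: "cinner u u = 1"
      using \<open>x \<noteq> 0\<close> by (simp add: u_def cinner_self)
    have u2: "cinner e u = 0" if "e \<in> M" for e
      using x that by (simp add: u_def cinner_scaleR_right)
    have u3: "cinner u e = 0" if "e \<in> M" for e
      using u2[OF that] cinner_commute[of u e] by simp
    have "insert u M \<in> ON"
      using M(1) u1 u2 u3 unfolding ON_def by auto
    then have "u \<in> M" using M(2)[of "insert u M"] by blast
    then show False using u1 u2 by force
  qed
  then have "is_onb M"
    using M(1) unfolding is_onb_def ON_def by blast
  then show ?thesis by blast
qed

definition onb :: "'a::chilbert_space set" where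
  "onb = (SOME B. is_onb B)"

lemma is_onb_onb: "is_onb onb"
  unfolding onb_def using ex_onb by (rule someI_ex)

lemma cinner_onb: "e \<in> onb \<Longrightarrow> f \<in> onb \<Longrightarrow> cinner e f = (if e = f then 1 else 0)"
  using is_onb_onb unfolding is_onb_def by blast

lemma onb_total: "(\<And>e. e \<in> onb \<Longrightarrow> cinner e x = 0) \<Longrightarrow> x = 0"
  using is_onb_onb unfolding is_onb_def by blast

lemma cinner_onb_sum:
  assumes "finite F" "F \<subseteq> onb" "e \<in> onb"
  shows "cinner e (\<Sum>f\<in>F. c f *\<^sub>C f) = (if e \<in> F then c e else 0)"
proof -
  have "cinner e (\<Sum>f\<in>F. c f *\<^sub>C f) = (\<Sum>f\<in>F. if e = f then c f else 0)"
    unfolding cinner_sum_right using assms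
    by (intro sum.cong) (auto simp: cinner_scaleC_right cinner_onb)
  then show ?thesis using assms(1) by simp
qed

lemma norm_onb_sum:
  assumes "finite F" "F \<subseteq> onb"
  shows "(norm (\<Sum>f\<in>F. c f *\<^sub>C f))\<^sup>2 = (\<Sum>f\<in>F. (cmod (c f))\<^sup>2)"
proof -
  have "complex_of_real ((norm (\<Sum>f\<in>F. c f *\<^sub>C f))\<^sup>2)
      = (\<Sum>e\<in>F. cnj (c e) * cinner e (\<Sum>f\<in>F. c f *\<^sub>C f))"
    unfolding cinner_self[symmetric] by (subst cinner_sum_left) (simp add: cinner_scaleC_left)
  also have "\<dots> = (\<Sum>e\<in>F. cnj (c e) * c e)"
    using assms by (intro sum.cong refl) (simp add: cinner_onb_sum subset_iff)
  also have "\<dots> = complex_of_real (\<Sum>f\<in>F. (cmod (c f))\<^sup>2)"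
    by (simp add: complex_norm_square mult.commute del: of_real_power)
  finally show ?thesis using of_real_eq_iff by blast
qed

lemma norm_diff_onb_sum:
  assumes "finite F" "F \<subseteq> onb"
  shows "(norm (x - (\<Sum>e\<in>F. cinner e x *\<^sub>C e)))\<^sup>2 = (norm x)\<^sup>2 - (\<Sum>e\<in>F. (cmod (cinner e x))\<^sup>2)"
proof -
  let ?s = "\<Sum>e\<in>F. cinner e x *\<^sub>C e"
  have "cinner ?s x = (\<Sum>e\<in>F. cnj (cinner e x) * cinner e x)"
    by (simp add: cinner_sum_left cinner_scaleC_left)
  also have "\<dots> = complex_of_real (\<Sum>f\<in>F. (cmod (cinner f x))\<^sup>2)"
    by (simp add: complex_norm_square mult.commute del: of_real_power)
  finally have "inner ?s x = (\<Sum>f\<in>F. (cmod (cinner f x))\<^sup>2)"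
    by (simp add: inner_eq_Re_cinner)
  moreover have "(norm (x - ?s))\<^sup>2 = (norm x)\<^sup>2 - 2 * inner ?s x + (norm ?s)\<^sup>2"
    by (simp add: power2_norm_eq_inner inner_diff inner_commute)
  ultimately show ?thesis by (simp add: norm_onb_sum[OF assms])
qed

lemma bessel:
  assumes "finite F" "F \<subseteq> onb"
  shows "(\<Sum>e\<in>F. (cmod (cinner e x))\<^sup>2) \<le> (norm x)\<^sup>2"
  using norm_diff_onb_sum[OF assms, of x] by (smt (verit) zero_le_power2)

lemma summable_onb: "(\<lambda>e. (cmod (cinner e x))\<^sup>2) summable_on onb"
  by (rule nonneg_bdd_above_summable_on)
    (auto intro!: bdd_aboveI[where M = "(norm x)\<^sup>2"] bessel)

lemma onb_expansion: "((\<lambda>e. cinner e x *\<^sub>C e) has_sum (x::'a::chilbert_space)) onb"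
proof -
  define c where "c e = (cmod (cinner e x))\<^sup>2" for e :: 'a
  define s where "s F = (\<Sum>e\<in>F. cinner e x *\<^sub>C e)" for F :: "'a set"
  define S where "S = infsum c onb"
  have hs: "(c has_sum S) onb"
    unfolding S_def c_def using summable_onb has_sum_infsum by blast
  have le: "sum c F \<le> S" if "finite F" "F \<subseteq> onb" for F
    unfolding S_def c_def using summable_onb that
    by (intro finite_sum_le_infsum) auto
  have ex: "\<exists>F. finite F \<and> F \<subseteq> onb \<and> S - sum c F < \<epsilon>" if "\<epsilon> > 0" for \<epsilon>
  proof -
    have "\<forall>\<^sub>F F in finite_subsets_at_top onb. dist (sum c F) S < \<epsilon>"
      using hs that unfolding has_sum_def tendsto_iff by blast
    then obtain F where "finite F" "F \<subseteq> onb" "dist (sum c F) S < \<epsilon>"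
      unfolding eventually_finite_subsets_at_top by blast
    then show ?thesis using le by (intro exI[of _ F]) (auto simp: dist_real_def)
  qed
  have small: "(norm (s (F \<union> G) - s F))\<^sup>2 \<le> S - sum c F"
    if "finite F" "F \<subseteq> onb" "finite G" "G \<subseteq> onb" for F G
  proof -
    have "s (F \<union> G) - s F = s (G - F)"
      unfolding s_def using that sum.union_disjoint[of F "G - F" "\<lambda>e. cinner e x *\<^sub>C e"] by simp
    then have "(norm (s (F \<union> G) - s F))\<^sup>2 = sum c (G - F)"
      using that norm_onb_sum[of "G - F" "\<lambda>e. cinner e x"] unfolding s_def c_def by auto
    also have "\<dots> = sum c (F \<union> G) - sum c F"
      using that sum.union_disjoint[of F "G - F" c] by simp
    also have "\<dots> \<le> S - sum c F" using le[of "F \<union> G"] that by simp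
    finally show ?thesis .
  qed
  have "\<forall>n. \<exists>F. finite F \<and> F \<subseteq> onb \<and> S - sum c F < (1 / real (Suc n))\<^sup>2"
    using ex by simp
  then obtain F where F: "\<And>n. finite (F n)" "\<And>n. F n \<subseteq> onb"
    "\<And>n. S - sum c (F n) < (1 / real (Suc n))\<^sup>2"
    by metis
  have d: "norm (s (F n \<union> F m) - s (F n)) < 1 / real (Suc n)" for n m
    by (rule power2_less_imp_less[OF order_le_less_trans[OF small[OF F(1,2) F(1,2)] F(3)]]) simp
  have "Cauchy (\<lambda>n. s (F n))"
  proof (rule metric_CauchyI)
    fix e :: real assume "e > 0"
    then obtain N where N: "1 / real (Suc N) < e / 2"
      using nat_approx_posE[of "e/2"] by auto
    show "\<exists>M. \<forall>m\<ge>M. \<forall>n\<ge>M. dist (s (F m)) (s (F n)) < e"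
    proof (intro exI allI impI)
      fix m n assume mn: "m \<ge> N" "n \<ge> N"
      have "1 / real (Suc m) \<le> 1 / real (Suc N)" "1 / real (Suc n) \<le> 1 / real (Suc N)"
        using mn by (auto intro!: divide_left_mono)
      then have mn': "1 / real (Suc m) < e / 2" "1 / real (Suc n) < e / 2"
        using N by linarith+
      have "dist (s (F m)) (s (F n))
          \<le> dist (s (F m \<union> F n)) (s (F m)) + dist (s (F m \<union> F n)) (s (F n))"
        by (rule dist_triangle3)
      also have "\<dots> = norm (s (F m \<union> F n) - s (F m)) + norm (s (F n \<union> F m) - s (F n))"
        by (simp add: dist_norm Un_commute)
      finally have "dist (s (F m)) (s (F n))
          \<le> norm (s (F m \<union> F n) - s (F m)) + norm (s (F n \<union> F m) - s (F n))" .
      then show "dist (s (F m)) (s (F n)) < e"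
        using d[of m n] d[of n m] mn' by linarith
    qed
  qed
  then obtain y where y: "(\<lambda>n. s (F n)) \<longlonglongrightarrow> y"
    using Cauchy_convergent_iff convergent_def by blast
  have inv: "(\<lambda>n. 1 / real (Suc n)) \<longlonglongrightarrow> 0"
    by (rule LIMSEQ_Suc) (rule lim_const_over_n)
  have "cinner e (x - y) = 0" if e: "e \<in> onb" for e
  proof -
    have "cmod (cinner e (x - s (F n))) \<le> 1 / real (Suc n)" for n
    proof -
      have eq: "cinner e (x - s (F n)) = (if e \<in> F n then 0 else cinner e x)"
        unfolding cinner_diff_right s_def cinner_onb_sum[OF F(1,2) e] by simp
      show ?thesis
      proof (cases "e \<in> F n")
        case False
        have "c e + sum c (F n) \<le> S"
          using e F(1,2) False le[of "insert e (F n)"] by simp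
        then have "(cmod (cinner e x))\<^sup>2 \<le> (1 / real (Suc n))\<^sup>2"
          using F(3)[of n] unfolding c_def by linarith
        then have "cmod (cinner e x) \<le> 1 / real (Suc n)"
          by (rule power2_le_imp_le) simp
        then show ?thesis unfolding eq using False by simp
      qed (simp add: eq)
    qed
    then have "(\<lambda>n. cinner e (x - s (F n))) \<longlonglongrightarrow> 0"
      by (intro Lim_null_comparison[OF _ inv] always_eventually) auto
    moreover have "(\<lambda>n. cinner e (x - s (F n))) \<longlonglongrightarrow> cinner e (x - y)"
      by (intro bounded_linear.tendsto[OF bounded_linear_cinner_right] tendsto_intros y)
    ultimately show ?thesis using LIMSEQ_unique by blast
  qed
  then have "x = y" using onb_total[of "x - y"] by simp
  have "(\<lambda>n. (norm (x - s (F n)))\<^sup>2) \<longlonglongrightarrow> (norm (x - y))\<^sup>2"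
    by (intro tendsto_intros y)
  moreover have "(\<lambda>n. (norm (x - s (F n)))\<^sup>2) \<longlonglongrightarrow> (norm x)\<^sup>2 - S"
  proof -
    have "(\<lambda>n. S - sum c (F n)) \<longlonglongrightarrow> 0"
    proof (rule Lim_null_comparison[where g = "\<lambda>n. (1 / real (Suc n))\<^sup>2"])
      show "\<forall>\<^sub>F n in sequentially. norm (S - sum c (F n)) \<le> (1 / real (Suc n))\<^sup>2"
        using F(3) le[OF F(1,2)] by (intro always_eventually) (auto simp: less_imp_le)
      show "(\<lambda>n. (1 / real (Suc n))\<^sup>2) \<longlonglongrightarrow> 0"
        using tendsto_power[OF inv, of 2] by simp
    qed
    then have "(\<lambda>n. (norm x)\<^sup>2 - S + (S - sum c (F n))) \<longlonglongrightarrow> (norm x)\<^sup>2 - S + 0"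
      by (intro tendsto_intros)
    then show ?thesis
      by (simp add: norm_diff_onb_sum[OF F(1,2)] s_def c_def)
  qed
  ultimately have "(norm x)\<^sup>2 = S"
    using \<open>x = y\<close> LIMSEQ_unique by fastforce
  have "((\<lambda>F. sqrt ((norm x)\<^sup>2 - sum c F)) \<longlongrightarrow> sqrt ((norm x)\<^sup>2 - S)) (finite_subsets_at_top onb)"
    using hs unfolding has_sum_def by (intro tendsto_intros)
  moreover have "\<forall>\<^sub>F F in finite_subsets_at_top onb.
      norm (s F - x) = sqrt ((norm x)\<^sup>2 - sum c F)"
    by (rule eventually_finite_subsets_at_top_weakI)
      (simp add: c_def s_def norm_diff_onb_sum[symmetric] norm_minus_commute)
  ultimately have "((\<lambda>F. norm (s F - x)) \<longlongrightarrow> 0) (finite_subsets_at_top onb)"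
    using \<open>(norm x)\<^sup>2 = S\<close> by (simp add: tendsto_cong)
  then have "((\<lambda>F. s F - x) \<longlongrightarrow> 0) (finite_subsets_at_top onb)"
    by (rule tendsto_norm_zero_cancel)
  then show ?thesis
    unfolding has_sum_def s_def[symmetric] by (simp add: LIM_zero_iff)
qed

lemma parseval:
  fixes x y :: "'a::chilbert_space"
  shows "((\<lambda>e. cnj (cinner e x) * cinner e y) has_sum cinner x y) onb"
proof -
  have "((\<lambda>z. cinner z y) \<circ> (\<lambda>e. cinner e x *\<^sub>C e) has_sum cinner x y) onb"
    using has_sum_bounded_linear[OF bounded_linear_cinner_left onb_expansion] by (simp add: o_def)
  then show ?thesis by (simp add: o_def cinner_scaleC_left)
qed


section \<open>The tensor product of Hilbert spaces\<close>

definition l2 :: "('i \<Rightarrow> complex) \<Rightarrow> bool" where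
  "l2 f \<longleftrightarrow> (\<lambda>i. (cmod (f i))\<^sup>2) summable_on UNIV"

lemma l2_zero [simp]: "l2 (\<lambda>_. 0)"
  by (simp add: l2_def)

lemma l2_scale:
  assumes "l2 f"
  shows "l2 (\<lambda>i. c * f i)"
  using summable_on_cmult_right[OF assms[unfolded l2_def], of "(cmod c)\<^sup>2"]
  by (simp add: l2_def norm_mult power_mult_distrib)

lemma l2_add:
  assumes "l2 f" "l2 g"
  shows "l2 (\<lambda>i. f i + g i)"
  unfolding l2_def
proof (rule summable_on_comparison_test)
  show "(\<lambda>i. 2 * (cmod (f i))\<^sup>2 + 2 * (cmod (g i))\<^sup>2) summable_on UNIV"
    using assms unfolding l2_def by (intro summable_on_add summable_on_cmult_right)
  show "(cmod (f i + g i))\<^sup>2 \<le> 2 * (cmod (f i))\<^sup>2 + 2 * (cmod (g i))\<^sup>2" for i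
  proof -
    have "(cmod (f i + g i))\<^sup>2 \<le> (cmod (f i) + cmod (g i))\<^sup>2"
      by (intro power_mono norm_triangle_ineq) simp
    also have "\<dots> \<le> 2 * (cmod (f i))\<^sup>2 + 2 * (cmod (g i))\<^sup>2"
      using sum_squares_bound[of "cmod (f i)" "cmod (g i)"] by (simp add: power2_sum)
    finally show ?thesis .
  qed
qed simp

lemma l2_uminus: "l2 f \<Longrightarrow> l2 (\<lambda>i. - f i)"
  using l2_scale[of f "-1"] by simp

lemma l2_diff: "l2 f \<Longrightarrow> l2 g \<Longrightarrow> l2 (\<lambda>i. f i - g i)"
  using l2_add[of f "\<lambda>i. - g i"] l2_uminus[of g] by simp

lemma l2_prod_summable:
  assumes "l2 f" "l2 g"
  shows "(\<lambda>i. cnj (f i) * g i) summable_on UNIV"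
proof (rule abs_summable_summable, rule summable_on_comparison_test)
  show "(\<lambda>i. (cmod (f i))\<^sup>2 + (cmod (g i))\<^sup>2) summable_on UNIV"
    using assms unfolding l2_def by (rule summable_on_add)
  show "cmod (cnj (f i) * g i) \<le> (cmod (f i))\<^sup>2 + (cmod (g i))\<^sup>2" for i
  proof -
    have "cmod (f i) * cmod (g i) \<le> 2 * cmod (f i) * cmod (g i)"
      by (simp add: mult_right_mono)
    also have "\<dots> \<le> (cmod (f i))\<^sup>2 + (cmod (g i))\<^sup>2"
      by (rule sum_squares_bound)
    finally show ?thesis by (simp add: norm_mult)
  qed
qed simp

text \<open>The tensor product of \<open>'a\<close> and \<open>'b\<close> is realised as the space of square-summable
  coefficient families on the product of the chosen orthonormal bases. It is characterised,
  independently of these bases, by \<open>tensor_add_left\<close> to \<open>tensor_scaleC_right\<close>,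
  \<open>cinner_tensor\<close> and \<open>tensor_dense\<close> below.\<close>

typedef (overloaded) ('a, 'b) tensor =
  "{f :: 'a::chilbert_space \<times> 'b::chilbert_space \<Rightarrow> complex.
      (\<forall>p. p \<notin> onb \<times> onb \<longrightarrow> f p = 0) \<and> l2 f}"
  morphisms tcoeff Abs_tensor
  by (rule exI[of _ "\<lambda>_. 0"]) simp

type_notation tensor (infixr "\<otimes>\<^sub>H" 25)

setup_lifting type_definition_tensor

instantiation tensor :: (chilbert_space, chilbert_space)
  "{zero, plus, minus, uminus, scaleR, scaleC, cinner}"
begin

lift_definition zero_tensor :: "'a \<otimes>\<^sub>H 'b" is "\<lambda>_. 0" by simp
lift_definition plus_tensor :: "'a \<otimes>\<^sub>H 'b \<Rightarrow> 'a \<otimes>\<^sub>H 'b \<Rightarrow> 'a \<otimes>\<^sub>H 'b"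
  is "\<lambda>f g p. f p + g p" by (simp add: l2_add)
lift_definition minus_tensor :: "'a \<otimes>\<^sub>H 'b \<Rightarrow> 'a \<otimes>\<^sub>H 'b \<Rightarrow> 'a \<otimes>\<^sub>H 'b"
  is "\<lambda>f g p. f p - g p" by (simp add: l2_diff)
lift_definition uminus_tensor :: "'a \<otimes>\<^sub>H 'b \<Rightarrow> 'a \<otimes>\<^sub>H 'b"
  is "\<lambda>f p. - f p" by (simp add: l2_uminus)
lift_definition scaleR_tensor :: "real \<Rightarrow> 'a \<otimes>\<^sub>H 'b \<Rightarrow> 'a \<otimes>\<^sub>H 'b"
  is "\<lambda>r f p. complex_of_real r * f p" by (simp add: l2_scale)
lift_definition scaleC_tensor :: "complex \<Rightarrow> 'a \<otimes>\<^sub>H 'b \<Rightarrow> 'a \<otimes>\<^sub>H 'b"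
  is "\<lambda>c f p. c * f p" by (simp add: l2_scale)

definition cinner_tensor_def:
  "cinner f g = (\<Sum>\<^sub>\<infinity>p. cnj (tcoeff f p) * tcoeff g p)" for f g :: "'a \<otimes>\<^sub>H 'b"

instance ..

end

instantiation tensor :: (chilbert_space, chilbert_space) real_inner
begin

definition inner_tensor_def: "inner f g = Re (cinner f g)" for f g :: "'a \<otimes>\<^sub>H 'b"
definition norm_tensor_def: "norm f = sqrt (inner f f)" for f :: "'a \<otimes>\<^sub>H 'b"
definition dist_tensor_def: "dist f g = norm (f - g)" for f g :: "'a \<otimes>\<^sub>H 'b"
definition sgn_tensor_def: "sgn f = f /\<^sub>R norm f" for f :: "'a \<otimes>\<^sub>H 'b"
definition uniformity_tensor_def:
  "(uniformity :: (('a \<otimes>\<^sub>H 'b) \<times> ('a \<otimes>\<^sub>H 'b)) filter) = (INF e\<in>{0<..}. principal {(x, y). dist x y < e})"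
definition open_tensor_def:
  "open U = (\<forall>x\<in>U. \<forall>\<^sub>F (x', y) in uniformity. x' = x \<longrightarrow> y \<in> U)" for U :: "('a \<otimes>\<^sub>H 'b) set"

lemma l2_tcoeff: "l2 (tcoeff (f :: 'a \<otimes>\<^sub>H 'b))"
  using tcoeff by blast

lemma tcoeff_outside: "p \<notin> onb \<times> onb \<Longrightarrow> tcoeff (f :: 'a \<otimes>\<^sub>H 'b) p = 0"
  using tcoeff by blast

lemma cinner_tensor_add: "cinner (x + y) z = cinner x z + cinner y (z :: 'a \<otimes>\<^sub>H 'b)"
  unfolding cinner_tensor_def
  by (simp add: plus_tensor.rep_eq distrib_right infsum_add l2_prod_summable l2_tcoeff)

lemma cinner_tensor_commute: "cinner x y = cnj (cinner y (x :: 'a \<otimes>\<^sub>H 'b))"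
  unfolding cinner_tensor_def by (subst infsum_cnj[symmetric]) (simp add: mult.commute)

lemma cinner_tensor_scale: "cinner x (c *\<^sub>C y) = c * cinner x (y :: 'a \<otimes>\<^sub>H 'b)"
  unfolding cinner_tensor_def
  by (simp add: scaleC_tensor.rep_eq infsum_cmult_right' mult.left_commute)

lemma scaleR_tensor_eq: "r *\<^sub>R x = complex_of_real r *\<^sub>C (x :: 'a \<otimes>\<^sub>H 'b)"
  by (simp add: tcoeff_inject[symmetric] scaleC_tensor.rep_eq scaleR_tensor.rep_eq)

lemma inner_tensor_self: "inner f f = (\<Sum>\<^sub>\<infinity>p. (cmod (tcoeff (f :: 'a \<otimes>\<^sub>H 'b) p))\<^sup>2)"
proof -
  have "cinner f f = (\<Sum>\<^sub>\<infinity>p. complex_of_real ((cmod (tcoeff f p))\<^sup>2))"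
    unfolding cinner_tensor_def by (intro infsum_cong) (metis complex_norm_square mult.commute)
  moreover have "((\<lambda>p. complex_of_real ((cmod (tcoeff f p))\<^sup>2)) has_sum
      complex_of_real (\<Sum>\<^sub>\<infinity>p. (cmod (tcoeff f p))\<^sup>2)) UNIV"
    using l2_tcoeff[of f] unfolding l2_def by (intro has_sum_of_real has_sum_infsum)
  ultimately show ?thesis
    by (simp add: inner_tensor_def infsumI del: of_real_power)
qed

instance
proof
  fix x y z :: "'a \<otimes>\<^sub>H 'b" and a b :: real
  show "x + y + z = x + (y + z)" "x + y = y + x" "0 + x = x" "- x + x = 0" "x - y = x + - y"
    "a *\<^sub>R (x + y) = a *\<^sub>R x + a *\<^sub>R y" "(a + b) *\<^sub>R x = a *\<^sub>R x + b *\<^sub>R x"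
    "a *\<^sub>R b *\<^sub>R x = (a * b) *\<^sub>R x" "1 *\<^sub>R x = x"
    by (transfer; simp add: fun_eq_iff algebra_simps)+
  show "dist x y = norm (x - y)" by (rule dist_tensor_def)
  show "sgn x = x /\<^sub>R norm x" by (rule sgn_tensor_def)
  show "(uniformity :: (('a \<otimes>\<^sub>H 'b) \<times> ('a \<otimes>\<^sub>H 'b)) filter) = (INF e\<in>{0<..}. principal {(x, y). dist x y < e})"
    by (rule uniformity_tensor_def)
  show "open U = (\<forall>x\<in>U. \<forall>\<^sub>F (x', y) in uniformity. x' = x \<longrightarrow> y \<in> U)" for U :: "('a \<otimes>\<^sub>H 'b) set"
    by (rule open_tensor_def)
  show *: "inner x y = inner y x" for x y :: "'a \<otimes>\<^sub>H 'b"
    unfolding inner_tensor_def by (subst cinner_tensor_commute) simp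
  show "inner (x + y) z = inner x z + inner y z"
    by (simp add: inner_tensor_def cinner_tensor_add)
  have "inner y (a *\<^sub>R x) = a * inner y x" for x y :: "'a \<otimes>\<^sub>H 'b"
    by (simp add: inner_tensor_def scaleR_tensor_eq cinner_tensor_scale)
  then show "inner (a *\<^sub>R x) y = a * inner x y"
    by (simp only: *[of _ y])
  show "0 \<le> inner x x"
    unfolding inner_tensor_self by (rule infsum_nonneg) simp
  show "(inner x x = 0) = (x = 0)"
  proof
    assume *: "inner x x = 0"
    have "(cmod (tcoeff x p))\<^sup>2 = 0" for p
      using l2_tcoeff[of x] *
      by (intro nonneg_infsum_le_0D[of "\<lambda>p. (cmod (tcoeff x p))\<^sup>2" UNIV])
        (auto simp: l2_def inner_tensor_self)
    then show "x = 0"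
      by (simp add: tcoeff_inject[symmetric] zero_tensor.rep_eq fun_eq_iff)
  qed (simp add: inner_tensor_self zero_tensor.rep_eq)
  show "norm x = sqrt (inner x x)" by (rule norm_tensor_def)
qed

end

lemma norm_tensor_sq: "(norm f)\<^sup>2 = (\<Sum>\<^sub>\<infinity>p. (cmod (tcoeff (f :: 'a::chilbert_space \<otimes>\<^sub>H 'b::chilbert_space) p))\<^sup>2)"
  by (simp add: power2_norm_eq_inner inner_tensor_self)

lemma sum_coeff_le_norm:
  assumes "finite F"
  shows "(\<Sum>p\<in>F. (cmod (tcoeff (f :: 'a::chilbert_space \<otimes>\<^sub>H 'b::chilbert_space) p))\<^sup>2) \<le> (norm f)\<^sup>2"
  unfolding norm_tensor_sq using l2_tcoeff[of f] assms
  by (intro finite_sum_le_infsum) (auto simp: l2_def)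

lemma cmod_coeff_le_norm: "cmod (tcoeff (f :: 'a::chilbert_space \<otimes>\<^sub>H 'b::chilbert_space) p) \<le> norm f"
  using sum_coeff_le_norm[of "{p}" f] by simp

instance tensor :: (chilbert_space, chilbert_space) banach
proof
  fix X :: "nat \<Rightarrow> 'a \<otimes>\<^sub>H 'b"
  assume X: "Cauchy X"
  have "Cauchy (\<lambda>n. tcoeff (X n) p)" for p
  proof (rule CauchyI)
    fix e :: real assume "e > 0"
    then obtain M where M: "\<forall>m\<ge>M. \<forall>n\<ge>M. norm (X m - X n) < e"
      using X CauchyD by blast
    have "norm (tcoeff (X m) p - tcoeff (X n) p) \<le> norm (X m - X n)" for m n
      using cmod_coeff_le_norm[of "X m - X n" p] by (simp add: minus_tensor.rep_eq)
    then show "\<exists>M. \<forall>m\<ge>M. \<forall>n\<ge>M. norm (tcoeff (X m) p - tcoeff (X n) p) < e"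
      using M by (intro exI[of _ M] allI impI) (rule order_le_less_trans, assumption, simp)
  qed
  then have "\<forall>p. \<exists>l. (\<lambda>n. tcoeff (X n) p) \<longlonglongrightarrow> l"
    using Cauchy_convergent_iff convergent_def by blast
  then obtain g where g: "\<And>p. (\<lambda>n. tcoeff (X n) p) \<longlonglongrightarrow> g p"
    by metis
  have bound: "(\<Sum>p\<in>F. (cmod (tcoeff (X m) p - g p))\<^sup>2) \<le> e\<^sup>2"
    if "finite F" "\<And>n. n \<ge> m \<Longrightarrow> norm (X m - X n) < e" for F m e
  proof (rule LIMSEQ_le_const2)
    show "(\<lambda>n. \<Sum>p\<in>F. (cmod (tcoeff (X m) p - tcoeff (X n) p))\<^sup>2)
        \<longlonglongrightarrow> (\<Sum>p\<in>F. (cmod (tcoeff (X m) p - g p))\<^sup>2)"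
      by (intro tendsto_intros g)
    have "(\<Sum>p\<in>F. (cmod (tcoeff (X m) p - tcoeff (X n) p))\<^sup>2) \<le> e\<^sup>2" if "n \<ge> m" for n
    proof -
      have "(\<Sum>p\<in>F. (cmod (tcoeff (X m) p - tcoeff (X n) p))\<^sup>2) \<le> (norm (X m - X n))\<^sup>2"
        using sum_coeff_le_norm[OF \<open>finite F\<close>, of "X m - X n"] by (simp add: minus_tensor.rep_eq)
      also have "\<dots> \<le> e\<^sup>2"
        using \<open>\<And>n. n \<ge> m \<Longrightarrow> norm (X m - X n) < e\<close>[OF \<open>n \<ge> m\<close>]
        by (intro power_mono) auto
      finally show ?thesis .
    qed
    then show "\<exists>N. \<forall>n\<ge>N. (\<Sum>p\<in>F. (cmod (tcoeff (X m) p - tcoeff (X n) p))\<^sup>2) \<le> e\<^sup>2"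
      by blast
  qed
  have diff_l2: "l2 (\<lambda>p. tcoeff (X m) p - g p)"
    if "\<And>n. n \<ge> m \<Longrightarrow> norm (X m - X n) < e" for m e
    unfolding l2_def
    by (rule nonneg_bdd_above_summable_on)
      (auto intro!: bdd_aboveI[where M = "e\<^sup>2"] bound[OF _ that])
  have outside: "g p = 0" if "p \<notin> onb \<times> onb" for p
    using LIMSEQ_unique[OF g[of p], of 0] by (simp add: tcoeff_outside[OF that])
  obtain m where "\<And>n. n \<ge> m \<Longrightarrow> norm (X m - X n) < 1"
    using CauchyD[OF X, of 1] by auto
  then have "l2 (\<lambda>p. tcoeff (X m) p - (tcoeff (X m) p - g p))"
    by (intro l2_diff l2_tcoeff diff_l2)
  then have "l2 g" by simp
  define G where "G = (Abs_tensor g :: 'a \<otimes>\<^sub>H 'b)"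
  have coeff_G: "tcoeff G = g"
    unfolding G_def using outside \<open>l2 g\<close> by (intro Abs_tensor_inverse) auto
  have "X \<longlonglongrightarrow> G"
  proof (rule LIMSEQ_I)
    fix r :: real assume "r > 0"
    then obtain M where M: "\<forall>m\<ge>M. \<forall>n\<ge>M. norm (X m - X n) < r / 2"
      using CauchyD[OF X, of "r / 2"] by auto
    have "norm (X m - G) < r" if "m \<ge> M" for m
    proof -
      have less: "norm (X m - X n) < r / 2" if "n \<ge> m" for n
        using M \<open>m \<ge> M\<close> that by simp
      have "(norm (X m - G))\<^sup>2 \<le> (r / 2)\<^sup>2"
        unfolding norm_tensor_sq minus_tensor.rep_eq coeff_G
        by (intro infsum_le_finite_sums bound less)
          (use diff_l2[OF less] in \<open>auto simp: l2_def\<close>)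
      then have "norm (X m - G) \<le> r / 2"
        by (rule power2_le_imp_le) (use \<open>r > 0\<close> in simp)
      then show ?thesis using \<open>r > 0\<close> by simp
    qed
    then show "\<exists>no. \<forall>n\<ge>no. norm (X n - G) < r" by blast
  qed
  then show "convergent X" unfolding convergent_def by blast
qed

instance tensor :: (chilbert_space, chilbert_space) chilbert_space
proof
  fix x y z :: "'a \<otimes>\<^sub>H 'b" and c d :: complex and r :: real
  show "c *\<^sub>C (x + y) = c *\<^sub>C x + c *\<^sub>C y" "(c + d) *\<^sub>C x = c *\<^sub>C x + d *\<^sub>C x"
    "c *\<^sub>C d *\<^sub>C x = (c * d) *\<^sub>C x"
    by (transfer; simp add: fun_eq_iff algebra_simps)+
  show "cinner x (y + z) = cinner x y + cinner x z"
    by (simp only: cinner_tensor_commute[of x] cinner_tensor_add complex_cnj_add)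
qed (rule scaleR_tensor_eq cinner_tensor_scale cinner_tensor_commute inner_tensor_def)+

definition tensor_fun :: "'a::chilbert_space \<Rightarrow> 'b::chilbert_space \<Rightarrow> 'a \<times> 'b \<Rightarrow> complex" where
  "tensor_fun x y = (\<lambda>(e, f). if e \<in> onb \<and> f \<in> onb then cinner e x * cinner f y else 0)"

lemma has_sum_product_complex:
  fixes a :: "'i \<Rightarrow> complex" and b :: "'j \<Rightarrow> complex"
  assumes a: "(a has_sum s) A" and b: "(b has_sum t) B"
  shows "((\<lambda>(i, j). a i * b j) has_sum s * t) (A \<times> B)"
proof (rule has_sum_SigmaI)
  show "((\<lambda>j. case (i, j) of (i, j) \<Rightarrow> a i * b j) has_sum a i * t) B" for i
    using has_sum_cmult_right[OF b] by simp
  show "((\<lambda>i. a i * t) has_sum s * t) A"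
    using has_sum_cmult_left[OF a] by simp
  have sa: "(\<lambda>i. cmod (a i)) summable_on A" and sb: "(\<lambda>j. cmod (b j)) summable_on B"
    using a b by (auto simp: summable_on_iff_abs_summable_on_complex[symmetric]
        intro: has_sum_imp_summable)
  show "(\<lambda>(i, j). a i * b j) summable_on A \<times> B"
  proof (rule abs_summable_summable, rule nonneg_bdd_above_summable_on)
    show "bdd_above (sum (\<lambda>p. cmod (case p of (i, j) \<Rightarrow> a i * b j)) ` {F. F \<subseteq> A \<times> B \<and> finite F})"
    proof (rule bdd_aboveI2)
      fix F assume F: "F \<in> {F. F \<subseteq> A \<times> B \<and> finite F}"
      have "(\<Sum>p\<in>F. cmod (case p of (i, j) \<Rightarrow> a i * b j))
          \<le> (\<Sum>p\<in>fst ` F \<times> snd ` F. cmod (case p of (i, j) \<Rightarrow> a i * b j))"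
        using F by (intro sum_mono2) (auto simp: rev_image_eqI)
      also have "\<dots> = (\<Sum>i\<in>fst ` F. cmod (a i)) * (\<Sum>j\<in>snd ` F. cmod (b j))"
        by (simp add: sum_product sum.cartesian_product norm_mult split_def)
      also have "\<dots> \<le> (\<Sum>\<^sub>\<infinity>i\<in>A. cmod (a i)) * (\<Sum>\<^sub>\<infinity>j\<in>B. cmod (b j))"
        using F sa sb by (intro mult_mono finite_sum_le_infsum infsum_nonneg sum_nonneg) auto
      finally show "(\<Sum>p\<in>F. cmod (case p of (i, j) \<Rightarrow> a i * b j))
          \<le> (\<Sum>\<^sub>\<infinity>i\<in>A. cmod (a i)) * (\<Sum>\<^sub>\<infinity>j\<in>B. cmod (b j))" .
    qed
  qed simp
qed

lemma tensor_fun_has_sum: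
  "((\<lambda>p. cnj (tensor_fun x y p) * tensor_fun x' y' p) has_sum cinner x x' * cinner y y') UNIV"
proof -
  have s: "((\<lambda>(e, f). (cnj (cinner e x) * cinner e x') * (cnj (cinner f y) * cinner f y'))
      has_sum cinner x x' * cinner y y') (onb \<times> onb)"
    by (rule has_sum_product_complex[OF parseval parseval])
  show ?thesis
    by (rule has_sum_cong_neutral[THEN iffD1, OF _ _ _ s])
      (auto simp: tensor_fun_def split: if_splits)
qed

lift_definition tensor :: "'a::chilbert_space \<Rightarrow> 'b::chilbert_space \<Rightarrow> 'a \<otimes>\<^sub>H 'b"
  (infixr "\<otimes>\<^sub>v" 70) is tensor_fun
proof -
  fix x :: 'a and y :: 'b
  have "(\<lambda>p. cnj (tensor_fun x y p) * tensor_fun x y p) summable_on UNIV"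
    using tensor_fun_has_sum by (rule has_sum_imp_summable)
  then have "(\<lambda>p. complex_of_real ((cmod (tensor_fun x y p))\<^sup>2)) summable_on UNIV"
    by (rule summable_on_cong[THEN iffD1, rotated]) (metis complex_norm_square mult.commute)
  then have "l2 (tensor_fun x y)"
    unfolding l2_def using summable_on_Re by fastforce
  then show "(\<forall>p. p \<notin> onb \<times> onb \<longrightarrow> tensor_fun x y p = 0) \<and> l2 (tensor_fun x y)"
    by (auto simp: tensor_fun_def)
qed

lemma tensor_add_left: "(x + x') \<otimes>\<^sub>v y = x \<otimes>\<^sub>v y + x' \<otimes>\<^sub>v y"
  by transfer (auto simp: tensor_fun_def fun_eq_iff cinner_add_right algebra_simps)

lemma tensor_add_right: "x \<otimes>\<^sub>v (y + y') = x \<otimes>\<^sub>v y + x \<otimes>\<^sub>v y'"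
  by transfer (auto simp: tensor_fun_def fun_eq_iff cinner_add_right algebra_simps)

lemma tensor_scaleC_left: "(c *\<^sub>C x) \<otimes>\<^sub>v y = c *\<^sub>C (x \<otimes>\<^sub>v y)"
  by transfer (auto simp: tensor_fun_def fun_eq_iff cinner_scaleC_right)

lemma tensor_scaleC_right: "x \<otimes>\<^sub>v (c *\<^sub>C y) = c *\<^sub>C (x \<otimes>\<^sub>v y)"
  by transfer (auto simp: tensor_fun_def fun_eq_iff cinner_scaleC_right)

lemma cinner_tensor: "cinner (x \<otimes>\<^sub>v y) (x' \<otimes>\<^sub>v y') = cinner x x' * cinner y y'"
  unfolding cinner_tensor_def tensor.rep_eq using tensor_fun_has_sum by (rule infsumI)

lemma tensor_dense:
  "closure {\<Sum>i<n. x i \<otimes>\<^sub>v y i | (n::nat) x y. True} = (UNIV :: ('a::chilbert_space \<otimes>\<^sub>H 'b::chilbert_space) set)"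
  (is "closure ?D = UNIV")
proof -
  have "\<xi> \<in> closure ?D" for \<xi> :: "'a \<otimes>\<^sub>H 'b"
    unfolding closure_approachable
  proof (intro allI impI)
    fix r :: real assume "r > 0"
    define c where "c p = (cmod (tcoeff \<xi> p))\<^sup>2" for p
    have "(c has_sum (norm \<xi>)\<^sup>2) UNIV"
      unfolding c_def norm_tensor_sq using l2_tcoeff[of \<xi>] unfolding l2_def by (rule has_sum_infsum)
    then have "\<forall>\<^sub>F F in finite_subsets_at_top UNIV. dist (sum c F) ((norm \<xi>)\<^sup>2) < r\<^sup>2"
      using \<open>r > 0\<close> unfolding has_sum_def tendsto_iff by simp
    then obtain F where F: "finite F" "dist (sum c F) ((norm \<xi>)\<^sup>2) < r\<^sup>2"
      unfolding eventually_finite_subsets_at_top by blast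
    define F' where "F' = F \<inter> onb \<times> onb"
    have F': "finite F'" "F' \<subseteq> onb \<times> onb" using F(1) by (auto simp: F'_def)
    define \<eta> where "\<eta> = (\<Sum>p\<in>F'. (tcoeff \<xi> p *\<^sub>C fst p) \<otimes>\<^sub>v snd p)"
    obtain p where p: "bij_betw p {..<card F'} F'"
      using ex_bij_betw_nat_finite[OF F'(1)] by (auto simp: atLeast0LessThan)
    have "\<eta> = (\<Sum>i<card F'. (tcoeff \<xi> (p i) *\<^sub>C fst (p i)) \<otimes>\<^sub>v snd (p i))"
      unfolding \<eta>_def using sum.reindex_bij_betw[OF p] by (rule sym)
    then have "\<eta> \<in> ?D"
      by (intro CollectI exI[of _ "card F'"] exI[of _ "\<lambda>i. tcoeff \<xi> (p i) *\<^sub>C fst (p i)"]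
          exI[of _ "\<lambda>i. snd (p i)"]) simp
    have coeff_sum: "tcoeff (sum h A) q = (\<Sum>p\<in>A. tcoeff (h p) q)"
      for h :: "'a \<times> 'b \<Rightarrow> 'a \<otimes>\<^sub>H 'b" and A q
      by (induction A rule: infinite_finite_induct) (auto simp: zero_tensor.rep_eq plus_tensor.rep_eq)
    have basis: "tcoeff (fst p \<otimes>\<^sub>v snd p) q = (if p = q then 1 else 0)"
      if "p \<in> onb \<times> onb" for p q :: "'a \<times> 'b"
      using that by (cases p; cases q) (auto simp: tensor.rep_eq tensor_fun_def cinner_onb)
    have coeff_\<eta>: "tcoeff \<eta> q = (if q \<in> F' then tcoeff \<xi> q else 0)" for q
    proof -
      have "tcoeff \<eta> q = (\<Sum>p\<in>F'. if p = q then tcoeff \<xi> p else 0)"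
        unfolding \<eta>_def coeff_sum using F'(2)
        by (intro sum.cong refl) (simp add: tensor_scaleC_left scaleC_tensor.rep_eq basis subsetD)
      then show ?thesis using F'(1) by simp
    qed
    have "(norm (\<xi> - \<eta>))\<^sup>2 = (norm \<xi>)\<^sup>2 - sum c F"
    proof -
      have *: "(c has_sum sum c F) F" using F(1) by (rule has_sum_finite)
      have "(norm (\<xi> - \<eta>))\<^sup>2 = infsum c (UNIV - F)"
        unfolding norm_tensor_sq minus_tensor.rep_eq coeff_\<eta> c_def
        by (rule infsum_cong_neutral) (auto simp: F'_def tcoeff_outside)
      also have "\<dots> = (norm \<xi>)\<^sup>2 - sum c F"
        using has_sum_Diff[OF \<open>(c has_sum (norm \<xi>)\<^sup>2) UNIV\<close> *] by (intro infsumI) auto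
      finally show ?thesis .
    qed
    then have "(norm (\<xi> - \<eta>))\<^sup>2 < r\<^sup>2"
      using F(2) by (simp add: dist_real_def)
    then have "dist \<eta> \<xi> < r"
      using \<open>r > 0\<close> by (simp add: dist_norm norm_minus_commute power2_less_imp_less)
    then show "\<exists>\<zeta>\<in>?D. dist \<zeta> \<xi> < r" using \<open>\<eta> \<in> ?D\<close> by blast
  qed
  then show ?thesis by blast
qed


section \<open>The complex-conjugate Hilbert space\<close>

datatype 'a conjugate = Conj (unconj: 'a)

lemma Conj_unconj [simp]: "Conj (unconj x) = x"
  by (cases x) simp

instantiation conjugate :: (chilbert_space) "{zero, plus, minus, uminus, scaleR, scaleC, cinner}"
begin

definition zero_conjugate_def: "0 = Conj (0::'a)"
definition plus_conjugate_def: "x + y = Conj (unconj x + (unconj y :: 'a))"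
definition minus_conjugate_def: "x - y = Conj (unconj x - (unconj y :: 'a))"
definition uminus_conjugate_def: "- x = Conj (- (unconj x :: 'a))"
definition scaleR_conjugate_def: "r *\<^sub>R x = Conj (r *\<^sub>R (unconj x :: 'a))"
definition scaleC_conjugate_def: "c *\<^sub>C x = Conj (cnj c *\<^sub>C (unconj x :: 'a))"
definition cinner_conjugate_def: "cinner x y = cinner (unconj y) (unconj x :: 'a)"

instance ..

end

instantiation conjugate :: (chilbert_space) real_inner
begin

definition inner_conjugate_def: "inner x y = inner (unconj x) (unconj y :: 'a)"
definition norm_conjugate_def: "norm x = norm (unconj x :: 'a)"
definition dist_conjugate_def: "dist x y = dist (unconj x) (unconj y :: 'a)"
definition sgn_conjugate_def: "sgn x = x /\<^sub>R norm x" for x :: "'a conjugate"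
definition uniformity_conjugate_def:
  "(uniformity :: ('a conjugate \<times> 'a conjugate) filter) = (INF e\<in>{0<..}. principal {(x, y). dist x y < e})"
definition open_conjugate_def:
  "open U = (\<forall>x\<in>U. \<forall>\<^sub>F (x', y) in uniformity. x' = x \<longrightarrow> y \<in> U)" for U :: "'a conjugate set"

instance
proof
  fix x y z :: "'a conjugate" and a b :: real
  note defs = zero_conjugate_def plus_conjugate_def minus_conjugate_def uminus_conjugate_def
    scaleR_conjugate_def inner_conjugate_def norm_conjugate_def dist_conjugate_def
  show "x + y + z = x + (y + z)" "x + y = y + x" "0 + x = x" "- x + x = 0" "x - y = x + - y"
    "a *\<^sub>R (x + y) = a *\<^sub>R x + a *\<^sub>R y" "(a + b) *\<^sub>R x = a *\<^sub>R x + b *\<^sub>R x"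
    "a *\<^sub>R b *\<^sub>R x = (a * b) *\<^sub>R x" "1 *\<^sub>R x = x"
    by (simp_all add: defs algebra_simps)
  show "dist x y = norm (x - y)" by (simp add: defs dist_norm)
  show "sgn x = x /\<^sub>R norm x" by (rule sgn_conjugate_def)
  show "(uniformity :: ('a conjugate \<times> 'a conjugate) filter) = (INF e\<in>{0<..}. principal {(x, y). dist x y < e})"
    by (rule uniformity_conjugate_def)
  show "open U = (\<forall>x\<in>U. \<forall>\<^sub>F (x', y) in uniformity. x' = x \<longrightarrow> y \<in> U)" for U :: "'a conjugate set"
    by (rule open_conjugate_def)
  show "inner x y = inner y x" by (simp add: defs inner_commute)
  show "inner (x + y) z = inner x z + inner y z" by (simp add: defs inner_add_left)
  show "inner (a *\<^sub>R x) y = a * inner x y" by (simp add: defs)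
  show "0 \<le> inner x x" by (simp add: defs)
  show "(inner x x = 0) = (x = 0)" by (cases x) (simp add: defs)
  show "norm x = sqrt (inner x x)" by (simp add: defs norm_eq_sqrt_inner)
qed

end

instance conjugate :: (chilbert_space) banach
proof
  fix X :: "nat \<Rightarrow> 'a conjugate"
  assume "Cauchy X"
  then have "Cauchy (\<lambda>n. unconj (X n))"
    unfolding Cauchy_def dist_conjugate_def .
  then obtain l where "(\<lambda>n. unconj (X n)) \<longlonglongrightarrow> l"
    using Cauchy_convergent_iff convergent_def by blast
  then have "X \<longlonglongrightarrow> Conj l"
    unfolding tendsto_iff dist_conjugate_def by simp
  then show "convergent X" unfolding convergent_def by blast
qed

instance conjugate :: (chilbert_space) chilbert_space
proof
  fix x y z :: "'a conjugate" and c d :: complex and r :: real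
  note defs = plus_conjugate_def scaleR_conjugate_def scaleC_conjugate_def cinner_conjugate_def
    inner_conjugate_def
  show "c *\<^sub>C (x + y) = c *\<^sub>C x + c *\<^sub>C y" by (simp add: defs scaleC_add_right)
  show "(c + d) *\<^sub>C x = c *\<^sub>C x + d *\<^sub>C x" by (simp add: defs scaleC_add_left)
  show "c *\<^sub>C d *\<^sub>C x = (c * d) *\<^sub>C x" by (simp add: defs scaleC_scaleC)
  show "r *\<^sub>R x = complex_of_real r *\<^sub>C x" by (simp add: defs scaleR_scaleC)
  show "cinner x (y + z) = cinner x y + cinner x z" by (simp add: defs cinner_add_left)
  show "cinner x (c *\<^sub>C y) = c * cinner x y" by (simp add: defs cinner_scaleC_left)
  show "cinner x y = cnj (cinner y x)" by (simp add: defs cinner_commute[symmetric])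
  show "inner x y = Re (cinner x y)"
    unfolding defs by (subst inner_commute) (rule inner_eq_Re_cinner)
qed


section \<open>Bounded operators\<close>

text \<open>Bounded operators are elements of the library type \<open>'a \<Rightarrow>\<^sub>L 'b\<close>, whose members are only
  real-linear; \<open>bop\<close> singles out the complex-linear ones.\<close>

definition bop :: "('a::chilbert_space \<Rightarrow>\<^sub>L 'b::chilbert_space) set" where
  "bop = {T. \<forall>c x. blinfun_apply T (c *\<^sub>C x) = c *\<^sub>C blinfun_apply T x}"

definition op_scale :: "complex \<Rightarrow> ('a::chilbert_space \<Rightarrow>\<^sub>L 'b::chilbert_space) \<Rightarrow> ('a \<Rightarrow>\<^sub>L 'b)" where
  "op_scale c T = Blinfun (\<lambda>x. c *\<^sub>C blinfun_apply T x)"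

definition adj :: "('a::chilbert_space \<Rightarrow>\<^sub>L 'b::chilbert_space) \<Rightarrow> ('b \<Rightarrow>\<^sub>L 'a)" where
  "adj T = (THE S. \<forall>x y. cinner (blinfun_apply S y) x = cinner y (blinfun_apply T x))"

definition unitary :: "('a::chilbert_space \<Rightarrow>\<^sub>L 'b::chilbert_space) \<Rightarrow> bool" where
  "unitary U \<longleftrightarrow> U \<in> bop \<and> adj U o\<^sub>L U = id_blinfun \<and> U o\<^sub>L adj U = id_blinfun"

definition op_tensor ::
  "('a::chilbert_space \<Rightarrow>\<^sub>L 'c::chilbert_space) \<Rightarrow> ('b::chilbert_space \<Rightarrow>\<^sub>L 'd::chilbert_space)
    \<Rightarrow> ('a \<otimes>\<^sub>H 'b \<Rightarrow>\<^sub>L 'c \<otimes>\<^sub>H 'd)"  (infixr "\<otimes>\<^sub>o" 70) where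
  "S \<otimes>\<^sub>o T = (THE R. R \<in> bop \<and>
     (\<forall>x y. blinfun_apply R (x \<otimes>\<^sub>v y) = blinfun_apply S x \<otimes>\<^sub>v blinfun_apply T y))"

definition flip :: "('a::chilbert_space \<otimes>\<^sub>H 'b::chilbert_space) \<Rightarrow>\<^sub>L ('b \<otimes>\<^sub>H 'a)" where
  "flip = (THE R. R \<in> bop \<and> (\<forall>x y. blinfun_apply R (x \<otimes>\<^sub>v y) = y \<otimes>\<^sub>v x))"

definition assoc ::
  "(('a::chilbert_space \<otimes>\<^sub>H 'b::chilbert_space) \<otimes>\<^sub>H 'c::chilbert_space) \<Rightarrow>\<^sub>L ('a \<otimes>\<^sub>H 'b \<otimes>\<^sub>H 'c)" where
  "assoc = (THE R. R \<in> bop \<and> (\<forall>x y z. blinfun_apply R ((x \<otimes>\<^sub>v y) \<otimes>\<^sub>v z) = x \<otimes>\<^sub>v y \<otimes>\<^sub>v z))"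

text \<open>Leg numbering on the threefold tensor product, which is always bracketed to the right.\<close>

definition leg12 ::
  "('a::chilbert_space \<otimes>\<^sub>H 'b::chilbert_space \<Rightarrow>\<^sub>L 'a \<otimes>\<^sub>H 'b)
    \<Rightarrow> ('a \<otimes>\<^sub>H 'b \<otimes>\<^sub>H 'c::chilbert_space \<Rightarrow>\<^sub>L 'a \<otimes>\<^sub>H 'b \<otimes>\<^sub>H 'c)" where
  "leg12 T = assoc o\<^sub>L (T \<otimes>\<^sub>o id_blinfun) o\<^sub>L adj assoc"

definition leg23 ::
  "('b::chilbert_space \<otimes>\<^sub>H 'c::chilbert_space \<Rightarrow>\<^sub>L 'b \<otimes>\<^sub>H 'c)
    \<Rightarrow> ('a::chilbert_space \<otimes>\<^sub>H 'b \<otimes>\<^sub>H 'c \<Rightarrow>\<^sub>L 'a \<otimes>\<^sub>H 'b \<otimes>\<^sub>H 'c)" where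
  "leg23 T = id_blinfun \<otimes>\<^sub>o T"

definition leg13 ::
  "('a::chilbert_space \<otimes>\<^sub>H 'c::chilbert_space \<Rightarrow>\<^sub>L 'a \<otimes>\<^sub>H 'c)
    \<Rightarrow> ('a \<otimes>\<^sub>H 'b::chilbert_space \<otimes>\<^sub>H 'c \<Rightarrow>\<^sub>L 'a \<otimes>\<^sub>H 'b \<otimes>\<^sub>H 'c)" where
  "leg13 T = (id_blinfun \<otimes>\<^sub>o flip) o\<^sub>L leg12 T o\<^sub>L (id_blinfun \<otimes>\<^sub>o flip)"


section \<open>Unbounded operators\<close>

text \<open>An unbounded operator is represented by its graph; its inverse (if it is injective) is then
  the converse relation.\<close>

type_synonym 'a graph = "('a \<times> 'a) set"

definition linear_graph :: "'a::chilbert_space graph \<Rightarrow> bool" where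
  "linear_graph G \<longleftrightarrow> single_valued G \<and> (0, 0) \<in> G \<and>
     (\<forall>(x, y)\<in>G. \<forall>(x', y')\<in>G. (x + x', y + y') \<in> G) \<and>
     (\<forall>c. \<forall>(x, y)\<in>G. (c *\<^sub>C x, c *\<^sub>C y) \<in> G)"

definition graph_adj :: "'a::chilbert_space graph \<Rightarrow> 'a graph" where
  "graph_adj G = {(y, z). \<forall>(x, w)\<in>G. cinner z x = cinner y w}"

definition positive_self_adjoint :: "'a::chilbert_space graph \<Rightarrow> bool" where
  "positive_self_adjoint G \<longleftrightarrow> linear_graph G \<and> closure (Domain G) = UNIV \<and> graph_adj G = G \<and>
     (\<forall>(x, y)\<in>G. cinner x y \<in> \<real>\<^sub>\<ge>\<^sub>0)"

definition trivial_kernel :: "'a::chilbert_space graph \<Rightarrow> bool" where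
  "trivial_kernel G \<longleftrightarrow> (\<forall>x. (x, 0) \<in> G \<longrightarrow> x = 0)"

text \<open>The tensor product of closable operators is the closure of their algebraic tensor product.\<close>

definition graph_tensor ::
  "'a::chilbert_space graph \<Rightarrow> 'b::chilbert_space graph \<Rightarrow> ('a \<otimes>\<^sub>H 'b) graph"  (infixr "\<otimes>\<^sub>g" 70) where
  "P \<otimes>\<^sub>g Q = closure {(\<Sum>i<n. x i \<otimes>\<^sub>v y i, \<Sum>i<n. x' i \<otimes>\<^sub>v y' i) | (n::nat) x y x' y'.
     \<forall>i<n. (x i, x' i) \<in> P \<and> (y i, y' i) \<in> Q}"


section \<open>Modular multiplicative unitaries\<close>

definition multiplicative_unitary ::
  "('h::chilbert_space \<otimes>\<^sub>H 'h \<Rightarrow>\<^sub>L 'h \<otimes>\<^sub>H 'h) \<Rightarrow> bool" where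
  "multiplicative_unitary W \<longleftrightarrow> unitary W \<and>
     leg23 W o\<^sub>L leg12 W = leg12 W o\<^sub>L leg13 W o\<^sub>L leg23 W"

definition modular_multiplicative_unitary ::
  "('h::chilbert_space \<otimes>\<^sub>H 'h \<Rightarrow>\<^sub>L 'h \<otimes>\<^sub>H 'h) \<Rightarrow> bool" where
  "modular_multiplicative_unitary W \<longleftrightarrow> multiplicative_unitary W \<and>
     (\<exists>(Qh :: 'h graph) (Q :: 'h graph) (Wt :: 'h conjugate \<otimes>\<^sub>H 'h \<Rightarrow>\<^sub>L 'h conjugate \<otimes>\<^sub>H 'h).
        positive_self_adjoint Qh \<and> trivial_kernel Qh \<and>
        positive_self_adjoint Q \<and> trivial_kernel Q \<and>
        unitary Wt \<and>
        {(\<xi>, blinfun_apply (adj W) \<eta>) | \<xi> \<eta>. (blinfun_apply W \<xi>, \<eta>) \<in> Qh \<otimes>\<^sub>g Q} = Qh \<otimes>\<^sub>g Q \<and>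
        (\<forall>x z. \<forall>(y, Qy)\<in>Q. \<forall>(u, Qinv_u)\<in>Q\<inverse>.
           cinner (x \<otimes>\<^sub>v y) (blinfun_apply W (z \<otimes>\<^sub>v u)) =
           cinner (Conj z \<otimes>\<^sub>v Qy) (blinfun_apply Wt (Conj x \<otimes>\<^sub>v Qinv_u))))"


section \<open>Slices\<close>

text \<open>The predual, i.e. the normal functionals: those of the form
  \<open>T \<mapsto> \<Sum>n. cinner (x n) (T (y n))\<close> with square-summable sequences \<open>x\<close> and \<open>y\<close>.\<close>

definition predual :: "(('a::chilbert_space \<Rightarrow>\<^sub>L 'a) \<Rightarrow> complex) set" where
  "predual = {\<lambda>T. \<Sum>n. cinner (x n) (blinfun_apply T (y n)) | x y.
     summable (\<lambda>n. (norm (x n))\<^sup>2) \<and> summable (\<lambda>n. (norm (y n))\<^sup>2)}"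

text \<open>\<open>coef1 u v T\<close> is \<open>(id \<otimes> \<omega>) T\<close> and \<open>coef2 u v T\<close> is \<open>(\<omega> \<otimes> id) T\<close> for the vector functional
  \<open>\<omega> = cinner u (_ v)\<close>. The slices by a general normal functional are determined by their matrix
  coefficients: \<open>cinner u ((\<omega> \<otimes> id)(T) v) = \<omega> (coef1 u v T)\<close>.\<close>

definition coef1 :: "'b::chilbert_space \<Rightarrow> 'b \<Rightarrow> ('a::chilbert_space \<otimes>\<^sub>H 'b \<Rightarrow>\<^sub>L 'a \<otimes>\<^sub>H 'b) \<Rightarrow> ('a \<Rightarrow>\<^sub>L 'a)" where
  "coef1 u v T = (THE S. S \<in> bop \<and>
     (\<forall>x y. cinner x (blinfun_apply S y) = cinner (x \<otimes>\<^sub>v u) (blinfun_apply T (y \<otimes>\<^sub>v v))))"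

definition coef2 :: "'a::chilbert_space \<Rightarrow> 'a \<Rightarrow> ('a \<otimes>\<^sub>H 'b::chilbert_space \<Rightarrow>\<^sub>L 'a \<otimes>\<^sub>H 'b) \<Rightarrow> ('b \<Rightarrow>\<^sub>L 'b)" where
  "coef2 u v T = (THE S. S \<in> bop \<and>
     (\<forall>x y. cinner x (blinfun_apply S y) = cinner (u \<otimes>\<^sub>v x) (blinfun_apply T (v \<otimes>\<^sub>v y))))"

definition slice1 ::
  "(('a::chilbert_space \<Rightarrow>\<^sub>L 'a) \<Rightarrow> complex) \<Rightarrow> ('a \<otimes>\<^sub>H 'b::chilbert_space \<Rightarrow>\<^sub>L 'a \<otimes>\<^sub>H 'b) \<Rightarrow> ('b \<Rightarrow>\<^sub>L 'b)" where
  "slice1 \<omega> T = (THE S. S \<in> bop \<and> (\<forall>u v. cinner u (blinfun_apply S v) = \<omega> (coef1 u v T)))"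

definition slice2 ::
  "(('b::chilbert_space \<Rightarrow>\<^sub>L 'b) \<Rightarrow> complex) \<Rightarrow> ('a::chilbert_space \<otimes>\<^sub>H 'b \<Rightarrow>\<^sub>L 'a \<otimes>\<^sub>H 'b) \<Rightarrow> ('a \<Rightarrow>\<^sub>L 'a)" where
  "slice2 \<omega> T = (THE S. S \<in> bop \<and> (\<forall>u v. cinner u (blinfun_apply S v) = \<omega> (coef2 u v T)))"


section \<open>The quantum group of a multiplicative unitary and its dual\<close>

definition qg_algebra :: "('h::chilbert_space \<otimes>\<^sub>H 'h \<Rightarrow>\<^sub>L 'h \<otimes>\<^sub>H 'h) \<Rightarrow> ('h \<Rightarrow>\<^sub>L 'h) set" where
  "qg_algebra W = closure {slice1 \<omega> W | \<omega>. \<omega> \<in> predual}"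

definition qg_comult ::
  "('h::chilbert_space \<otimes>\<^sub>H 'h \<Rightarrow>\<^sub>L 'h \<otimes>\<^sub>H 'h) \<Rightarrow> ('h \<Rightarrow>\<^sub>L 'h) \<Rightarrow> ('h \<otimes>\<^sub>H 'h \<Rightarrow>\<^sub>L 'h \<otimes>\<^sub>H 'h)" where
  "qg_comult W x = W o\<^sub>L (x \<otimes>\<^sub>o id_blinfun) o\<^sub>L adj W"

definition dual_algebra :: "('h::chilbert_space \<otimes>\<^sub>H 'h \<Rightarrow>\<^sub>L 'h \<otimes>\<^sub>H 'h) \<Rightarrow> ('h \<Rightarrow>\<^sub>L 'h) set" where
  "dual_algebra W = closure {slice2 \<omega> (adj W) | \<omega>. \<omega> \<in> predual}"

definition dual_comult ::
  "('h::chilbert_space \<otimes>\<^sub>H 'h \<Rightarrow>\<^sub>L 'h \<otimes>\<^sub>H 'h) \<Rightarrow> ('h \<Rightarrow>\<^sub>L 'h) \<Rightarrow> ('h \<otimes>\<^sub>H 'h \<Rightarrow>\<^sub>L 'h \<otimes>\<^sub>H 'h)" where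
  "dual_comult W y = flip o\<^sub>L adj W o\<^sub>L (id_blinfun \<otimes>\<^sub>o y) o\<^sub>L W o\<^sub>L flip"


section \<open>Spatial tensor products and multipliers\<close>

definition spatial_tensor ::
  "('a::chilbert_space \<Rightarrow>\<^sub>L 'a) set \<Rightarrow> ('b::chilbert_space \<Rightarrow>\<^sub>L 'b) set
    \<Rightarrow> ('a \<otimes>\<^sub>H 'b \<Rightarrow>\<^sub>L 'a \<otimes>\<^sub>H 'b) set"  (infixr "\<otimes>\<^sub>s" 70) where
  "B \<otimes>\<^sub>s D = closure {\<Sum>i<n. b i \<otimes>\<^sub>o d i | (n::nat) b d. \<forall>i<n. b i \<in> B \<and> d i \<in> D}"

text \<open>For a nondegenerate C*-algebra \<open>B\<close> of operators on \<open>'a\<close>, the multiplier algebra is realised,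
  as usual, as the idealiser of \<open>B\<close> in the algebra of all bounded operators on \<open>'a\<close>.\<close>

definition multipliers :: "('a::chilbert_space \<Rightarrow>\<^sub>L 'a) set \<Rightarrow> ('a \<Rightarrow>\<^sub>L 'a) set" where
  "multipliers B = {T \<in> bop. \<forall>b\<in>B. T o\<^sub>L b \<in> B \<and> b o\<^sub>L T \<in> B}"

definition unitary_multipliers :: "('a::chilbert_space \<Rightarrow>\<^sub>L 'a) set \<Rightarrow> ('a \<Rightarrow>\<^sub>L 'a) set" where
  "unitary_multipliers B = {U \<in> multipliers B. unitary U}"

text \<open>The extension of a nondegenerate *-homomorphism \<open>\<Phi>\<close> from \<open>B\<close> to the multiplier algebra
  of \<open>B\<close>; nondegeneracy of \<open>\<Phi>\<close> makes the operator \<open>S\<close> unique.\<close>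

definition multiplier_ext ::
  "('a::chilbert_space \<Rightarrow>\<^sub>L 'a) set \<Rightarrow> (('a \<Rightarrow>\<^sub>L 'a) \<Rightarrow> ('b::chilbert_space \<Rightarrow>\<^sub>L 'b))
    \<Rightarrow> ('a \<Rightarrow>\<^sub>L 'a) \<Rightarrow> ('b \<Rightarrow>\<^sub>L 'b)" where
  "multiplier_ext B \<Phi> T = (THE S. S \<in> bop \<and> (\<forall>b\<in>B. S o\<^sub>L \<Phi> b = \<Phi> (T o\<^sub>L b)))"

definition star_hom_on ::
  "('a::chilbert_space \<Rightarrow>\<^sub>L 'a) set \<Rightarrow> (('a \<Rightarrow>\<^sub>L 'a) \<Rightarrow> ('b::chilbert_space \<Rightarrow>\<^sub>L 'b)) \<Rightarrow> bool" where
  "star_hom_on B \<Phi> \<longleftrightarrow> \<Phi> ` B \<subseteq> bop \<and> continuous_on B \<Phi> \<and>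
     (\<forall>x\<in>B. \<forall>y\<in>B. \<Phi> (x + y) = \<Phi> x + \<Phi> y) \<and>
     (\<forall>c. \<forall>x\<in>B. \<Phi> (op_scale c x) = op_scale c (\<Phi> x)) \<and>
     (\<forall>x\<in>B. \<forall>y\<in>B. \<Phi> (x o\<^sub>L y) = \<Phi> x o\<^sub>L \<Phi> y) \<and>
     (\<forall>x\<in>B. \<Phi> (adj x) = adj (\<Phi> x))"

text \<open>The *-homomorphism \<open>\<phi> \<otimes> \<psi>\<close> on the spatial tensor product. The value \<open>0\<close> outside of it is
  a convention that makes the function unique.\<close>

definition hom_tensor ::
  "('a::chilbert_space \<Rightarrow>\<^sub>L 'a) set \<Rightarrow> ('b::chilbert_space \<Rightarrow>\<^sub>L 'b) set
    \<Rightarrow> (('a \<Rightarrow>\<^sub>L 'a) \<Rightarrow> ('c::chilbert_space \<Rightarrow>\<^sub>L 'c)) \<Rightarrow> (('b \<Rightarrow>\<^sub>L 'b) \<Rightarrow> ('d::chilbert_space \<Rightarrow>\<^sub>L 'd))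
    \<Rightarrow> ('a \<otimes>\<^sub>H 'b \<Rightarrow>\<^sub>L 'a \<otimes>\<^sub>H 'b) \<Rightarrow> ('c \<otimes>\<^sub>H 'd \<Rightarrow>\<^sub>L 'c \<otimes>\<^sub>H 'd)" where
  "hom_tensor B D \<phi> \<psi> = (THE \<Phi>. star_hom_on (B \<otimes>\<^sub>s D) \<Phi> \<and>
     (\<forall>b\<in>B. \<forall>d\<in>D. \<Phi> (b \<otimes>\<^sub>o d) = \<phi> b \<otimes>\<^sub>o \<psi> d) \<and> (\<forall>x. x \<notin> B \<otimes>\<^sub>s D \<longrightarrow> \<Phi> x = 0))"


section \<open>Bicharacters\<close>

text \<open>\<open>bicharacter WC WA V\<close>: \<open>V\<close> is a bicharacter from the quantum group of \<open>WC\<close> to that of \<open>WA\<close>.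
  Conjugation by \<open>assoc\<close> only moves the first identity to the right-bracketed threefold
  tensor product.\<close>

definition bicharacter ::
  "('c::chilbert_space \<otimes>\<^sub>H 'c \<Rightarrow>\<^sub>L 'c \<otimes>\<^sub>H 'c) \<Rightarrow> ('a::chilbert_space \<otimes>\<^sub>H 'a \<Rightarrow>\<^sub>L 'a \<otimes>\<^sub>H 'a)
    \<Rightarrow> ('c \<otimes>\<^sub>H 'a \<Rightarrow>\<^sub>L 'c \<otimes>\<^sub>H 'a) \<Rightarrow> bool" where
  "bicharacter WC WA V \<longleftrightarrow>
     V \<in> unitary_multipliers (dual_algebra WC \<otimes>\<^sub>s qg_algebra WA) \<and>
     assoc o\<^sub>L
       multiplier_ext (dual_algebra WC \<otimes>\<^sub>s qg_algebra WA)
         (hom_tensor (dual_algebra WC) (qg_algebra WA) (dual_comult WC) (\<lambda>a. a)) V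
       o\<^sub>L adj assoc
     = leg23 V o\<^sub>L leg13 V \<and>
     multiplier_ext (dual_algebra WC \<otimes>\<^sub>s qg_algebra WA)
       (hom_tensor (dual_algebra WC) (qg_algebra WA) (\<lambda>c. c) (qg_comult WA)) V
     = leg12 V o\<^sub>L leg13 V"

text \<open>\<open>comes_from WC WA U V\<close>: the unitary operator \<open>U\<close> is the image of the multiplier \<open>V\<close> under the
  extension to multipliers of the defining representation (i.e. the inclusion).\<close>

definition comes_from ::
  "('c::chilbert_space \<otimes>\<^sub>H 'c \<Rightarrow>\<^sub>L 'c \<otimes>\<^sub>H 'c) \<Rightarrow> ('a::chilbert_space \<otimes>\<^sub>H 'a \<Rightarrow>\<^sub>L 'a \<otimes>\<^sub>H 'a)
    \<Rightarrow> ('c \<otimes>\<^sub>H 'a \<Rightarrow>\<^sub>L 'c \<otimes>\<^sub>H 'a) \<Rightarrow> ('c \<otimes>\<^sub>H 'a \<Rightarrow>\<^sub>L 'c \<otimes>\<^sub>H 'a) \<Rightarrow> bool" where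
  "comes_from WC WA U V \<longleftrightarrow>
     multiplier_ext (dual_algebra WC \<otimes>\<^sub>s qg_algebra WA) (\<lambda>x. x) V = U"

end

theory Submission
  imports Defs
begin

text \<open>Let \<open>D\<close> be the dual of \<open>C\<close>. The representation of \<open>D \<otimes> A\<close> is its inclusion, and the extensions of
  \<open>\<Delta> \<otimes> id\<close> and \<open>id \<otimes> \<Delta>\<close> to multipliers are conjugations by the multiplicative unitaries. So the equations of a
  bicharacter are the two equations of the theorem, and the point is that a unitary \<open>U\<close> with
  these equations is a multiplier of \<open>D \<otimes> A\<close>.

  The second equation says \<open>U\<^sub>1\<^sub>3 = U\<^sub>1\<^sub>2\<^sup>* W\<^sub>2\<^sub>3 U\<^sub>1\<^sub>2 W\<^sub>2\<^sub>3\<^sup>*\<close> with \<open>W = W\<^sup>A\<close>. Hence \<open>U\<close> maps the space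
  \<open>H \<otimes> A\<close> of columns with entries in \<open>A\<close> into itself if \<open>W\<^sup>A\<close> and its adjoint do. Likewise the first
  equation \<open>U\<^sub>1\<^sub>3 = W\<^sub>1\<^sub>2\<^sup>* U\<^sub>2\<^sub>3 W\<^sub>1\<^sub>2 U\<^sub>2\<^sub>3\<^sup>*\<close> with \<open>W = W\<^sup>C\<close> gives \<open>U (D \<otimes> A) \<subseteq> D \<otimes> A\<close>, because \<open>W\<^sup>C\<close>
  and its adjoint preserve \<open>D \<otimes> H\<close>; the same holds for the adjoint of \<open>U\<close>.

  That a modular multiplicative unitary \<open>W\<close> preserves \<open>H \<otimes> A\<close> is shown in an ultrapower of \<open>H\<close>, to
  which \<open>W\<close> extends as a contraction \<open>X\<close>. The pentagon equation makes \<open>X\<close> isometric on the vectors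
  coming from \<open>A\<close>, and an isometric \<open>X\<close> excludes, by an argument of Dini type, that a column of \<open>W\<close>
  loses mass at infinity. For the adjoint of \<open>W\<close> the modularity enters: the adjoint of the unitary
  \<open>Wt\<close> on \<open>K \<otimes> H\<close>, with \<open>K\<close> conjugate to \<open>H\<close>, inherits the property from \<open>W\<close>, and there is a unitary that
  carries the complex conjugates of the entries of \<open>W\<close> to the entries of \<open>Wt\<close>. By the C*-identity
  the tails of the columns of both adjoints are then comparable in norm.\<close>

section \<open>Closed linear spans\<close>

text \<open>Being a multiplier is a statement about norms. A column
  \<open>W o\<^sub>L ketL v o\<^sub>L a\<close> is the strong limit of its finite truncations by
  \<open>proj1 F\<close>, whose entries lie in the algebra; the work is to make this a norm limit,
  and an ultrapower turns a failure of norm convergence into a single vector. The obstacle is that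
  passing to the ultrapower is a compression: it is multiplicative when the right factor has tight
  columns, which for \<open>W\<close> is just what is to be proved. For comultiplied elements it is
  known beforehand, from the adjoint pentagon equation and the self-adjointness of the algebra, and
  this makes \<open>adj X o\<^sub>L X\<close> commute with
  \<open>b \<otimes>\<^sub>o id_blinfun\<close> for \<open>b\<close> in the algebra. The operator
  \<open>X o\<^sub>L adj X\<close> commutes instead with amplified comultiplications, so the
  argument does not carry over to the adjoint of \<open>W\<close>. There, the squared tail of a
  column is a polynomial in entries and their adjoints. The passage from entries of \<open>W\<close>
  to entries of \<open>Wt\<close> is the antilinear homomorphism that sends x to the adjoint of
  R(x), with R the unitary antipode; as a unitary implements it, norms of such polynomials can be
  compared.\<close>

definition closed_span :: "'a::real_normed_vector set \<Rightarrow> 'a set" where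
  "closed_span S = closure (span S)"

lemma subspace_closure:
  fixes S :: "'a::real_normed_vector set"
  assumes "subspace S"
  shows "subspace (closure S)"
proof (rule subspaceI)
  show "0 \<in> closure S"
    using assms closure_subset subspace_0 by blast
next
  fix x y assume "x \<in> closure S" "y \<in> closure S"
  then obtain f g where "\<forall>n. f n \<in> S" "f \<longlonglongrightarrow> x" "\<forall>n. g n \<in> S" "g \<longlonglongrightarrow> y"
    unfolding closure_sequential by blast
  then have "\<forall>n. f n + g n \<in> S" "(\<lambda>n. f n + g n) \<longlonglongrightarrow> x + y"
    using assms by (auto intro: subspace_add tendsto_add)
  then show "x + y \<in> closure S"
    unfolding closure_sequential by (intro exI[of _ "\<lambda>n. f n + g n"]) simp
next
  fix c :: real and x assume "x \<in> closure S"
  then obtain f where "\<forall>n. f n \<in> S" "f \<longlonglongrightarrow> x"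
    unfolding closure_sequential by blast
  then have "\<forall>n. c *\<^sub>R f n \<in> S" "(\<lambda>n. c *\<^sub>R f n) \<longlonglongrightarrow> c *\<^sub>R x"
    using assms by (auto intro: subspace_scale tendsto_scaleR)
  then show "c *\<^sub>R x \<in> closure S"
    unfolding closure_sequential by (intro exI[of _ "\<lambda>n. c *\<^sub>R f n"]) simp
qed

lemma subspace_closed_span [simp, intro]: "subspace (closed_span S)"
  unfolding closed_span_def by (simp add: subspace_closure)

lemma closed_closed_span [simp, intro]: "closed (closed_span S)"
  unfolding closed_span_def by simp

lemma closed_span_base: "x \<in> S \<Longrightarrow> x \<in> closed_span S"
  unfolding closed_span_def using closure_subset span_base by blast

lemma closed_span_minimal:
  assumes "S \<subseteq> M" "subspace M" "closed M"
  shows "closed_span S \<subseteq> M"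
  unfolding closed_span_def using assms by (intro closure_minimal span_minimal)

lemma closed_span_mono: "S \<subseteq> T \<Longrightarrow> closed_span S \<subseteq> closed_span T"
  by (rule closed_span_minimal) (auto intro: closed_span_base)

text \<open>Preimages of closed subspaces under bounded linear maps are closed subspaces, so
  generators suffice. Nearly all memberships in spaces of operators are obtained in this
  way.\<close>

lemma closed_span_image:
  assumes x: "x \<in> closed_span S" and f: "bounded_linear f"
    and M: "\<And>s. s \<in> S \<Longrightarrow> f s \<in> M" "subspace M" "closed M"
  shows "f x \<in> M"
proof -
  have "subspace (f -` M)"
    using M(2) by (auto simp: subspace_def linear_simps[OF f])
  moreover have "closed (f -` M)"
    using continuous_closed_vimage[OF M(3), of f] f
    by (simp add: linear_continuous_at)
  ultimately have "closed_span S \<subseteq> f -` M"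
    using M(1) by (intro closed_span_minimal) auto
  then show ?thesis using x by blast
qed

lemma closed_span_bilinear:
  assumes "x \<in> closed_span S" "y \<in> closed_span T" and h: "bounded_bilinear h"
    and M: "\<And>s t. s \<in> S \<Longrightarrow> t \<in> T \<Longrightarrow> h s t \<in> M" "subspace M" "closed M"
  shows "h x y \<in> M"
proof (rule closed_span_image[OF assms(1)])
  show "bounded_linear (\<lambda>x. h x y)"
    by (rule bounded_bilinear.bounded_linear_left[OF h])
  fix s assume "s \<in> S"
  show "h s y \<in> M"
    by (rule closed_span_image[OF assms(2) bounded_bilinear.bounded_linear_right[OF h]])
      (use M \<open>s \<in> S\<close> in auto)
qed (use M in auto)

lemma closed_span_eq:
  assumes x: "x \<in> closed_span S" and f: "bounded_linear f" and g: "bounded_linear g"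
    and eq: "\<And>s. s \<in> S \<Longrightarrow> f s = g s"
  shows "f x = g x"
proof -
  have "f x - g x \<in> {0}"
    by (rule closed_span_image[OF x bounded_linear_sub[OF f g]]) (auto simp: eq subspace_def)
  then show ?thesis by simp
qed

section \<open>Projections and the Riesz representation\<close>

lemma parallelogram:
  fixes x y :: "'a::real_inner"
  shows "(norm (x + y))\<^sup>2 + (norm (x - y))\<^sup>2 = 2 * (norm x)\<^sup>2 + 2 * (norm y)\<^sup>2"
  by (simp add: power2_norm_eq_inner inner_add inner_diff inner_commute)

text \<open>A minimising sequence is Cauchy: the midpoint of two of its terms lies in
  \<open>M\<close> as well, and the parallelogram law turns near minimality into closeness.\<close>

lemma ex_closest_point_subspace:
  fixes M :: "'a::{real_inner,banach} set"
  assumes "subspace M" "closed M"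
  shows "\<exists>m\<in>M. \<forall>n\<in>M. norm (x - m) \<le> norm (x - n)"
proof -
  define d where "d = (INF n\<in>M. norm (x - n))"
  have ne: "M \<noteq> {}" using assms(1) subspace_0 by blast
  have bdd: "bdd_below ((\<lambda>n. norm (x - n)) ` M)" by (rule bdd_belowI2[of _ 0]) simp
  have d_le: "d \<le> norm (x - n)" if "n \<in> M" for n
    unfolding d_def using bdd that by (rule cINF_lower)
  have d0: "0 \<le> d" unfolding d_def using ne by (intro cINF_greatest) auto
  have "\<exists>n\<in>M. norm (x - n) < d + 1 / real (Suc k)" for k
  proof (rule ccontr)
    assume "\<not> ?thesis"
    then have "d + 1 / real (Suc k) \<le> d"
      unfolding d_def using ne by (intro cINF_greatest) auto
    then show False by simp
  qed
  then obtain f where f: "\<And>k. f k \<in> M" "\<And>k. norm (x - f k) < d + 1 / real (Suc k)"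
    by metis
  \<comment> \<open>With e = 1/(N+1), the parallelogram law leaves 4(d+e)^2 - (2d)^2 = 4(2d+e)e, and
    e is at most 1.\<close>
  have est: "(norm (f j - f k))\<^sup>2 \<le> 4 * (2 * d + 1) * (1 / real (Suc N))"
    if jk: "j \<ge> N" "k \<ge> N" for j k N
  proof -
    let ?e = "1 / real (Suc N)"
    have e: "0 \<le> ?e" "?e \<le> 1" by auto
    have "1 / real (Suc j) \<le> ?e" "1 / real (Suc k) \<le> ?e"
      using jk by (auto intro!: divide_left_mono)
    then have n: "norm (x - f j) \<le> d + ?e" "norm (x - f k) \<le> d + ?e"
      using f(2)[of j] f(2)[of k] by linarith+
    then have n2: "(norm (x - f j))\<^sup>2 \<le> (d + ?e)\<^sup>2" "(norm (x - f k))\<^sup>2 \<le> (d + ?e)\<^sup>2"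
      by (simp_all add: power_mono)
    have "(1/2) *\<^sub>R (f j + f k) \<in> M"
      using f(1) assms(1) by (simp add: subspace_add subspace_scale)
    then have "2 * d \<le> 2 * norm (x - (1/2) *\<^sub>R (f j + f k))" using d_le by simp
    also have "\<dots> = norm (2 *\<^sub>R (x - (1/2) *\<^sub>R (f j + f k)))" by simp
    also have "2 *\<^sub>R (x - (1/2) *\<^sub>R (f j + f k)) = (x - f j) + (x - f k)"
      by (simp add: algebra_simps scaleR_2)
    finally have "(2 * d)\<^sup>2 \<le> (norm ((x - f j) + (x - f k)))\<^sup>2"
      using d0 by (intro power_mono) auto
    moreover have "(norm ((x - f j) + (x - f k)))\<^sup>2 + (norm (f k - f j))\<^sup>2
        = 2 * (norm (x - f j))\<^sup>2 + 2 * (norm (x - f k))\<^sup>2"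
      using parallelogram[of "x - f j" "x - f k"] by simp
    ultimately have "(norm (f k - f j))\<^sup>2 \<le> 4 * (d + ?e)\<^sup>2 - (2 * d)\<^sup>2"
      using n2 by linarith
    also have "\<dots> = 4 * (2 * d + ?e) * ?e" by (simp add: power2_eq_square algebra_simps)
    also have "\<dots> \<le> 4 * (2 * d + 1) * ?e"
      using e by (intro mult_right_mono mult_left_mono) auto
    finally show ?thesis by (simp add: norm_minus_commute)
  qed
  have "Cauchy f"
  proof (rule CauchyI)
    fix r :: real assume "r > 0"
    have pos: "0 < r\<^sup>2 / (4 * (2 * d + 1))" using \<open>r > 0\<close> d0 by simp
    then obtain N where N: "1 / real (Suc N) < r\<^sup>2 / (4 * (2 * d + 1))"
      using nat_approx_posE by blast
    have "norm (f j - f k) < r" if "j \<ge> N" "k \<ge> N" for j k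
    proof (rule power2_less_imp_less)
      have "4 * (2 * d + 1) * (1 / real (Suc N)) < r\<^sup>2"
        using N d0 by (simp add: pos_less_divide_eq mult.commute)
      then show "(norm (f j - f k))\<^sup>2 < r\<^sup>2" using est[OF that] by linarith
    qed (use \<open>r > 0\<close> in simp)
    then show "\<exists>N. \<forall>m\<ge>N. \<forall>n\<ge>N. norm (f m - f n) < r" by blast
  qed
  then obtain m where m: "f \<longlonglongrightarrow> m"
    using Cauchy_convergent_iff convergent_def by blast
  then have "m \<in> M"
    using assms(2) f(1) closed_sequentially by blast
  have "norm (x - m) \<le> d"
  proof (rule LIMSEQ_le)
    show "(\<lambda>k. norm (x - f k)) \<longlonglongrightarrow> norm (x - m)" by (intro tendsto_intros m)
    have "(\<lambda>k. d + 1 / real (Suc k)) \<longlonglongrightarrow> d + 0"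
      by (intro tendsto_intros LIMSEQ_Suc lim_const_over_n)
    then show "(\<lambda>k. d + 1 / real (Suc k)) \<longlonglongrightarrow> d" by simp
    show "\<exists>N. \<forall>n\<ge>N. norm (x - f n) \<le> d + 1 / real (Suc n)" using f(2) less_imp_le by blast
  qed
  then show ?thesis using \<open>m \<in> M\<close> d_le order_trans by blast
qed

text \<open>Subspaces are real here. Stability under complex scalars lets real orthogonality to
  \<open>\<i> *\<^sub>C m\<close> supply the imaginary part.\<close>

lemma ex_cinner_orthogonal:
  fixes M :: "'a::chilbert_space set"
  assumes M: "subspace M" "closed M" "M \<noteq> UNIV" and scale: "\<And>c m. m \<in> M \<Longrightarrow> c *\<^sub>C m \<in> M"
  shows "\<exists>z. z \<noteq> 0 \<and> (\<forall>m\<in>M. cinner m z = 0)"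
proof -
  obtain x where "x \<notin> M" using M(3) by blast
  obtain p where p: "p \<in> M" "\<And>n. n \<in> M \<Longrightarrow> norm (x - p) \<le> norm (x - n)"
    using ex_closest_point_subspace[OF M(1,2)] by blast
  define z where "z = x - p"
  have "z \<noteq> 0" using p(1) \<open>x \<notin> M\<close> by (auto simp: z_def)
  have orth: "inner m z = 0" if m: "m \<in> M" for m
  proof (cases "m = 0")
    case False
    \<comment> \<open>This real number minimises the norm of \<open>z - t *\<^sub>R m\<close>; as
      \<open>z\<close> is already minimal, \<open>inner m z\<close> must vanish.\<close>
    define t where "t = inner m z / (norm m)\<^sup>2"
    have nm: "(norm m)\<^sup>2 \<noteq> 0" using False by simp
    have "norm z \<le> norm (z - t *\<^sub>R m)"
      using p(2)[of "p + t *\<^sub>R m"] p(1) m M(1)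
      by (simp add: z_def subspace_add subspace_scale algebra_simps)
    then have "(norm z)\<^sup>2 \<le> (norm (z - t *\<^sub>R m))\<^sup>2" by (simp add: power_mono)
    also have "\<dots> = (norm z)\<^sup>2 - 2 * t * inner m z + t * t * (norm m)\<^sup>2"
      unfolding power2_norm_eq_inner inner_diff_left inner_diff_right
      by (simp add: inner_commute[of z m])
    also have "t * t * (norm m)\<^sup>2 = t * inner m z"
      using nm by (simp add: t_def power2_eq_square)
    finally have "t * inner m z \<le> 0" by simp
    then have "(inner m z)\<^sup>2 / (norm m)\<^sup>2 \<le> 0" by (simp add: t_def power2_eq_square)
    then have "(inner m z)\<^sup>2 \<le> 0" using nm by (simp add: divide_le_0_iff)
    then show ?thesis by simp
  qed simp
  have "cinner m z = 0" if "m \<in> M" for m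
  proof (rule complex_eqI)
    show "Re (cinner m z) = Re 0" using orth[OF that] by (simp add: inner_eq_Re_cinner)
    have "Re (cinner (\<i> *\<^sub>C m) z) = 0"
      using orth[OF scale[OF that]] by (simp add: inner_eq_Re_cinner)
    then show "Im (cinner m z) = Im 0" by (simp add: cinner_scaleC_left)
  qed
  then show ?thesis using \<open>z \<noteq> 0\<close> by blast
qed

lemma scaleC_scaleR: "c *\<^sub>C (r *\<^sub>R x) = r *\<^sub>R c *\<^sub>C (x::'a::chilbert_space)"
  by (simp only: scaleR_scaleC scaleC_scaleC mult.commute[of c])

lemma bounded_linear_scaleC [intro]: "bounded_linear (\<lambda>x::'a::chilbert_space. c *\<^sub>C x)"
  by (rule bounded_linear_intro[where K = "cmod c"])
    (simp_all add: scaleC_add_right scaleC_scaleR norm_scaleC mult.commute)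

text \<open>Spans are real because operators are handled as a real normed space. Complex scalars are
  recovered from generating sets that absorb them.\<close>

lemma closed_span_scaleC:
  fixes S :: "'a::chilbert_space set"
  assumes "\<And>c s. s \<in> S \<Longrightarrow> c *\<^sub>C s \<in> closed_span S" "x \<in> closed_span S"
  shows "c *\<^sub>C x \<in> closed_span S"
  by (rule closed_span_image[OF assms(2) bounded_linear_scaleC]) (use assms(1) in auto)

lemma closed_span_UNIV:
  fixes S :: "'a::chilbert_space set"
  assumes "\<And>c s. s \<in> S \<Longrightarrow> c *\<^sub>C s \<in> closed_span S"
    and "\<And>z. (\<And>s. s \<in> S \<Longrightarrow> cinner s z = 0) \<Longrightarrow> z = 0"
  shows "closed_span S = UNIV"
proof (rule ccontr)
  assume "closed_span S \<noteq> UNIV"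
  then have "\<exists>z. z \<noteq> 0 \<and> (\<forall>m\<in>closed_span S. cinner m z = 0)"
    by (intro ex_cinner_orthogonal closed_span_scaleC[OF assms(1)]) auto
  then obtain z where z: "z \<noteq> 0" "\<forall>m\<in>closed_span S. cinner m z = 0" by blast
  have "z = 0" by (rule assms(2)) (use z(2) closed_span_base in blast)
  then show False using z(1) by contradiction
qed

lemma riesz:
  fixes f :: "'a::chilbert_space \<Rightarrow> complex"
  assumes f: "bounded_linear f" and scale: "\<And>c x. f (c *\<^sub>C x) = c * f x"
  shows "\<exists>y. \<forall>x. f x = cinner y x"
proof (cases "\<forall>x. f x = 0")
  case True
  then show ?thesis by (intro exI[of _ 0]) simp
next
  case False
  interpret f: bounded_linear f by (rule f)
  let ?M = "f -` {0}"
  have "subspace ?M"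
    by (auto simp: subspace_def f.zero f.add f.scaleR)
  moreover have "closed ?M"
    using continuous_closed_vimage[of "{0}" f] f by (simp add: linear_continuous_at)
  ultimately obtain z where z: "z \<noteq> 0" "\<And>m. f m = 0 \<Longrightarrow> cinner m z = 0"
    using ex_cinner_orthogonal[of ?M] False by (force simp: scale)
  have fz: "f z \<noteq> 0" using z cinner_self[of z] by force
  \<comment> \<open>A vector orthogonal to the kernel represents \<open>f\<close> up to a factor,
    which is found by evaluating at \<open>z\<close>.\<close>
  define y where "y = cnj (f z / cinner z z) *\<^sub>C z"
  have "f x = cinner y x" for x
  proof -
    have "f (x - (f x / f z) *\<^sub>C z) = 0"
      using fz by (simp add: f.diff scale)
    then have "cinner (x - (f x / f z) *\<^sub>C z) z = 0" by (rule z)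
    then have "cinner z (x - (f x / f z) *\<^sub>C z) = 0"
      by (subst cinner_commute) simp
    then have "cinner z x = (f x / f z) * cinner z z"
      by (simp add: cinner_diff_right cinner_scaleC_right)
    moreover have "cinner z z \<noteq> 0" using z(1) by (simp add: cinner_self)
    ultimately show ?thesis
      using fz by (simp add: y_def cinner_scaleC_left)
  qed
  then show ?thesis by blast
qed

lemma cinner_eqI_left: "(\<And>z. cinner x z = cinner y z) \<Longrightarrow> x = (y::'a::chilbert_space)"
  by (metis cinner_diff_left cinner_self eq_iff_diff_eq_0 norm_eq_zero of_real_eq_0_iff
      zero_eq_power2)

lemma cinner_eqI_right: "(\<And>z. cinner z x = cinner z y) \<Longrightarrow> x = (y::'a::chilbert_space)"
  by (rule cinner_eqI_left) (metis cinner_commute)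

section \<open>Bounded operators and adjoints\<close>

lemma scaleC_zero_right [simp]: "c *\<^sub>C (0::'a::chilbert_space) = 0"
  by (rule cinner_eqI_right) (simp add: cinner_scaleC_right)

lemma scaleC_zero_left [simp]: "0 *\<^sub>C (x::'a::chilbert_space) = 0"
  by (rule cinner_eqI_right) (simp add: cinner_scaleC_right)

lemma scaleC_minus_one: "(-1) *\<^sub>C (x::'a::chilbert_space) = - x"
  using scaleR_scaleC[of "-1" x] by simp

lemma bopI:
  fixes T :: "'a::chilbert_space \<Rightarrow>\<^sub>L 'b::chilbert_space"
  shows "(\<And>c x. T (c *\<^sub>C x) = c *\<^sub>C T x) \<Longrightarrow> T \<in> bop"
  by (simp add: bop_def)

lemma bop_scaleC:
  fixes T :: "'a::chilbert_space \<Rightarrow>\<^sub>L 'b::chilbert_space"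
  shows "T \<in> bop \<Longrightarrow> T (c *\<^sub>C x) = c *\<^sub>C T x"
  by (simp add: bop_def)

lemma bop_id [simp, intro]: "id_blinfun \<in> bop"
  by (simp add: bop_def)

lemma bop_zero [simp, intro]: "0 \<in> bop"
  by (simp add: bop_def)

lemma bop_compose [simp, intro]: "S \<in> bop \<Longrightarrow> T \<in> bop \<Longrightarrow> S o\<^sub>L T \<in> bop"
  by (simp add: bop_def)

lemma bop_add [simp, intro]: "S \<in> bop \<Longrightarrow> T \<in> bop \<Longrightarrow> S + T \<in> bop"
  by (simp add: bop_def blinfun.add_left scaleC_add_right)

lemma bop_scaleR [simp, intro]: "S \<in> bop \<Longrightarrow> r *\<^sub>R S \<in> bop"
  by (simp add: bop_def blinfun.scaleR_left scaleC_scaleR)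

lemma bop_diff [simp, intro]: "S \<in> bop \<Longrightarrow> T \<in> bop \<Longrightarrow> S - T \<in> bop"
  using bop_add[of S "(-1) *\<^sub>R T"] bop_scaleR[of T "-1"] by simp

lemma subspace_bop [simp, intro]: "subspace bop"
  by (rule subspaceI) auto

lemma closed_bop [simp, intro]: "closed (bop :: ('a::chilbert_space \<Rightarrow>\<^sub>L 'b::chilbert_space) set)"
proof -
  have "closed {T :: 'a \<Rightarrow>\<^sub>L 'b. T (c *\<^sub>C x) = c *\<^sub>C T x}" for c x
  proof (rule closed_Collect_eq)
    show "continuous_on UNIV (\<lambda>T :: 'a \<Rightarrow>\<^sub>L 'b. T (c *\<^sub>C x))"
      by (intro linear_continuous_on blinfun.bounded_linear_left)
    show "continuous_on UNIV (\<lambda>T :: 'a \<Rightarrow>\<^sub>L 'b. c *\<^sub>C T x)"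
      by (intro linear_continuous_on bounded_linear_compose[OF bounded_linear_scaleC]
          blinfun.bounded_linear_left)
  qed
  then have "closed {T :: 'a \<Rightarrow>\<^sub>L 'b. \<forall>c x. T (c *\<^sub>C x) = c *\<^sub>C T x}"
    by (intro closed_Collect_all)
  then show ?thesis unfolding bop_def .
qed

lemma bop_eqI:
  fixes S T :: "'a::chilbert_space \<Rightarrow>\<^sub>L 'b::chilbert_space"
  assumes "\<And>x y. cinner x (S y) = cinner x (T y)"
  shows "S = T"
  by (intro blinfun_eqI cinner_eqI_right assms)

lemma ex_adj:
  fixes T :: "'a::chilbert_space \<Rightarrow>\<^sub>L 'b::chilbert_space"
  assumes T: "T \<in> bop"
  shows "\<exists>S :: 'b \<Rightarrow>\<^sub>L 'a. \<forall>x y. cinner (S y) x = cinner y (T x)"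
proof -
  have "\<exists>z. \<forall>x. cinner y (T x) = cinner z x" for y
  proof (rule riesz)
    show "bounded_linear (\<lambda>x. cinner y (T x))"
      by (rule bounded_linear_compose[OF bounded_linear_cinner_right blinfun.bounded_linear_right])
  qed (simp add: bop_scaleC[OF T] cinner_scaleC_right)
  then obtain S where S: "\<And>y x. cinner y (T x) = cinner (S y) x" by metis
  have "bounded_linear S"
  proof (rule bounded_linear_intro[where K = "norm T"])
    show "S (x + y) = S x + S y" for x y
      by (rule cinner_eqI_left) (simp add: cinner_add_left flip: S)
    show "S (r *\<^sub>R x) = r *\<^sub>R S x" for r x
      by (rule cinner_eqI_left) (simp add: cinner_scaleR_left flip: S)
    show "norm (S y) \<le> norm y * norm T" for y
    proof (cases "S y = 0")
      case False
      have "(norm (S y))\<^sup>2 = cmod (cinner (S y) (S y))"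
        by (simp add: cinner_self del: of_real_power)
      also have "\<dots> = cmod (cinner y (T (S y)))" by (simp add: S)
      also have "\<dots> \<le> norm y * norm (T (S y))" by (rule cmod_cinner_le)
      also have "\<dots> \<le> norm y * (norm T * norm (S y))"
        by (intro mult_left_mono norm_blinfun) simp
      finally show ?thesis using False by (simp add: power2_eq_square)
    qed simp
  qed
  then show ?thesis
    by (intro exI[of _ "Blinfun S"]) (simp add: bounded_linear_Blinfun_apply S)
qed

lemma adj_eqI:
  fixes T :: "'a::chilbert_space \<Rightarrow>\<^sub>L 'b::chilbert_space" and S :: "'b \<Rightarrow>\<^sub>L 'a"
  assumes "\<And>x y. cinner (S y) x = cinner y (T x)"
  shows "adj T = S"
  unfolding adj_def
proof (rule the_equality)
  fix S' :: "'b \<Rightarrow>\<^sub>L 'a"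
  assume "\<forall>x y. cinner (S' y) x = cinner y (T x)"
  then show "S' = S" by (intro blinfun_eqI cinner_eqI_left) (simp add: assms)
qed (simp add: assms)

lemma cinner_adj_left:
  fixes T :: "'a::chilbert_space \<Rightarrow>\<^sub>L 'b::chilbert_space"
  assumes "T \<in> bop"
  shows "cinner (adj T y) x = cinner y (T x)"
  using ex_adj[OF assms] adj_eqI by metis

lemma cinner_adj_right:
  fixes T :: "'a::chilbert_space \<Rightarrow>\<^sub>L 'b::chilbert_space"
  assumes "T \<in> bop"
  shows "cinner x (adj T y) = cinner (T x) y"
  by (subst (1 2) cinner_commute) (simp add: cinner_adj_left[OF assms])

lemma bop_adj [simp, intro]: "T \<in> bop \<Longrightarrow> adj T \<in> bop"
  by (rule bopI, rule cinner_eqI_left) (simp add: cinner_adj_left cinner_scaleC_left)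

lemma adj_adj [simp]:
  assumes "T \<in> bop"
  shows "adj (adj T) = T"
  by (rule adj_eqI) (rule cinner_adj_right[OF assms, symmetric])

lemma adj_compose:
  assumes "S \<in> bop" "T \<in> bop"
  shows "adj (S o\<^sub>L T) = adj T o\<^sub>L adj S"
proof (rule adj_eqI)
  fix x y
  have "cinner ((adj T o\<^sub>L adj S) y) x = cinner (adj S y) (T x)"
    by (simp add: cinner_adj_left[OF assms(2)])
  then show "cinner ((adj T o\<^sub>L adj S) y) x = cinner y ((S o\<^sub>L T) x)"
    by (simp add: cinner_adj_left[OF assms(1)])
qed

lemma adj_id [simp]: "adj id_blinfun = id_blinfun"
  by (rule adj_eqI) simp

lemma adj_zero [simp]: "adj 0 = 0"
  by (rule adj_eqI) simp

lemma adj_add: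
  assumes "S \<in> bop" "T \<in> bop"
  shows "adj (S + T) = adj S + adj T"
  by (rule adj_eqI)
    (simp only: cinner_adj_left[OF assms(1)] cinner_adj_left[OF assms(2)] blinfun.add_left
      cinner_add_left cinner_add_right)

lemma adj_diff:
  assumes "S \<in> bop" "T \<in> bop"
  shows "adj (S - T) = adj S - adj T"
  by (rule adj_eqI)
    (simp only: cinner_adj_left[OF assms(1)] cinner_adj_left[OF assms(2)] blinfun.diff_left
      cinner_diff_left cinner_diff_right)

lemma adj_scaleR:
  assumes "T \<in> bop"
  shows "adj (r *\<^sub>R T) = r *\<^sub>R adj T"
  by (rule adj_eqI)
    (simp only: cinner_adj_left[OF assms] blinfun.scaleR_left cinner_scaleR_left cinner_scaleR_right)

lemma norm_adj_le:
  assumes "T \<in> bop"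
  shows "norm (adj T) \<le> norm T"
proof (rule norm_blinfun_bound)
  fix y
  show "norm (adj T y) \<le> norm T * norm y"
  proof (cases "adj T y = 0")
    case False
    have "(norm (adj T y))\<^sup>2 = cmod (cinner (adj T y) (adj T y))"
      by (simp add: cinner_self del: of_real_power)
    also have "\<dots> = cmod (cinner y (T (adj T y)))" by (simp only: cinner_adj_left[OF assms])
    also have "\<dots> \<le> norm y * norm (T (adj T y))" by (rule cmod_cinner_le)
    also have "\<dots> \<le> norm y * (norm T * norm (adj T y))"
      by (intro mult_left_mono norm_blinfun) simp
    finally show ?thesis using False by (simp add: power2_eq_square mult.commute)
  qed simp
qed simp

lemma norm_adj: "T \<in> bop \<Longrightarrow> norm (adj T) = norm T"
  using norm_adj_le[of T] norm_adj_le[of "adj T"] by simp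

lemma closed_span_bop: "S \<subseteq> bop \<Longrightarrow> closed_span S \<subseteq> bop"
  by (rule closed_span_minimal) auto

text \<open>The adjoint and the tensor product of operators are linear on \<open>bop\<close> only, so the images of
  closed spans have to be treated relative to it.\<close>

definition bounded_linear_on ::
  "'a::real_normed_vector set \<Rightarrow> ('a \<Rightarrow> 'b::real_normed_vector) \<Rightarrow> bool" where
  "bounded_linear_on D f \<longleftrightarrow> (\<forall>x\<in>D. \<forall>y\<in>D. f (x + y) = f x + f y) \<and>
     (\<forall>r. \<forall>x\<in>D. f (r *\<^sub>R x) = r *\<^sub>R f x) \<and> (\<exists>K. \<forall>x\<in>D. norm (f x) \<le> norm x * K)"

lemma bounded_linear_onI:
  assumes "\<And>x y. x \<in> D \<Longrightarrow> y \<in> D \<Longrightarrow> f (x + y) = f x + f y"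
    "\<And>r x. x \<in> D \<Longrightarrow> f (r *\<^sub>R x) = r *\<^sub>R f x" "\<And>x. x \<in> D \<Longrightarrow> norm (f x) \<le> norm x * K"
  shows "bounded_linear_on D f"
  using assms unfolding bounded_linear_on_def by blast

lemma bounded_linear_on_tendsto:
  assumes f: "bounded_linear_on D f" and D: "subspace D"
    and x: "\<And>n. x n \<in> D" "l \<in> D" "x \<longlonglongrightarrow> l"
  shows "(\<lambda>n. f (x n)) \<longlonglongrightarrow> f l"
proof -
  obtain K where K: "\<And>x. x \<in> D \<Longrightarrow> norm (f x) \<le> norm x * K"
    using f unfolding bounded_linear_on_def by blast
  have add: "f (u + v) = f u + f v" if "u \<in> D" "v \<in> D" for u v
    using f that unfolding bounded_linear_on_def by blast
  have scale: "f (r *\<^sub>R u) = r *\<^sub>R f u" if "u \<in> D" for u r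
    using f that unfolding bounded_linear_on_def by blast
  have "f (x n) - f l = f (x n - l)" for n
    using add[OF x(1)[of n] subspace_scale[OF D x(2), of "-1"]] scale[OF x(2), of "-1"] by simp
  then have "norm (f (x n) - f l) \<le> norm (x n - l) * K" for n
    using K[of "x n - l"] x D by (simp add: subspace_diff)
  moreover have "(\<lambda>n. norm (x n - l) * K) \<longlonglongrightarrow> 0"
    by (rule tendsto_mult_left_zero[OF tendsto_norm_zero[OF LIM_zero[OF x(3)]]])
  ultimately have "(\<lambda>n. f (x n) - f l) \<longlonglongrightarrow> 0"
    using Lim_null_comparison[of "\<lambda>n. f (x n) - f l" "\<lambda>n. norm (x n - l) * K" sequentially] by simp
  then show ?thesis by (simp add: LIM_zero_iff)
qed

lemma closed_span_image_on:
  assumes x: "x \<in> closed_span S" and S: "S \<subseteq> D" and D: "subspace D" "closed D"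
    and f: "bounded_linear_on D f"
    and M: "\<And>s. s \<in> S \<Longrightarrow> f s \<in> M" "subspace M" "closed M"
  shows "f x \<in> M"
proof -
  let ?N = "{x\<in>D. f x \<in> M}"
  have add: "f (x + y) = f x + f y" if "x \<in> D" "y \<in> D" for x y
    using f that unfolding bounded_linear_on_def by blast
  have scale: "f (r *\<^sub>R x) = r *\<^sub>R f x" if "x \<in> D" for x r
    using f that unfolding bounded_linear_on_def by blast
  have "f 0 = 0" using scale[of 0 0] D(1) by (simp add: subspace_0)
  then have "subspace ?N"
    using D(1) M(2) by (auto simp: subspace_def add scale)
  moreover have "closed ?N"
    unfolding closed_sequential_limits
  proof (intro allI impI)
    fix x l assume *: "(\<forall>n. x n \<in> ?N) \<and> x \<longlonglongrightarrow> l"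
    then have "l \<in> D" using D(2) closed_sequentially by blast
    then have "(\<lambda>n. f (x n)) \<longlonglongrightarrow> f l"
      using * by (intro bounded_linear_on_tendsto[OF f D(1)]) auto
    then have "f l \<in> M"
      by (rule closed_sequentially[OF M(3), rotated]) (use * in auto)
    then show "l \<in> ?N" using \<open>l \<in> D\<close> by blast
  qed
  ultimately have "closed_span S \<subseteq> ?N"
    using S M(1) by (intro closed_span_minimal) auto
  then show ?thesis using x by blast
qed

lemma bounded_linear_imp_on: "bounded_linear f \<Longrightarrow> bounded_linear_on D f"
  using bounded_linear.bounded[of f] by (auto simp: bounded_linear_on_def linear_simps)

lemma bounded_linear_on_comp:
  assumes f: "bounded_linear_on D f" "\<And>x. x \<in> D \<Longrightarrow> f x \<in> E" and g: "bounded_linear_on E g"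
  shows "bounded_linear_on D (\<lambda>x. g (f x))"
proof -
  obtain K L where K: "\<And>x. x \<in> D \<Longrightarrow> norm (f x) \<le> norm x * K"
    and L: "\<And>x. x \<in> E \<Longrightarrow> norm (g x) \<le> norm x * L"
    using f(1) g unfolding bounded_linear_on_def by meson
  show ?thesis
  proof (rule bounded_linear_onI[where K = "K * max L 0"])
    fix x assume x: "x \<in> D"
    have "norm (g (f x)) \<le> norm (f x) * max L 0"
      using L[OF f(2)[OF x]] mult_left_mono[of L "max L 0" "norm (f x)"] by simp
    also have "\<dots> \<le> norm x * K * max L 0" using K[OF x] by (intro mult_right_mono) auto
    finally show "norm (g (f x)) \<le> norm x * (K * max L 0)" by (simp add: mult.assoc)
  qed (use assms in \<open>auto simp: bounded_linear_on_def\<close>)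
qed

lemma bounded_linear_on_compose:
  assumes "bounded_linear_on D g" "bounded_linear f" "\<And>x. f x \<in> D"
  shows "bounded_linear (\<lambda>x. g (f x))"
proof -
  have "bounded_linear_on UNIV (\<lambda>x. g (f x))"
    by (rule bounded_linear_on_comp[OF bounded_linear_imp_on[OF assms(2)] _ assms(1)]) (rule assms(3))
  then show ?thesis by (auto simp: bounded_linear_on_def intro: bounded_linear_intro)
qed

lemma bounded_linear_on_adj: "bounded_linear_on bop adj"
  by (rule bounded_linear_onI[where K = 1]) (simp_all add: adj_add adj_scaleR norm_adj)

lemma closed_span_adj:
  assumes "x \<in> closed_span S" "S \<subseteq> bop" "\<And>s. s \<in> S \<Longrightarrow> adj s \<in> M" "subspace M" "closed M"
  shows "adj x \<in> M"
  by (rule closed_span_image_on[OF assms(1,2) subspace_bop closed_bop bounded_linear_on_adj])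
    (use assms in auto)

lemma bounded_bilinear_compose: "bounded_bilinear (o\<^sub>L)"
  by (rule bounded_bilinear_blinfun_compose)

lemma bounded_linear_compose_left: "bounded_linear (\<lambda>x. x o\<^sub>L y)"
  by (rule bounded_bilinear.bounded_linear_left[OF bounded_bilinear_compose])

lemma bounded_linear_compose_right: "bounded_linear (\<lambda>y. x o\<^sub>L y)"
  by (rule bounded_bilinear.bounded_linear_right[OF bounded_bilinear_compose])

lemma bounded_linear_apply: "bounded_linear (\<lambda>T. blinfun_apply T x)"
  by (rule blinfun.bounded_linear_left)

lemma op_scale_apply:
  fixes T :: "'a::chilbert_space \<Rightarrow>\<^sub>L 'b::chilbert_space"
  shows "op_scale c T x = c *\<^sub>C T x"
  unfolding op_scale_def
  by (simp add: bounded_linear_Blinfun_apply bounded_linear_compose[OF bounded_linear_scaleC]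
      blinfun.bounded_linear_right)

lemma bop_op_scale [simp, intro]: "T \<in> bop \<Longrightarrow> op_scale c T \<in> bop"
  by (simp add: bop_def op_scale_apply scaleC_scaleC mult.commute)

lemma bounded_linear_op_scale: "bounded_linear (op_scale c)"
proof (rule bounded_linear_intro[where K = "cmod c"])
  show "norm (op_scale c T) \<le> norm T * cmod c" for T
  proof (rule norm_blinfun_bound)
    fix x
    have "cmod c * norm (T x) \<le> cmod c * (norm T * norm x)"
      by (intro mult_left_mono norm_blinfun) simp
    then show "norm (op_scale c T x) \<le> norm T * cmod c * norm x"
      by (simp add: op_scale_apply norm_scaleC mult_ac)
  qed simp
qed (auto intro!: blinfun_eqI simp: op_scale_apply blinfun.add_left blinfun.scaleR_left
    scaleC_add_right scaleC_scaleR)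

lemma unitaryD:
  assumes "unitary U"
  shows "U \<in> bop" "adj U o\<^sub>L U = id_blinfun" "U o\<^sub>L adj U = id_blinfun"
  using assms by (auto simp: unitary_def)

lemma unitary_apply [simp]:
  assumes "unitary U"
  shows "adj U (U x) = x" "U (adj U y) = y"
  using unitaryD[OF assms] by (metis blinfun_apply_blinfun_compose blinfun_apply_id_blinfun)+

lemma unitary_adj: "unitary U \<Longrightarrow> unitary (adj U)"
  by (simp add: unitary_def)

lemma unitary_compose:
  assumes "unitary U" "unitary V"
  shows "unitary (U o\<^sub>L V)"
  unfolding unitary_def using assms[THEN unitaryD(1)]
  by (auto simp: adj_compose assms intro!: blinfun_eqI)

lemma unitary_cinner:
  assumes "unitary U"
  shows "cinner (U x) (U y) = cinner x y"
  using cinner_adj_left[OF unitaryD(1)[OF assms], of "U x" y] assms by simp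

lemma unitaryI:
  assumes "U \<in> bop" "\<And>x y. cinner (U x) (U y) = cinner x y" "\<And>y. \<exists>x. U x = y"
  shows "unitary U"
proof -
  have *: "adj U (U x) = x" for x
    by (rule cinner_eqI_left) (simp only: cinner_adj_left[OF assms(1)] assms(2))
  then have "U (adj U y) = y" for y using assms(3)[of y] by auto
  with * show ?thesis by (auto simp: unitary_def assms intro!: blinfun_eqI)
qed

section \<open>Operators on tensor products\<close>

lemma tensor_scaleR_left: "(r *\<^sub>R x) \<otimes>\<^sub>v y = r *\<^sub>R (x \<otimes>\<^sub>v y)"
  by (simp only: scaleR_scaleC tensor_scaleC_left)

lemma tensor_scaleR_right: "x \<otimes>\<^sub>v (r *\<^sub>R y) = r *\<^sub>R (x \<otimes>\<^sub>v y)"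
  by (simp only: scaleR_scaleC tensor_scaleC_right)

lemma norm_tensor: "norm (x \<otimes>\<^sub>v y) = norm x * norm y"
proof -
  have "complex_of_real ((norm (x \<otimes>\<^sub>v y))\<^sup>2) = complex_of_real ((norm x * norm y)\<^sup>2)"
    by (simp only: cinner_self[symmetric] cinner_tensor) (simp add: cinner_self power_mult_distrib)
  then have "(norm (x \<otimes>\<^sub>v y))\<^sup>2 = (norm x * norm y)\<^sup>2"
    using of_real_eq_iff by blast
  then show ?thesis by (simp add: power2_eq_iff_nonneg)
qed

lemma bounded_bilinear_tensor: "bounded_bilinear (\<otimes>\<^sub>v)"
proof
  show "\<exists>K. \<forall>(a::'a::chilbert_space) (b::'b::chilbert_space). norm (a \<otimes>\<^sub>v b) \<le> norm a * norm b * K"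
    by (rule exI[of _ 1]) (simp add: norm_tensor)
qed (simp_all only: tensor_add_left tensor_add_right tensor_scaleR_left tensor_scaleR_right)

lemmas tensor_zero_left [simp] = bounded_bilinear.zero_left[OF bounded_bilinear_tensor]
lemmas tensor_zero_right [simp] = bounded_bilinear.zero_right[OF bounded_bilinear_tensor]
lemmas bounded_linear_tensor_left = bounded_bilinear.bounded_linear_left[OF bounded_bilinear_tensor]
lemmas bounded_linear_tensor_right = bounded_bilinear.bounded_linear_right[OF bounded_bilinear_tensor]

definition simple_tensors :: "('a::chilbert_space \<otimes>\<^sub>H 'b::chilbert_space) set" where
  "simple_tensors = {x \<otimes>\<^sub>v y | x y. True}"

lemma simple_tensorsI [simp]: "x \<otimes>\<^sub>v y \<in> simple_tensors"
  by (auto simp: simple_tensors_def)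

lemma simple_tensorsE:
  assumes "\<xi> \<in> simple_tensors"
  obtains x y where "\<xi> = x \<otimes>\<^sub>v y"
  using assms by (auto simp: simple_tensors_def)

lemma closed_span_simple_tensors [simp]: "closed_span simple_tensors = UNIV"
proof -
  have "{\<Sum>i<n. x i \<otimes>\<^sub>v y i | (n::nat) x y. True} \<subseteq> span (simple_tensors :: ('a \<otimes>\<^sub>H 'b) set)"
    by (force intro: span_sum span_base)
  then have "closure {\<Sum>i<n. x i \<otimes>\<^sub>v y i | (n::nat) x y. True}
      \<subseteq> closed_span (simple_tensors :: ('a \<otimes>\<^sub>H 'b) set)"
    unfolding closed_span_def by (rule closure_mono)
  then show ?thesis by (simp only: tensor_dense top.extremum_unique)
qed

lemma tensor_linear_eq:
  fixes f g :: "'a::chilbert_space \<otimes>\<^sub>H 'b::chilbert_space \<Rightarrow> 'd::real_normed_vector"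
  assumes "bounded_linear f" "bounded_linear g" "\<And>x y. f (x \<otimes>\<^sub>v y) = g (x \<otimes>\<^sub>v y)"
  shows "f \<xi> = g \<xi>"
  by (rule closed_span_eq[of \<xi> simple_tensors]) (use assms in \<open>auto elim!: simple_tensorsE\<close>)

lemma tensor_linear_mem:
  fixes f :: "'a::chilbert_space \<otimes>\<^sub>H 'b::chilbert_space \<Rightarrow> 'd::real_normed_vector"
  assumes "bounded_linear f" "\<And>x y. f (x \<otimes>\<^sub>v y) \<in> M" "subspace M" "closed M"
  shows "f \<xi> \<in> M"
  by (rule closed_span_image[of \<xi> simple_tensors]) (use assms in \<open>auto elim!: simple_tensorsE\<close>)

lemma tensor_op_eqI:
  fixes S T :: "'a::chilbert_space \<otimes>\<^sub>H 'b::chilbert_space \<Rightarrow>\<^sub>L 'd::real_normed_vector"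
  assumes "\<And>x y. S (x \<otimes>\<^sub>v y) = T (x \<otimes>\<^sub>v y)"
  shows "S = T"
  by (rule blinfun_eqI, rule tensor_linear_eq)
    (auto intro: blinfun.bounded_linear_right assms)

lemma cinner_tensor_eqI:
  assumes "\<And>x y. cinner (x \<otimes>\<^sub>v y) \<xi> = cinner (x \<otimes>\<^sub>v y) \<eta>"
  shows "\<xi> = \<eta>"
  by (rule cinner_eqI_right, rule tensor_linear_eq)
    (auto intro: bounded_linear_cinner_left assms)

lemma tensor_op_cinner_eqI:
  fixes S T :: "'a::chilbert_space \<otimes>\<^sub>H 'b::chilbert_space \<Rightarrow>\<^sub>L 'c::chilbert_space \<otimes>\<^sub>H 'd::chilbert_space"
  assumes "\<And>a b x y. cinner (a \<otimes>\<^sub>v b) (S (x \<otimes>\<^sub>v y)) = cinner (a \<otimes>\<^sub>v b) (T (x \<otimes>\<^sub>v y))"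
  shows "S = T"
  by (rule tensor_op_eqI, rule cinner_tensor_eqI, rule assms)

section \<open>Bounded maps determined by their values on elementary tensors\<close>

text \<open>Lists of pairs serve as formal sums of elementary tensors: a map is described on
  representatives, and one norm bound makes it well defined and continuous.\<close>

definition tsum :: "('a::chilbert_space \<Rightarrow> 'b::chilbert_space \<Rightarrow> 'k::monoid_add) \<Rightarrow> ('a \<times> 'b) list \<Rightarrow> 'k" where
  "tsum \<phi> xs = sum_list (map (\<lambda>(x, y). \<phi> x y) xs)"

lemma tsum_simps [simp]:
  "tsum \<phi> [] = 0" "tsum \<phi> ((x, y) # xs) = \<phi> x y + tsum \<phi> xs"
  "tsum \<phi> (xs @ ys) = tsum \<phi> xs + tsum \<phi> ys"
  by (simp_all add: tsum_def)

text \<open>Additivity of \<open>\<phi>\<close> is a consequence of the bound.\<close>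

lemma tensor_extend:
  fixes \<phi> :: "'a::chilbert_space \<Rightarrow> 'b::chilbert_space \<Rightarrow> 'k::chilbert_space"
  assumes scale: "\<And>c x y. \<phi> (c *\<^sub>C x) y = c *\<^sub>C \<phi> x y" and C: "C \<ge> 0"
    and bound: "\<And>xs. norm (tsum \<phi> xs) \<le> C * norm (tsum (\<otimes>\<^sub>v) xs)"
  shows "\<exists>R :: 'a \<otimes>\<^sub>H 'b \<Rightarrow>\<^sub>L 'k. R \<in> bop \<and> (\<forall>x y. R (x \<otimes>\<^sub>v y) = \<phi> x y) \<and> norm R \<le> C"
proof -
  define D where "D = range (tsum (\<otimes>\<^sub>v) :: ('a \<times> 'b) list \<Rightarrow> 'a \<otimes>\<^sub>H 'b)"
  \<comment> \<open>The choice of a representative is harmless: by \<open>diff\<close>, lists with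
    the same tensor sum have the same value.\<close>
  define g where "g t = tsum \<phi> (SOME xs. t = tsum (\<otimes>\<^sub>v) xs)" for t
  define sc where "sc c xs = map (\<lambda>(x, y). (c *\<^sub>C x, y)) xs" for c and xs :: "('a \<times> 'b) list"
  have sc: "tsum \<phi> (sc c xs) = c *\<^sub>C tsum \<phi> xs" "tsum (\<otimes>\<^sub>v) (sc c xs) = c *\<^sub>C tsum (\<otimes>\<^sub>v) xs" for c xs
    by (induction xs) (auto simp: sc_def scale scaleC_add_right tensor_scaleC_left)
  have diff: "norm (tsum \<phi> xs - tsum \<phi> ys) \<le> C * norm (tsum (\<otimes>\<^sub>v) xs - tsum (\<otimes>\<^sub>v) ys)" for xs ys
    using bound[of "xs @ sc (-1) ys"] by (simp add: sc scaleC_minus_one)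
  have g: "g (tsum (\<otimes>\<^sub>v) xs) = tsum \<phi> xs" for xs
  proof -
    have "tsum (\<otimes>\<^sub>v) xs = tsum (\<otimes>\<^sub>v) (SOME ys. tsum (\<otimes>\<^sub>v) xs = tsum (\<otimes>\<^sub>v) ys)"
      by (rule someI) simp
    then show ?thesis
      using diff[of "SOME ys. tsum (\<otimes>\<^sub>v) xs = tsum (\<otimes>\<^sub>v) ys" xs] by (simp add: g_def)
  qed
  have "C-lipschitz_on D g"
    by (rule lipschitz_onI) (use C diff in \<open>auto simp: D_def g dist_norm\<close>)
  then obtain G where G: "C-lipschitz_on (closure D) G" "\<And>x. x \<in> D \<Longrightarrow> G x = g x"
    using lipschitz_extend_closure by blast
  have dense: "closure D = UNIV"
  proof -
    have "{\<Sum>i<n. x i \<otimes>\<^sub>v y i | (n::nat) x y. True} \<subseteq> D"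
    proof clarify
      fix n :: nat and x :: "nat \<Rightarrow> 'a" and y :: "nat \<Rightarrow> 'b"
      have "(\<Sum>i<n. x i \<otimes>\<^sub>v y i) = tsum (\<otimes>\<^sub>v) (map (\<lambda>i. (x i, y i)) [0..<n])"
        by (simp add: tsum_def o_def interv_sum_list_conv_sum_set_nat atLeast0LessThan)
      then show "(\<Sum>i<n. x i \<otimes>\<^sub>v y i) \<in> D" unfolding D_def by blast
    qed
    then have "closure {\<Sum>i<n. x i \<otimes>\<^sub>v y i | (n::nat) x y. True} \<subseteq> closure D"
      by (rule closure_mono)
    then show ?thesis by (simp only: tensor_dense top.extremum_unique)
  qed
  have lip: "norm (G x - G y) \<le> C * norm (x - y)" for x y
    using lipschitz_onD[OF G(1), of x y] dense by (simp add: dist_norm)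
  have Gt: "G (tsum (\<otimes>\<^sub>v) xs) = tsum \<phi> xs" for xs
    using G(2)[of "tsum (\<otimes>\<^sub>v) xs"] by (simp add: D_def g)
  have cont: "continuous_on UNIV G"
    using G(1) dense lipschitz_on_continuous_on by auto
  have lim: "\<exists>s. (\<forall>n. s n \<in> D) \<and> s \<longlonglongrightarrow> x" for x
    using dense closure_sequential[of x D] by auto
  have tend: "(\<lambda>n. G (s n)) \<longlonglongrightarrow> G x" if "s \<longlonglongrightarrow> x" for s x
    using cont that continuous_on_tendsto_compose[of UNIV G s x sequentially] by simp
  have G_add: "G (x + y) = G x + G y" for x y
  proof -
    obtain s t where st: "\<And>n. s n \<in> D" "s \<longlonglongrightarrow> x" "\<And>n. t n \<in> D" "t \<longlonglongrightarrow> y"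
      using lim[of x] lim[of y] by blast
    have "G (s n + t n) = G (s n) + G (t n)" for n
      using st(1)[of n] st(3)[of n] Gt[of "_ @ _"] by (auto simp: D_def Gt simp del: tsum_simps(3) simp flip: tsum_simps(3))
    then have "(\<lambda>n. G (s n + t n)) \<longlonglongrightarrow> G x + G y"
      using tendsto_add[OF tend[OF st(2)] tend[OF st(4)]] by simp
    then show ?thesis
      using tend[OF tendsto_add[OF st(2,4)]] LIMSEQ_unique by blast
  qed
  have G_scale: "G (c *\<^sub>C x) = c *\<^sub>C G x" for c x
  proof -
    obtain s where s: "\<And>n. s n \<in> D" "s \<longlonglongrightarrow> x"
      using lim[of x] by blast
    have "G (c *\<^sub>C s n) = c *\<^sub>C G (s n)" for n
      using s(1)[of n] by (auto simp: D_def Gt simp flip: sc)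
    then have "(\<lambda>n. G (c *\<^sub>C s n)) \<longlonglongrightarrow> c *\<^sub>C G x"
      using bounded_linear.tendsto[OF bounded_linear_scaleC tend[OF s(2)]] by simp
    then show ?thesis
      using tend[OF bounded_linear.tendsto[OF bounded_linear_scaleC s(2)]] LIMSEQ_unique by blast
  qed
  have "G 0 = 0" using Gt[of "[]"] by simp
  then have nG: "norm (G x) \<le> C * norm x" for x using lip[of x 0] by simp
  have bl: "bounded_linear G"
    by (rule bounded_linear_intro[where K = C])
      (use nG in \<open>simp_all add: G_add G_scale scaleR_scaleC mult.commute\<close>)
  have "Blinfun G \<in> bop" by (rule bopI) (simp add: bounded_linear_Blinfun_apply[OF bl] G_scale)
  moreover have "\<forall>x y. Blinfun G (x \<otimes>\<^sub>v y) = \<phi> x y"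
    using Gt[of "[(_, _)]"] by (simp add: bounded_linear_Blinfun_apply[OF bl])
  moreover have "norm (Blinfun G) \<le> C"
    by (rule norm_blinfun_bound) (use C nG in \<open>auto simp: bounded_linear_Blinfun_apply[OF bl]\<close>)
  ultimately show ?thesis by blast
qed

text \<open>Equal Gram matrices give equal norms of finite sums, so \<open>tensor_extend\<close>
  applies with constant 1. The maps \<open>flip\<close>, \<open>assoc\<close>, \<open>iota\<close>
  and \<open>bar\<close> all come from here.\<close>

lemma tensor_isometry:
  fixes \<phi> :: "'a::chilbert_space \<Rightarrow> 'b::chilbert_space \<Rightarrow> 'k::chilbert_space"
  assumes scale: "\<And>c x y. \<phi> (c *\<^sub>C x) y = c *\<^sub>C \<phi> x y"
    and gram: "\<And>x y x' y'. cinner (\<phi> x y) (\<phi> x' y') = cinner x x' * cinner y y'"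
  shows "\<exists>R :: 'a \<otimes>\<^sub>H 'b \<Rightarrow>\<^sub>L 'k. R \<in> bop \<and> (\<forall>x y. R (x \<otimes>\<^sub>v y) = \<phi> x y) \<and>
    (\<forall>\<xi> \<eta>. cinner (R \<xi>) (R \<eta>) = cinner \<xi> \<eta>)"
proof -
  have 1: "cinner (\<phi> x y) (tsum \<phi> ys) = cinner (x \<otimes>\<^sub>v y) (tsum (\<otimes>\<^sub>v) ys)" for x y ys
    by (induction ys) (auto simp: cinner_add_right gram cinner_tensor)
  have 2: "cinner (tsum \<phi> xs) (tsum \<phi> ys) = cinner (tsum (\<otimes>\<^sub>v) xs) (tsum (\<otimes>\<^sub>v) ys)" for xs ys
    by (induction xs) (auto simp: cinner_add_left 1)
  have 3: "norm (tsum \<phi> xs) = norm (tsum (\<otimes>\<^sub>v) xs)" for xs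
    by (simp add: norm_eq_sqrt_inner inner_eq_Re_cinner 2)
  obtain R :: "'a \<otimes>\<^sub>H 'b \<Rightarrow>\<^sub>L 'k" where R: "R \<in> bop" "\<And>x y. R (x \<otimes>\<^sub>v y) = \<phi> x y"
    using tensor_extend[of \<phi> 1] 3 scale by auto
  have "cinner (R \<xi>) (R \<eta>) = cinner \<xi> \<eta>" for \<xi> \<eta>
  proof (rule tensor_linear_eq[of "\<lambda>\<eta>. cinner (R \<xi>) (R \<eta>)"])
    fix x' y'
    show "cinner (R \<xi>) (R (x' \<otimes>\<^sub>v y')) = cinner \<xi> (x' \<otimes>\<^sub>v y')"
      by (rule tensor_linear_eq[of "\<lambda>\<xi>. cinner (R \<xi>) (R (x' \<otimes>\<^sub>v y'))"])
        (auto intro: bounded_linear_compose[OF bounded_linear_cinner_left blinfun.bounded_linear_right]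
          bounded_linear_cinner_left simp: R gram cinner_tensor)
  qed (auto intro: bounded_linear_compose[OF bounded_linear_cinner_right blinfun.bounded_linear_right]
      bounded_linear_cinner_right)
  with R show ?thesis by blast
qed

lemma compose_id [simp]: "T o\<^sub>L id_blinfun = T" "id_blinfun o\<^sub>L T = T"
  by (auto intro: blinfun_eqI)

lemma compose_assoc: "(R o\<^sub>L S) o\<^sub>L T = R o\<^sub>L (S o\<^sub>L T)"
  by (rule blinfun_eqI) simp

text \<open>Slicing the second leg along an orthonormal basis splits a sum of tensors into pieces in
  the first space, so that operators on the first leg can be estimated piece by piece.\<close>

lemma tsum_parseval:
  fixes xs ys :: "('a::chilbert_space \<times> 'b::chilbert_space) list"
  shows "((\<lambda>e. cinner (tsum (\<lambda>x y. cinner e y *\<^sub>C x) xs) (tsum (\<lambda>x y. cinner e y *\<^sub>C x) ys))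
    has_sum cinner (tsum (\<otimes>\<^sub>v) xs) (tsum (\<otimes>\<^sub>v) ys)) onb"
proof -
  have 0: "((\<lambda>e. cinner (cinner e y *\<^sub>C x) (cinner e y' *\<^sub>C x')) has_sum cinner (x \<otimes>\<^sub>v y) (x' \<otimes>\<^sub>v y')) onb"
    for x x' :: 'a and y y' :: 'b
    using has_sum_cmult_left[OF parseval[of y y'], of "cinner x x'"]
    by (simp add: cinner_tensor cinner_scaleC_left cinner_scaleC_right mult_ac)
  have 1: "((\<lambda>e. cinner (cinner e y *\<^sub>C x) (tsum (\<lambda>x y. cinner e y *\<^sub>C x) ys))
      has_sum cinner (x \<otimes>\<^sub>v y) (tsum (\<otimes>\<^sub>v) ys)) onb" for x :: 'a and y :: 'b
    by (induction ys) (auto simp: cinner_add_right intro: has_sum_add[OF 0])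
  show ?thesis
    by (induction xs) (auto simp: cinner_add_left intro: has_sum_add[OF 1])
qed

text \<open>\<open>S\<close> maps each slice to the corresponding slice of the image. The bounds for
  the slices add up by Parseval's identity, independently of the number of terms.\<close>

lemma op_tensor_left_bound:
  fixes S :: "'a::chilbert_space \<Rightarrow>\<^sub>L 'c::chilbert_space" and xs :: "('a \<times> 'b::chilbert_space) list"
  assumes S: "S \<in> bop"
  shows "norm (tsum (\<lambda>x y. S x \<otimes>\<^sub>v y) xs) \<le> norm S * norm (tsum (\<otimes>\<^sub>v) xs)"
proof -
  let ?xs' = "map (\<lambda>(x, y). (S x, y)) xs"
  define v where "v e = tsum (\<lambda>x y. cinner e y *\<^sub>C x) xs" for e
  have 1: "tsum (\<lambda>x y. S x \<otimes>\<^sub>v y) xs = tsum (\<otimes>\<^sub>v) ?xs'"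
    by (simp add: tsum_def o_def split_def)
  have 2: "tsum (\<lambda>x y. cinner e y *\<^sub>C x) ?xs' = S (v e)" for e
    unfolding v_def by (induction xs) (auto simp: blinfun.add_right bop_scaleC[OF S])
  have sq: "((\<lambda>e. (norm (tsum (\<lambda>x y. cinner e y *\<^sub>C x) zs))\<^sup>2) has_sum (norm (tsum (\<otimes>\<^sub>v) zs))\<^sup>2) onb"
    for zs :: "('d::chilbert_space \<times> 'b) list"
    using has_sum_Re[OF tsum_parseval[of zs zs]] by (simp add: cinner_self del: of_real_power)
  have "(norm (tsum (\<otimes>\<^sub>v) ?xs'))\<^sup>2 \<le> (norm S)\<^sup>2 * (norm (tsum (\<otimes>\<^sub>v) xs))\<^sup>2"
  proof (rule has_sum_mono[OF sq has_sum_cmult_right[OF sq]])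
    fix e :: 'b
    have "(norm (S (v e)))\<^sup>2 \<le> (norm S * norm (v e))\<^sup>2"
      by (intro power_mono norm_blinfun) simp
    then show "(norm (tsum (\<lambda>x y. cinner e y *\<^sub>C x) ?xs'))\<^sup>2
        \<le> (norm S)\<^sup>2 * (norm (tsum (\<lambda>x y. cinner e y *\<^sub>C x) xs))\<^sup>2"
      unfolding 2 v_def[symmetric] by (simp add: power_mult_distrib)
  qed
  then have "(norm (tsum (\<otimes>\<^sub>v) ?xs'))\<^sup>2 \<le> (norm S * norm (tsum (\<otimes>\<^sub>v) xs))\<^sup>2"
    by (simp only: power_mult_distrib)
  then show ?thesis
    unfolding 1 by (rule power2_le_imp_le) simp
qed

lemma flip_ex: "\<exists>R :: ('a::chilbert_space \<otimes>\<^sub>H 'b::chilbert_space) \<Rightarrow>\<^sub>L ('b \<otimes>\<^sub>H 'a).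
    R \<in> bop \<and> (\<forall>x y. R (x \<otimes>\<^sub>v y) = y \<otimes>\<^sub>v x) \<and> (\<forall>\<xi> \<eta>. cinner (R \<xi>) (R \<eta>) = cinner \<xi> \<eta>)"
  by (rule tensor_isometry) (simp_all add: tensor_scaleC_right cinner_tensor mult.commute)

lemma flip_props:
  fixes x :: "'a::chilbert_space" and y :: "'b::chilbert_space" and \<xi> \<eta> :: "'a \<otimes>\<^sub>H 'b"
  shows bop_flip [simp, intro]: "(flip :: ('a \<otimes>\<^sub>H 'b) \<Rightarrow>\<^sub>L ('b \<otimes>\<^sub>H 'a)) \<in> bop"
    and flip_apply [simp]: "flip (x \<otimes>\<^sub>v y) = y \<otimes>\<^sub>v x"
    and flip_cinner: "cinner (flip \<xi>) (flip \<eta>) = cinner \<xi> \<eta>"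
proof -
  obtain R :: "('a \<otimes>\<^sub>H 'b) \<Rightarrow>\<^sub>L ('b \<otimes>\<^sub>H 'a)" where
    R: "R \<in> bop" "\<And>x y. R (x \<otimes>\<^sub>v y) = y \<otimes>\<^sub>v x" "\<And>\<xi> \<eta>. cinner (R \<xi>) (R \<eta>) = cinner \<xi> \<eta>"
    using flip_ex by blast
  have "flip = R"
    unfolding flip_def by (rule the_equality) (auto simp: R intro!: tensor_op_eqI)
  then show "(flip :: ('a \<otimes>\<^sub>H 'b) \<Rightarrow>\<^sub>L ('b \<otimes>\<^sub>H 'a)) \<in> bop" "flip (x \<otimes>\<^sub>v y) = y \<otimes>\<^sub>v x"
    "cinner (flip \<xi>) (flip \<eta>) = cinner \<xi> \<eta>"
    using R by auto
qed

lemma flip_flip_op [simp]: "flip o\<^sub>L flip = id_blinfun"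
  by (rule tensor_op_eqI) simp

lemma flip_flip [simp]: "flip (flip \<xi>) = \<xi>"
  using flip_flip_op by (metis blinfun_apply_blinfun_compose blinfun_apply_id_blinfun)

lemma unitary_flip [simp, intro]: "unitary flip"
  by (rule unitaryI) (auto simp: flip_cinner intro: exI[of _ "flip _"])

lemma norm_flip [simp]: "norm (flip \<xi>) = norm \<xi>"
  by (simp add: norm_eq_sqrt_inner inner_eq_Re_cinner flip_cinner)

lemma adj_flip [simp]: "adj flip = flip"
  by (rule adj_eqI) (metis flip_cinner flip_flip)

lemma op_tensor_left_ex:
  fixes S :: "'a::chilbert_space \<Rightarrow>\<^sub>L 'c::chilbert_space"
  assumes S: "S \<in> bop"
  shows "\<exists>R :: 'a \<otimes>\<^sub>H 'b::chilbert_space \<Rightarrow>\<^sub>L 'c \<otimes>\<^sub>H 'b.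
    R \<in> bop \<and> (\<forall>x y. R (x \<otimes>\<^sub>v y) = S x \<otimes>\<^sub>v y) \<and> norm R \<le> norm S"
  by (rule tensor_extend)
    (simp_all add: bop_scaleC[OF S] tensor_scaleC_left op_tensor_left_bound[OF S])

lemma op_tensor_ex:
  fixes S :: "'a::chilbert_space \<Rightarrow>\<^sub>L 'c::chilbert_space" and T :: "'b::chilbert_space \<Rightarrow>\<^sub>L 'd::chilbert_space"
  assumes S: "S \<in> bop" and T: "T \<in> bop"
  shows "\<exists>R :: 'a \<otimes>\<^sub>H 'b \<Rightarrow>\<^sub>L 'c \<otimes>\<^sub>H 'd. R \<in> bop \<and> (\<forall>x y. R (x \<otimes>\<^sub>v y) = S x \<otimes>\<^sub>v T y) \<and>
    norm R \<le> norm S * norm T"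
proof -
  obtain R1 :: "'a \<otimes>\<^sub>H 'd \<Rightarrow>\<^sub>L 'c \<otimes>\<^sub>H 'd" where
    R1: "R1 \<in> bop" "\<And>x y. R1 (x \<otimes>\<^sub>v y) = S x \<otimes>\<^sub>v y" "norm R1 \<le> norm S"
    using op_tensor_left_ex[OF S] by blast
  obtain R2 :: "'b \<otimes>\<^sub>H 'a \<Rightarrow>\<^sub>L 'd \<otimes>\<^sub>H 'a" where
    R2: "R2 \<in> bop" "\<And>x y. R2 (x \<otimes>\<^sub>v y) = T x \<otimes>\<^sub>v y" "norm R2 \<le> norm T"
    using op_tensor_left_ex[OF T] by blast
  \<comment> \<open>The tensor product is composed of \<open>S\<close> and \<open>T\<close> acting
    on a first leg, with flips moving \<open>T\<close> to the second.\<close>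
  let ?R = "R1 o\<^sub>L (flip o\<^sub>L R2 o\<^sub>L flip)"
  have "norm (?R \<xi>) \<le> (norm S * norm T) * norm \<xi>" for \<xi>
  proof -
    have "norm (?R \<xi>) \<le> norm R1 * norm (flip (R2 (flip \<xi>)))"
      using norm_blinfun[of R1 "flip (R2 (flip \<xi>))"] by simp
    also have "norm (flip (R2 (flip \<xi>))) \<le> norm R2 * norm \<xi>"
      using norm_blinfun[of R2 "flip \<xi>"] by simp
    finally have "norm (?R \<xi>) \<le> norm R1 * (norm R2 * norm \<xi>)" by (simp add: mult_left_mono)
    also have "\<dots> \<le> norm S * (norm T * norm \<xi>)"
      using R1(3) R2(3) by (intro mult_mono) auto
    finally show ?thesis by (simp add: mult_ac)
  qed
  then have "norm ?R \<le> norm S * norm T" by (intro norm_blinfun_bound) auto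
  moreover have "?R \<in> bop" by (intro bop_compose R1(1) R2(1) bop_flip)
  ultimately show ?thesis by (intro exI[of _ ?R]) (simp add: R1 R2)
qed

lemma op_tensor_props:
  fixes S :: "'a::chilbert_space \<Rightarrow>\<^sub>L 'c::chilbert_space" and T :: "'b::chilbert_space \<Rightarrow>\<^sub>L 'd::chilbert_space"
  assumes S: "S \<in> bop" and T: "T \<in> bop"
  shows bop_op_tensor [simp, intro]: "S \<otimes>\<^sub>o T \<in> bop"
    and op_tensor_apply [simp]: "(S \<otimes>\<^sub>o T) (x \<otimes>\<^sub>v y) = S x \<otimes>\<^sub>v T y"
    and norm_op_tensor: "norm (S \<otimes>\<^sub>o T) \<le> norm S * norm T"
proof -
  obtain R :: "'a \<otimes>\<^sub>H 'b \<Rightarrow>\<^sub>L 'c \<otimes>\<^sub>H 'd" where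
    R: "R \<in> bop" "\<And>x y. R (x \<otimes>\<^sub>v y) = S x \<otimes>\<^sub>v T y" "norm R \<le> norm S * norm T"
    using op_tensor_ex[OF S T] by blast
  have "S \<otimes>\<^sub>o T = R"
    unfolding op_tensor_def by (rule the_equality) (auto simp: R intro!: tensor_op_eqI)
  then show "S \<otimes>\<^sub>o T \<in> bop" "(S \<otimes>\<^sub>o T) (x \<otimes>\<^sub>v y) = S x \<otimes>\<^sub>v T y" "norm (S \<otimes>\<^sub>o T) \<le> norm S * norm T"
    using R by auto
qed

lemma op_tensor_compose:
  assumes "S \<in> bop" "T \<in> bop" "S' \<in> bop" "T' \<in> bop"
  shows "(S \<otimes>\<^sub>o T) o\<^sub>L (S' \<otimes>\<^sub>o T') = (S o\<^sub>L S') \<otimes>\<^sub>o (T o\<^sub>L T')"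
  by (rule tensor_op_eqI) (simp add: assms)

lemma op_tensor_id [simp]: "id_blinfun \<otimes>\<^sub>o id_blinfun = id_blinfun"
  by (rule tensor_op_eqI) simp

lemma adj_op_tensor:
  assumes "S \<in> bop" "T \<in> bop"
  shows "adj (S \<otimes>\<^sub>o T) = adj S \<otimes>\<^sub>o adj T"
  by (rule tensor_op_cinner_eqI)
    (simp add: assms cinner_adj_right bop_op_tensor cinner_tensor)

lemma op_tensor_add_left:
  "S \<in> bop \<Longrightarrow> S' \<in> bop \<Longrightarrow> T \<in> bop \<Longrightarrow> (S + S') \<otimes>\<^sub>o T = S \<otimes>\<^sub>o T + S' \<otimes>\<^sub>o T"
  by (rule tensor_op_eqI) (simp add: blinfun.add_left tensor_add_left)

lemma op_tensor_add_right:
  "S \<in> bop \<Longrightarrow> T \<in> bop \<Longrightarrow> T' \<in> bop \<Longrightarrow> S \<otimes>\<^sub>o (T + T') = S \<otimes>\<^sub>o T + S \<otimes>\<^sub>o T'"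
  by (rule tensor_op_eqI) (simp add: blinfun.add_left tensor_add_right)

lemma op_tensor_scaleR_left: "S \<in> bop \<Longrightarrow> T \<in> bop \<Longrightarrow> (r *\<^sub>R S) \<otimes>\<^sub>o T = r *\<^sub>R (S \<otimes>\<^sub>o T)"
  by (rule tensor_op_eqI) (simp add: blinfun.scaleR_left tensor_scaleR_left)

lemma op_tensor_scaleR_right: "S \<in> bop \<Longrightarrow> T \<in> bop \<Longrightarrow> S \<otimes>\<^sub>o (r *\<^sub>R T) = r *\<^sub>R (S \<otimes>\<^sub>o T)"
  by (rule tensor_op_eqI) (simp add: blinfun.scaleR_left tensor_scaleR_right)

lemma op_tensor_op_scale_left: "S \<in> bop \<Longrightarrow> T \<in> bop \<Longrightarrow> op_scale c S \<otimes>\<^sub>o T = op_scale c (S \<otimes>\<^sub>o T)"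
  by (rule tensor_op_eqI) (simp add: op_scale_apply tensor_scaleC_left)

lemma bounded_linear_on_tensor_left: "T \<in> bop \<Longrightarrow> bounded_linear_on bop (\<lambda>S. S \<otimes>\<^sub>o T)"
  by (rule bounded_linear_onI[where K = "norm T"])
    (simp_all add: op_tensor_add_left op_tensor_scaleR_left norm_op_tensor)

lemma bounded_linear_on_tensor_right: "S \<in> bop \<Longrightarrow> bounded_linear_on bop (\<lambda>T. S \<otimes>\<^sub>o T)"
  by (rule bounded_linear_onI[where K = "norm S"])
    (simp_all add: op_tensor_add_right op_tensor_scaleR_right norm_op_tensor mult.commute)

lemma unitary_op_tensor:
  assumes "unitary U" "unitary V"
  shows "unitary (U \<otimes>\<^sub>o V)"
  unfolding unitary_def
  using assms[THEN unitaryD(1)] assms[THEN unitaryD(2)] assms[THEN unitaryD(3)]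
  by (simp add: adj_op_tensor op_tensor_compose)

lemma unitary_id [simp, intro]: "unitary id_blinfun"
  by (simp add: unitary_def)

section \<open>Creation operators and threefold tensor products\<close>

definition ketL :: "'a::chilbert_space \<Rightarrow> 'b::chilbert_space \<Rightarrow>\<^sub>L 'a \<otimes>\<^sub>H 'b" where
  "ketL x = Blinfun (\<lambda>y. x \<otimes>\<^sub>v y)"

definition ketR :: "'b::chilbert_space \<Rightarrow> 'a::chilbert_space \<Rightarrow>\<^sub>L 'a \<otimes>\<^sub>H 'b" where
  "ketR y = Blinfun (\<lambda>x. x \<otimes>\<^sub>v y)"

lemma ketL_apply [simp]: "ketL x y = x \<otimes>\<^sub>v y"
  unfolding ketL_def by (simp add: bounded_linear_Blinfun_apply bounded_linear_tensor_right)

lemma ketR_apply [simp]: "ketR y x = x \<otimes>\<^sub>v y"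
  unfolding ketR_def by (simp add: bounded_linear_Blinfun_apply bounded_linear_tensor_left)

lemma bop_ketL [simp, intro]: "ketL x \<in> bop"
  by (rule bopI) (simp add: tensor_scaleC_right)

lemma bop_ketR [simp, intro]: "ketR x \<in> bop"
  by (rule bopI) (simp add: tensor_scaleC_left)

lemma adj_ketL_apply [simp]: "adj (ketL x) (a \<otimes>\<^sub>v b) = cinner x a *\<^sub>C b"
  by (rule cinner_eqI_right) (simp add: cinner_adj_right cinner_tensor cinner_scaleC_right cinner_commute[of x])

lemma adj_ketR_apply [simp]: "adj (ketR y) (a \<otimes>\<^sub>v b) = cinner y b *\<^sub>C a"
  by (rule cinner_eqI_right) (simp add: cinner_adj_right cinner_tensor cinner_scaleC_right)

lemma bounded_linear_ketL: "bounded_linear ketL"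
proof (rule bounded_linear_intro[where K = 1])
  show "norm (ketL x) \<le> norm x * 1" for x
    by (rule norm_blinfun_bound) (simp_all add: norm_tensor)
qed (auto intro!: blinfun_eqI simp: tensor_add_left tensor_scaleR_left blinfun.add_left blinfun.scaleR_left)

lemma op_tensor_ketL:
  assumes "S \<in> bop" "T \<in> bop"
  shows "(S \<otimes>\<^sub>o T) o\<^sub>L ketL x = ketL (S x) o\<^sub>L T"
  by (rule blinfun_eqI) (simp add: assms)

lemma op_tensor_ketR:
  assumes "S \<in> bop" "T \<in> bop"
  shows "(S \<otimes>\<^sub>o T) o\<^sub>L ketR y = ketR (T y) o\<^sub>L S"
  by (rule blinfun_eqI) (simp add: assms)

lemma tensor3_linear_eq:
  fixes f g :: "'a::chilbert_space \<otimes>\<^sub>H 'b::chilbert_space \<otimes>\<^sub>H 'c::chilbert_space \<Rightarrow> 'd::real_normed_vector"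
  assumes "bounded_linear f" "bounded_linear g"
    and eq: "\<And>x y z. f (x \<otimes>\<^sub>v y \<otimes>\<^sub>v z) = g (x \<otimes>\<^sub>v y \<otimes>\<^sub>v z)"
  shows "f \<xi> = g \<xi>"
proof (rule tensor_linear_eq[OF assms(1,2)])
  fix x \<eta>
  show "f (x \<otimes>\<^sub>v \<eta>) = g (x \<otimes>\<^sub>v \<eta>)"
    by (rule tensor_linear_eq[of "\<lambda>\<eta>. f (x \<otimes>\<^sub>v \<eta>)" "\<lambda>\<eta>. g (x \<otimes>\<^sub>v \<eta>)"])
      (auto intro: bounded_linear_compose[OF assms(1)] bounded_linear_compose[OF assms(2)]
        bounded_linear_tensor_right eq)
qed

lemma tensor3_op_eqI:
  fixes S T :: "'a::chilbert_space \<otimes>\<^sub>H 'b::chilbert_space \<otimes>\<^sub>H 'c::chilbert_space \<Rightarrow>\<^sub>L 'd::real_normed_vector"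
  assumes "\<And>x y z. S (x \<otimes>\<^sub>v y \<otimes>\<^sub>v z) = T (x \<otimes>\<^sub>v y \<otimes>\<^sub>v z)"
  shows "S = T"
  by (rule blinfun_eqI, rule tensor3_linear_eq)
    (auto intro: blinfun.bounded_linear_right assms)

lemma cinner_tensor3_eqI:
  fixes \<xi> \<eta> :: "'a::chilbert_space \<otimes>\<^sub>H 'b::chilbert_space \<otimes>\<^sub>H 'c::chilbert_space"
  assumes "\<And>x y z. cinner (x \<otimes>\<^sub>v y \<otimes>\<^sub>v z) \<xi> = cinner (x \<otimes>\<^sub>v y \<otimes>\<^sub>v z) \<eta>"
  shows "\<xi> = \<eta>"
  by (rule cinner_eqI_right, rule tensor3_linear_eq)
    (auto intro: bounded_linear_cinner_left assms)

definition insR :: "'c::chilbert_space \<Rightarrow>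
    'a::chilbert_space \<otimes>\<^sub>H 'b::chilbert_space \<Rightarrow>\<^sub>L 'a \<otimes>\<^sub>H 'b \<otimes>\<^sub>H 'c" where
  "insR z = id_blinfun \<otimes>\<^sub>o ketR z"

definition insM :: "'b::chilbert_space \<Rightarrow>
    'a::chilbert_space \<otimes>\<^sub>H 'c::chilbert_space \<Rightarrow>\<^sub>L 'a \<otimes>\<^sub>H 'b \<otimes>\<^sub>H 'c" where
  "insM y = id_blinfun \<otimes>\<^sub>o ketL y"

lemma insR_apply [simp]: "insR z (x \<otimes>\<^sub>v y) = x \<otimes>\<^sub>v y \<otimes>\<^sub>v z"
  by (simp add: insR_def)

lemma insM_apply [simp]: "insM y (x \<otimes>\<^sub>v z) = x \<otimes>\<^sub>v y \<otimes>\<^sub>v z"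
  by (simp add: insM_def)

lemma bop_insR [simp, intro]: "insR z \<in> bop"
  by (simp add: insR_def)

lemma bop_insM [simp, intro]: "insM z \<in> bop"
  by (simp add: insM_def)

lemma cinner_insR: "cinner (insR z \<xi>) (insR z' \<xi>') = cinner \<xi> \<xi>' * cinner z z'"
proof (rule tensor_linear_eq[of "\<lambda>\<xi>'. cinner (insR z \<xi>) (insR z' \<xi>')"])
  fix x' y'
  show "cinner (insR z \<xi>) (insR z' (x' \<otimes>\<^sub>v y')) = cinner \<xi> (x' \<otimes>\<^sub>v y') * cinner z z'"
    by (rule tensor_linear_eq[of "\<lambda>\<xi>. cinner (insR z \<xi>) (insR z' (x' \<otimes>\<^sub>v y'))"])
      (auto intro: bounded_linear_compose[OF bounded_linear_cinner_left blinfun.bounded_linear_right]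
        bounded_linear_mult_left bounded_linear_compose[OF bounded_linear_mult_left bounded_linear_cinner_left]
        simp: cinner_tensor)
qed (auto intro: bounded_linear_compose[OF bounded_linear_cinner_right blinfun.bounded_linear_right]
    bounded_linear_compose[OF bounded_linear_mult_left bounded_linear_cinner_right])

text \<open>The first two legs count as one factor, and \<open>insR\<close> is already isometric up
  to the norm of the inserted vector. This gives the values at
  \<open>\<xi> \<otimes>\<^sub>v z\<close> for arbitrary \<open>\<xi>\<close> at once.\<close>

lemma assoc_ex: "\<exists>R :: (('a::chilbert_space \<otimes>\<^sub>H 'b::chilbert_space) \<otimes>\<^sub>H 'c::chilbert_space) \<Rightarrow>\<^sub>L ('a \<otimes>\<^sub>H 'b \<otimes>\<^sub>H 'c).
    R \<in> bop \<and> (\<forall>\<xi> z. R (\<xi> \<otimes>\<^sub>v z) = insR z \<xi>) \<and> (\<forall>\<xi> \<eta>. cinner (R \<xi>) (R \<eta>) = cinner \<xi> \<eta>)"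
  by (rule tensor_isometry) (simp_all add: cinner_insR bop_scaleC)

lemma assoc_props:
  fixes \<xi> :: "'a::chilbert_space \<otimes>\<^sub>H 'b::chilbert_space" and z :: "'c::chilbert_space"
    and \<phi> \<psi> :: "('a \<otimes>\<^sub>H 'b) \<otimes>\<^sub>H 'c"
  shows bop_assoc [simp, intro]: "(assoc :: (('a \<otimes>\<^sub>H 'b) \<otimes>\<^sub>H 'c) \<Rightarrow>\<^sub>L ('a \<otimes>\<^sub>H 'b \<otimes>\<^sub>H 'c)) \<in> bop"
    and assoc_insR [simp]: "assoc (\<xi> \<otimes>\<^sub>v z) = insR z \<xi>"
    and assoc_cinner: "cinner (assoc \<phi>) (assoc \<psi>) = cinner \<phi> \<psi>"
proof -
  obtain R :: "(('a \<otimes>\<^sub>H 'b) \<otimes>\<^sub>H 'c) \<Rightarrow>\<^sub>L ('a \<otimes>\<^sub>H 'b \<otimes>\<^sub>H 'c)" where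
    R: "R \<in> bop" "\<And>\<xi> z. R (\<xi> \<otimes>\<^sub>v z) = insR z \<xi>" "\<And>\<xi> \<eta>. cinner (R \<xi>) (R \<eta>) = cinner \<xi> \<eta>"
    using assoc_ex by blast
  have "assoc = R"
    unfolding assoc_def
  proof (rule the_equality)
    fix S :: "(('a \<otimes>\<^sub>H 'b) \<otimes>\<^sub>H 'c) \<Rightarrow>\<^sub>L ('a \<otimes>\<^sub>H 'b \<otimes>\<^sub>H 'c)"
    assume S: "S \<in> bop \<and> (\<forall>x y z. S ((x \<otimes>\<^sub>v y) \<otimes>\<^sub>v z) = x \<otimes>\<^sub>v y \<otimes>\<^sub>v z)"
    show "S = R"
    proof (rule tensor_op_eqI)
      fix \<xi> z
      show "S (\<xi> \<otimes>\<^sub>v z) = R (\<xi> \<otimes>\<^sub>v z)"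
        by (rule tensor_linear_eq[of "\<lambda>\<xi>. S (\<xi> \<otimes>\<^sub>v z)" "\<lambda>\<xi>. R (\<xi> \<otimes>\<^sub>v z)"])
          (auto intro: bounded_linear_compose[OF blinfun.bounded_linear_right bounded_linear_tensor_left]
            blinfun.bounded_linear_right simp: S R(2))
    qed
  qed (simp add: R)
  then show "(assoc :: (('a \<otimes>\<^sub>H 'b) \<otimes>\<^sub>H 'c) \<Rightarrow>\<^sub>L ('a \<otimes>\<^sub>H 'b \<otimes>\<^sub>H 'c)) \<in> bop"
    "assoc (\<xi> \<otimes>\<^sub>v z) = insR z \<xi>"
    "cinner (assoc \<phi>) (assoc \<psi>) = cinner \<phi> \<psi>"
    using R by auto
qed

lemma adj_assoc_apply [simp]: "adj assoc (x \<otimes>\<^sub>v y \<otimes>\<^sub>v z) = (x \<otimes>\<^sub>v y) \<otimes>\<^sub>v z"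
proof (rule cinner_eqI_left)
  fix \<phi>
  have "cinner (adj assoc (x \<otimes>\<^sub>v y \<otimes>\<^sub>v z)) \<phi> = cinner (assoc ((x \<otimes>\<^sub>v y) \<otimes>\<^sub>v z)) (assoc \<phi>)"
    by (simp add: cinner_adj_left)
  then show "cinner (adj assoc (x \<otimes>\<^sub>v y \<otimes>\<^sub>v z)) \<phi> = cinner ((x \<otimes>\<^sub>v y) \<otimes>\<^sub>v z) \<phi>"
    by (simp only: assoc_cinner)
qed

lemma unitary_assoc [simp, intro]: "unitary assoc"
proof (rule unitaryI)
  fix y
  have "(assoc o\<^sub>L adj assoc) y = y"
    by (rule tensor3_linear_eq[of "(assoc o\<^sub>L adj assoc)"])
      (auto intro: blinfun.bounded_linear_right bounded_linear_ident)
  then show "\<exists>x. assoc x = y" by auto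
qed (simp_all add: assoc_cinner)

section \<open>Leg numbering\<close>

lemmas assoc_cancel [simp] = unitaryD(2,3)[OF unitary_assoc] unitary_apply[OF unitary_assoc]

lemma assoc_ketR: "assoc o\<^sub>L ketR z = insR z"
  by (rule blinfun_eqI) simp

lemma adj_assoc_insR: "adj assoc o\<^sub>L insR z = ketR z"
  by (rule tensor_op_eqI) simp

lemma assoc_ketL_tensor: "assoc o\<^sub>L ketL (x \<otimes>\<^sub>v y) = ketL x o\<^sub>L ketL y"
  by (rule blinfun_eqI) simp

lemma bop_leg [simp, intro]:
  assumes "T \<in> bop"
  shows "leg12 T \<in> bop" "leg23 T \<in> bop" "leg13 T \<in> bop"
  using assms by (auto simp: leg12_def leg13_def leg23_def)

lemma adj_leg:
  assumes "T \<in> bop"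
  shows "adj (leg12 T) = leg12 (adj T)" "adj (leg23 T) = leg23 (adj T)" "adj (leg13 T) = leg13 (adj T)"
  using assms by (auto simp: leg12_def leg13_def leg23_def adj_compose adj_op_tensor compose_assoc)

text \<open>An operator commutes with the insertion of a vector into a leg that it does not touch.
  This relation and its analogues for the other legs replace calculations with \<open>assoc\<close>
  and \<open>flip\<close>.\<close>

lemma leg12_insR:
  assumes "T \<in> bop"
  shows "leg12 T o\<^sub>L insR z = insR z o\<^sub>L T"
proof -
  have "leg12 T o\<^sub>L insR z = assoc o\<^sub>L ((T \<otimes>\<^sub>o id_blinfun) o\<^sub>L (adj assoc o\<^sub>L insR z))"
    by (simp add: leg12_def compose_assoc)
  also have "\<dots> = insR z o\<^sub>L T"
    by (simp add: adj_assoc_insR op_tensor_ketR assms flip: compose_assoc) (simp add: assoc_ketR)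
  finally show ?thesis .
qed

lemma leg23_ketL: "T \<in> bop \<Longrightarrow> leg23 T o\<^sub>L ketL x = ketL x o\<^sub>L T"
  by (simp add: leg23_def op_tensor_ketL)

lemma flip23_insM: "(id_blinfun \<otimes>\<^sub>o flip) o\<^sub>L insM y = insR y"
  by (rule tensor_op_eqI) simp

lemma flip23_insR: "(id_blinfun \<otimes>\<^sub>o flip) o\<^sub>L insR y = insM y"
  by (rule tensor_op_eqI) simp

lemma leg13_insM:
  assumes "T \<in> bop"
  shows "leg13 T o\<^sub>L insM y = insM y o\<^sub>L T"
proof -
  have "leg13 T o\<^sub>L insM y = (id_blinfun \<otimes>\<^sub>o flip) o\<^sub>L (leg12 T o\<^sub>L insR y)"
    by (simp add: leg13_def compose_assoc flip23_insM)
  then show ?thesis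
    by (simp add: leg12_insR[OF assms] flip23_insR flip: compose_assoc)
qed

lemma leg12_insR_apply [simp]: "T \<in> bop \<Longrightarrow> leg12 T (insR z \<xi>) = insR z (T \<xi>)"
  using leg12_insR[of T z] by (metis blinfun_apply_blinfun_compose)

lemma leg13_insM_apply [simp]: "T \<in> bop \<Longrightarrow> leg13 T (insM y \<xi>) = insM y (T \<xi>)"
  using leg13_insM[of T y] by (metis blinfun_apply_blinfun_compose)

lemma leg23_ketL_apply [simp]: "T \<in> bop \<Longrightarrow> leg23 T (x \<otimes>\<^sub>v \<xi>) = x \<otimes>\<^sub>v T \<xi>"
  by (simp add: leg23_def)

lemma leg12_apply: "T \<in> bop \<Longrightarrow> leg12 T (x \<otimes>\<^sub>v y \<otimes>\<^sub>v z) = insR z (T (x \<otimes>\<^sub>v y))"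
  using leg12_insR_apply[of T z "x \<otimes>\<^sub>v y"] by simp

lemma leg13_apply: "T \<in> bop \<Longrightarrow> leg13 T (x \<otimes>\<^sub>v y \<otimes>\<^sub>v z) = insM y (T (x \<otimes>\<^sub>v z))"
  using leg13_insM_apply[of T y "x \<otimes>\<^sub>v z"] by simp

lemma leg_compose:
  assumes "S \<in> bop" "T \<in> bop"
  shows "leg12 (S o\<^sub>L T) = leg12 S o\<^sub>L leg12 T" "leg23 (S o\<^sub>L T) = leg23 S o\<^sub>L leg23 T"
    "leg13 (S o\<^sub>L T) = leg13 S o\<^sub>L leg13 T"
  by (rule tensor3_op_eqI, simp add: assms leg12_apply leg13_apply)+

lemma leg_id [simp]: "leg12 id_blinfun = id_blinfun" "leg23 id_blinfun = id_blinfun"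
  "leg13 id_blinfun = id_blinfun"
  by (rule tensor3_op_eqI, simp add: leg12_apply leg13_apply)+

lemma unitary_leg:
  assumes "unitary U"
  shows "unitary (leg12 U)" "unitary (leg23 U)" "unitary (leg13 U)"
  using unitaryD[OF assms] by (auto simp: unitary_def adj_leg simp flip: leg_compose)

section \<open>Coefficients and slices\<close>

lemma coef2_eq:
  assumes "T \<in> bop"
  shows "coef2 u v T = adj (ketL u) o\<^sub>L T o\<^sub>L ketL v"
  unfolding coef2_def
proof (rule the_equality)
  fix S assume S: "S \<in> bop \<and> (\<forall>x y. cinner x (S y) = cinner (u \<otimes>\<^sub>v x) (T (v \<otimes>\<^sub>v y)))"
  show "S = adj (ketL u) o\<^sub>L T o\<^sub>L ketL v"
    by (rule bop_eqI) (simp add: S cinner_adj_right)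
qed (simp add: assms cinner_adj_right)

lemma coef1_eq:
  assumes "T \<in> bop"
  shows "coef1 u v T = adj (ketR u) o\<^sub>L T o\<^sub>L ketR v"
  unfolding coef1_def
proof (rule the_equality)
  fix S assume S: "S \<in> bop \<and> (\<forall>x y. cinner x (S y) = cinner (x \<otimes>\<^sub>v u) (T (y \<otimes>\<^sub>v v)))"
  show "S = adj (ketR u) o\<^sub>L T o\<^sub>L ketR v"
    by (rule bop_eqI) (simp add: S cinner_adj_right)
qed (simp add: assms cinner_adj_right)

lemma bop_coef2 [simp, intro]: "T \<in> bop \<Longrightarrow> coef2 u v T \<in> bop"
  by (simp add: coef2_eq)

lemma cinner_coef2: "T \<in> bop \<Longrightarrow> cinner x (coef2 u v T y) = cinner (u \<otimes>\<^sub>v x) (T (v \<otimes>\<^sub>v y))"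
  by (simp add: coef2_eq cinner_adj_right)

lemma cinner_coef1: "T \<in> bop \<Longrightarrow> cinner x (coef1 u v T y) = cinner (x \<otimes>\<^sub>v u) (T (y \<otimes>\<^sub>v v))"
  by (simp add: coef1_eq cinner_adj_right)

lemma adj_coef2: "T \<in> bop \<Longrightarrow> adj (coef2 u v T) = coef2 v u (adj T)"
  by (simp add: coef2_eq adj_compose compose_assoc)

lemma norm_coef2:
  fixes T :: "'a::chilbert_space \<otimes>\<^sub>H 'b::chilbert_space \<Rightarrow>\<^sub>L 'a \<otimes>\<^sub>H 'b"
  assumes "T \<in> bop"
  shows "norm (coef2 u v T) \<le> norm u * norm T * norm v"
proof (rule norm_blinfun_bound)
  fix y :: 'b
  have "norm (coef2 u v T y) \<le> norm (adj (ketL u :: 'b \<Rightarrow>\<^sub>L 'a \<otimes>\<^sub>H 'b)) * norm (T (v \<otimes>\<^sub>v y))"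
    unfolding coef2_eq[OF assms] blinfun_apply_blinfun_compose ketL_apply by (rule norm_blinfun)
  also have "\<dots> \<le> norm u * (norm T * norm (v \<otimes>\<^sub>v y))"
  proof (intro mult_mono norm_blinfun)
    show "norm (adj (ketL u :: 'b \<Rightarrow>\<^sub>L 'a \<otimes>\<^sub>H 'b)) \<le> norm u"
      by (simp add: norm_adj) (rule norm_blinfun_bound, simp_all add: norm_tensor)
  qed auto
  finally show "norm (coef2 u v T y) \<le> norm u * norm T * norm v * norm y"
    by (simp add: norm_tensor mult_ac)
qed simp

definition coefs :: "('a::chilbert_space \<otimes>\<^sub>H 'b::chilbert_space \<Rightarrow>\<^sub>L 'a \<otimes>\<^sub>H 'b) \<Rightarrow> ('b \<Rightarrow>\<^sub>L 'b) set" where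
  "coefs T = {coef2 u v T | u v. True}"

lemma coefsI: "coef2 u v T \<in> coefs T"
  by (auto simp: coefs_def)

lemma coefs_bop: "T \<in> bop \<Longrightarrow> coefs T \<subseteq> bop"
  by (auto simp: coefs_def)

lemma coef2_zero [simp]:
  "T \<in> bop \<Longrightarrow> coef2 0 v T = 0" "T \<in> bop \<Longrightarrow> coef2 u 0 T = 0"
  by (rule bop_eqI, simp add: cinner_coef2)+

lemma coef2_scaleC: "T \<in> bop \<Longrightarrow> coef2 u (c *\<^sub>C v) T = op_scale c (coef2 u v T)"
  by (rule bop_eqI)
    (simp add: cinner_coef2 op_scale_apply tensor_scaleC_left bop_scaleC cinner_scaleC_right)

lemma coef2_scaleR: "T \<in> bop \<Longrightarrow> coef2 u (r *\<^sub>R v) T = r *\<^sub>R (coef2 u v T)"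
  by (rule bop_eqI)
    (simp add: cinner_coef2 tensor_scaleR_left blinfun.scaleR_right blinfun.scaleR_left cinner_scaleR_right)

lemma op_scale_closed_span_coefs:
  assumes "T \<in> bop" "x \<in> closed_span (coefs T)"
  shows "op_scale c x \<in> closed_span (coefs T)"
proof (rule closed_span_image[OF assms(2) bounded_linear_op_scale])
  fix s assume "s \<in> coefs T"
  then obtain u v where "s = coef2 u v T" by (auto simp: coefs_def)
  then have "op_scale c s = coef2 u (c *\<^sub>C v) T" by (simp add: coef2_scaleC[OF assms(1)])
  then show "op_scale c s \<in> closed_span (coefs T)" by (simp add: closed_span_base coefsI)
qed auto

text \<open>The slice is a norm-convergent series of vector slices, because the products of the
  norms are dominated by the sums of their squares. Hence vector functionals suffice to generate the
  algebra.\<close>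

lemma slice1_eq:
  fixes T :: "'a::chilbert_space \<otimes>\<^sub>H 'b::chilbert_space \<Rightarrow>\<^sub>L 'a \<otimes>\<^sub>H 'b" and x y :: "nat \<Rightarrow> 'a"
  assumes T: "T \<in> bop" and x: "summable (\<lambda>n. (norm (x n))\<^sup>2)" and y: "summable (\<lambda>n. (norm (y n))\<^sup>2)"
  shows "(\<lambda>n. coef2 (x n) (y n) T) sums slice1 (\<lambda>S. \<Sum>n. cinner (x n) (S (y n))) T"
proof -
  have sm: "summable (\<lambda>n. norm T * (((norm (x n))\<^sup>2 + (norm (y n))\<^sup>2)))"
    by (intro summable_mult summable_add x y)
  have "norm (coef2 (x n) (y n) T) \<le> norm T * (((norm (x n))\<^sup>2 + (norm (y n))\<^sup>2))" for n
  proof -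
    have "norm (x n) * norm (y n) \<le> 2 * norm (x n) * norm (y n)"
      by (simp add: mult_right_mono)
    also have "\<dots> \<le> (norm (x n))\<^sup>2 + (norm (y n))\<^sup>2" by (rule sum_squares_bound)
    finally have "norm T * (norm (x n) * norm (y n)) \<le> norm T * ((norm (x n))\<^sup>2 + (norm (y n))\<^sup>2)"
      by (rule mult_left_mono) simp
    then show ?thesis using norm_coef2[OF T, of "x n" "y n"] by (simp add: mult_ac)
  qed
  then have "summable (\<lambda>n. norm (coef2 (x n) (y n) T))"
    by (intro summable_comparison_test'[OF sm, of 0]) simp
  then have "summable (\<lambda>n. coef2 (x n) (y n) T)" by (rule summable_norm_cancel)
  then obtain R where R: "(\<lambda>n. coef2 (x n) (y n) T) sums R" unfolding summable_def by blast
  have "R \<in> bop"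
  proof (rule closed_sequentially[OF closed_bop])
    show "(\<lambda>n. \<Sum>i<n. coef2 (x i) (y i) T) \<longlonglongrightarrow> R" using R unfolding sums_def .
    show "(\<Sum>i<n. coef2 (x i) (y i) T) \<in> bop" for n
      by (rule subspace_sum[OF subspace_bop]) (simp add: T)
  qed
  have form: "cinner u (R v) = (\<Sum>n. cinner (x n) (coef1 u v T (y n)))" for u v
  proof -
    have "(\<lambda>n. coef2 (x n) (y n) T v) sums R v"
      by (rule bounded_linear.sums[OF bounded_linear_apply R])
    then have "(\<lambda>n. cinner u (coef2 (x n) (y n) T v)) sums cinner u (R v)"
      by (rule bounded_linear.sums[OF bounded_linear_cinner_right])
    then show ?thesis using T by (simp add: cinner_coef1 cinner_coef2 sums_iff)
  qed
  have "slice1 (\<lambda>S. \<Sum>n. cinner (x n) (S (y n))) T = R"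
    unfolding slice1_def
  proof (rule the_equality)
    fix S assume "S \<in> bop \<and> (\<forall>u v. cinner u (S v) = (\<Sum>n. cinner (x n) (coef1 u v T (y n))))"
    then show "S = R" by (intro bop_eqI) (simp add: form)
  qed (simp add: form \<open>R \<in> bop\<close>)
  then show ?thesis using R by simp
qed

lemma qg_algebra_eq:
  fixes W :: "'a::chilbert_space \<otimes>\<^sub>H 'a \<Rightarrow>\<^sub>L 'a \<otimes>\<^sub>H 'a"
  assumes W: "W \<in> bop"
  shows "qg_algebra W = closed_span (coefs W)"
proof
  have "slice1 \<omega> W \<in> closed_span (coefs W)" if "\<omega> \<in> predual" for \<omega>
  proof -
    from that obtain x y :: "nat \<Rightarrow> 'a" where
      \<omega>: "\<omega> = (\<lambda>T. \<Sum>n. cinner (x n) (T (y n)))"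
      and xy: "summable (\<lambda>n. (norm (x n))\<^sup>2)" "summable (\<lambda>n. (norm (y n))\<^sup>2)"
      unfolding predual_def by blast
    have "(\<lambda>n. \<Sum>i<n. coef2 (x i) (y i) W) \<longlonglongrightarrow> slice1 \<omega> W"
      using slice1_eq[OF W xy] unfolding sums_def \<omega> .
    then show ?thesis
      by (rule closed_sequentially[OF closed_closed_span, rotated])
        (intro subspace_sum subspace_closed_span closed_span_base coefsI)
  qed
  then show "qg_algebra W \<subseteq> closed_span (coefs W)"
    unfolding qg_algebra_def by (intro closure_minimal) auto
next
  \<comment> \<open>Finite sums of coefficients already form a subspace, since real scalars are
    absorbed into the second vector.\<close>
  define L where "L = range (\<lambda>l. tsum (\<lambda>u v. coef2 u v W) l)"
  have "subspace L"
  proof (rule subspaceI)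
    show "0 \<in> L" unfolding L_def by (rule range_eqI[of _ _ "[]"]) simp
    fix a b assume "a \<in> L" "b \<in> L"
    then obtain l m where "a = tsum (\<lambda>u v. coef2 u v W) l" "b = tsum (\<lambda>u v. coef2 u v W) m"
      by (auto simp: L_def)
    then show "a + b \<in> L" unfolding L_def by (intro range_eqI[of _ _ "l @ m"]) simp
  next
    fix r a assume "a \<in> L"
    then obtain l where l: "a = tsum (\<lambda>u v. coef2 u v W) l" by (auto simp: L_def)
    have "r *\<^sub>R a = tsum (\<lambda>u v. coef2 u v W) (map (\<lambda>(u, v). (u, r *\<^sub>R v)) l)"
      unfolding l by (induction l) (auto simp: W scaleR_add_right coef2_scaleR)
    then show "r *\<^sub>R a \<in> L" unfolding L_def by blast
  qed
  moreover have "coefs W \<subseteq> L"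
    unfolding coefs_def L_def
  proof clarify
    fix u v show "coef2 u v W \<in> range (tsum (\<lambda>u v. coef2 u v W))"
      by (rule range_eqI[of _ _ "[(u, v)]"]) simp
  qed
  ultimately have "span (coefs W) \<subseteq> L" by (rule span_minimal[rotated])
  moreover have "L \<subseteq> {slice1 \<omega> W |\<omega>. \<omega> \<in> predual}"
    unfolding L_def
  proof clarify
    fix l :: "('a \<times> 'a) list"
    \<comment> \<open>Padding a list by zeros makes it a normal functional.\<close>
    define x where "x n = (if n < length l then fst (l ! n) else 0)" for n
    define y where "y n = (if n < length l then snd (l ! n) else 0)" for n
    have xy: "summable (\<lambda>n. (norm (x n))\<^sup>2)" "summable (\<lambda>n. (norm (y n))\<^sup>2)"
      by (rule summable_finite[of "{..<length l}"], simp_all add: x_def y_def)+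
    have "(\<lambda>n. coef2 (x n) (y n) W) sums (\<Sum>n<length l. coef2 (x n) (y n) W)"
      by (rule sums_finite) (simp_all add: x_def y_def W)
    then have "slice1 (\<lambda>T. \<Sum>n. cinner (x n) (T (y n))) W = (\<Sum>n<length l. coef2 (x n) (y n) W)"
      using slice1_eq[OF W xy] sums_unique2 by blast
    also have "\<dots> = tsum (\<lambda>u v. coef2 u v W) l"
      unfolding tsum_def sum_list_sum_nth
      by (simp add: x_def y_def split_def atLeast0LessThan)
    finally have "tsum (\<lambda>u v. coef2 u v W) l = slice1 (\<lambda>T. \<Sum>n. cinner (x n) (T (y n))) W" by simp
    moreover have "(\<lambda>T :: 'a \<Rightarrow>\<^sub>L 'a. \<Sum>n. cinner (x n) (T (y n))) \<in> predual"
      using xy unfolding predual_def by blast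
    ultimately show "\<exists>\<omega>. tsum (\<lambda>u v. coef2 u v W) l = slice1 \<omega> W \<and> \<omega> \<in> predual"
      by blast
  qed
  ultimately show "closed_span (coefs W) \<subseteq> qg_algebra W"
    unfolding closed_span_def qg_algebra_def by (intro closure_mono) blast
qed

definition flipped :: "('a::chilbert_space \<otimes>\<^sub>H 'b::chilbert_space \<Rightarrow>\<^sub>L 'a \<otimes>\<^sub>H 'b)
    \<Rightarrow> ('b \<otimes>\<^sub>H 'a \<Rightarrow>\<^sub>L 'b \<otimes>\<^sub>H 'a)" where
  "flipped T = flip o\<^sub>L T o\<^sub>L flip"

lemma bop_flipped [simp, intro]: "T \<in> bop \<Longrightarrow> flipped T \<in> bop"
  by (simp add: flipped_def)

lemma flipped_flipped [simp]: "flipped (flipped T) = T"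
  by (simp add: flipped_def compose_assoc) (simp flip: compose_assoc)

lemma adj_flipped: "T \<in> bop \<Longrightarrow> adj (flipped T) = flipped (adj T)"
  by (simp add: flipped_def adj_compose compose_assoc)

lemma unitary_flipped: "unitary T \<Longrightarrow> unitary (flipped T)"
  unfolding flipped_def by (intro unitary_compose unitary_flip)

lemma coef1_flipped: "T \<in> bop \<Longrightarrow> coef1 u v (flipped T) = coef2 u v T"
  by (rule bop_eqI)
    (simp add: cinner_coef1 cinner_coef2, simp add: flipped_def, metis flip_apply flip_cinner)

text \<open>The flip exchanges the legs. Everything proved of \<open>qg_algebra\<close> thus reaches
  the dual by inserting \<open>flipped (adj W)\<close> for \<open>W\<close>.\<close>

lemma dual_algebra_eq:
  assumes "W \<in> bop"
  shows "dual_algebra W = qg_algebra (flipped (adj W))"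
proof -
  have "slice2 \<omega> (adj W) = slice1 \<omega> (flipped (adj W))" for \<omega>
    unfolding slice1_def slice2_def by (simp add: coef1_flipped assms)
  then show ?thesis by (simp add: dual_algebra_def qg_algebra_def)
qed

section \<open>Slicing threefold tensor products\<close>

lemma bounded_linear_coef2_left:
  assumes "T \<in> bop"
  shows "bounded_linear (\<lambda>u. coef2 u v T)"
proof (rule bounded_linear_intro[where K = "norm T * norm v"])
  show "norm (coef2 u v T) \<le> norm u * (norm T * norm v)" for u
    using norm_coef2[OF assms, of u v] by (simp add: mult_ac)
qed (auto intro!: bop_eqI simp: assms cinner_coef2 tensor_add_left tensor_scaleR_left cinner_add_left
    cinner_scaleR_left cinner_scaleR_right cinner_add_right blinfun.add_left blinfun.scaleR_left)

lemma bounded_linear_coef2_right: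
  assumes "T \<in> bop"
  shows "bounded_linear (\<lambda>v. coef2 u v T)"
proof (rule bounded_linear_intro[where K = "norm u * norm T"])
  show "norm (coef2 u v T) \<le> norm v * (norm u * norm T)" for v
    using norm_coef2[OF assms, of u v] by (simp add: mult_ac)
qed (auto intro!: bop_eqI simp: assms cinner_coef2 tensor_add_left tensor_scaleR_left
    cinner_scaleR_right cinner_add_right blinfun.add_left blinfun.scaleR_left
    blinfun.add_right blinfun.scaleR_right)

text \<open>The modular relation speaks of vectors in the domain or range of an unbounded operator.
  These are total, and coefficients depend continuously on both vectors.\<close>

lemma coef2_mem:
  assumes T: "T \<in> bop" and total: "closed_span X = UNIV" "closed_span Y = UNIV"
    and M: "\<And>u v. u \<in> X \<Longrightarrow> v \<in> Y \<Longrightarrow> coef2 u v T \<in> M" "subspace M" "closed M"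
  shows "coef2 u v T \<in> M"
proof (rule closed_span_image[of u X "\<lambda>u. coef2 u v T"])
  fix u assume "u \<in> X"
  show "coef2 u v T \<in> M"
    by (rule closed_span_image[of v Y "\<lambda>v. coef2 u v T"])
      (use \<open>u \<in> X\<close> M bounded_linear_coef2_right[OF T] total in auto)
qed (use M bounded_linear_coef2_left[OF T] total in auto)

lemma closed_span_coefs_subset:
  assumes "T \<in> bop" "closed_span X = UNIV" "closed_span Y = UNIV"
    and "\<And>u v. u \<in> X \<Longrightarrow> v \<in> Y \<Longrightarrow> coef2 u v T \<in> M" "subspace M" "closed M"
  shows "closed_span (coefs T) \<subseteq> M"
proof (rule closed_span_minimal)
  show "coefs T \<subseteq> M" using coef2_mem[OF assms] unfolding coefs_def by blast
qed (use assms in auto)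

lemma closed_span_tensor_UNIV:
  assumes "closed_span X = UNIV"
  shows "closed_span {x \<otimes>\<^sub>v t | x t. x \<in> X} = (UNIV :: ('a::chilbert_space \<otimes>\<^sub>H 'b::chilbert_space) set)"
    (is "closed_span ?Y = _")
proof -
  have "x \<otimes>\<^sub>v t \<in> closed_span ?Y" for x :: 'a and t :: 'b
    by (rule closed_span_image[of x X "\<lambda>x. x \<otimes>\<^sub>v t"])
      (use assms bounded_linear_tensor_left in \<open>auto intro: closed_span_base\<close>)
  then have "closed_span simple_tensors \<subseteq> closed_span ?Y"
    by (intro closed_span_minimal) (auto elim!: simple_tensorsE)
  then show ?thesis by auto
qed

lemma op_eqI_total:
  fixes S T :: "'a::chilbert_space \<Rightarrow>\<^sub>L 'b::chilbert_space"
  assumes total: "closed_span X = UNIV" "closed_span Y = UNIV"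
    and eq: "\<And>x y. x \<in> X \<Longrightarrow> y \<in> Y \<Longrightarrow> cinner x (S y) = cinner x (T y)"
  shows "S = T"
proof (rule bop_eqI)
  fix x y
  show "cinner x (S y) = cinner x (T y)"
  proof (rule closed_span_eq[of y Y "\<lambda>y. cinner x (S y)"])
    fix y assume y: "y \<in> Y"
    show "cinner x (S y) = cinner x (T y)"
      by (rule closed_span_eq[of x X "\<lambda>x. cinner x (S y)"])
        (use total y eq in \<open>auto intro: bounded_linear_cinner_left\<close>)
  qed (use total in \<open>auto intro: bounded_linear_compose[OF bounded_linear_cinner_right]
      blinfun.bounded_linear_right\<close>)
qed

section \<open>Slices over the first two legs\<close>

definition ket12 :: "'a::chilbert_space \<otimes>\<^sub>H 'b::chilbert_space
    \<Rightarrow> 'c::chilbert_space \<Rightarrow>\<^sub>L 'a \<otimes>\<^sub>H 'b \<otimes>\<^sub>H 'c" where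
  "ket12 \<zeta> = assoc o\<^sub>L ketL \<zeta>"

lemma bop_ket12 [simp, intro]: "ket12 \<zeta> \<in> bop"
  by (simp add: ket12_def)

lemma ket12_apply [simp]: "ket12 \<zeta> z = insR z \<zeta>"
  by (simp add: ket12_def)

lemma ket12_tensor: "ket12 (x \<otimes>\<^sub>v y) = ketL x o\<^sub>L ketL y"
  by (simp add: ket12_def assoc_ketL_tensor)

lemma leg12_ket12: "T \<in> bop \<Longrightarrow> leg12 T o\<^sub>L ket12 \<zeta> = ket12 (T \<zeta>)"
  by (rule blinfun_eqI) simp

lemma bounded_linear_ket12: "bounded_linear ket12"
  unfolding ket12_def by (rule bounded_linear_compose[OF bounded_linear_compose_right bounded_linear_ketL])

text \<open>The slicing vectors range over the whole tensor product of the first two legs, so that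
  they can absorb operators on these legs, as \<open>sl12_leg12\<close> states.\<close>

definition sl12 :: "'a::chilbert_space \<otimes>\<^sub>H 'b::chilbert_space \<Rightarrow> 'a \<otimes>\<^sub>H 'b
    \<Rightarrow> ('a \<otimes>\<^sub>H 'b \<otimes>\<^sub>H 'c::chilbert_space \<Rightarrow>\<^sub>L 'a \<otimes>\<^sub>H 'b \<otimes>\<^sub>H 'c) \<Rightarrow> ('c \<Rightarrow>\<^sub>L 'c)" where
  "sl12 \<zeta> \<zeta>' T = adj (ket12 \<zeta>) o\<^sub>L T o\<^sub>L ket12 \<zeta>'"

lemma adj_ket12_leg12:
  assumes "R \<in> bop"
  shows "adj (ket12 \<zeta>) o\<^sub>L leg12 R = adj (ket12 (adj R \<zeta>))"
proof -
  have "adj (ket12 \<zeta>) o\<^sub>L leg12 R = adj (leg12 (adj R) o\<^sub>L ket12 \<zeta>)"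
    by (simp add: adj_compose adj_leg assms)
  then show ?thesis by (simp add: leg12_ket12 assms)
qed

lemma sl12_leg12:
  assumes "R \<in> bop" "S \<in> bop"
  shows "sl12 \<zeta> \<zeta>' (leg12 R o\<^sub>L T o\<^sub>L leg12 S) = sl12 (adj R \<zeta>) (S \<zeta>') T"
  unfolding sl12_def
  by (simp add: compose_assoc leg12_ket12 assms) (simp add: adj_ket12_leg12 assms flip: compose_assoc)

lemma sl12_mem:
  assumes M: "\<And>p q r s. sl12 (p \<otimes>\<^sub>v q) (r \<otimes>\<^sub>v s) T \<in> M" "subspace M" "closed M"
  shows "sl12 \<zeta> \<zeta>' T \<in> M"
proof (rule tensor_linear_mem[of "\<lambda>\<zeta>. sl12 \<zeta> \<zeta>' T"])
  show "bounded_linear (\<lambda>\<zeta>. sl12 \<zeta> \<zeta>' T)"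
    unfolding sl12_def
    by (intro bounded_linear_compose[OF bounded_linear_compose_left] bounded_linear_on_compose[OF bounded_linear_on_adj]
        bounded_linear_ket12 bop_ket12)
  fix p q
  show "sl12 (p \<otimes>\<^sub>v q) \<zeta>' T \<in> M"
  proof (rule tensor_linear_mem[of "\<lambda>\<zeta>'. sl12 (p \<otimes>\<^sub>v q) \<zeta>' T"])
    show "bounded_linear (\<lambda>\<zeta>'. sl12 (p \<otimes>\<^sub>v q) \<zeta>' T)"
      unfolding sl12_def
      by (intro bounded_linear_compose[OF bounded_linear_compose_right] bounded_linear_ket12)
  qed (use M in auto)
qed (use M in auto)

lemma cinner_insM: "cinner (p \<otimes>\<^sub>v b \<otimes>\<^sub>v c) (insM b' \<tau>) = cinner b b' * cinner (p \<otimes>\<^sub>v c) \<tau>"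
  by (rule tensor_linear_eq[of "\<lambda>\<tau>. cinner (p \<otimes>\<^sub>v b \<otimes>\<^sub>v c) (insM b' \<tau>)"])
    (auto intro: bounded_linear_compose[OF bounded_linear_cinner_right] blinfun.bounded_linear_right
      bounded_linear_compose[OF bounded_linear_mult_right] bounded_linear_cinner_right simp: cinner_tensor)

lemma cinner_insR_left: "cinner (p \<otimes>\<^sub>v b \<otimes>\<^sub>v c) (insR c' \<tau>) = cinner c c' * cinner (p \<otimes>\<^sub>v b) \<tau>"
  by (rule tensor_linear_eq[of "\<lambda>\<tau>. cinner (p \<otimes>\<^sub>v b \<otimes>\<^sub>v c) (insR c' \<tau>)"])
    (auto intro: bounded_linear_compose[OF bounded_linear_cinner_right] blinfun.bounded_linear_right
      bounded_linear_compose[OF bounded_linear_mult_right] bounded_linear_cinner_right simp: cinner_tensor)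

lemma slice_leg13:
  assumes "S \<in> bop"
  shows "adj (ketL p) o\<^sub>L leg13 S o\<^sub>L ketL r = id_blinfun \<otimes>\<^sub>o coef2 p r S"
  by (rule tensor_op_cinner_eqI)
    (simp add: assms cinner_adj_right leg13_apply cinner_insM cinner_tensor cinner_coef2)

lemma slice_leg12:
  assumes "S \<in> bop"
  shows "adj (ketL p) o\<^sub>L leg12 S o\<^sub>L ketL r = coef2 p r S \<otimes>\<^sub>o id_blinfun"
  by (rule tensor_op_cinner_eqI)
    (simp add: assms cinner_adj_right leg12_apply cinner_insR_left cinner_tensor cinner_coef2)

lemma adj_ketL_op_tensor:
  assumes "S \<in> bop" "T \<in> bop"
  shows "adj (ketL x) o\<^sub>L (S \<otimes>\<^sub>o T) = T o\<^sub>L adj (ketL (adj S x))"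
  by (rule tensor_op_eqI) (simp add: assms cinner_adj_left bop_scaleC)

text \<open>Contracting leg 1 and then leg 2 leaves the product of the coefficients on leg 3.
  Together with \<open>sl12_leg12\<close>, this turns pentagon equations into statements about
  products in the algebra.\<close>

lemma sl12_leg13_leg23:
  assumes "S \<in> bop" "T \<in> bop"
  shows "sl12 (p \<otimes>\<^sub>v q) (r \<otimes>\<^sub>v s) (leg13 S o\<^sub>L leg23 T) = coef2 p r S o\<^sub>L coef2 q s T"
proof -
  have "sl12 (p \<otimes>\<^sub>v q) (r \<otimes>\<^sub>v s) (leg13 S o\<^sub>L leg23 T)
      = adj (ketL q) o\<^sub>L (adj (ketL p) o\<^sub>L leg13 S o\<^sub>L (leg23 T o\<^sub>L ketL r)) o\<^sub>L ketL s"
    by (simp add: sl12_def ket12_tensor adj_compose compose_assoc)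
  also have "\<dots> = adj (ketL q) o\<^sub>L (id_blinfun \<otimes>\<^sub>o coef2 p r S) o\<^sub>L T o\<^sub>L ketL s"
    by (simp add: leg23_ketL assms flip: compose_assoc) (simp add: compose_assoc slice_leg13[OF assms(1), unfolded compose_assoc])
  also have "\<dots> = coef2 p r S o\<^sub>L coef2 q s T"
    by (simp add: adj_ketL_op_tensor assms coef2_eq[OF assms(2)] compose_assoc)
  finally show ?thesis .
qed

lemma sl12_leg23:
  assumes "T \<in> bop"
  shows "sl12 (p \<otimes>\<^sub>v q) (r \<otimes>\<^sub>v s) (leg23 T) = op_scale (cinner p r) (coef2 q s T)"
  using sl12_leg13_leg23[OF bop_id assms, of p q r s] 
  by (simp add: coef2_eq assms) (auto intro!: blinfun_eqI simp: op_scale_apply)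

text \<open>The two factors meet only in the first leg. Contracting the other legs leaves there a
  row vector of \<open>S\<close> and a column vector of \<open>T\<close>.\<close>

lemma cinner_leg12_leg13:
  assumes "S \<in> bop" "T \<in> bop" and \<xi>: "\<And>f. cinner \<xi> f = cinner (a \<otimes>\<^sub>v b) (S (f \<otimes>\<^sub>v b'))"
    and \<eta>: "\<And>f. cinner f \<eta> = cinner (f \<otimes>\<^sub>v c) (T (a' \<otimes>\<^sub>v c'))"
  shows "cinner (a \<otimes>\<^sub>v b \<otimes>\<^sub>v c) (leg12 S (leg13 T (a' \<otimes>\<^sub>v b' \<otimes>\<^sub>v c'))) = cinner \<xi> \<eta>"
proof -
  have *: "cinner (insR c \<sigma>) (insM b' \<tau>) = cinner (adj (ketR b') \<sigma>) (adj (ketR c) \<tau>)" for \<sigma> \<tau>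
  proof (rule tensor_linear_eq[of "\<lambda>\<sigma>. cinner (insR c \<sigma>) (insM b' \<tau>)"])
    fix p q
    show "cinner (insR c (p \<otimes>\<^sub>v q)) (insM b' \<tau>) = cinner (adj (ketR b') (p \<otimes>\<^sub>v q)) (adj (ketR c) \<tau>)"
      by (simp add: cinner_insM cinner_scaleC_left cinner_adj_right flip: cinner_commute)
  qed (auto intro: bounded_linear_compose[OF bounded_linear_cinner_left] blinfun.bounded_linear_right)
  have "adj (ketR b') (adj S (a \<otimes>\<^sub>v b)) = \<xi>"
    by (rule cinner_eqI_left) (simp add: cinner_adj_left assms)
  moreover have "adj (ketR c) (T (a' \<otimes>\<^sub>v c')) = \<eta>"
    by (rule cinner_eqI_right) (simp add: cinner_adj_right assms)
  moreover have "cinner (a \<otimes>\<^sub>v b \<otimes>\<^sub>v c) (leg12 S (leg13 T (a' \<otimes>\<^sub>v b' \<otimes>\<^sub>v c')))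
      = cinner (insR c (adj S (a \<otimes>\<^sub>v b))) (insM b' (T (a' \<otimes>\<^sub>v c')))"
    by (subst cinner_adj_left[symmetric]) (simp_all add: adj_leg leg12_apply leg13_apply assms)
  ultimately show ?thesis by (simp add: *)
qed

lemma cinner_leg13_leg12:
  assumes "S \<in> bop" "T \<in> bop" and \<xi>: "\<And>f. cinner f \<xi> = cinner (f \<otimes>\<^sub>v b) (S (a' \<otimes>\<^sub>v b'))"
    and \<eta>: "\<And>f. cinner \<eta> f = cinner (a \<otimes>\<^sub>v c) (T (f \<otimes>\<^sub>v c'))"
  shows "cinner (a \<otimes>\<^sub>v b \<otimes>\<^sub>v c) (leg13 T (leg12 S (a' \<otimes>\<^sub>v b' \<otimes>\<^sub>v c'))) = cinner \<eta> \<xi>"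
proof -
  have "cinner (a' \<otimes>\<^sub>v b' \<otimes>\<^sub>v c') (leg12 (adj S) (leg13 (adj T) (a \<otimes>\<^sub>v b \<otimes>\<^sub>v c))) = cinner \<xi> \<eta>"
  proof (rule cinner_leg12_leg13)
    show "cinner \<xi> f = cinner (a' \<otimes>\<^sub>v b') (adj S (f \<otimes>\<^sub>v b))" for f
      by (subst (1 2) cinner_commute) (simp add: \<xi> cinner_adj_left assms)
    show "cinner f \<eta> = cinner (f \<otimes>\<^sub>v c') (adj T (a \<otimes>\<^sub>v c))" for f
      by (subst (1 2) cinner_commute) (simp add: \<eta> cinner_adj_left assms)
  qed (auto simp: assms)
  then show ?thesis
    by (subst (1 2) cinner_commute)
      (simp add: cinner_adj_right assms flip: adj_leg)
qed

section \<open>The C*-algebra of a multiplicative unitary\<close>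

text \<open>\<open>tight A\<close> is the space \<open>H \<otimes> A\<close> of columns with entries in \<open>A\<close>.\<close>

definition tight :: "('b::chilbert_space \<Rightarrow>\<^sub>L 'b) set \<Rightarrow> ('b \<Rightarrow>\<^sub>L 'a::chilbert_space \<otimes>\<^sub>H 'b) set" where
  "tight A = closed_span {ketL g o\<^sub>L a | g a. a \<in> A}"

lemma tightI: "a \<in> A \<Longrightarrow> ketL g o\<^sub>L a \<in> tight A"
  unfolding tight_def by (rule closed_span_base) blast

lemma subspace_tight [simp, intro]: "subspace (tight A)"
  and closed_tight [simp, intro]: "closed (tight A)"
  by (auto simp: tight_def)

lemma tight_image:
  assumes x: "x \<in> tight A" and f: "bounded_linear f"
    and M: "\<And>g a. a \<in> A \<Longrightarrow> f (ketL g o\<^sub>L a) \<in> M" "subspace M" "closed M"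
  shows "f x \<in> M"
  by (rule closed_span_image[OF x[unfolded tight_def] f]) (use M in auto)

definition star_algebra :: "('a::chilbert_space \<Rightarrow>\<^sub>L 'a) set \<Rightarrow> bool" where
  "star_algebra A \<longleftrightarrow> subspace A \<and> closed A \<and> A \<subseteq> bop \<and> (\<forall>c. \<forall>x\<in>A. op_scale c x \<in> A) \<and>
     (\<forall>x\<in>A. adj x \<in> A) \<and> (\<forall>x\<in>A. \<forall>y\<in>A. x o\<^sub>L y \<in> A)"

lemma star_algebraD:
  assumes "star_algebra A"
  shows "subspace A" "closed A" "A \<subseteq> bop" "\<And>x. x \<in> A \<Longrightarrow> x \<in> bop"
    "\<And>c x. x \<in> A \<Longrightarrow> op_scale c x \<in> A" "\<And>x. x \<in> A \<Longrightarrow> adj x \<in> A"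
    "\<And>x y. x \<in> A \<Longrightarrow> y \<in> A \<Longrightarrow> x o\<^sub>L y \<in> A"
  using assms by (auto simp: star_algebra_def)

definition nondegenerate :: "('a::chilbert_space \<Rightarrow>\<^sub>L 'a) set \<Rightarrow> bool" where
  "nondegenerate A \<longleftrightarrow> closed_span {blinfun_apply a x | a x. a \<in> A} = UNIV"

lemma bounded_linear_Conj: "bounded_linear Conj"
  by (rule bounded_linear_intro[where K = 1])
    (simp_all add: plus_conjugate_def scaleR_conjugate_def norm_conjugate_def)

lemma cinner_Conj [simp]: "cinner (Conj x) (Conj y) = cinner y x"
  by (simp add: cinner_conjugate_def)

lemma closed_span_Conj:
  assumes "closed_span X = UNIV"
  shows "closed_span (Conj ` X) = UNIV"
proof -
  have "Conj x \<in> closed_span (Conj ` X)" for x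
    by (rule closed_span_image[of x X Conj])
      (use assms bounded_linear_Conj in \<open>auto intro: closed_span_base\<close>)
  then have "x \<in> closed_span (Conj ` X)" for x by (metis Conj_unconj)
  then show ?thesis by auto
qed

text \<open>This is the part of modularity that \<open>W\<close> shares with its dual \<open>flipped (adj W)\<close>. For \<open>W\<close> the graph
  \<open>P\<close> is that of \<open>Qh\<close>, for the dual it is that of \<open>Q\<close>.\<close>

locale half_modular =
  fixes W :: "'h::chilbert_space \<otimes>\<^sub>H 'h \<Rightarrow>\<^sub>L 'h \<otimes>\<^sub>H 'h"
    and Wt :: "'h conjugate \<otimes>\<^sub>H 'h \<Rightarrow>\<^sub>L 'h conjugate \<otimes>\<^sub>H 'h"
    and P :: "'h graph"
  assumes unitary_W: "unitary W" and unitary_Wt: "unitary Wt"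
    and pentagon: "leg23 W o\<^sub>L leg12 W = leg12 W o\<^sub>L leg13 W o\<^sub>L leg23 W"
    and P_adj: "graph_adj P = P"
    and P_total: "closed_span (Domain P) = UNIV" "closed_span (Range P) = UNIV"
    and rel: "(x, x') \<in> P \<Longrightarrow> (z', z) \<in> P \<Longrightarrow>
      cinner (x' \<otimes>\<^sub>v y) (W (z' \<otimes>\<^sub>v u)) = cinner (Conj z \<otimes>\<^sub>v y) (Wt (Conj x \<otimes>\<^sub>v u))"
begin

lemma bop_W [simp, intro]: "W \<in> bop" and bop_Wt [simp, intro]: "Wt \<in> bop"
  using unitary_W unitary_Wt by (auto simp: unitary_def)

lemmas W_cancel [simp] = unitaryD(2,3)[OF unitary_W] unitary_apply[OF unitary_W]
lemmas Wt_cancel [simp] = unitaryD(2,3)[OF unitary_Wt] unitary_apply[OF unitary_Wt]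
lemmas leg_W_cancel [simp] = unitary_leg[OF unitary_W, THEN unitaryD(2)]
  unitary_leg[OF unitary_W, THEN unitaryD(3)] unitary_leg[OF unitary_W, THEN unitary_apply(1)]
  unitary_leg[OF unitary_W, THEN unitary_apply(2)]
lemmas leg_Wt_cancel [simp] = unitary_leg[OF unitary_Wt, THEN unitaryD(2)]
  unitary_leg[OF unitary_Wt, THEN unitaryD(3)] unitary_leg[OF unitary_Wt, THEN unitary_apply(1)]
  unitary_leg[OF unitary_Wt, THEN unitary_apply(2)]

lemma pentagon': "leg23 W o\<^sub>L leg12 W o\<^sub>L adj (leg23 W) = leg12 W o\<^sub>L leg13 W"
  by (simp add: pentagon compose_assoc)

text \<open>Rows and columns of \<open>W\<close> and \<open>Wt\<close> as vectors, defined by \<open>cinner_vrow\<close>, \<open>cinner_vcol\<close>,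
  \<open>cinner_vrow_t\<close> and \<open>cinner_vcol_t\<close>. The relation between \<open>W\<close> and \<open>Wt\<close> says that \<open>P = graph_adj P\<close>
  contains the pairs in \<open>vrow_P\<close> and \<open>vcol_P\<close>, which turns unbounded operators into the symmetry of \<open>P\<close>.\<close>

definition vrow :: "'h \<Rightarrow> 'h \<Rightarrow> 'h \<Rightarrow> 'h" where
  "vrow x y u = adj (ketR u) (adj W (x \<otimes>\<^sub>v y))"

definition vcol :: "'h \<Rightarrow> 'h \<Rightarrow> 'h \<Rightarrow> 'h" where
  "vcol y z u = adj (ketR y) (W (z \<otimes>\<^sub>v u))"

definition vrow_t :: "'h \<Rightarrow> 'h \<Rightarrow> 'h \<Rightarrow> 'h" where
  "vrow_t x y u = unconj (adj (ketR y) (Wt (Conj x \<otimes>\<^sub>v u)))"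

definition vcol_t :: "'h \<Rightarrow> 'h \<Rightarrow> 'h \<Rightarrow> 'h" where
  "vcol_t y z u = unconj (adj (ketR u) (adj Wt (Conj z \<otimes>\<^sub>v y)))"

lemma cinner_vrow: "cinner (vrow x y u) f = cinner (x \<otimes>\<^sub>v y) (W (f \<otimes>\<^sub>v u))"
  by (simp add: vrow_def cinner_adj_left)

lemma cinner_vcol: "cinner f (vcol y z u) = cinner (f \<otimes>\<^sub>v y) (W (z \<otimes>\<^sub>v u))"
  by (simp add: vcol_def cinner_adj_right)

lemma cinner_unconj: "cinner (unconj v) z = cinner (Conj z) v" "cinner z (unconj v) = cinner v (Conj z)"
  by (simp_all add: cinner_conjugate_def)

lemma cinner_vrow_t: "cinner (vrow_t x y u) f = cinner (Conj f \<otimes>\<^sub>v y) (Wt (Conj x \<otimes>\<^sub>v u))"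
  by (simp add: vrow_t_def cinner_adj_right cinner_unconj)

lemma cinner_vcol_t: "cinner f (vcol_t y z u) = cinner (Conj z \<otimes>\<^sub>v y) (Wt (Conj f \<otimes>\<^sub>v u))"
  by (simp add: vcol_t_def cinner_adj_left cinner_unconj)

lemma P_I: "(\<And>a b. (a, b) \<in> P \<Longrightarrow> cinner z a = cinner y b) \<Longrightarrow> (y, z) \<in> P"
  by (subst P_adj[symmetric]) (auto simp: graph_adj_def)

lemma P_symmetric:
  assumes "(a, b) \<in> P" "(c, d) \<in> P"
  shows "cinner b c = cinner a d"
proof -
  have "(a, b) \<in> graph_adj P" using assms(1) by (simp only: P_adj)
  then show ?thesis using assms(2) by (auto simp: graph_adj_def)
qed

lemma vrow_P: "(x, x') \<in> P \<Longrightarrow> (vrow_t x y u, vrow x' y u) \<in> P"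
  by (rule P_I) (simp add: cinner_vrow cinner_vrow_t rel)

lemma vcol_P: "(z', z) \<in> P \<Longrightarrow> (vcol y z' u, vcol_t y z u) \<in> P"
proof (rule P_I)
  fix a b assume *: "(z', z) \<in> P" "(a, b) \<in> P"
  show "cinner (vcol_t y z u) a = cinner (vcol y z' u) b"
    by (subst (1 2) cinner_commute) (simp add: cinner_vcol cinner_vcol_t rel[OF *(2,1)])
qed

lemma cinner_vrow_vcol:
  assumes "(x, x') \<in> P" "(z', z) \<in> P"
  shows "cinner (vrow x' y u) (vcol y' z' u') = cinner (vrow_t x y u) (vcol_t y' z u')"
  by (rule P_symmetric[OF vrow_P[OF assms(1)] vcol_P[OF assms(2)]])

lemma Wt_leg12:
  assumes "(x, x') \<in> P" "(z', z) \<in> P"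
  shows "cinner (Conj z \<otimes>\<^sub>v t) (leg12 Wt (Conj x \<otimes>\<^sub>v t')) = cinner (x' \<otimes>\<^sub>v t) (leg12 W (z' \<otimes>\<^sub>v t'))"
proof (rule tensor_linear_eq[of "\<lambda>t. cinner (Conj z \<otimes>\<^sub>v t) (leg12 Wt (Conj x \<otimes>\<^sub>v t'))"])
  fix p q
  show "cinner (Conj z \<otimes>\<^sub>v p \<otimes>\<^sub>v q) (leg12 Wt (Conj x \<otimes>\<^sub>v t'))
      = cinner (x' \<otimes>\<^sub>v p \<otimes>\<^sub>v q) (leg12 W (z' \<otimes>\<^sub>v t'))"
  proof (rule tensor_linear_eq[of "\<lambda>t'. cinner (Conj z \<otimes>\<^sub>v p \<otimes>\<^sub>v q) (leg12 Wt (Conj x \<otimes>\<^sub>v t'))"])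
    fix r s
    show "cinner (Conj z \<otimes>\<^sub>v p \<otimes>\<^sub>v q) (leg12 Wt (Conj x \<otimes>\<^sub>v r \<otimes>\<^sub>v s))
      = cinner (x' \<otimes>\<^sub>v p \<otimes>\<^sub>v q) (leg12 W (z' \<otimes>\<^sub>v r \<otimes>\<^sub>v s))"
      by (simp add: leg12_apply cinner_insR_left rel[OF assms])
  qed (auto intro!: bounded_linear_compose[OF bounded_linear_cinner_right]
      bounded_linear_compose[OF blinfun.bounded_linear_right] bounded_linear_tensor_right)
qed (auto intro!: bounded_linear_compose[OF bounded_linear_cinner_left] bounded_linear_tensor_right)

text \<open>By \<open>rel\<close>, matrix entries of the left side become entries of
  \<open>leg12 W o\<^sub>L leg13 W\<close>, that is, inner products of rows with columns. The
  symmetry of \<open>P\<close> replaces these by rows and columns of \<open>Wt\<close>, and the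
  conjugate space reverses the order of the two factors.\<close>

lemma Wt_pentagon': "leg23 W o\<^sub>L leg12 Wt o\<^sub>L adj (leg23 W) = leg13 Wt o\<^sub>L leg12 Wt"
proof (rule op_eqI_total)
  show "closed_span {\<xi> \<otimes>\<^sub>v t | \<xi> t. \<xi> \<in> Conj ` Range P} = UNIV"
    "closed_span {\<xi> \<otimes>\<^sub>v t | \<xi> t. \<xi> \<in> Conj ` Domain P} = UNIV"
    by (intro closed_span_tensor_UNIV closed_span_Conj P_total)+
  fix \<xi> \<eta> :: "'h conjugate \<otimes>\<^sub>H 'h \<otimes>\<^sub>H 'h"
  assume "\<xi> \<in> {\<xi> \<otimes>\<^sub>v t | \<xi> t. \<xi> \<in> Conj ` Range P}" "\<eta> \<in> {\<xi> \<otimes>\<^sub>v t | \<xi> t. \<xi> \<in> Conj ` Domain P}"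
  then obtain x x' z z' t t' where
    P: "(x, x') \<in> P" "(z', z) \<in> P" and \<xi>: "\<xi> = Conj z \<otimes>\<^sub>v t" and \<eta>: "\<eta> = Conj x \<otimes>\<^sub>v t'"
    by blast
  show "cinner \<xi> ((leg23 W o\<^sub>L leg12 Wt o\<^sub>L adj (leg23 W)) \<eta>) = cinner \<xi> ((leg13 Wt o\<^sub>L leg12 Wt) \<eta>)"
    unfolding \<xi> \<eta>
  proof (rule tensor_linear_eq[of "\<lambda>t. cinner (Conj z \<otimes>\<^sub>v t) ((leg23 W o\<^sub>L leg12 Wt o\<^sub>L adj (leg23 W)) (Conj x \<otimes>\<^sub>v t'))"])
    fix y y'
    show "cinner (Conj z \<otimes>\<^sub>v y \<otimes>\<^sub>v y') ((leg23 W o\<^sub>L leg12 Wt o\<^sub>L adj (leg23 W)) (Conj x \<otimes>\<^sub>v t'))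
        = cinner (Conj z \<otimes>\<^sub>v y \<otimes>\<^sub>v y') ((leg13 Wt o\<^sub>L leg12 Wt) (Conj x \<otimes>\<^sub>v t'))"
    proof (rule tensor_linear_eq[of "\<lambda>t'. cinner (Conj z \<otimes>\<^sub>v y \<otimes>\<^sub>v y') ((leg23 W o\<^sub>L leg12 Wt o\<^sub>L adj (leg23 W)) (Conj x \<otimes>\<^sub>v t'))"])
      fix u u'
      let ?t = "adj W (y \<otimes>\<^sub>v y')" and ?t' = "adj W (u \<otimes>\<^sub>v u')"
      have "cinner (Conj z \<otimes>\<^sub>v y \<otimes>\<^sub>v y') ((leg23 W o\<^sub>L leg12 Wt o\<^sub>L adj (leg23 W)) (Conj x \<otimes>\<^sub>v u \<otimes>\<^sub>v u'))
          = cinner (Conj z \<otimes>\<^sub>v ?t) (leg12 Wt (Conj x \<otimes>\<^sub>v ?t'))"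
        by (simp add: adj_leg) (subst cinner_adj_left[symmetric], auto simp: adj_leg)
      also have "\<dots> = cinner (x' \<otimes>\<^sub>v ?t) (leg12 W (z' \<otimes>\<^sub>v ?t'))"
        by (rule Wt_leg12[OF P])
      also have "\<dots> = cinner (x' \<otimes>\<^sub>v y \<otimes>\<^sub>v y') ((leg23 W o\<^sub>L leg12 W o\<^sub>L adj (leg23 W)) (z' \<otimes>\<^sub>v u \<otimes>\<^sub>v u'))"
        by (simp add: adj_leg) (subst cinner_adj_left[symmetric], auto simp: adj_leg)
      also have "\<dots> = cinner (x' \<otimes>\<^sub>v y \<otimes>\<^sub>v y') (leg12 W (leg13 W (z' \<otimes>\<^sub>v u \<otimes>\<^sub>v u')))"
        by (simp add: pentagon')
      also have "\<dots> = cinner (vrow x' y u) (vcol y' z' u')"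
        by (rule cinner_leg12_leg13) (simp_all add: cinner_vrow cinner_vcol)
      also have "\<dots> = cinner (vrow_t x y u) (vcol_t y' z u')"
        by (rule cinner_vrow_vcol[OF P])
      also have "\<dots> = cinner (Conj (vcol_t y' z u')) (Conj (vrow_t x y u))"
        by simp
      also have "\<dots> = cinner (Conj z \<otimes>\<^sub>v y \<otimes>\<^sub>v y') (leg13 Wt (leg12 Wt (Conj x \<otimes>\<^sub>v u \<otimes>\<^sub>v u')))"
      proof (rule cinner_leg13_leg12[symmetric])
        show "cinner f (Conj (vrow_t x y u)) = cinner (f \<otimes>\<^sub>v y) (Wt (Conj x \<otimes>\<^sub>v u))" for f
          using cinner_vrow_t[of x y u "unconj f"] by (simp add: cinner_conjugate_def)
        show "cinner (Conj (vcol_t y' z u')) f = cinner (Conj z \<otimes>\<^sub>v y') (Wt (f \<otimes>\<^sub>v u'))" for f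
          using cinner_vcol_t[of "unconj f" y' z u'] by (simp add: cinner_conjugate_def)
      qed auto
      finally show "cinner (Conj z \<otimes>\<^sub>v y \<otimes>\<^sub>v y') ((leg23 W o\<^sub>L leg12 Wt o\<^sub>L adj (leg23 W)) (Conj x \<otimes>\<^sub>v u \<otimes>\<^sub>v u'))
          = cinner (Conj z \<otimes>\<^sub>v y \<otimes>\<^sub>v y') ((leg13 Wt o\<^sub>L leg12 Wt) (Conj x \<otimes>\<^sub>v u \<otimes>\<^sub>v u'))"
        by simp
    qed (intro bounded_linear_compose[OF bounded_linear_cinner_right]
        bounded_linear_compose[OF blinfun.bounded_linear_right] bounded_linear_tensor_right)+
  qed (intro bounded_linear_compose[OF bounded_linear_cinner_left] bounded_linear_tensor_right)+
qed

text \<open>The pentagon equation is solved for the adjoint of \<open>Wt\<close> on legs 13. On the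
  right, \<open>Wt\<close> acts on legs 12 only, where slices absorb it. This one identity yields
  the algebra structure and the tightness of the adjoint of \<open>Wt\<close>.\<close>

lemma Wt_W: "adj (leg13 Wt) o\<^sub>L leg23 W = leg12 Wt o\<^sub>L leg23 W o\<^sub>L adj (leg12 Wt)"
proof -
  have "adj (leg13 Wt) o\<^sub>L (leg23 W o\<^sub>L leg12 Wt o\<^sub>L adj (leg23 W)) o\<^sub>L leg23 W o\<^sub>L adj (leg12 Wt)
      = adj (leg13 Wt) o\<^sub>L (leg13 Wt o\<^sub>L leg12 Wt) o\<^sub>L leg23 W o\<^sub>L adj (leg12 Wt)"
    by (simp only: Wt_pentagon')
  moreover have "adj (leg13 Wt) o\<^sub>L (leg13 Wt o\<^sub>L (leg12 Wt o\<^sub>L X)) = leg12 Wt o\<^sub>L X"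
    for X :: "'h conjugate \<otimes>\<^sub>H 'h \<otimes>\<^sub>H 'h \<Rightarrow>\<^sub>L 'h conjugate \<otimes>\<^sub>H 'h \<otimes>\<^sub>H 'h"
    by (rule blinfun_eqI) simp
  ultimately show ?thesis by (simp add: compose_assoc)
qed

section \<open>The algebra spanned by the coefficients\<close>

definition alg :: "('h \<Rightarrow>\<^sub>L 'h) set" where
  "alg = closed_span (coefs W)"

lemma subspace_alg [simp, intro]: "subspace alg" and closed_alg [simp, intro]: "closed alg"
  by (auto simp: alg_def)

lemma coef_alg [simp, intro]: "coef2 u v W \<in> alg"
  unfolding alg_def by (rule closed_span_base[OF coefsI])

lemma alg_bop: "alg \<subseteq> bop"
  unfolding alg_def by (rule closed_span_bop) (simp add: coefs_bop)

lemma coef2_Wt: "(x, x') \<in> P \<Longrightarrow> (z', z) \<in> P \<Longrightarrow> coef2 (Conj z) (Conj x) Wt = coef2 x' z' W"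
  by (rule bop_eqI) (simp add: cinner_coef2 rel)

text \<open>For vectors in the domain and range of \<open>P\<close>, coefficients of
  \<open>W\<close> and \<open>Wt\<close> coincide, and such vectors are total.\<close>

lemma alg_Wt: "alg = closed_span (coefs Wt)"
proof
  have "coef2 u v Wt \<in> alg" if "u \<in> Conj ` Range P" "v \<in> Conj ` Domain P" for u v
    using that by (auto simp: coef2_Wt)
  then show "closed_span (coefs Wt) \<subseteq> alg"
    by (intro closed_span_coefs_subset[of Wt "Conj ` Range P" "Conj ` Domain P"] closed_span_Conj P_total) auto
  have "coef2 u v W \<in> closed_span (coefs Wt)" if "u \<in> Range P" "v \<in> Domain P" for u v
  proof -
    from \<open>u \<in> Range P\<close> \<open>v \<in> Domain P\<close> obtain x z where "(x, u) \<in> P" "(v, z) \<in> P" by blast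
    then show ?thesis using coef2_Wt[of x u v z] closed_span_base[OF coefsI] by metis
  qed
  then show "alg \<subseteq> closed_span (coefs Wt)"
    unfolding alg_def by (intro closed_span_coefs_subset[of W "Range P" "Domain P"] P_total) auto
qed

lemma op_scale_alg: "x \<in> alg \<Longrightarrow> op_scale c x \<in> alg"
  unfolding alg_def by (rule op_scale_closed_span_coefs) auto

lemma sl12_W_alg: "sl12 \<zeta> \<zeta>' (leg23 W) \<in> alg"
  by (rule sl12_mem) (auto simp: sl12_leg23 op_scale_alg)

lemma adj_Wt_W_alg: "adj (coef2 r p Wt) o\<^sub>L coef2 q s W \<in> alg"
proof -
  have "adj (coef2 r p Wt) o\<^sub>L coef2 q s W
      = sl12 (p \<otimes>\<^sub>v q) (r \<otimes>\<^sub>v s) (adj (leg13 Wt) o\<^sub>L leg23 W)"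
    by (simp add: adj_coef2 adj_leg sl12_leg13_leg23)
  also have "\<dots> = sl12 (adj Wt (p \<otimes>\<^sub>v q)) (adj Wt (r \<otimes>\<^sub>v s)) (leg23 W)"
    unfolding Wt_W by (simp add: adj_leg sl12_leg12)
  finally show ?thesis using sl12_W_alg by simp
qed

text \<open>The left factor is approximated by coefficients of \<open>Wt\<close> and the right one
  by coefficients of \<open>W\<close>, to which the sliced identity \<open>Wt_W\<close>
  applies.\<close>

lemma adj_compose_alg:
  assumes "x \<in> alg" "y \<in> alg"
  shows "adj x o\<^sub>L y \<in> alg"
proof (rule closed_span_image[OF assms(2)[unfolded alg_def], of "\<lambda>y. adj x o\<^sub>L y"])
  fix y assume y: "y \<in> coefs W"
  have "adj x \<in> {z. z o\<^sub>L y \<in> alg}"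
  proof (rule closed_span_adj[OF assms(1)[unfolded alg_Wt]])
    show "adj s \<in> {z. z o\<^sub>L y \<in> alg}" if "s \<in> coefs Wt" for s
      using that y adj_Wt_W_alg by (auto simp: coefs_def)
    show "subspace {z. z o\<^sub>L y \<in> alg}"
      using subspace_alg by (auto simp: subspace_def linear_simps[OF bounded_linear_compose_left])
    show "closed {z. z o\<^sub>L y \<in> alg}"
      using continuous_closed_vimage[OF closed_alg linear_continuous_at[OF bounded_linear_compose_left[of y]]]
      by (simp add: vimage_def)
  qed (simp add: coefs_bop)
  then show "adj x o\<^sub>L y \<in> alg" by simp
qed (auto intro: bounded_linear_compose_right)

text \<open>\<open>Wt_W\<close> read backwards: unitarity of \<open>Wt\<close> expresses a slice of
  \<open>leg23 W\<close> by slices of \<open>adj (leg13 Wt) o\<^sub>L leg23 W\<close>, which are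
  products.\<close>

lemma alg_factor: "alg \<subseteq> closed_span {adj x o\<^sub>L y | x y. x \<in> alg \<and> y \<in> alg}" (is "_ \<subseteq> closed_span ?F")
proof -
  have Wt_alg: "coef2 u v Wt \<in> alg" for u v
    unfolding alg_Wt by (rule closed_span_base[OF coefsI])
  have "coef2 q s W \<in> closed_span ?F" for q s
  proof (cases "q = 0")
    case True
    then show ?thesis using subspace_0[OF subspace_closed_span] by simp
  next
    case False
    \<comment> \<open>\<open>Conj q\<close> serves as a nonzero vector of the conjugate space; its
      squared norm is divided out at the end.\<close>
    let ?M = "adj (leg13 Wt) o\<^sub>L leg23 W" and ?p = "Conj q"
    have "leg23 W = adj (leg12 Wt) o\<^sub>L ?M o\<^sub>L leg12 Wt"
      unfolding Wt_W by (rule blinfun_eqI) simp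
    then have "op_scale (cinner ?p ?p) (coef2 q s W)
        = sl12 (?p \<otimes>\<^sub>v q) (?p \<otimes>\<^sub>v s) (adj (leg12 Wt) o\<^sub>L ?M o\<^sub>L leg12 Wt)"
      by (simp only: sl12_leg23[OF bop_W, symmetric])
    also have "\<dots> = sl12 (Wt (?p \<otimes>\<^sub>v q)) (Wt (?p \<otimes>\<^sub>v s)) ?M"
      by (simp add: adj_leg sl12_leg12)
    also have "\<dots> \<in> closed_span ?F"
    proof (rule sl12_mem)
      show "sl12 (p \<otimes>\<^sub>v q) (r \<otimes>\<^sub>v s) ?M \<in> closed_span ?F" for p q r s
        using Wt_alg by (auto simp: adj_leg sl12_leg13_leg23 adj_coef2[symmetric] intro!: closed_span_base)
    qed auto
    finally have "(1 / (norm q)\<^sup>2) *\<^sub>R op_scale (cinner ?p ?p) (coef2 q s W) \<in> closed_span ?F"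
      by (intro subspace_scale) auto
    moreover have "(1 / (norm q)\<^sup>2) *\<^sub>R op_scale (cinner ?p ?p) (coef2 q s W) = coef2 q s W"
      using False by (intro blinfun_eqI)
        (simp add: op_scale_apply blinfun.scaleR_left cinner_self scaleR_scaleC scaleC_scaleC
          norm_conjugate_def)
    ultimately show ?thesis by simp
  qed
  then show ?thesis
    unfolding alg_def[of] by (intro closed_span_minimal) (auto simp: coefs_def)
qed

text \<open>The products \<open>adj x o\<^sub>L y\<close> span a dense part of \<open>alg\<close>,
  and their adjoints have the same form.\<close>

lemma adj_alg:
  assumes "x \<in> alg"
  shows "adj x \<in> alg"
proof (rule closed_span_adj)
  show "x \<in> closed_span {adj x o\<^sub>L y | x y. x \<in> alg \<and> y \<in> alg}" using assms alg_factor by blast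
  show "{adj x o\<^sub>L y | x y. x \<in> alg \<and> y \<in> alg} \<subseteq> bop" using alg_bop by blast
  show "adj s \<in> alg" if "s \<in> {adj x o\<^sub>L y | x y. x \<in> alg \<and> y \<in> alg}" for s
  proof -
    obtain x y where s: "s = adj x o\<^sub>L y" "x \<in> alg" "y \<in> alg" using \<open>s \<in> _\<close> by blast
    then have "x \<in> bop" "y \<in> bop" using alg_bop by auto
    then have "adj s = adj y o\<^sub>L x" by (simp add: s adj_compose)
    then show ?thesis using s adj_compose_alg by simp
  qed
qed auto

lemma compose_alg: "x \<in> alg \<Longrightarrow> y \<in> alg \<Longrightarrow> x o\<^sub>L y \<in> alg"
  using adj_compose_alg[OF adj_alg] alg_bop by fastforce

lemma star_algebra_alg: "star_algebra alg"
  by (simp add: star_algebra_def alg_bop op_scale_alg adj_alg compose_alg)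

lemma alg_compose_span: "alg \<subseteq> closed_span {x o\<^sub>L y | x y. x \<in> alg \<and> y \<in> alg}"
proof -
  have "closed_span {adj x o\<^sub>L y | x y. x \<in> alg \<and> y \<in> alg} \<subseteq> closed_span {x o\<^sub>L y | x y. x \<in> alg \<and> y \<in> alg}"
    using adj_alg by (intro closed_span_mono) blast
  then show ?thesis using alg_factor by blast
qed

lemma nondegenerate_alg: "nondegenerate alg"
  unfolding nondegenerate_def
proof (rule closed_span_UNIV)
  fix c s assume "s \<in> {blinfun_apply a x | a x. a \<in> alg}"
  then obtain a x where s: "s = blinfun_apply a x" "a \<in> alg" by blast
  then have "c *\<^sub>C s = a (c *\<^sub>C x)" using alg_bop by (auto simp: bop_scaleC)
  then show "c *\<^sub>C s \<in> closed_span {blinfun_apply a x | a x. a \<in> alg}"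
    using s(2) by (auto intro!: closed_span_base)
next
  fix z assume z: "\<And>s. s \<in> {blinfun_apply a x | a x. a \<in> alg} \<Longrightarrow> cinner s z = 0"
  have "a z = 0" if "a \<in> alg" for a
  proof (rule cinner_eqI_right)
    fix x
    have "cinner (adj a x) z = 0" using z adj_alg[OF that] by blast
    then show "cinner x (a z) = cinner x 0" using that alg_bop by (auto simp: cinner_adj_left)
  qed
  then have "coef2 u v W z = 0" for u v by blast
  then have "cinner (u \<otimes>\<^sub>v x) (W (v \<otimes>\<^sub>v z)) = 0" for u v x
    using cinner_coef2[OF bop_W, of x u v z] by simp
  \<comment> \<open>A vector killed by all coefficients gives a zero of the injective
    \<open>W\<close>.\<close>
  then have "W (z \<otimes>\<^sub>v z) = 0" by (intro cinner_tensor_eqI) simp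
  then have "adj W (W (z \<otimes>\<^sub>v z)) = 0" by (simp only: blinfun.zero_right)
  then have "norm (z \<otimes>\<^sub>v z) = 0" by simp
  then show "z = 0" unfolding norm_tensor by simp
qed

lemma closed_span_coefs_adj: "closed_span (coefs (adj W)) = alg"
proof
  show "closed_span (coefs (adj W)) \<subseteq> alg"
    by (rule closed_span_minimal) (auto simp: coefs_def adj_coef2[symmetric] intro: adj_alg)
  show "alg \<subseteq> closed_span (coefs (adj W))"
  proof
    fix x assume "x \<in> alg"
    have "adj (adj x) \<in> closed_span (coefs (adj W))"
    proof (rule closed_span_adj[of "adj x" "coefs W"])
      show "adj x \<in> closed_span (coefs W)" using adj_alg[OF \<open>x \<in> alg\<close>] by (simp add: alg_def)
      fix s assume "s \<in> coefs W"
      then obtain u v where "s = coef2 u v W" by (auto simp: coefs_def)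
      then show "adj s \<in> closed_span (coefs (adj W))"
        by (simp add: adj_coef2 closed_span_base coefsI)
    qed (auto simp: coefs_bop)
    then show "x \<in> closed_span (coefs (adj W))" using \<open>x \<in> alg\<close> alg_bop by auto
  qed
qed

section \<open>The comultiplication on columns\<close>

lemma adj_pentagon: "leg23 W o\<^sub>L leg12 (adj W) o\<^sub>L adj (leg23 W) = leg13 (adj W) o\<^sub>L leg12 (adj W)"
  using arg_cong[OF pentagon', of adj] by (simp add: adj_compose adj_leg compose_assoc)

lemma bop_comult [simp, intro]: "x \<in> bop \<Longrightarrow> qg_comult W x \<in> bop"
  by (simp add: qg_comult_def)

text \<open>By the adjoint pentagon equation, the comultiplied coefficient is a slice of
  \<open>leg13 (adj W) o\<^sub>L leg12 (adj W)\<close>. The right factor acts only on the vector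
  \<open>q \<otimes>\<^sub>v v\<close>, and slicing the left one produces a column of coefficients.
  Using coefficients of the adjoint puts the factors in this favourable order.\<close>

lemma comult_tight_coef: "qg_comult W (coef2 p q (adj W)) o\<^sub>L ketL v \<in> tight alg"
proof -
  have "qg_comult W (coef2 p q (adj W)) = W o\<^sub>L (adj (ketL p) o\<^sub>L leg12 (adj W) o\<^sub>L ketL q) o\<^sub>L adj W"
    by (simp add: qg_comult_def slice_leg12)
  also have "\<dots> = adj (ketL p) o\<^sub>L (leg23 W o\<^sub>L leg12 (adj W) o\<^sub>L adj (leg23 W)) o\<^sub>L ketL q"
  proof -
    have "W o\<^sub>L adj (ketL p) = adj (ketL p) o\<^sub>L (leg23 W :: 'h \<otimes>\<^sub>H 'h \<otimes>\<^sub>H 'h \<Rightarrow>\<^sub>L _)"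
      by (simp add: leg23_def adj_ketL_op_tensor)
    moreover have "(ketL q o\<^sub>L adj W :: _ \<Rightarrow>\<^sub>L 'h \<otimes>\<^sub>H 'h \<otimes>\<^sub>H 'h) = adj (leg23 W) o\<^sub>L ketL q"
      by (simp add: adj_leg leg23_ketL)
    ultimately show ?thesis by (simp add: compose_assoc) (simp flip: compose_assoc)
  qed
  also have "\<dots> = adj (ketL p) o\<^sub>L leg13 (adj W) o\<^sub>L leg12 (adj W) o\<^sub>L ketL q"
    unfolding adj_pentagon by (simp add: compose_assoc)
  finally have "qg_comult W (coef2 p q (adj W)) o\<^sub>L ketL v
      = adj (ketL p) o\<^sub>L leg13 (adj W) o\<^sub>L (leg12 (adj W) o\<^sub>L ket12 (q \<otimes>\<^sub>v v))"
    by (simp add: compose_assoc ket12_tensor)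
  also have "\<dots> = adj (ketL p) o\<^sub>L leg13 (adj W) o\<^sub>L ket12 (adj W (q \<otimes>\<^sub>v v))"
    by (simp add: leg12_ket12)
  also have "\<dots> \<in> tight alg"
  proof (rule tensor_linear_mem[of "\<lambda>\<zeta>. adj (ketL p) o\<^sub>L leg13 (adj W) o\<^sub>L ket12 \<zeta>"])
    fix r s
    have "adj (ketL p) o\<^sub>L leg13 (adj W) o\<^sub>L ket12 (r \<otimes>\<^sub>v s)
        = (adj (ketL p) o\<^sub>L leg13 (adj W) o\<^sub>L ketL r) o\<^sub>L ketL s"
      by (simp add: ket12_tensor compose_assoc)
    also have "\<dots> = ketL s o\<^sub>L coef2 p r (adj W)"
      by (simp add: slice_leg13 op_tensor_ketL)
    finally show "adj (ketL p) o\<^sub>L leg13 (adj W) o\<^sub>L ket12 (r \<otimes>\<^sub>v s) \<in> tight alg"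
      by (simp add: tightI adj_coef2[symmetric] adj_alg)
  qed (auto intro: bounded_linear_compose[OF bounded_linear_compose_right] bounded_linear_ket12)
  finally show ?thesis .
qed

lemma comult_tight:
  assumes "x \<in> alg"
  shows "qg_comult W x o\<^sub>L ketL v \<in> tight alg"
proof (rule closed_span_image_on[of x "coefs (adj W)" bop "\<lambda>x. qg_comult W x o\<^sub>L ketL v"])
  show "x \<in> closed_span (coefs (adj W))" using assms by (simp add: closed_span_coefs_adj)
  show "bounded_linear_on bop (\<lambda>x. qg_comult W x o\<^sub>L ketL v)"
    unfolding qg_comult_def
    by (rule bounded_linear_on_comp[OF bounded_linear_on_tensor_left[OF bop_id] UNIV_I bounded_linear_imp_on])
      (intro bounded_linear_compose[OF bounded_linear_compose_left] bounded_linear_compose_right)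
qed (auto simp: coefs_bop, auto simp: coefs_def comult_tight_coef)

lemma adj_comult: "x \<in> bop \<Longrightarrow> adj (qg_comult W x) = qg_comult W (adj x)"
  by (simp add: qg_comult_def adj_compose adj_op_tensor compose_assoc)

end

section \<open>Ultrapowers of Hilbert spaces\<close>

text \<open>Zorn's lemma gives a maximal proper refinement of \<open>F\<close>. If neither a
  property nor its negation held eventually, restricting to the property would refine it
  further.\<close>

lemma ex_ultrafilter:
  fixes F :: "'a filter"
  assumes "F \<noteq> bot"
  shows "\<exists>U. U \<le> F \<and> U \<noteq> bot \<and> (\<forall>P. eventually P U \<or> eventually (\<lambda>x. \<not> P x) U)"
proof -
  \<comment> \<open>Finer filters have more eventual properties, so inclusion of these sets is the
    order to be maximised.\<close>
  define ev where "ev G = {P. eventually P G}" for G :: "'a filter"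
  define \<A> where "\<A> = {ev G | G. G \<le> F \<and> G \<noteq> bot}"
  have "\<exists>M\<in>\<A>. \<forall>X\<in>\<A>. M \<subseteq> X \<longrightarrow> X = M"
  proof (rule subset_Zorn_nonempty)
    show "\<A> \<noteq> {}" using assms by (auto simp: \<A>_def)
    fix C assume C: "C \<noteq> {}" "subset.chain \<A> C"
    have ex: "\<exists>G. X = ev G \<and> G \<le> F \<and> G \<noteq> bot" if "X \<in> C" for X
      using C(2) that unfolding subset_chain_def \<A>_def by blast
    have filt: "is_filter (\<lambda>P. P \<in> \<Union>C)"
    proof
      show "(\<lambda>x. True) \<in> \<Union>C" using C(1) ex by (force simp: ev_def)
    next
      fix P Q assume "P \<in> \<Union>C" "Q \<in> \<Union>C"
      then obtain X Y where XY: "X \<in> C" "P \<in> X" "Y \<in> C" "Q \<in> Y" by blast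
      then have "X \<subseteq> Y \<or> Y \<subseteq> X" using C(2) unfolding subset_chain_def by blast
      then obtain Z where Z: "Z \<in> C" "P \<in> Z" "Q \<in> Z" using XY by blast
      then obtain G where "Z = ev G" using ex by blast
      then have "(\<lambda>x. P x \<and> Q x) \<in> Z" using Z by (auto simp: ev_def eventually_conj)
      then show "(\<lambda>x. P x \<and> Q x) \<in> \<Union>C" using Z by blast
    next
      fix P Q assume PQ: "\<forall>x. P x \<longrightarrow> Q x" "P \<in> \<Union>C"
      then obtain Z where Z: "Z \<in> C" "P \<in> Z" by blast
      then obtain G where "Z = ev G" using ex by blast
      then have "Q \<in> Z" using Z PQ(1) by (auto simp: ev_def elim: eventually_mono)
      then show "Q \<in> \<Union>C" using Z by blast
    qed
    define G where "G = Abs_filter (\<lambda>P. P \<in> \<Union>C)"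
    have G: "eventually P G \<longleftrightarrow> P \<in> \<Union>C" for P
      unfolding G_def by (rule eventually_Abs_filter[OF filt])
    obtain X0 where "X0 \<in> C" using C(1) by blast
    then obtain G0 where G0: "X0 = ev G0" "G0 \<le> F" using ex by blast
    have "G \<le> F"
      using \<open>X0 \<in> C\<close> G0 unfolding le_filter_def G by (auto simp: ev_def intro!: bexI[of _ X0])
    moreover have "G \<noteq> bot"
    proof
      assume "G = bot"
      then have "(\<lambda>x. False) \<in> \<Union>C" using G[of "\<lambda>x. False"] by simp
      then obtain X where X: "X \<in> C" "(\<lambda>x. False) \<in> X" by blast
      then obtain G' where "X = ev G'" "G' \<noteq> bot" using ex by blast
      then show False using X(2) by (simp add: ev_def trivial_limit_def)
    qed
    moreover have "\<Union>C = ev G" by (auto simp: ev_def G)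
    ultimately show "\<Union>C \<in> \<A>" unfolding \<A>_def by blast
  qed
  then obtain U where U: "U \<le> F" "U \<noteq> bot"
    and max: "\<And>G. G \<le> F \<Longrightarrow> G \<noteq> bot \<Longrightarrow> ev U \<subseteq> ev G \<Longrightarrow> ev G = ev U"
    unfolding \<A>_def by blast
  have "eventually P U \<or> eventually (\<lambda>x. \<not> P x) U" for P
  proof (rule disjCI)
    assume nP: "\<not> eventually (\<lambda>x. \<not> P x) U"
    let ?G = "inf U (principal {x. P x})"
    have "?G \<noteq> bot"
      using nP by (simp add: trivial_limit_def eventually_inf_principal)
    moreover have "ev U \<subseteq> ev ?G" by (auto simp: ev_def eventually_inf_principal elim: eventually_mono)
    ultimately have "ev ?G = ev U" using U(1) by (intro max) (auto intro: le_infI1)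
    moreover have "P \<in> ev ?G" by (simp add: ev_def eventually_inf_principal)
    ultimately show "eventually P U" by (simp add: ev_def)
  qed
  then show ?thesis using U by blast
qed

text \<open>The index set consists of finite sets directed by inclusion: the vectors of the Dini
  argument are indexed by finite sets, and each fixed finite set must eventually lie below the
  index.\<close>

definition ultra :: "'i set filter" where
  "ultra = (SOME U. U \<le> finite_subsets_at_top UNIV \<and> U \<noteq> bot \<and>
     (\<forall>P. eventually P U \<or> eventually (\<lambda>x. \<not> P x) U))"

lemma ultra:
  shows ultra_le: "ultra \<le> finite_subsets_at_top UNIV" and ultra_neq_bot: "ultra \<noteq> bot"
    and ultra_cases: "eventually Q ultra \<or> eventually (\<lambda>x. \<not> Q x) ultra"
proof -
  have *: "\<exists>U. U \<le> finite_subsets_at_top UNIV \<and> U \<noteq> bot \<and>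
     (\<forall>P. eventually P U \<or> eventually (\<lambda>x. \<not> P x) (U :: 'x set filter))"
    by (rule ex_ultrafilter) simp
  show "ultra \<le> finite_subsets_at_top (UNIV :: 'a set)"
    unfolding ultra_def using someI_ex[OF *] by blast
  show "ultra \<noteq> (bot :: 'b set filter)"
    unfolding ultra_def using someI_ex[OF *] by blast
  show "eventually Q ultra \<or> eventually (\<lambda>x. \<not> Q x) ultra"
    unfolding ultra_def using someI_ex[OF *] by blast
qed

text \<open>Compactness of a ball gives a cluster point, and along an ultrafilter every cluster
  point is a limit.\<close>

lemma ultra_convergent:
  fixes f :: "'i set \<Rightarrow> complex"
  assumes "\<And>i. norm (f i) \<le> K"
  shows "\<exists>l. (f \<longlongrightarrow> l) ultra"
proof -
  have "filtermap f ultra \<noteq> bot" by (simp add: filtermap_bot_iff ultra_neq_bot)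
  moreover have "eventually (\<lambda>x. x \<in> cball 0 K) (filtermap f ultra)"
    using assms by (simp add: eventually_filtermap)
  ultimately obtain l where l: "inf (nhds l) (filtermap f ultra) \<noteq> bot"
    using compact_cball[of 0 K] unfolding compact_filter by blast
  have "(f \<longlongrightarrow> l) ultra"
  proof (rule topological_tendstoI)
    fix S assume S: "open S" "l \<in> S"
    show "eventually (\<lambda>x. f x \<in> S) ultra"
    proof (rule ccontr)
      assume "\<not> ?thesis"
      then have "eventually (\<lambda>x. f x \<notin> S) ultra" using ultra_cases by blast
      then have "eventually (\<lambda>x. x \<notin> S) (filtermap f ultra)" by (simp add: eventually_filtermap)
      then have "eventually (\<lambda>x. x \<notin> S) (inf (nhds l) (filtermap f ultra))"
        by (rule filter_leD[OF inf_le2])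
      moreover have "eventually (\<lambda>x. x \<in> S) (inf (nhds l) (filtermap f ultra))"
        by (rule filter_leD[OF inf_le1 eventually_nhds_in_open[OF S]])
      ultimately have "eventually (\<lambda>x. False) (inf (nhds l) (filtermap f ultra))"
        by (rule eventually_elim2) simp
      then show False using l by (simp add: eventually_False)
    qed
  qed
  then show ?thesis by blast
qed

definition ulim :: "('i set \<Rightarrow> complex) \<Rightarrow> complex" where
  "ulim f = Lim ultra f"

lemma ulimI: "(f \<longlongrightarrow> l) ultra \<Longrightarrow> ulim f = l"
  unfolding ulim_def by (rule tendsto_Lim[OF ultra_neq_bot])

definition bdd :: "('i set \<Rightarrow> 'a::real_normed_vector) \<Rightarrow> bool" where
  "bdd f \<longleftrightarrow> (\<exists>K. \<forall>i. norm (f i) \<le> K)"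

lemma bddI: "(\<And>i. norm (f i) \<le> K) \<Longrightarrow> bdd f"
  by (auto simp: bdd_def)

lemma bdd_const [simp]: "bdd (\<lambda>i. c)"
  by (auto simp: bdd_def)

lemma bdd_add [simp]: "bdd f \<Longrightarrow> bdd g \<Longrightarrow> bdd (\<lambda>i. f i + g i)"
  unfolding bdd_def by (metis norm_triangle_mono)

lemma bdd_linear: "bounded_linear T \<Longrightarrow> bdd f \<Longrightarrow> bdd (\<lambda>i. T (f i))"
proof -
  assume T: "bounded_linear T" and "bdd f"
  then obtain K where K: "\<And>i. norm (f i) \<le> K" by (auto simp: bdd_def)
  obtain L where L: "L \<ge> 0" "\<And>x. norm (T x) \<le> norm x * L"
    using bounded_linear.nonneg_bounded[OF T] by blast
  have "norm (T (f i)) \<le> K * L" for i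
    using L(2)[of "f i"] mult_right_mono[OF K[of i] L(1)] by linarith
  then show ?thesis by (rule bddI)
qed

lemma bdd_uminus [simp]: "bdd f \<Longrightarrow> bdd (\<lambda>i. - f i)"
  by (rule bdd_linear[OF bounded_linear_minus[OF bounded_linear_ident]])

lemma bdd_diff [simp]: "bdd f \<Longrightarrow> bdd g \<Longrightarrow> bdd (\<lambda>i. f i - g i)"
  using bdd_add[of f "\<lambda>i. - g i"] by simp

lemma bdd_scaleR [simp]: "bdd f \<Longrightarrow> bdd (\<lambda>i. r *\<^sub>R f i)"
  by (rule bdd_linear[OF bounded_linear_scaleR_right])

lemma bdd_scaleC [simp]: "bdd f \<Longrightarrow> bdd (\<lambda>i. c *\<^sub>C (f i :: 'a::chilbert_space))"
  by (rule bdd_linear[OF bounded_linear_scaleC])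

lemma bdd_cinner:
  fixes f g :: "'i set \<Rightarrow> 'a::chilbert_space"
  assumes "bdd f" "bdd g"
  shows "bdd (\<lambda>i. cinner (f i) (g i))"
proof -
  obtain K L where KL: "\<And>i. norm (f i) \<le> K" "\<And>i. norm (g i) \<le> L"
    using assms by (auto simp: bdd_def)
  have "norm (cinner (f i) (g i)) \<le> K * L" for i
    using cmod_cinner_le[of "f i" "g i"]
      mult_mono[OF KL(1)[of i] KL(2)[of i] order_trans[OF norm_ge_zero KL(1)]] by fastforce
  then show ?thesis by (rule bddI)
qed

lemma tendsto_ulim:
  assumes "bdd f"
  shows "(f \<longlongrightarrow> ulim f) ultra"
proof -
  obtain K where "\<And>i. norm (f i) \<le> K" using assms by (auto simp: bdd_def)
  then show ?thesis using ultra_convergent[of f K] ulimI by blast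
qed

lemma tendsto_cinner_zero:
  fixes f g :: "'i set \<Rightarrow> 'a::chilbert_space"
  assumes f: "(f \<longlongrightarrow> 0) F" and g: "bdd g"
  shows "((\<lambda>i. cinner (f i) (g i)) \<longlongrightarrow> 0) F" "((\<lambda>i. cinner (g i) (f i)) \<longlongrightarrow> 0) F"
proof -
  obtain K where K: "\<And>i. norm (g i) \<le> K" using g by (auto simp: bdd_def)
  have lim: "((\<lambda>i. norm (f i) * K) \<longlongrightarrow> 0) F"
    by (rule tendsto_mult_left_zero[OF tendsto_norm_zero[OF f]])
  have "norm (cinner (f i) (g i)) \<le> norm (f i) * K" "norm (cinner (g i) (f i)) \<le> norm (f i) * K" for i
    using cmod_cinner_le[of "f i" "g i"] cmod_cinner_le[of "g i" "f i"]
      mult_left_mono[OF K[of i] norm_ge_zero[of "f i"]] by (auto simp: mult.commute)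
  then show "((\<lambda>i. cinner (f i) (g i)) \<longlongrightarrow> 0) F" "((\<lambda>i. cinner (g i) (f i)) \<longlongrightarrow> 0) F"
    by (auto intro: Lim_null_comparison[OF _ lim])
qed

section \<open>The ultrapower as a Hilbert space\<close>

definition uprel :: "('i set \<Rightarrow> 'a::chilbert_space) \<Rightarrow> ('i set \<Rightarrow> 'a) \<Rightarrow> bool" where
  "uprel f g \<longleftrightarrow> bdd f \<and> bdd g \<and> ((\<lambda>i. f i - g i) \<longlongrightarrow> 0) ultra"

lemma uprel_refl: "uprel f f \<longleftrightarrow> bdd f"
  by (simp add: uprel_def)

lemma uprel_linear:
  assumes T: "bounded_linear T" and "uprel f g"
  shows "uprel (\<lambda>i. T (f i)) (\<lambda>i. T (g i))"
  using assms(2) bounded_linear.tendsto_zero[OF T, of "\<lambda>i. f i - g i" ultra]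
  unfolding uprel_def by (simp add: bdd_linear[OF T] linear_simps[OF T])

lemma uprel_add:
  assumes "uprel f f'" "uprel g g'"
  shows "uprel (\<lambda>i. f i + g i) (\<lambda>i. f' i + g' i)"
  using assms tendsto_add[of "\<lambda>i. f i - f' i" 0 ultra "\<lambda>i. g i - g' i" 0]
  unfolding uprel_def by (simp add: algebra_simps)

lemma uprel_ulim:
  assumes "uprel f f'" "uprel g g'"
  shows "ulim (\<lambda>i. cinner (f i) (g i)) = ulim (\<lambda>i. cinner (f' i) (g' i))"
proof (rule ulimI)
  have b: "bdd f" "bdd f'" "bdd g" "bdd g'" using assms by (auto simp: uprel_def)
  have "((\<lambda>i. cinner (f' i) (g' i) + (cinner (f i - f' i) (g i) + cinner (f' i) (g i - g' i)))
      \<longlongrightarrow> ulim (\<lambda>i. cinner (f' i) (g' i)) + (0 + 0)) ultra"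
    using assms b unfolding uprel_def
    by (intro tendsto_add tendsto_ulim bdd_cinner tendsto_cinner_zero) auto
  then show "((\<lambda>i. cinner (f i) (g i)) \<longlongrightarrow> ulim (\<lambda>i. cinner (f' i) (g' i))) ultra"
    by (simp add: cinner_diff_left cinner_diff_right)
qed

quotient_type (overloaded) ('i, 'a) upower = "'i set \<Rightarrow> 'a::chilbert_space" / partial: uprel
proof (rule part_equivpI)
  show "\<exists>f :: 'i set \<Rightarrow> 'a. uprel f f" by (rule exI[of _ "\<lambda>_. 0"]) (simp add: uprel_refl)
  show "symp (uprel :: ('i set \<Rightarrow> 'a) \<Rightarrow> _)"
  proof (rule sympI)
    fix f g :: "'i set \<Rightarrow> 'a" assume "uprel f g"
    then show "uprel g f"
      using tendsto_minus[of "\<lambda>i. f i - g i" 0 ultra] by (auto simp: uprel_def)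
  qed
  show "transp (uprel :: ('i set \<Rightarrow> 'a) \<Rightarrow> _)"
  proof (rule transpI)
    fix f g h :: "'i set \<Rightarrow> 'a" assume "uprel f g" "uprel g h"
    then show "uprel f h"
      using tendsto_add[of "\<lambda>i. f i - g i" 0 ultra "\<lambda>i. g i - h i" 0] by (auto simp: uprel_def)
  qed
qed

instantiation upower :: (type, chilbert_space) "{zero, plus, minus, uminus, scaleR, scaleC, cinner}"
begin

lift_definition zero_upower :: "('a, 'b) upower" is "\<lambda>_. 0" by (simp add: uprel_refl)
lift_definition plus_upower :: "('a, 'b) upower \<Rightarrow> ('a, 'b) upower \<Rightarrow> ('a, 'b) upower" is "\<lambda>f g i. f i + g i"
  by (rule uprel_add)
lift_definition uminus_upower :: "('a, 'b) upower \<Rightarrow> ('a, 'b) upower" is "\<lambda>f i. - f i"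
  by (rule uprel_linear[OF bounded_linear_minus[OF bounded_linear_ident]])
lift_definition minus_upower :: "('a, 'b) upower \<Rightarrow> ('a, 'b) upower \<Rightarrow> ('a, 'b) upower" is "\<lambda>f g i. f i - g i"
  using uprel_add[OF _ uprel_linear[OF bounded_linear_minus[OF bounded_linear_ident]]] by fastforce
lift_definition scaleR_upower :: "real \<Rightarrow> ('a, 'b) upower \<Rightarrow> ('a, 'b) upower" is "\<lambda>r f i. r *\<^sub>R f i"
  by (rule uprel_linear[OF bounded_linear_scaleR_right])
lift_definition scaleC_upower :: "complex \<Rightarrow> ('a, 'b) upower \<Rightarrow> ('a, 'b) upower" is "\<lambda>r f i. r *\<^sub>C f i"
  by (rule uprel_linear[OF bounded_linear_scaleC])
lift_definition cinner_upower :: "('a, 'b) upower \<Rightarrow> ('a, 'b) upower \<Rightarrow> complex"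
  is "\<lambda>f g. ulim (\<lambda>i. cinner (f i) (g i))"
  by (rule uprel_ulim)

instance ..

end

lemma uprel_pointwise:
  assumes "bdd f" "\<And>i. f i = g i"
  shows "uprel f g"
proof -
  have "f = g" using assms(2) by blast
  then show ?thesis using assms(1) by (simp add: uprel_refl)
qed

lemma cinner_upower_add: "cinner (x + y) z = cinner x z + cinner y (z :: ('i, 'a::chilbert_space) upower)"
proof transfer
  fix x y z :: "'i set \<Rightarrow> 'a"
  assume "uprel x x" "uprel y y" "uprel z z"
  then show "ulim (\<lambda>i. cinner (x i + y i) (z i)) = ulim (\<lambda>i. cinner (x i) (z i)) + ulim (\<lambda>i. cinner (y i) (z i))"
    by (intro ulimI) (simp add: cinner_add_left, intro tendsto_add tendsto_ulim bdd_cinner, auto simp: uprel_refl)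
qed

lemma cinner_upower_commute: "cinner x y = cnj (cinner y (x :: ('i, 'a::chilbert_space) upower))"
proof transfer
  fix x y :: "'i set \<Rightarrow> 'a"
  assume "uprel x x" "uprel y y"
  then have "((\<lambda>i. cnj (cinner (y i) (x i))) \<longlongrightarrow> cnj (ulim (\<lambda>i. cinner (y i) (x i)))) ultra"
    by (intro tendsto_cnj tendsto_ulim bdd_cinner) (auto simp: uprel_refl)
  then show "ulim (\<lambda>i. cinner (x i) (y i)) = cnj (ulim (\<lambda>i. cinner (y i) (x i)))"
    by (intro ulimI) (simp flip: cinner_commute)
qed

lemma cinner_upower_scale: "cinner x (c *\<^sub>C y) = c * cinner x (y :: ('i, 'a::chilbert_space) upower)"
proof transfer
  fix x y :: "'i set \<Rightarrow> 'a" and c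
  assume "uprel x x" "uprel y y"
  then have "((\<lambda>i. c * cinner (x i) (y i)) \<longlongrightarrow> c * ulim (\<lambda>i. cinner (x i) (y i))) ultra"
    by (intro tendsto_mult tendsto_const tendsto_ulim bdd_cinner) (auto simp: uprel_refl)
  then show "ulim (\<lambda>i. cinner (x i) (c *\<^sub>C y i)) = c * ulim (\<lambda>i. cinner (x i) (y i))"
    by (intro ulimI) (simp add: cinner_scaleC_right)
qed

lemma scaleR_upower_eq: "r *\<^sub>R x = complex_of_real r *\<^sub>C (x :: ('i, 'a::chilbert_space) upower)"
  by transfer (simp only: scaleR_scaleC[symmetric], rule uprel_pointwise, auto simp: uprel_refl)

instantiation upower :: (type, chilbert_space) real_inner
begin

definition inner_upower_def: "inner f g = Re (cinner f g)" for f g :: "('a, 'b) upower"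
definition norm_upower_def: "norm f = sqrt (inner f f)" for f :: "('a, 'b) upower"
definition dist_upower_def: "dist f g = norm (f - g)" for f g :: "('a, 'b) upower"
definition sgn_upower_def: "sgn f = f /\<^sub>R norm f" for f :: "('a, 'b) upower"
definition uniformity_upower_def:
  "(uniformity :: (('a, 'b) upower \<times> ('a, 'b) upower) filter) = (INF e\<in>{0<..}. principal {(x, y). dist x y < e})"
definition open_upower_def:
  "open U = (\<forall>x\<in>U. \<forall>\<^sub>F (x', y) in uniformity. x' = x \<longrightarrow> y \<in> U)" for U :: "('a, 'b) upower set"

lemma inner_upower_self_tendsto:
  fixes f :: "'a set \<Rightarrow> 'b"
  assumes "bdd f"
  shows "((\<lambda>i. (norm (f i))\<^sup>2) \<longlongrightarrow> Re (ulim (\<lambda>i. cinner (f i) (f i)))) ultra"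
  using tendsto_Re[OF tendsto_ulim[OF bdd_cinner[OF assms assms]]]
  by (simp add: cinner_self del: of_real_power)

instance
proof
  fix x y z :: "('a, 'b) upower" and a b :: real
  show "x + y + z = x + (y + z)" "x + y = y + x" "0 + x = x" "- x + x = 0" "x - y = x + - y"
    "a *\<^sub>R (x + y) = a *\<^sub>R x + a *\<^sub>R y" "(a + b) *\<^sub>R x = a *\<^sub>R x + b *\<^sub>R x"
    "a *\<^sub>R b *\<^sub>R x = (a * b) *\<^sub>R x" "1 *\<^sub>R x = x"
    by (transfer; auto simp: uprel_refl algebra_simps intro!: uprel_pointwise)+
  show "dist x y = norm (x - y)" by (rule dist_upower_def)
  show "sgn x = x /\<^sub>R norm x" by (rule sgn_upower_def)
  show "(uniformity :: (('a, 'b) upower \<times> ('a, 'b) upower) filter) = (INF e\<in>{0<..}. principal {(x, y). dist x y < e})"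
    by (rule uniformity_upower_def)
  show "open U = (\<forall>x\<in>U. \<forall>\<^sub>F (x', y) in uniformity. x' = x \<longrightarrow> y \<in> U)" for U :: "('a, 'b) upower set"
    by (rule open_upower_def)
  show *: "inner x y = inner y x" for x y :: "('a, 'b) upower"
    unfolding inner_upower_def by (subst cinner_upower_commute) simp
  show "inner (x + y) z = inner x z + inner y z"
    by (simp add: inner_upower_def cinner_upower_add)
  have "inner y (a *\<^sub>R x) = a * inner y x" for x y :: "('a, 'b) upower"
    by (simp add: inner_upower_def scaleR_upower_eq cinner_upower_scale)
  then show "inner (a *\<^sub>R x) y = a * inner x y"
    by (simp only: *[of _ y])
  show "0 \<le> inner x x"
    unfolding inner_upower_def
  proof transfer
    fix x :: "'a set \<Rightarrow> 'b" assume "uprel x x"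
    then show "0 \<le> Re (ulim (\<lambda>i. cinner (x i) (x i)))"
      by (intro tendsto_lowerbound[OF inner_upower_self_tendsto _ ultra_neq_bot]) (auto simp: uprel_refl)
  qed
  show "(inner x x = 0) = (x = 0)"
    unfolding inner_upower_def
  proof transfer
    fix x :: "'a set \<Rightarrow> 'b" assume "uprel x x"
    then have lim: "((\<lambda>i. (norm (x i))\<^sup>2) \<longlongrightarrow> Re (ulim (\<lambda>i. cinner (x i) (x i)))) ultra" and b: "bdd x"
      by (auto simp: uprel_refl inner_upower_self_tendsto)
    show "(Re (ulim (\<lambda>i. cinner (x i) (x i))) = 0) = uprel x (\<lambda>_. 0)"
    proof
      assume "Re (ulim (\<lambda>i. cinner (x i) (x i))) = 0"
      then have "((\<lambda>i. sqrt ((norm (x i))\<^sup>2)) \<longlongrightarrow> sqrt 0) ultra"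
        using lim by (intro tendsto_real_sqrt) simp
      then have "(x \<longlongrightarrow> 0) ultra" by (simp add: tendsto_norm_zero_iff)
      then show "uprel x (\<lambda>_. 0)" using b by (simp add: uprel_def)
    next
      assume "uprel x (\<lambda>_. 0)"
      then have "(x \<longlongrightarrow> 0) ultra" by (simp add: uprel_def)
      then have "((\<lambda>i. (norm (x i))\<^sup>2) \<longlongrightarrow> 0\<^sup>2) ultra"
        by (intro tendsto_power tendsto_norm_zero)
      then show "Re (ulim (\<lambda>i. cinner (x i) (x i))) = 0"
        using tendsto_unique[OF ultra_neq_bot lim] by simp
    qed
  qed
  show "norm x = sqrt (inner x x)" by (rule norm_upower_def)
qed

end

text \<open>Unbounded families are sent to 0 so that taking classes is total.\<close>

lift_definition ucls :: "('i set \<Rightarrow> 'a::chilbert_space) \<Rightarrow> ('i, 'a) upower" is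
  "\<lambda>f. if bdd f then f else (\<lambda>_. 0)"
  by (simp add: uprel_refl)

lemma ucls_eq_iff: "bdd f \<Longrightarrow> bdd g \<Longrightarrow> ucls f = ucls g \<longleftrightarrow> ((\<lambda>i. f i - g i) \<longlongrightarrow> 0) ultra"
  by transfer (simp add: uprel_def)

lemma ucls_exhaust:
  fixes x :: "('i, 'a::chilbert_space) upower"
  obtains f where "x = ucls f" "bdd f"
proof -
  have "\<exists>f. x = ucls f \<and> bdd f"
  proof (induct x rule: upower.abs_induct)
    fix f :: "'i set \<Rightarrow> 'a" assume "uprel f f"
    then show "\<exists>g. abs_upower f = ucls g \<and> bdd g"
      by (intro exI[of _ f]) (simp add: ucls_def uprel_refl)
  qed
  then show ?thesis using that by blast
qed

lemma ucls_add: "bdd f \<Longrightarrow> bdd g \<Longrightarrow> ucls f + ucls g = ucls (\<lambda>i. f i + g i)"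
  by transfer (simp add: uprel_refl)

lemma ucls_diff: "bdd f \<Longrightarrow> bdd g \<Longrightarrow> ucls f - ucls g = ucls (\<lambda>i. f i - g i)"
  by transfer (simp add: uprel_refl)

lemma ucls_scaleR: "bdd f \<Longrightarrow> r *\<^sub>R ucls f = ucls (\<lambda>i. r *\<^sub>R f i)"
  by transfer (simp add: uprel_refl)

lemma ucls_scaleC: "bdd f \<Longrightarrow> c *\<^sub>C ucls f = ucls (\<lambda>i. c *\<^sub>C f i)"
  by transfer (simp add: uprel_refl)

lemma ucls_cinner_tendsto:
  fixes f g :: "'i set \<Rightarrow> 'a::chilbert_space"
  assumes "bdd f" "bdd g"
  shows "((\<lambda>i. cinner (f i) (g i)) \<longlongrightarrow> cinner (ucls f) (ucls g)) ultra"
proof -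
  have "cinner (ucls f) (ucls g) = ulim (\<lambda>i. cinner (f i) (g i))"
    using assms by transfer simp
  then show ?thesis using tendsto_ulim[OF bdd_cinner[OF assms]] by simp
qed

lemma ucls_norm_tendsto:
  fixes f :: "'i set \<Rightarrow> 'a::chilbert_space"
  assumes "bdd f"
  shows "((\<lambda>i. norm (f i)) \<longlongrightarrow> norm (ucls f)) ultra"
proof -
  have "((\<lambda>i. sqrt (Re (cinner (f i) (f i)))) \<longlongrightarrow> sqrt (Re (cinner (ucls f) (ucls f)))) ultra"
    by (intro tendsto_real_sqrt tendsto_Re ucls_cinner_tendsto assms)
  then show ?thesis
    by (simp add: norm_upower_def inner_upower_def cinner_self del: of_real_power)
qed

lemma ucls_norm_le:
  fixes f :: "'i set \<Rightarrow> 'a::chilbert_space"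
  assumes "\<And>i. norm (f i) \<le> K"
  shows "norm (ucls f) \<le> K"
proof (rule tendsto_upperbound[OF ucls_norm_tendsto _ ultra_neq_bot])
  show "bdd f" by (rule bddI[OF assms])
qed (simp add: assms)

instance upower :: (type, chilbert_space) banach
proof
  fix X :: "nat \<Rightarrow> ('a, 'b) upower"
  assume X: "Cauchy X"
  have "\<forall>k. \<exists>N. \<forall>m\<ge>N. \<forall>n\<ge>N. norm (X m - X n) < (1/2) ^ k"
    using CauchyD[OF X] by simp
  then obtain N where N: "\<And>k m n. m \<ge> N k \<Longrightarrow> n \<ge> N k \<Longrightarrow> norm (X m - X n) < (1/2) ^ k"
    by metis
  \<comment> \<open>Partial sums of \<open>N\<close> give indices for which both \<open>r k\<close>
    and \<open>r (Suc k)\<close> are at least \<open>N k\<close>.\<close>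
  define r where "r k = sum N {..k}" for k
  have r: "N k \<le> r k" "N k \<le> r (Suc k)" for k
    unfolding r_def by (rule member_le_sum; simp)+
  have "\<forall>k. \<exists>f. X (r (Suc k)) - X (r k) = ucls f \<and> bdd f"
    using ucls_exhaust by metis
  then obtain f where f: "\<And>k. X (r (Suc k)) - X (r k) = ucls (f k)" "\<And>k. bdd (f k)"
    by metis
  obtain f0 where f0: "X (r 0) = ucls f0" "bdd f0"
    using ucls_exhaust by blast
  \<comment> \<open>Truncation does not change the class, since the bound holds eventually along the
    ultrafilter. The truncated differences are small at every index, so their series converges
    uniformly in the index.\<close>
  define d where "d k i = (if norm (f k i) \<le> (1/2) ^ k then f k i else 0)" for k i
  have d: "norm (d k i) \<le> (1/2) ^ k" for k i by (simp add: d_def)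
  have bd: "bdd (d k)" for k by (rule bddI[OF d])
  have fd: "ucls (f k) = ucls (d k)" for k
  proof -
    have "norm (ucls (f k)) < (1/2) ^ k" using N[OF r(2,1), of k] by (simp add: f(1))
    then have "eventually (\<lambda>i. norm (f k i) < (1/2) ^ k) ultra"
      by (rule order_tendstoD(2)[OF ucls_norm_tendsto[OF f(2)]])
    then have "eventually (\<lambda>i. f k i - d k i = 0) ultra"
      by (rule eventually_mono) (simp add: d_def)
    then have "((\<lambda>i. f k i - d k i) \<longlongrightarrow> 0) ultra" by (rule tendsto_eventually)
    then show ?thesis using ucls_eq_iff[OF f(2) bd] by simp
  qed
  define p where "p m i = f0 i + (\<Sum>k<m. d k i)" for m i
  have bp: "bdd (p m)" for m
    unfolding p_def by (induction m) (use f0 bd in \<open>auto simp: add.assoc[symmetric]\<close>)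
  have Xp: "X (r m) = ucls (p m)" for m
  proof (induction m)
    case 0
    then show ?case by (simp add: f0 p_def)
  next
    case (Suc m)
    have "X (r (Suc m)) = ucls (p m) + ucls (d m)"
      using f(1)[of m] Suc by (simp add: fd algebra_simps)
    also have "\<dots> = ucls (\<lambda>i. p m i + d m i)" by (rule ucls_add[OF bp bd])
    finally show ?case by (simp add: p_def[abs_def] add.assoc)
  qed
  have geo: "summable (\<lambda>k. (1/2 :: real) ^ (k + m))" for m
    using summable_mult2[OF summable_geometric[of "1/2 :: real"]] by (simp add: power_add)
  have sd: "summable (\<lambda>k. d (k + m) i)" for i m
    by (rule summable_norm_cancel, rule summable_comparison_test'[OF geo[of m], of 0]) (simp add: d)
  define g where "g i = f0 i + (\<Sum>k. d k i)" for i
  have gp: "norm (g i - p m i) \<le> 2 * (1/2) ^ m" for i m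
  proof -
    have "g i - p m i = (\<Sum>k. d (k + m) i)"
      using suminf_split_initial_segment[OF sd[of 0 i, simplified], of m] by (simp add: g_def p_def)
    also have "norm \<dots> \<le> (\<Sum>k. (1/2 :: real) ^ (k + m))"
      by (rule norm_suminf_le[OF d geo])
    also have "\<dots> = 2 * (1/2) ^ m"
      by (simp add: power_add suminf_mult2[symmetric] suminf_geometric)
    finally show ?thesis .
  qed
  have bg: "bdd g"
  proof -
    have "bdd (\<lambda>i. g i - p 0 i)" by (rule bddI[OF gp])
    from bdd_add[OF this bp[of 0]] show ?thesis by simp
  qed
  have lim: "norm (X (r m) - ucls g) \<le> 2 * (1/2) ^ m" for m
    unfolding Xp ucls_diff[OF bp bg]
    by (rule ucls_norm_le) (use gp in \<open>simp add: norm_minus_commute\<close>)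
  have "X \<longlonglongrightarrow> ucls g"
  proof (rule LIMSEQ_I)
    fix e :: real assume "e > 0"
    then obtain k where k: "(1/2 :: real) ^ k < e / 3"
      using real_arch_pow_inv[of "e / 3" "1/2"] by auto
    have "norm (X n - ucls g) < e" if "n \<ge> N k" for n
    proof -
      have "norm (X n - ucls g) \<le> norm (X n - X (r k)) + norm (X (r k) - ucls g)"
        using norm_triangle_ineq[of "X n - X (r k)" "X (r k) - ucls g"] by simp
      also have "\<dots> < (1/2) ^ k + 2 * (1/2) ^ k"
        using N[OF that r(1)] lim[of k] by linarith
      finally show ?thesis using k by linarith
    qed
    then show "\<exists>no. \<forall>n\<ge>no. norm (X n - ucls g) < e" by blast
  qed
  then show "convergent X" unfolding convergent_def by blast
qed

instance upower :: (type, chilbert_space) chilbert_space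
proof
  fix x y z :: "('a, 'b) upower" and c d :: complex and r :: real
  obtain f g where fg: "x = ucls f" "bdd f" "y = ucls g" "bdd g"
    using ucls_exhaust[of x] ucls_exhaust[of y] by metis
  show "c *\<^sub>C (x + y) = c *\<^sub>C x + c *\<^sub>C y" "(c + d) *\<^sub>C x = c *\<^sub>C x + d *\<^sub>C x"
    "c *\<^sub>C d *\<^sub>C x = (c * d) *\<^sub>C x"
    by (simp_all add: fg ucls_add ucls_scaleC scaleC_add_right scaleC_add_left scaleC_scaleC)
  show "cinner x (y + z) = cinner x y + cinner x z"
    by (simp only: cinner_upower_commute[of x] cinner_upower_add complex_cnj_add)
qed (rule scaleR_upower_eq cinner_upower_scale cinner_upower_commute inner_upower_def)+

section \<open>Operators on the ultrapower\<close>

lift_definition umap_fun :: "('a::chilbert_space \<Rightarrow>\<^sub>L 'b::chilbert_space) \<Rightarrow> ('i, 'a) upower \<Rightarrow> ('i, 'b) upower"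
  is "\<lambda>T f i. T (f i)"
  by (rule uprel_linear)

lemma umap_fun_ucls: "bdd f \<Longrightarrow> umap_fun T (ucls f) = ucls (\<lambda>i. T (f i))"
  by transfer (simp add: uprel_refl bdd_linear)

lemma bdd_blinfun [simp]: "bdd f \<Longrightarrow> bdd (\<lambda>i. blinfun_apply T (f i))"
  by (rule bdd_linear[OF blinfun.bounded_linear_right])

lemma norm_umap_fun:
  fixes T :: "'a::chilbert_space \<Rightarrow>\<^sub>L 'b::chilbert_space" and x :: "('i, 'a) upower"
  shows "norm (umap_fun T x) \<le> norm T * norm x"
proof -
  obtain f where f: "x = ucls f" "bdd f" by (rule ucls_exhaust)
  have "norm (ucls (\<lambda>i. T (f i))) \<le> norm T * norm (ucls f)"
    by (rule tendsto_le[OF ultra_neq_bot tendsto_mult[OF tendsto_const ucls_norm_tendsto] ucls_norm_tendsto])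
      (simp_all add: f norm_blinfun)
  then show ?thesis by (simp add: f umap_fun_ucls)
qed

definition umap :: "('a::chilbert_space \<Rightarrow>\<^sub>L 'b::chilbert_space) \<Rightarrow> ('i, 'a) upower \<Rightarrow>\<^sub>L ('i, 'b) upower" where
  "umap T = Blinfun (umap_fun T)"

lemma umap_apply:
  fixes T :: "'a::chilbert_space \<Rightarrow>\<^sub>L 'b::chilbert_space" and x :: "('i, 'a) upower"
  shows "umap T x = umap_fun T x"
proof -
  have "bounded_linear (umap_fun T :: ('i, 'a) upower \<Rightarrow> ('i, 'b) upower)"
  proof (rule bounded_linear_intro[where K = "norm T"])
    fix x y :: "('i, 'a) upower" and r
    obtain f g where "x = ucls f" "bdd f" "y = ucls g" "bdd g"
      using ucls_exhaust[of x] ucls_exhaust[of y] by metis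
    then show "umap_fun T (x + y) = umap_fun T x + umap_fun T y"
      "umap_fun T (r *\<^sub>R x) = r *\<^sub>R umap_fun T x"
      by (simp_all add: ucls_add ucls_scaleR umap_fun_ucls blinfun.add_right blinfun.scaleR_right)
    show "norm (umap_fun T x) \<le> norm x * norm T" using norm_umap_fun[of T x] by (simp add: mult.commute)
  qed
  then show ?thesis by (simp add: umap_def bounded_linear_Blinfun_apply)
qed

lemma umap_ucls: "bdd f \<Longrightarrow> umap T (ucls f) = ucls (\<lambda>i. T (f i))"
  by (simp add: umap_apply umap_fun_ucls)

lemma norm_umap: "norm (umap T) \<le> norm T"
  by (rule norm_blinfun_bound) (simp_all add: umap_apply norm_umap_fun)

lemma upower_op_eqI:
  fixes S T :: "('i, 'a::chilbert_space) upower \<Rightarrow>\<^sub>L 'b::real_normed_vector"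
  assumes "\<And>f. bdd f \<Longrightarrow> S (ucls f) = T (ucls f)"
  shows "S = T"
proof (rule blinfun_eqI)
  fix x :: "('i, 'a) upower"
  obtain f where "x = ucls f" "bdd f" by (rule ucls_exhaust)
  then show "S x = T x" using assms by simp
qed

lemma bop_umap [simp, intro]:
  fixes T :: "'a::chilbert_space \<Rightarrow>\<^sub>L 'b::chilbert_space"
  assumes "T \<in> bop"
  shows "(umap T :: ('i, 'a) upower \<Rightarrow>\<^sub>L ('i, 'b) upower) \<in> bop"
proof (rule bopI)
  fix c and x :: "('i, 'a) upower"
  obtain f where "x = ucls f" "bdd f" by (rule ucls_exhaust)
  then show "umap T (c *\<^sub>C x) = c *\<^sub>C umap T x"
    using assms by (simp add: ucls_scaleC umap_ucls bop_scaleC)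
qed

lemma umap_compose: "umap (S o\<^sub>L T) = umap S o\<^sub>L umap T"
  by (rule upower_op_eqI) (simp add: umap_ucls)

lemma umap_id [simp]: "umap id_blinfun = id_blinfun"
  by (rule upower_op_eqI) (simp add: umap_ucls)

lemma umap_op_scale: "umap (op_scale c T) = op_scale c (umap T)"
  by (rule upower_op_eqI) (simp add: umap_ucls op_scale_apply ucls_scaleC)

lemma bounded_linear_umap: "bounded_linear umap"
proof (rule bounded_linear_intro[where K = 1])
  show "norm (umap T) \<le> norm T * 1" for T using norm_umap by simp
qed (auto intro!: upower_op_eqI simp: umap_ucls blinfun.add_left blinfun.scaleR_left ucls_add ucls_scaleR)

lemma adj_umap:
  fixes T :: "'a::chilbert_space \<Rightarrow>\<^sub>L 'b::chilbert_space"
  assumes "T \<in> bop"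
  shows "adj (umap T :: ('i, 'a) upower \<Rightarrow>\<^sub>L ('i, 'b) upower) = umap (adj T)"
proof (rule adj_eqI)
  fix x :: "('i, 'a) upower" and y :: "('i, 'b) upower"
  obtain f g where fg: "x = ucls f" "bdd f" "y = ucls g" "bdd g"
    using ucls_exhaust[of x] ucls_exhaust[of y] by metis
  have "((\<lambda>i. cinner (adj T (g i)) (f i)) \<longlongrightarrow> cinner (ucls (\<lambda>i. adj T (g i))) (ucls f)) ultra"
    "((\<lambda>i. cinner (g i) (T (f i))) \<longlongrightarrow> cinner (ucls g) (ucls (\<lambda>i. T (f i)))) ultra"
    by (intro ucls_cinner_tendsto bdd_blinfun fg)+
  then have "cinner (ucls (\<lambda>i. adj T (g i))) (ucls f) = cinner (ucls g) (ucls (\<lambda>i. T (f i)))"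
    unfolding cinner_adj_left[OF assms] by (rule tendsto_unique[OF ultra_neq_bot])
  then show "cinner (umap (adj T) y) x = cinner y (umap T x)"
    by (simp add: fg umap_ucls)
qed

section \<open>Amplification of the second leg\<close>

text \<open>A vector tensored with the class of a family goes to the class of the tensored family.
  The range can be proper, as a bounded family may escape to infinity in the first leg; tightness
  rules this out.\<close>

lemma iota_ex: "\<exists>R :: 'g::chilbert_space \<otimes>\<^sub>H ('i, 'a::chilbert_space) upower \<Rightarrow>\<^sub>L ('i, 'g \<otimes>\<^sub>H 'a) upower.
    R \<in> bop \<and> (\<forall>g k. R (g \<otimes>\<^sub>v k) = umap (ketL g) k) \<and> (\<forall>\<xi> \<eta>. cinner (R \<xi>) (R \<eta>) = cinner \<xi> \<eta>)"
proof (rule tensor_isometry)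
  fix g g' :: 'g and k k' :: "('i, 'a) upower" and c
  obtain f where "k = ucls f" "bdd f" by (rule ucls_exhaust)
  then show "umap (ketL (c *\<^sub>C g)) k = c *\<^sub>C umap (ketL g) k"
    by (simp add: umap_ucls ucls_scaleC tensor_scaleC_left bdd_linear[OF bounded_linear_tensor_right])
  have "adj (ketL g) o\<^sub>L ketL g' = op_scale (cinner g g') (id_blinfun :: 'a \<Rightarrow>\<^sub>L 'a)"
    by (rule blinfun_eqI) (simp add: op_scale_apply)
  then have "umap (adj (ketL g)) o\<^sub>L umap (ketL g') = op_scale (cinner g g') (id_blinfun :: ('i, 'a) upower \<Rightarrow>\<^sub>L ('i, 'a) upower)"
    by (simp add: umap_compose[symmetric] umap_op_scale)
  then have "(umap (adj (ketL g)) o\<^sub>L umap (ketL g')) k' = cinner g g' *\<^sub>C k'"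
    by (simp add: op_scale_apply)
  then show "cinner (umap (ketL g) k) (umap (ketL g') k') = cinner g g' * cinner k k'"
    by (simp add: cinner_adj_right[symmetric] adj_umap cinner_scaleC_right)
qed

definition iota :: "'g::chilbert_space \<otimes>\<^sub>H ('i, 'a::chilbert_space) upower \<Rightarrow>\<^sub>L ('i, 'g \<otimes>\<^sub>H 'a) upower" where
  "iota = (SOME R. R \<in> bop \<and> (\<forall>g k. R (g \<otimes>\<^sub>v k) = umap (ketL g) k) \<and>
     (\<forall>\<xi> \<eta>. cinner (R \<xi>) (R \<eta>) = cinner \<xi> \<eta>))"

lemma iota_props:
  fixes g :: "'g::chilbert_space" and k :: "('i, 'a::chilbert_space) upower" and \<xi> \<eta> :: "'g \<otimes>\<^sub>H ('i, 'a) upower"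
  shows bop_iota [simp, intro]: "(iota :: 'g \<otimes>\<^sub>H ('i, 'a) upower \<Rightarrow>\<^sub>L ('i, 'g \<otimes>\<^sub>H 'a) upower) \<in> bop"
    and iota_apply [simp]: "iota (g \<otimes>\<^sub>v k) = umap (ketL g) k"
    and cinner_iota: "cinner (iota \<xi>) (iota \<eta>) = cinner \<xi> \<eta>"
  using someI_ex[OF iota_ex[where ?'g = 'g and ?'i = 'i and ?'a = 'a]] unfolding iota_def[symmetric] by auto

lemma adj_iota_iota [simp]: "adj iota (iota \<xi>) = \<xi>"
  by (rule cinner_eqI_left) (simp add: cinner_adj_left cinner_iota)

lemma norm_iota: "norm (iota \<xi>) = norm \<xi>"
  by (simp add: norm_eq_sqrt_inner inner_eq_Re_cinner cinner_iota)

text \<open>\<open>amp T\<close> is \<open>(id \<otimes> \<pi>)(T)\<close> for the representation \<open>\<pi>\<close> of the bounded operators on the ultrapower.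
  It is multiplicative only under a tightness condition on the first leg.\<close>

definition amp :: "('g::chilbert_space \<otimes>\<^sub>H 'a::chilbert_space \<Rightarrow>\<^sub>L 'g \<otimes>\<^sub>H 'a)
    \<Rightarrow> ('g \<otimes>\<^sub>H ('i, 'a) upower \<Rightarrow>\<^sub>L 'g \<otimes>\<^sub>H ('i, 'a) upower)" where
  "amp T = adj iota o\<^sub>L umap T o\<^sub>L iota"

lemma bop_amp [simp, intro]: "T \<in> bop \<Longrightarrow> amp T \<in> bop"
  by (simp add: amp_def)

lemma adj_amp: "T \<in> bop \<Longrightarrow> adj (amp T) = amp (adj T)"
  by (simp add: amp_def adj_compose adj_umap compose_assoc)

lemma cinner_amp:
  assumes "T \<in> bop"
  shows "cinner (u \<otimes>\<^sub>v k) (amp T (v \<otimes>\<^sub>v k')) = cinner k (umap (coef2 u v T) k')"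
proof -
  have "cinner (u \<otimes>\<^sub>v k) (amp T (v \<otimes>\<^sub>v k')) = cinner (umap (ketL u) k) (umap T (umap (ketL v) k'))"
    by (simp add: amp_def cinner_adj_right)
  also have "\<dots> = cinner k (umap (adj (ketL u)) (umap T (umap (ketL v) k')))"
    by (subst cinner_adj_right[symmetric]) (simp_all add: adj_umap)
  finally show ?thesis
    by (simp add: coef2_eq[OF assms] umap_compose)
qed

text \<open>Coefficients in the first leg see the representation \<open>umap\<close> of the second
  leg alone, so identities whose amplified leg is a product of coefficients carry over.\<close>

lemma coef2_amp: "T \<in> bop \<Longrightarrow> coef2 u v (amp T) = umap (coef2 u v T)"
  by (rule bop_eqI) (simp add: cinner_coef2 cinner_amp)

lemma norm_amp:
  fixes T :: "'a::chilbert_space \<otimes>\<^sub>H 'b::chilbert_space \<Rightarrow>\<^sub>L 'a \<otimes>\<^sub>H 'b" and \<xi> :: "'a \<otimes>\<^sub>H ('c, 'b) upower"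
  assumes "T \<in> bop"
  shows "norm (amp T \<xi>) \<le> norm T * norm \<xi>"
proof -
  have "norm (adj iota x) \<le> norm x" for x :: "('c, 'a \<otimes>\<^sub>H 'b) upower"
  proof -
    have "norm (adj iota x :: 'a \<otimes>\<^sub>H ('c, 'b) upower) \<le> norm (adj (iota :: 'a \<otimes>\<^sub>H ('c, 'b) upower \<Rightarrow>\<^sub>L _)) * norm x"
      by (rule norm_blinfun)
    also have "norm (adj (iota :: 'a \<otimes>\<^sub>H ('c, 'b) upower \<Rightarrow>\<^sub>L _)) = norm (iota :: 'a \<otimes>\<^sub>H ('c, 'b) upower \<Rightarrow>\<^sub>L _)"
      by (simp add: norm_adj)
    also have "\<dots> * norm x \<le> 1 * norm x"
      by (intro mult_right_mono norm_blinfun_bound) (simp_all add: norm_iota)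
    finally show ?thesis by simp
  qed
  then have "norm (amp T \<xi>) \<le> norm (umap T (iota \<xi>))" by (simp add: amp_def)
  also have "\<dots> \<le> norm T * norm (iota \<xi>)" by (simp add: umap_apply norm_umap_fun)
  finally show ?thesis by (simp add: norm_iota)
qed

lemma amp_op_tensor_id:
  fixes b :: "'g::chilbert_space \<Rightarrow>\<^sub>L 'g"
  assumes "b \<in> bop"
  shows "amp (b \<otimes>\<^sub>o (id_blinfun :: 'b::chilbert_space \<Rightarrow>\<^sub>L 'b))
    = b \<otimes>\<^sub>o (id_blinfun :: ('i, 'b) upower \<Rightarrow>\<^sub>L ('i, 'b) upower)"
proof (rule tensor_op_cinner_eqI)
  fix u v and k k' :: "('i, 'b) upower"
  have "coef2 u v (b \<otimes>\<^sub>o (id_blinfun :: 'b \<Rightarrow>\<^sub>L 'b)) = op_scale (cinner u (b v)) id_blinfun"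
    by (rule bop_eqI) (simp add: cinner_coef2 assms cinner_tensor op_scale_apply cinner_scaleC_right)
  then show "cinner (u \<otimes>\<^sub>v k) (amp (b \<otimes>\<^sub>o (id_blinfun :: 'b \<Rightarrow>\<^sub>L 'b)) (v \<otimes>\<^sub>v k'))
      = cinner (u \<otimes>\<^sub>v k) ((b \<otimes>\<^sub>o id_blinfun) (v \<otimes>\<^sub>v k'))"
    by (simp add: cinner_amp assms umap_op_scale op_scale_apply cinner_scaleC_right cinner_tensor)
qed

text \<open>Between the two factors stands the projection \<open>iota o\<^sub>L adj iota\<close>.
  Tight columns of \<open>T\<close> have values in the range of \<open>iota\<close>, where this
  projection is the identity.\<close>

lemma amp_compose:
  fixes S T :: "'g::chilbert_space \<otimes>\<^sub>H 'a::chilbert_space \<Rightarrow>\<^sub>L 'g \<otimes>\<^sub>H 'a"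
  assumes T: "\<And>g. T o\<^sub>L ketL g \<in> tight B"
  shows "amp (S o\<^sub>L T) = (amp S o\<^sub>L amp T :: 'g \<otimes>\<^sub>H ('i, 'a) upower \<Rightarrow>\<^sub>L _)"
proof (rule tensor_op_eqI)
  fix g and k :: "('i, 'a) upower"
  define M where "M = {y :: ('i, 'g \<otimes>\<^sub>H 'a) upower. iota (adj iota y) = y}"
  have M: "subspace M" "closed M"
  proof -
    show "subspace M" by (auto simp: M_def subspace_def blinfun.add_right blinfun.scaleR_right)
    show "closed M" unfolding M_def by (intro closed_Collect_eq continuous_intros)
  qed
  have "umap (T o\<^sub>L ketL g) k \<in> M"
  proof (rule tight_image[OF T, of "\<lambda>x. umap x k"])
    show "bounded_linear (\<lambda>x. umap x k :: ('i, 'g \<otimes>\<^sub>H 'a) upower)"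
      by (rule bounded_linear_compose[OF bounded_linear_apply bounded_linear_umap])
    fix h :: 'g and b :: "'a \<Rightarrow>\<^sub>L 'a"
    have "umap (ketL h o\<^sub>L b) k = iota (h \<otimes>\<^sub>v umap b k)" by (simp add: umap_compose)
    then show "umap (ketL h o\<^sub>L b) k \<in> M" by (simp add: M_def del: iota_apply)
  qed (use M in auto)
  then have "iota (adj iota (umap T (umap (ketL g) k))) = umap T (umap (ketL g) k)"
    by (simp add: M_def umap_compose)
  then show "amp (S o\<^sub>L T) (g \<otimes>\<^sub>v k) = (amp S o\<^sub>L amp T) (g \<otimes>\<^sub>v k)"
    by (simp add: amp_def umap_compose)
qed

section \<open>Tightness\<close>

definition proj1 :: "'a::chilbert_space set \<Rightarrow> 'a \<otimes>\<^sub>H 'b::chilbert_space \<Rightarrow>\<^sub>L 'a \<otimes>\<^sub>H 'b" where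
  "proj1 F = (\<Sum>e\<in>F. ketL e o\<^sub>L adj (ketL e))"

lemma proj1_apply: "proj1 F \<tau> = (\<Sum>e\<in>F. e \<otimes>\<^sub>v adj (ketL e) \<tau>)"
  unfolding proj1_def by (simp add: blinfun.sum_left)

lemma proj1_tensor:
  assumes "finite F"
  shows "proj1 F (x \<otimes>\<^sub>v y) = (\<Sum>e\<in>F. cinner e x *\<^sub>C e) \<otimes>\<^sub>v y"
  unfolding proj1_apply
  by (simp add: tensor_scaleC_right tensor_scaleC_left
      linear_sum[OF bounded_linear.linear[OF bounded_linear_tensor_left[of y]]])

lemma cinner_tensor_adj: "cinner (x \<otimes>\<^sub>v y) \<tau> = cinner y (adj (ketL x) \<tau>)"
  by (simp add: cinner_adj_right)

definition orthonormal :: "'a::chilbert_space set \<Rightarrow> bool" where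
  "orthonormal F \<longleftrightarrow> finite F \<and> (\<forall>e\<in>F. \<forall>f\<in>F. cinner e f = (if e = f then 1 else 0))"

lemma orthonormal_onb: "finite F \<Longrightarrow> F \<subseteq> onb \<Longrightarrow> orthonormal F"
  by (auto simp: orthonormal_def cinner_onb subset_iff)

lemma orthonormal_finite: "orthonormal F \<Longrightarrow> finite F"
  by (simp add: orthonormal_def)

lemma norm_diff_proj1:
  assumes F: "orthonormal F"
  shows "(norm (\<tau> - proj1 F \<tau>))\<^sup>2 = (norm \<tau>)\<^sup>2 - (\<Sum>e\<in>F. (norm (adj (ketL e) \<tau>))\<^sup>2)"
proof -
  let ?p = "proj1 F \<tau>" and ?s = "\<Sum>e\<in>F. (norm (adj (ketL e) \<tau>))\<^sup>2"
  have 1: "cinner ?p \<tau> = complex_of_real ?s"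
    unfolding proj1_apply cinner_sum_left
    by (simp add: cinner_tensor_adj cinner_self)
  have 2: "cinner ?p ?p = complex_of_real ?s"
  proof -
    have "adj (ketL e) ?p = adj (ketL e) \<tau>" if "e \<in> F" for e
    proof -
      have "adj (ketL e) ?p = (\<Sum>f\<in>F. if e = f then adj (ketL f) \<tau> else 0)"
        unfolding proj1_apply blinfun.sum_right using F that
        by (intro sum.cong refl) (simp add: orthonormal_def)
      then show ?thesis using orthonormal_finite[OF F] that by simp
    qed
    then have "cinner ?p ?p = (\<Sum>e\<in>F. cinner (adj (ketL e) \<tau>) (adj (ketL e) \<tau>))"
      by (subst (1) proj1_apply) (simp add: cinner_sum_left cinner_tensor_adj)
    then show ?thesis by (simp add: cinner_self)
  qed
  have "inner ?p \<tau> = ?s" "inner ?p ?p = ?s" by (simp_all add: inner_eq_Re_cinner 1 2)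
  then show ?thesis
    by (simp add: power2_norm_eq_inner inner_diff_left inner_diff_right inner_commute[of \<tau> ?p])
qed

lemma norm_diff_proj1_le:
  assumes "orthonormal F"
  shows "norm (\<tau> - proj1 F \<tau>) \<le> norm \<tau>"
proof (rule power2_le_imp_le)
  show "(norm (\<tau> - proj1 F \<tau>))\<^sup>2 \<le> (norm \<tau>)\<^sup>2"
    unfolding norm_diff_proj1[OF assms] by (simp add: sum_nonneg)
qed simp

text \<open>Convergence on generators passes to the closed span because the maps are eventually
  contractions with a bound uniform in the argument.\<close>

lemma tendsto_zero_closed_span:
  fixes L :: "'i \<Rightarrow> 'x::real_normed_vector \<Rightarrow> 'y::real_normed_vector"
  assumes L: "\<And>i. bounded_linear (L i)" "\<forall>\<^sub>F i in F. \<forall>x. norm (L i x) \<le> norm x"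
    and S: "\<And>s. s \<in> S \<Longrightarrow> ((\<lambda>i. L i s) \<longlongrightarrow> 0) F" and x: "x \<in> closed_span S"
  shows "((\<lambda>i. L i x) \<longlongrightarrow> 0) F"
proof -
  define M where "M = {x. ((\<lambda>i. L i x) \<longlongrightarrow> 0) F}"
  have "subspace M"
    unfolding M_def subspace_def
    by (auto simp: linear_simps[OF L(1)] intro!: tendsto_add_zero tendsto_eq_intros)
  moreover have "closed M"
    unfolding closed_sequential_limits
  proof (intro allI impI)
    fix x l assume *: "(\<forall>n. x n \<in> M) \<and> x \<longlonglongrightarrow> l"
    have "((\<lambda>i. L i l) \<longlongrightarrow> 0) F"
      unfolding tendsto_iff
    proof (intro allI impI)
      fix e :: real assume "e > 0"
      then obtain n where n: "norm (x n - l) < e / 2"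
        using * LIMSEQ_D[of x l "e / 2"] by auto
      have "\<forall>\<^sub>F i in F. dist (L i (x n)) 0 < e / 2"
        using * tendstoD[of "\<lambda>i. L i (x n)" 0 F "e / 2"] \<open>e > 0\<close> unfolding M_def by simp
      with L(2) show "\<forall>\<^sub>F i in F. dist (L i l) 0 < e"
      proof eventually_elim
        case (elim i)
        have "norm (L i l) = norm (L i (x n) - L i (x n - l))"
          by (simp add: linear_simps[OF L(1)])
        also have "\<dots> \<le> norm (L i (x n)) + norm (x n - l)"
          using norm_triangle_ineq4[of "L i (x n)" "L i (x n - l)"] elim(1)[rule_format, of "x n - l"] by linarith
        finally show ?case using elim n by simp
      qed
    qed
    then show "l \<in> M" by (simp add: M_def)
  qed
  moreover have "S \<subseteq> M" using S by (auto simp: M_def)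
  ultimately show ?thesis using closed_span_minimal[of S M] x by (auto simp: M_def)
qed

lemma eventually_orthonormal_onb: "\<forall>\<^sub>F F in finite_subsets_at_top onb. orthonormal F"
  by (rule eventually_finite_subsets_at_top_weakI) (rule orthonormal_onb)

lemma tendsto_onb_sum: "((\<lambda>F. x - (\<Sum>e\<in>F. cinner e x *\<^sub>C e)) \<longlongrightarrow> 0) (finite_subsets_at_top onb)"
proof -
  have "((\<lambda>F. x - (\<Sum>e\<in>F. cinner e x *\<^sub>C e)) \<longlongrightarrow> x - x) (finite_subsets_at_top onb)"
    using onb_expansion[of x] unfolding has_sum_def by (intro tendsto_diff tendsto_const)
  then show ?thesis by simp
qed

lemma tendsto_proj1: "((\<lambda>F. \<tau> - proj1 F \<tau>) \<longlongrightarrow> 0) (finite_subsets_at_top onb)"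
proof (rule tendsto_zero_closed_span[of "\<lambda>F \<tau>. \<tau> - proj1 F \<tau>"])
  show "bounded_linear (\<lambda>\<tau>. \<tau> - proj1 F \<tau>)" for F :: "'a set"
    by (intro bounded_linear_sub bounded_linear_ident blinfun.bounded_linear_right)
  show "\<forall>\<^sub>F F in finite_subsets_at_top onb. \<forall>\<tau> :: 'a \<otimes>\<^sub>H 'b. norm (\<tau> - proj1 F \<tau>) \<le> norm \<tau>"
    using eventually_orthonormal_onb by eventually_elim (simp add: norm_diff_proj1_le)
  show "\<tau> \<in> closed_span simple_tensors" by simp
  fix s :: "'a \<otimes>\<^sub>H 'b" assume "s \<in> simple_tensors"
  then obtain x y where s: "s = x \<otimes>\<^sub>v y" by (rule simple_tensorsE)
  have "((\<lambda>F. (x - (\<Sum>e\<in>F. cinner e x *\<^sub>C e)) \<otimes>\<^sub>v y) \<longlongrightarrow> 0 \<otimes>\<^sub>v y) (finite_subsets_at_top onb)"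
    by (rule bounded_linear.tendsto[OF bounded_linear_tensor_left tendsto_onb_sum])
  moreover have "\<forall>\<^sub>F F in finite_subsets_at_top onb.
      (x - (\<Sum>e\<in>F. cinner e x *\<^sub>C e)) \<otimes>\<^sub>v y = s - proj1 F s"
    by (rule eventually_finite_subsets_at_top_weakI)
      (simp add: s proj1_tensor linear_simps[OF bounded_linear_tensor_left])
  ultimately show "((\<lambda>F. s - proj1 F s) \<longlongrightarrow> 0) (finite_subsets_at_top onb)"
    by (simp add: tendsto_cong)
qed

lemma norm_unitary: "unitary U \<Longrightarrow> norm (U x) = norm x"
  by (simp add: norm_eq_sqrt_inner inner_eq_Re_cinner unitary_cinner)

lemma norm_leg13:
  fixes T :: "'a::chilbert_space \<otimes>\<^sub>H 'c::chilbert_space \<Rightarrow>\<^sub>L 'a \<otimes>\<^sub>H 'c"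
    and \<xi> :: "'a \<otimes>\<^sub>H 'b::chilbert_space \<otimes>\<^sub>H 'c"
  assumes "T \<in> bop"
  shows "norm (leg13 T \<xi>) \<le> norm T * norm \<xi>"
proof -
  let ?T = "T \<otimes>\<^sub>o (id_blinfun :: 'b \<Rightarrow>\<^sub>L 'b)"
  have u: "unitary (id_blinfun \<otimes>\<^sub>o flip :: 'a \<otimes>\<^sub>H 'b \<otimes>\<^sub>H 'c \<Rightarrow>\<^sub>L 'a \<otimes>\<^sub>H 'c \<otimes>\<^sub>H 'b)"
    "unitary (id_blinfun \<otimes>\<^sub>o flip :: 'a \<otimes>\<^sub>H 'c \<otimes>\<^sub>H 'b \<Rightarrow>\<^sub>L 'a \<otimes>\<^sub>H 'b \<otimes>\<^sub>H 'c)"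
    by (intro unitary_op_tensor unitary_id unitary_flip)+
  have "norm (leg13 T \<xi>) = norm (?T (adj assoc ((id_blinfun \<otimes>\<^sub>o flip) \<xi>)))"
    by (simp add: leg13_def leg12_def norm_unitary[OF u(2)] norm_unitary[OF unitary_assoc])
  also have "\<dots> \<le> norm ?T * norm (adj assoc ((id_blinfun \<otimes>\<^sub>o flip) \<xi>) :: ('a \<otimes>\<^sub>H 'c) \<otimes>\<^sub>H 'b)"
    by (rule norm_blinfun)
  also have "norm (adj assoc ((id_blinfun \<otimes>\<^sub>o flip) \<xi>) :: ('a \<otimes>\<^sub>H 'c) \<otimes>\<^sub>H 'b) = norm \<xi>"
    by (simp add: norm_unitary[OF u(1)] norm_unitary[OF unitary_adj[OF unitary_assoc]])
  also have "norm ?T * norm \<xi> \<le> (norm T * 1) * norm \<xi>"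
    by (intro mult_right_mono order_trans[OF norm_op_tensor[OF assms bop_id]] mult_left_mono norm_blinfun_id_le)
      auto
  finally show ?thesis by simp
qed

lemma op_eqI_slices:
  fixes S T :: "'a::chilbert_space \<otimes>\<^sub>H 'b::chilbert_space \<Rightarrow>\<^sub>L 'a \<otimes>\<^sub>H 'b"
  assumes "\<And>p r. adj (ketL p) o\<^sub>L S o\<^sub>L ketL r = adj (ketL p) o\<^sub>L T o\<^sub>L ketL r"
  shows "S = T"
proof (rule tensor_op_cinner_eqI)
  fix p b r b'
  have "cinner b ((adj (ketL p) o\<^sub>L S o\<^sub>L ketL r) b') = cinner b ((adj (ketL p) o\<^sub>L T o\<^sub>L ketL r) b')"
    by (simp only: assms)
  then show "cinner (p \<otimes>\<^sub>v b) (S (r \<otimes>\<^sub>v b')) = cinner (p \<otimes>\<^sub>v b) (T (r \<otimes>\<^sub>v b'))"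
    by (simp add: cinner_adj_right)
qed

lemma op_eqI_sl12:
  fixes S T :: "'a::chilbert_space \<otimes>\<^sub>H 'b::chilbert_space \<otimes>\<^sub>H 'c::chilbert_space \<Rightarrow>\<^sub>L 'a \<otimes>\<^sub>H 'b \<otimes>\<^sub>H 'c"
  assumes "\<And>p q r s. sl12 (p \<otimes>\<^sub>v q) (r \<otimes>\<^sub>v s) S = sl12 (p \<otimes>\<^sub>v q) (r \<otimes>\<^sub>v s) T"
  shows "S = T"
proof (rule tensor3_op_eqI, rule cinner_tensor3_eqI)
  fix p q k r s k'
  have "cinner k (sl12 (p \<otimes>\<^sub>v q) (r \<otimes>\<^sub>v s) S k') = cinner k (sl12 (p \<otimes>\<^sub>v q) (r \<otimes>\<^sub>v s) T k')"
    by (simp only: assms)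
  then show "cinner (p \<otimes>\<^sub>v q \<otimes>\<^sub>v k) (S (r \<otimes>\<^sub>v s \<otimes>\<^sub>v k')) = cinner (p \<otimes>\<^sub>v q \<otimes>\<^sub>v k) (T (r \<otimes>\<^sub>v s \<otimes>\<^sub>v k'))"
    by (simp add: sl12_def cinner_adj_right)
qed

lemma bounded_linear_sl12_left: "bounded_linear (\<lambda>\<zeta>. sl12 \<zeta> \<zeta>' R)"
  unfolding sl12_def
  by (intro bounded_linear_compose[OF bounded_linear_compose_left] bounded_linear_on_compose[OF bounded_linear_on_adj]
      bounded_linear_ket12 bop_ket12)

lemma bounded_linear_sl12_right: "bounded_linear (\<lambda>\<zeta>'. sl12 \<zeta> \<zeta>' R)"
  unfolding sl12_def by (intro bounded_linear_compose[OF bounded_linear_compose_right] bounded_linear_ket12)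

lemma sl12_eqI:
  assumes f: "bounded_linear f"
    and eq: "\<And>p q r s. sl12 (p \<otimes>\<^sub>v q) (r \<otimes>\<^sub>v s) S = f (sl12 (p \<otimes>\<^sub>v q) (r \<otimes>\<^sub>v s) T)"
  shows "sl12 \<zeta> \<zeta>' S = f (sl12 \<zeta> \<zeta>' T)"
proof (rule tensor_linear_eq[of "\<lambda>\<zeta>. sl12 \<zeta> \<zeta>' S"])
  fix p q
  show "sl12 (p \<otimes>\<^sub>v q) \<zeta>' S = f (sl12 (p \<otimes>\<^sub>v q) \<zeta>' T)"
    by (rule tensor_linear_eq[of "\<lambda>\<zeta>'. sl12 (p \<otimes>\<^sub>v q) \<zeta>' S"])
      (intro bounded_linear_sl12_right bounded_linear_compose[OF f] eq)+
qed (intro bounded_linear_sl12_left bounded_linear_compose[OF f])+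

section \<open>The amplified unitary and its isometry on the algebra\<close>

context half_modular
begin

definition X :: "'h \<otimes>\<^sub>H ('h, 'h) upower \<Rightarrow>\<^sub>L 'h \<otimes>\<^sub>H ('h, 'h) upower" where
  "X = amp W"

lemma bop_X [simp, intro]: "X \<in> bop"
  by (simp add: X_def)

text \<open>\<open>X\<close> is a contraction, so it preserves the norm of a vector exactly if
  \<open>D\<close> fixes it. The commutation relations of \<open>D\<close> make this
  testable.\<close>

definition D :: "'h \<otimes>\<^sub>H ('h, 'h) upower \<Rightarrow>\<^sub>L 'h \<otimes>\<^sub>H ('h, 'h) upower" where
  "D = adj X o\<^sub>L X"

lemma bop_D [simp, intro]: "D \<in> bop"
  by (simp add: D_def)

lemma norm_X: "norm X \<le> 1"
proof (rule norm_blinfun_bound)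
  fix \<xi> :: "'h \<otimes>\<^sub>H ('h, 'h) upower"
  have "norm W \<le> 1" by (rule norm_blinfun_bound) (simp_all add: norm_unitary[OF unitary_W])
  then have "norm W * norm \<xi> \<le> 1 * norm \<xi>" by (rule mult_right_mono) simp
  then show "norm (X \<xi>) \<le> 1 * norm \<xi>" unfolding X_def using norm_amp[OF bop_W, of \<xi>] by linarith
qed simp

text \<open>In \<open>W o\<^sub>L (b \<otimes>\<^sub>o id_blinfun) = qg_comult W b o\<^sub>L
  W\<close>, the right side cannot be amplified directly, as the columns of \<open>W\<close> are not
  yet known to be tight. Those of \<open>qg_comult W (adj b)\<close> are, so the adjoint relation is
  amplified instead.\<close>

lemma X_intertwine:
  assumes "b \<in> alg"
  shows "X o\<^sub>L (b \<otimes>\<^sub>o id_blinfun) = amp (qg_comult W b) o\<^sub>L X"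
proof -
  have b: "b \<in> bop" "adj b \<in> alg" using assms alg_bop adj_alg by auto
  have "(b \<otimes>\<^sub>o (id_blinfun :: 'h \<Rightarrow>\<^sub>L 'h)) o\<^sub>L ketL g \<in> tight bop" for g
    using tightI[of id_blinfun bop "b g"] by (simp add: op_tensor_ketL b)
  then have "X o\<^sub>L (b \<otimes>\<^sub>o id_blinfun) = amp (W o\<^sub>L (b \<otimes>\<^sub>o id_blinfun))"
    unfolding X_def by (subst amp_compose) (simp_all add: amp_op_tensor_id b)
  also have "W o\<^sub>L (b \<otimes>\<^sub>o id_blinfun) = adj (adj W o\<^sub>L qg_comult W (adj b))"
    by (simp add: adj_compose adj_comult b) (simp add: qg_comult_def compose_assoc)
  also have "amp \<dots> = adj (amp (adj W o\<^sub>L qg_comult W (adj b)))"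
    by (subst adj_amp) (simp_all add: b)
  also have "amp (adj W o\<^sub>L qg_comult W (adj b)) = amp (adj W) o\<^sub>L amp (qg_comult W (adj b))"
    by (rule amp_compose[OF comult_tight[OF b(2)]])
  also have "adj \<dots> = amp (qg_comult W b) o\<^sub>L X"
    by (simp add: adj_compose b adj_amp adj_comult X_def)
  finally show ?thesis .
qed

lemma D_commute:
  assumes "b \<in> alg"
  shows "D o\<^sub>L (b \<otimes>\<^sub>o id_blinfun) = (b \<otimes>\<^sub>o id_blinfun) o\<^sub>L D"
proof -
  have b: "b \<in> bop" "adj b \<in> alg" using assms alg_bop adj_alg by auto
  have "(b \<otimes>\<^sub>o id_blinfun) o\<^sub>L adj X = adj (X o\<^sub>L (adj b \<otimes>\<^sub>o id_blinfun))"
    by (simp add: adj_compose adj_op_tensor b)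
  also have "\<dots> = adj X o\<^sub>L amp (qg_comult W b)"
    by (simp add: X_intertwine[OF b(2)] adj_compose b adj_amp adj_comult)
  finally have "(b \<otimes>\<^sub>o id_blinfun) o\<^sub>L D = adj X o\<^sub>L (amp (qg_comult W b) o\<^sub>L X)"
    unfolding D_def by (simp flip: compose_assoc)
  then show ?thesis
    unfolding X_intertwine[OF assms, symmetric] by (simp add: D_def compose_assoc)
qed

text \<open>Slices of \<open>leg12 W\<close> over leg 1 have the form
  \<open>b \<otimes>\<^sub>o id_blinfun\<close> with \<open>b\<close> in \<open>alg\<close>, so
  \<open>D_commute\<close> applies slice by slice.\<close>

lemma D_commute_leg: "leg23 D o\<^sub>L leg12 W = leg12 W o\<^sub>L leg23 D"
proof (rule op_eqI_slices)
  fix p r :: 'h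
  let ?k = "ketL r :: 'h \<otimes>\<^sub>H ('h, 'h) upower \<Rightarrow>\<^sub>L 'h \<otimes>\<^sub>H 'h \<otimes>\<^sub>H ('h, 'h) upower"
  let ?b = "adj (ketL p :: 'h \<otimes>\<^sub>H ('h, 'h) upower \<Rightarrow>\<^sub>L 'h \<otimes>\<^sub>H 'h \<otimes>\<^sub>H ('h, 'h) upower)"
  have "?b o\<^sub>L (leg23 D o\<^sub>L leg12 W) o\<^sub>L ?k = (?b o\<^sub>L leg23 D) o\<^sub>L leg12 W o\<^sub>L ?k"
    by (simp add: compose_assoc)
  also have "?b o\<^sub>L leg23 D = D o\<^sub>L ?b"
    by (simp add: leg23_def adj_ketL_op_tensor)
  also have "D o\<^sub>L ?b o\<^sub>L leg12 W o\<^sub>L ?k = D o\<^sub>L (?b o\<^sub>L leg12 W o\<^sub>L ?k)"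
    by (simp add: compose_assoc)
  also have "\<dots> = (?b o\<^sub>L leg12 W o\<^sub>L ?k) o\<^sub>L D"
    by (simp add: slice_leg12 D_commute)
  also have "\<dots> = ?b o\<^sub>L leg12 W o\<^sub>L (?k o\<^sub>L D)"
    by (simp add: compose_assoc)
  also have "?k o\<^sub>L D = leg23 D o\<^sub>L ?k"
    by (simp add: leg23_ketL)
  finally show "?b o\<^sub>L (leg23 D o\<^sub>L leg12 W) o\<^sub>L ?k = ?b o\<^sub>L (leg12 W o\<^sub>L leg23 D) o\<^sub>L ?k"
    by (simp add: compose_assoc)
qed

lemma pentagon_sl12: "adj (leg12 W) o\<^sub>L leg23 W o\<^sub>L leg12 W = leg13 W o\<^sub>L leg23 W"
proof -
  have "adj (leg12 W) o\<^sub>L (leg23 W o\<^sub>L leg12 W) = adj (leg12 W) o\<^sub>L (leg12 W o\<^sub>L leg13 W o\<^sub>L leg23 W)"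
    by (simp only: pentagon)
  then show ?thesis by (simp flip: compose_assoc)
qed

text \<open>Legs 1 and 2 are not amplified. After slicing over them, only the multiplicative
  representation \<open>umap\<close> acts on leg 3, so no multiplicativity of \<open>amp\<close>
  enters.\<close>

lemma X_pentagon: "adj (leg12 W) o\<^sub>L leg23 X o\<^sub>L leg12 W = leg13 X o\<^sub>L leg23 X"
proof (rule op_eqI_sl12)
  fix p q r s :: 'h
  have *: "sl12 \<zeta> \<zeta>' (leg23 X) = umap (sl12 \<zeta> \<zeta>' (leg23 W))" for \<zeta> \<zeta>' :: "'h \<otimes>\<^sub>H 'h"
    by (rule sl12_eqI[OF bounded_linear_umap]) (simp add: sl12_leg23 X_def coef2_amp umap_op_scale)
  have "sl12 (p \<otimes>\<^sub>v q) (r \<otimes>\<^sub>v s) (adj (leg12 W) o\<^sub>L leg23 X o\<^sub>L leg12 W)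
      = umap (sl12 (W (p \<otimes>\<^sub>v q)) (W (r \<otimes>\<^sub>v s)) (leg23 W))"
    by (simp add: adj_leg sl12_leg12 *)
  also have "\<dots> = umap (sl12 (p \<otimes>\<^sub>v q) (r \<otimes>\<^sub>v s) (adj (leg12 W) o\<^sub>L leg23 W o\<^sub>L leg12 W))"
    by (simp add: adj_leg sl12_leg12)
  also have "\<dots> = sl12 (p \<otimes>\<^sub>v q) (r \<otimes>\<^sub>v s) (leg13 X o\<^sub>L leg23 X)"
    by (simp add: pentagon_sl12 sl12_leg13_leg23 X_def coef2_amp umap_compose)
  finally show "sl12 (p \<otimes>\<^sub>v q) (r \<otimes>\<^sub>v s) (adj (leg12 W) o\<^sub>L leg23 X o\<^sub>L leg12 W)
      = sl12 (p \<otimes>\<^sub>v q) (r \<otimes>\<^sub>v s) (leg13 X o\<^sub>L leg23 X)" .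
qed

lemma leg_D: "leg23 D = adj (leg23 X) o\<^sub>L leg23 X" "leg13 D = adj (leg13 X) o\<^sub>L leg13 X"
  by (simp_all add: D_def leg_compose adj_leg)

text \<open>Since \<open>D\<close> commutes with the second leg of \<open>W\<close>, the relation \<open>X\<^sub>1\<^sub>3 X\<^sub>2\<^sub>3 = W\<^sub>1\<^sub>2\<^sup>* X\<^sub>2\<^sub>3 W\<^sub>1\<^sub>2\<close>
  makes \<open>X\<^sub>1\<^sub>3\<close> isometric on the range of \<open>X\<^sub>2\<^sub>3\<close>.\<close>

lemma leg13_D_leg23_X: "leg13 D (leg23 X \<xi>) = leg23 X \<xi>"
proof -
  let ?\<eta> = "leg23 X \<xi>"
  have re: "Re (cinner \<alpha> (leg23 D \<alpha>)) = (norm (leg23 X \<alpha>))\<^sup>2" for \<alpha> :: "'h \<otimes>\<^sub>H 'h \<otimes>\<^sub>H ('h, 'h) upower"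
    by (simp add: leg_D cinner_adj_right cinner_self del: of_real_power)
  have "(norm (leg13 X ?\<eta>))\<^sup>2 = (norm ((adj (leg12 W) o\<^sub>L leg23 X o\<^sub>L leg12 W) \<xi>))\<^sup>2"
    by (simp add: X_pentagon)
  also have "\<dots> = (norm (leg23 X (leg12 W \<xi>)))\<^sup>2"
    by (simp add: norm_unitary[OF unitary_adj[OF unitary_leg(1)[OF unitary_W]]])
  also have "\<dots> = Re (cinner (leg12 W \<xi>) ((leg23 D o\<^sub>L leg12 W) \<xi>))"
    by (simp add: re)
  also have "\<dots> = Re (cinner \<xi> (leg23 D \<xi>))"
    unfolding D_commute_leg by (simp add: unitary_cinner[OF unitary_leg(1)[OF unitary_W]])
  also have "\<dots> = (norm ?\<eta>)\<^sup>2" by (rule re)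
  finally have eq: "(norm (leg13 X ?\<eta>))\<^sup>2 = (norm ?\<eta>)\<^sup>2" .
  \<comment> \<open>A contraction fixes every vector at which its quadratic form equals the squared
    norm.\<close>
  have "norm (leg13 D ?\<eta>) \<le> norm ?\<eta>"
  proof -
    have "norm (adj X) \<le> 1" using norm_X by (simp add: norm_adj)
    then have "norm (adj X) * norm (leg13 X ?\<eta>) \<le> 1 * norm (leg13 X ?\<eta>)" by (rule mult_right_mono) simp
    moreover have "norm X * norm ?\<eta> \<le> 1 * norm ?\<eta>" by (rule mult_right_mono[OF norm_X]) simp
    ultimately show ?thesis
      using norm_leg13[of "adj X" "leg13 X ?\<eta>"] norm_leg13[of X ?\<eta>] by (simp add: leg_D adj_leg)
  qed
  then have "(norm (leg13 D ?\<eta>))\<^sup>2 \<le> (norm ?\<eta>)\<^sup>2" by (simp add: power_mono)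
  moreover have "inner (leg13 D ?\<eta>) ?\<eta> = (norm (leg13 X ?\<eta>))\<^sup>2"
    by (simp add: inner_eq_Re_cinner leg_D cinner_adj_left cinner_self del: of_real_power)
  moreover have "(norm (leg13 D ?\<eta> - ?\<eta>))\<^sup>2
      = (norm (leg13 D ?\<eta>))\<^sup>2 - 2 * inner (leg13 D ?\<eta>) ?\<eta> + (norm ?\<eta>)\<^sup>2"
    by (simp add: power2_norm_eq_inner inner_diff_left inner_diff_right inner_commute)
  ultimately have "(norm (leg13 D ?\<eta> - ?\<eta>))\<^sup>2 \<le> 0" using eq by linarith
  then show ?thesis by simp
qed

text \<open>Slicing the middle leg of \<open>leg13_D_leg23_X\<close> leaves \<open>D\<close>
  unchanged and turns \<open>leg23 X\<close> into the representation of a coefficient.\<close>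

lemma D_isometric:
  assumes "a \<in> alg"
  shows "D (v \<otimes>\<^sub>v umap a k) = v \<otimes>\<^sub>v umap a k"
proof (rule closed_span_eq[OF assms[unfolded alg_def], of "\<lambda>a. D (v \<otimes>\<^sub>v umap a k)"])
  have 1: "bounded_linear (\<lambda>a :: 'h \<Rightarrow>\<^sub>L 'h. v \<otimes>\<^sub>v umap a k)"
    by (rule bounded_linear_compose[OF bounded_linear_tensor_right
          bounded_linear_compose[OF bounded_linear_apply bounded_linear_umap]])
  then show "bounded_linear (\<lambda>a :: 'h \<Rightarrow>\<^sub>L 'h. v \<otimes>\<^sub>v umap a k)" .
  show "bounded_linear (\<lambda>a :: 'h \<Rightarrow>\<^sub>L 'h. D (v \<otimes>\<^sub>v umap a k))"
    by (rule bounded_linear_compose[OF blinfun.bounded_linear_right 1])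
  fix a assume "a \<in> coefs W"
  then obtain p q where a: "a = coef2 p q W" by (auto simp: coefs_def)
  let ?i = "adj (insM p) :: 'h \<otimes>\<^sub>H 'h \<otimes>\<^sub>H ('h, 'h) upower \<Rightarrow>\<^sub>L 'h \<otimes>\<^sub>H ('h, 'h) upower"
  have "?i o\<^sub>L leg13 D = adj (leg13 (adj D) o\<^sub>L insM p)"
    by (simp add: adj_compose adj_leg)
  also have "\<dots> = D o\<^sub>L ?i"
    by (simp add: leg13_insM adj_compose)
  finally have i: "?i o\<^sub>L leg13 D = D o\<^sub>L ?i" .
  have "?i (leg13 D \<eta>) = D (?i \<eta>)" for \<eta>
    using arg_cong[OF i, of "\<lambda>T. T \<eta>"] by simp
  from this[of "leg23 X (v \<otimes>\<^sub>v q \<otimes>\<^sub>v k)"]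
  have "D (?i (v \<otimes>\<^sub>v X (q \<otimes>\<^sub>v k))) = ?i (v \<otimes>\<^sub>v X (q \<otimes>\<^sub>v k))"
    unfolding leg13_D_leg23_X by simp
  moreover have "?i (v \<otimes>\<^sub>v X (q \<otimes>\<^sub>v k)) = v \<otimes>\<^sub>v umap a k"
  proof -
    have "?i (v \<otimes>\<^sub>v X (q \<otimes>\<^sub>v k)) = v \<otimes>\<^sub>v (adj (ketL p) o\<^sub>L X o\<^sub>L ketL q) k"
      by (simp add: insM_def adj_op_tensor)
    also have "adj (ketL p) o\<^sub>L X o\<^sub>L ketL q = umap a"
      by (simp only: a coef2_amp[OF bop_W, symmetric] X_def coef2_eq[OF bop_amp[OF bop_W]])
    finally show ?thesis .
  qed
  ultimately show "D (v \<otimes>\<^sub>v umap a k) = v \<otimes>\<^sub>v umap a k" by simp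
qed

lemma norm_X_isometric:
  assumes "a \<in> alg"
  shows "norm (X (v \<otimes>\<^sub>v umap a k)) = norm (v \<otimes>\<^sub>v umap a k)"
proof -
  let ?\<xi> = "v \<otimes>\<^sub>v umap a k"
  have "cinner (X ?\<xi>) (X ?\<xi>) = cinner ?\<xi> (D ?\<xi>)"
    by (simp add: D_def cinner_adj_right)
  then have "cinner (X ?\<xi>) (X ?\<xi>) = cinner ?\<xi> ?\<xi>" unfolding D_isometric[OF assms] .
  then show ?thesis by (simp add: norm_eq_sqrt_inner inner_eq_Re_cinner)
qed

text \<open>A Dini type argument: if the columns of \<open>W\<close> were not tight, unit vectors witnessing this along the
  finite sets \<open>F\<close> would define a vector of the ultrapower on which \<open>X\<close> is not isometric.\<close>

lemma W_tight:
  assumes a: "a \<in> alg"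
  shows "W o\<^sub>L ketL v o\<^sub>L a \<in> tight alg"
proof -
  let ?R = "W o\<^sub>L ketL v o\<^sub>L a"
  have pR: "proj1 F o\<^sub>L ?R \<in> tight alg" for F
  proof -
    have "proj1 F o\<^sub>L ?R = (\<Sum>e\<in>F. ketL e o\<^sub>L (coef2 e v W o\<^sub>L a))"
      by (rule blinfun_eqI) (simp add: proj1_apply blinfun.sum_left coef2_eq)
    then show ?thesis
      using a by (simp only:) (intro subspace_sum subspace_tight tightI compose_alg coef_alg)
  qed
  have "\<exists>F. finite F \<and> F \<subseteq> onb \<and> norm (?R - (proj1 F o\<^sub>L ?R)) \<le> \<epsilon>" if "\<epsilon> > 0" for \<epsilon>
  proof (rule ccontr)
    assume neg: "\<not> ?thesis"
    have "\<exists>h. norm h \<le> 1 \<and> norm ((?R - (proj1 F o\<^sub>L ?R)) h) > \<epsilon>" if F: "finite F" "F \<subseteq> onb" for F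
    proof (rule ccontr)
      assume no: "\<not> ?thesis"
      have "norm (?R - (proj1 F o\<^sub>L ?R)) \<le> \<epsilon>"
      proof (rule norm_blinfun_bound)
        fix x :: 'h
        show "norm ((?R - (proj1 F o\<^sub>L ?R)) x) \<le> \<epsilon> * norm x"
        proof (cases "x = 0")
          case False
          have "norm ((?R - (proj1 F o\<^sub>L ?R)) ((1 / norm x) *\<^sub>R x)) \<le> \<epsilon>"
          proof (rule leI, rule notI)
            assume *: "\<epsilon> < norm ((?R - (proj1 F o\<^sub>L ?R)) ((1 / norm x) *\<^sub>R x))"
            have "norm ((1 / norm x) *\<^sub>R x) \<le> 1" using False by simp
            then show False using no * by blast
          qed
          then show ?thesis using False by (simp add: blinfun.scaleR_right pos_divide_le_eq)
        qed simp
      qed (use \<open>\<epsilon> > 0\<close> in simp)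
      then show False using neg F by blast
    qed
    \<comment> \<open>The ultrafilter lives on all finite sets of vectors. Hence witnesses are
      chosen for the intersection with the basis, and infinite sets get an arbitrary admissible
      value.\<close>
    then have "\<forall>F. \<exists>h. norm h \<le> 1 \<and> (finite F \<longrightarrow> norm ((?R - (proj1 (F \<inter> onb) o\<^sub>L ?R)) h) > \<epsilon>)"
      by (metis finite_Int inf_le2 norm_zero zero_le_one)
    then obtain h where h: "\<And>F. norm (h F) \<le> 1"
      "\<And>F. finite F \<Longrightarrow> norm ((?R - (proj1 (F \<inter> onb) o\<^sub>L ?R)) (h F)) > \<epsilon>"
      by metis
    define s where "s F = a (h F)" for F
    have bh: "bdd h" by (rule bddI[OF h(1)])
    have bs: "bdd s" unfolding s_def by (rule bdd_blinfun[OF bh])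
    have us: "umap a (ucls h) = ucls s" unfolding s_def[abs_def] by (rule umap_ucls[OF bh])
    define \<tau> where "\<tau> = X (v \<otimes>\<^sub>v ucls s)"
    \<comment> \<open>Isometry says that no mass of the columns is lost in the limit.\<close>
    have n\<tau>: "norm \<tau> = norm v * norm (ucls s)"
      using norm_X_isometric[OF a, of v "ucls h"] by (simp add: \<tau>_def us norm_tensor)
    have "\<forall>\<^sub>F F in finite_subsets_at_top onb. dist (\<tau> - proj1 F \<tau>) 0 < \<epsilon>"
      using tendsto_proj1 \<open>\<epsilon> > 0\<close> unfolding tendsto_iff by blast
    \<comment> \<open>This set carries the limit vector up to \<open>\<epsilon>\<close>. Along the
      ultrafilter it must do the same for the columns applied to \<open>h F\<close>, against the
      choice of \<open>h\<close>.\<close>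
    then obtain F0 where F0: "finite F0" "F0 \<subseteq> onb" "norm (\<tau> - proj1 F0 \<tau>) < \<epsilon>"
      unfolding eventually_finite_subsets_at_top by auto
    have "(norm (\<tau> - proj1 F0 \<tau>))\<^sup>2 < \<epsilon>\<^sup>2" using F0(3) by (intro power_strict_mono) auto
    then have big: "(norm \<tau>)\<^sup>2 - \<epsilon>\<^sup>2 < (\<Sum>e\<in>F0. (norm (adj (ketL e) \<tau>))\<^sup>2)"
      unfolding norm_diff_proj1[OF orthonormal_onb[OF F0(1,2)]] by simp
    have ad: "adj (ketL e) \<tau> = ucls (\<lambda>F. coef2 e v W (s F))" for e
    proof -
      have "adj (ketL e) \<tau> = (adj (ketL e) o\<^sub>L X o\<^sub>L ketL v) (ucls s)" by (simp add: \<tau>_def)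
      also have "adj (ketL e) o\<^sub>L X o\<^sub>L ketL v = umap (coef2 e v W)"
        by (simp only: coef2_amp[OF bop_W, symmetric] X_def coef2_eq[OF bop_amp[OF bop_W]])
      finally show ?thesis by (simp add: umap_ucls[OF bs])
    qed
    have lim1: "((\<lambda>F. \<Sum>e\<in>F0. (norm (coef2 e v W (s F)))\<^sup>2) \<longlongrightarrow> (\<Sum>e\<in>F0. (norm (adj (ketL e) \<tau>))\<^sup>2)) ultra"
      unfolding ad by (intro tendsto_sum tendsto_power ucls_norm_tendsto bdd_blinfun bs)
    have "((\<lambda>F. (norm v * norm (s F))\<^sup>2 - \<epsilon>\<^sup>2) \<longlongrightarrow> (norm \<tau>)\<^sup>2 - \<epsilon>\<^sup>2) ultra"
      unfolding n\<tau> by (intro tendsto_diff tendsto_power tendsto_mult tendsto_const ucls_norm_tendsto bs)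
    from tendsto_diff[OF lim1 this]
    have "\<forall>\<^sub>F F in ultra. 0 < (\<Sum>e\<in>F0. (norm (coef2 e v W (s F)))\<^sup>2) - ((norm v * norm (s F))\<^sup>2 - \<epsilon>\<^sup>2)"
      by (rule order_tendstoD(1)) (use big in simp)
    \<comment> \<open>Once \<open>F\<close> contains \<open>F0\<close>, the tail outside
      \<open>F\<close> is at most the tail outside \<open>F0\<close>.\<close>
    moreover have "\<forall>\<^sub>F F in ultra. finite F \<and> F0 \<subseteq> F"
      by (rule filter_leD[OF ultra_le])
        (use F0(1) in \<open>auto simp: eventually_finite_subsets_at_top\<close>)
    ultimately have "\<exists>F. 0 < (\<Sum>e\<in>F0. (norm (coef2 e v W (s F)))\<^sup>2) - ((norm v * norm (s F))\<^sup>2 - \<epsilon>\<^sup>2) \<and>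
        finite F \<and> F0 \<subseteq> F"
      by (rule eventually_happens'[OF ultra_neq_bot eventually_conj])
    then show False
    proof (elim exE)
      fix F assume elim: "0 < (\<Sum>e\<in>F0. (norm (coef2 e v W (s F)))\<^sup>2) - ((norm v * norm (s F))\<^sup>2 - \<epsilon>\<^sup>2) \<and>
        finite F \<and> F0 \<subseteq> F"
      let ?r = "?R (h F)"
      have r: "adj (ketL e) ?r = coef2 e v W (s F)" for e
        by (simp add: coef2_eq s_def)
      have nr: "norm ?r = norm v * norm (s F)"
        by (simp add: norm_unitary[OF unitary_W] norm_tensor s_def)
      have fin: "finite (F \<inter> onb)" "F \<inter> onb \<subseteq> onb" "F0 \<subseteq> F \<inter> onb" using elim F0 by auto
      have "\<epsilon>\<^sup>2 < (norm ((?R - (proj1 (F \<inter> onb) o\<^sub>L ?R)) (h F)))\<^sup>2"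
        using h(2)[of F] elim \<open>\<epsilon> > 0\<close> by (intro power_strict_mono) auto
      also have "(?R - (proj1 (F \<inter> onb) o\<^sub>L ?R)) (h F) = ?r - proj1 (F \<inter> onb) ?r"
        by (simp add: blinfun.diff_left)
      also have "(norm (?r - proj1 (F \<inter> onb) ?r))\<^sup>2 = (norm v * norm (s F))\<^sup>2 - (\<Sum>e\<in>F \<inter> onb. (norm (coef2 e v W (s F)))\<^sup>2)"
        unfolding norm_diff_proj1[OF orthonormal_onb[OF fin(1,2)]] nr r ..
      also have "\<dots> \<le> (norm v * norm (s F))\<^sup>2 - (\<Sum>e\<in>F0. (norm (coef2 e v W (s F)))\<^sup>2)"
        using fin by (intro diff_left_mono sum_mono2) auto
      finally show False using elim by linarith
    qed
  qed
  note approx = this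
  have "?R \<in> closure (tight alg)"
    unfolding closure_approachable
  proof (intro allI impI)
    fix e :: real assume "e > 0"
    with approx[of "e / 2"] obtain F where "norm (?R - (proj1 F o\<^sub>L ?R)) \<le> e / 2" by auto
    then have "dist (proj1 F o\<^sub>L ?R) ?R < e"
      using \<open>e > 0\<close> by (simp add: dist_norm norm_minus_commute)
    then show "\<exists>y\<in>tight alg. dist y ?R < e" using pR by blast
  qed
  then show ?thesis by simp
qed

end

text \<open>\<open>tight3 A\<close> is the space \<open>K \<otimes> L \<otimes> A\<close> of columns.\<close>

definition tight3 :: "('c::chilbert_space \<Rightarrow>\<^sub>L 'c) set
    \<Rightarrow> ('c \<Rightarrow>\<^sub>L 'a::chilbert_space \<otimes>\<^sub>H 'b::chilbert_space \<otimes>\<^sub>H 'c) set" where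
  "tight3 A = closed_span {ket12 \<zeta> o\<^sub>L a | \<zeta> a. a \<in> A}"

lemma subspace_tight3 [simp, intro]: "subspace (tight3 A)"
  and closed_tight3 [simp, intro]: "closed (tight3 A)"
  by (auto simp: tight3_def)

lemma tight3I: "a \<in> A \<Longrightarrow> ket12 \<zeta> o\<^sub>L a \<in> tight3 A"
  unfolding tight3_def by (rule closed_span_base) blast

lemma tight3_image_ket12:
  fixes f :: "('c::chilbert_space \<Rightarrow>\<^sub>L 'a::chilbert_space \<otimes>\<^sub>H 'b::chilbert_space \<otimes>\<^sub>H 'c)
      \<Rightarrow> 'd::real_normed_vector"
  assumes R: "R \<in> tight3 A" and f: "bounded_linear f"
    and M: "\<And>(\<zeta>::'a \<otimes>\<^sub>H 'b) a. a \<in> A \<Longrightarrow> f (ket12 \<zeta> o\<^sub>L a) \<in> M" "subspace M" "closed M"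
  shows "f R \<in> M"
  by (rule closed_span_image[OF R[unfolded tight3_def] f]) (use M in auto)

lemma tight3_image:
  fixes f :: "('c::chilbert_space \<Rightarrow>\<^sub>L 'a::chilbert_space \<otimes>\<^sub>H 'b::chilbert_space \<otimes>\<^sub>H 'c)
      \<Rightarrow> 'd::real_normed_vector"
  assumes R: "R \<in> tight3 A" and f: "bounded_linear f"
    and M: "\<And>(x::'a) (y::'b) a. a \<in> A \<Longrightarrow> f (ketL x o\<^sub>L ketL y o\<^sub>L a) \<in> M" "subspace M" "closed M"
  shows "f R \<in> M"
proof (rule tight3_image_ket12[OF R f])
  fix \<zeta> :: "'a \<otimes>\<^sub>H 'b" and a assume a: "a \<in> A"
  show "f (ket12 \<zeta> o\<^sub>L a) \<in> M"
  proof (rule tensor_linear_mem[of "\<lambda>\<zeta>. f (ket12 \<zeta> o\<^sub>L a)"])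
    show "bounded_linear (\<lambda>\<zeta> :: 'a \<otimes>\<^sub>H 'b. f (ket12 \<zeta> o\<^sub>L a))"
      by (rule bounded_linear_compose[OF f bounded_linear_compose[OF bounded_linear_compose_left
              bounded_linear_ket12]])
  qed (use M a in \<open>auto simp: ket12_tensor\<close>)
qed (use M in auto)

section \<open>Leg operators on columns of threefold tensor products\<close>

lemma ketL_tight3:
  assumes "R \<in> tight A"
  shows "ketL x o\<^sub>L R \<in> tight3 A"
proof (rule tight_image[OF assms bounded_linear_compose_right])
  show "ketL x o\<^sub>L (ketL g o\<^sub>L a) \<in> tight3 A" if "a \<in> A" for g a
    using tight3I[OF that, of "x \<otimes>\<^sub>v g"] by (simp add: ket12_tensor compose_assoc)
qed auto

text \<open>The operator acts on the vector part of a column and leaves its entries alone, so it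
  need only be bounded.\<close>

lemma leg12_tight3:
  assumes "T \<in> bop" "R \<in> tight3 A"
  shows "leg12 T o\<^sub>L R \<in> tight3 A"
  by (rule tight3_image_ket12[OF assms(2) bounded_linear_compose_right])
    (use assms(1) in \<open>auto simp: leg12_ket12 intro: tight3I simp flip: compose_assoc\<close>)

definition tight_mult :: "('b::chilbert_space \<Rightarrow>\<^sub>L 'b) set
    \<Rightarrow> ('a::chilbert_space \<otimes>\<^sub>H 'b \<Rightarrow>\<^sub>L 'a \<otimes>\<^sub>H 'b) \<Rightarrow> bool" where
  "tight_mult A T \<longleftrightarrow> T \<in> bop \<and> (\<forall>v. \<forall>a\<in>A. T o\<^sub>L ketL v o\<^sub>L a \<in> tight A)"

lemma tight_multD:
  assumes "tight_mult A T"
  shows "T \<in> bop" "R \<in> tight A \<Longrightarrow> T o\<^sub>L R \<in> tight A"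
proof -
  show "T \<in> bop" using assms by (simp add: tight_mult_def)
  assume "R \<in> tight A"
  then show "T o\<^sub>L R \<in> tight A"
    by (rule tight_image[OF _ bounded_linear_compose_right])
      (use assms in \<open>auto simp: tight_mult_def simp flip: compose_assoc\<close>)
qed

lemma leg23_tight3:
  assumes T: "tight_mult A T" and R: "R \<in> tight3 A"
  shows "leg23 T o\<^sub>L R \<in> tight3 A"
proof (rule tight3_image[OF R bounded_linear_compose_right])
  fix x y a assume a: "a \<in> A"
  have "leg23 T o\<^sub>L (ketL x o\<^sub>L ketL y o\<^sub>L a) = (leg23 T o\<^sub>L ketL x) o\<^sub>L (ketL y o\<^sub>L a)"
    by (simp add: compose_assoc)
  also have "\<dots> = ketL x o\<^sub>L (T o\<^sub>L (ketL y o\<^sub>L a))"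
    by (simp add: leg23_ketL tight_multD(1)[OF T] compose_assoc)
  also have "\<dots> \<in> tight3 A"
    by (intro ketL_tight3 tight_multD(2)[OF T] tightI a)
  finally show "leg23 T o\<^sub>L (ketL x o\<^sub>L ketL y o\<^sub>L a) \<in> tight3 A" .
qed auto

lemma adj_insM_ketL: "adj (insM p) o\<^sub>L ketL x = ketL x o\<^sub>L adj (ketL p)"
  by (rule blinfun_eqI) (simp add: insM_def adj_op_tensor)

lemma adj_insM_leg13:
  assumes "T \<in> bop"
  shows "adj (insM p) o\<^sub>L leg13 T = T o\<^sub>L adj (insM p)"
proof -
  have "adj (insM p) o\<^sub>L leg13 T = adj (leg13 (adj T) o\<^sub>L insM p)"
    by (simp add: adj_compose adj_leg assms)
  then show ?thesis by (simp add: leg13_insM adj_compose assms)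
qed

lemma adj_insM_tight3:
  assumes "R \<in> tight3 A"
  shows "adj (insM p) o\<^sub>L R \<in> tight A"
proof (rule tight3_image[OF assms bounded_linear_compose_right])
  fix x y a assume a: "a \<in> A"
  have "adj (insM p) o\<^sub>L (ketL x o\<^sub>L ketL y o\<^sub>L a) = ketL (cinner p y *\<^sub>C x) o\<^sub>L a"
    by (rule blinfun_eqI) (simp add: insM_def adj_op_tensor tensor_scaleC_left tensor_scaleC_right)
  then show "adj (insM p) o\<^sub>L (ketL x o\<^sub>L ketL y o\<^sub>L a) \<in> tight A"
    by (simp add: tightI a)
qed auto

text \<open>A nonzero vector \<open>p\<close> is inserted into the middle leg and sliced off again
  at the cost of its squared norm. If there is none, all operators in question vanish.\<close>

lemma tight_mult_leg13:
  fixes T :: "'a::chilbert_space \<otimes>\<^sub>H 'b::chilbert_space \<Rightarrow>\<^sub>L 'a \<otimes>\<^sub>H 'b"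
  assumes T: "T \<in> bop"
    and leg: "\<And>R :: 'b \<Rightarrow>\<^sub>L 'a \<otimes>\<^sub>H 'b \<otimes>\<^sub>H 'b. R \<in> tight3 A \<Longrightarrow> leg13 T o\<^sub>L R \<in> tight3 A"
  shows "tight_mult A T"
  unfolding tight_mult_def
proof (intro conjI T allI ballI)
  fix v :: 'a and a assume a: "a \<in> A"
  show "T o\<^sub>L ketL v o\<^sub>L a \<in> tight A"
  proof (cases "\<exists>p :: 'b. p \<noteq> 0")
    case True
    then obtain p :: 'b where p: "p \<noteq> 0" by blast
    let ?R = "ketL v o\<^sub>L ketL p o\<^sub>L a :: 'b \<Rightarrow>\<^sub>L 'a \<otimes>\<^sub>H 'b \<otimes>\<^sub>H 'b"
    have "?R \<in> tight3 A"
      using ketL_tight3[OF tightI[OF a]] by (simp add: compose_assoc)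
    then have "(adj (insM p) o\<^sub>L leg13 T) o\<^sub>L ?R \<in> tight A"
      unfolding compose_assoc[of "adj (insM p)"] by (intro adj_insM_tight3 leg)
    then have "(1 / (norm p)\<^sup>2) *\<^sub>R (T o\<^sub>L adj (insM p) o\<^sub>L ?R) \<in> tight A"
      unfolding adj_insM_leg13[OF T] by (intro subspace_scale) auto
    also have "(1 / (norm p)\<^sup>2) *\<^sub>R (T o\<^sub>L adj (insM p) o\<^sub>L ?R) = T o\<^sub>L ketL v o\<^sub>L a"
      using p by (intro blinfun_eqI)
        (simp add: insM_def adj_op_tensor tensor_scaleC_right bop_scaleC[OF T] blinfun.scaleR_left
          cinner_self scaleR_scaleC scaleC_scaleC)
    finally show ?thesis .
  next
    case False
    then have "T o\<^sub>L ketL v o\<^sub>L a = 0" by (intro blinfun_eqI) (metis blinfun.zero_right)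
    then show ?thesis using subspace_0[OF subspace_tight] by simp
  qed
qed

context half_modular
begin

lemma tight_mult_W: "tight_mult alg W"
  by (simp add: tight_mult_def W_tight)

text \<open>The right side of \<open>Wt_W\<close> preserves threefold columns, as \<open>Wt\<close>
  stands there on legs 12 and \<open>W\<close> is tight. Slicing the middle leg shows how the
  adjoint of \<open>Wt\<close> acts on a coefficient of \<open>W\<close> times \<open>b\<close>;
  such products span \<open>alg\<close>.\<close>

lemma tight_mult_adj_Wt: "tight_mult alg (adj Wt)"
  unfolding tight_mult_def
proof (intro conjI allI ballI)
  fix z a assume "a \<in> alg"
  then have "a \<in> closed_span {x o\<^sub>L y | x y. x \<in> alg \<and> y \<in> alg}" using alg_compose_span by blast
  then show "adj Wt o\<^sub>L ketL z o\<^sub>L a \<in> tight alg"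
  proof (rule closed_span_image[OF _ bounded_linear_compose_right])
    fix s assume "s \<in> {x o\<^sub>L y | x y. x \<in> alg \<and> y \<in> alg}"
    then obtain x b where s: "s = x o\<^sub>L b" and x: "x \<in> alg" and b: "b \<in> alg" by blast
    have "adj Wt o\<^sub>L ketL z o\<^sub>L (x o\<^sub>L b) \<in> tight alg"
    proof (rule closed_span_image[OF x[unfolded alg_def], of "\<lambda>x. adj Wt o\<^sub>L ketL z o\<^sub>L (x o\<^sub>L b)"])
      show "bounded_linear (\<lambda>x. adj Wt o\<^sub>L ketL z o\<^sub>L (x o\<^sub>L b))"
        by (rule bounded_linear_compose[OF bounded_linear_compose_right bounded_linear_compose_left])
      fix x assume "x \<in> coefs W"
      then obtain p q where x: "x = coef2 p q W" by (auto simp: coefs_def)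
      have "adj (insM p) o\<^sub>L ((leg12 Wt o\<^sub>L leg23 W o\<^sub>L adj (leg12 Wt)) o\<^sub>L (ketL z o\<^sub>L (ketL q o\<^sub>L b))) \<in> tight alg"
        unfolding compose_assoc adj_leg(1)[OF bop_Wt]
        by (intro adj_insM_tight3 leg12_tight3 leg23_tight3[OF tight_mult_W] ketL_tight3 tightI b) auto
      also have "adj (insM p) o\<^sub>L ((leg12 Wt o\<^sub>L leg23 W o\<^sub>L adj (leg12 Wt)) o\<^sub>L (ketL z o\<^sub>L (ketL q o\<^sub>L b)))
          = (adj (insM p) o\<^sub>L leg13 (adj Wt)) o\<^sub>L (leg23 W o\<^sub>L ketL z) o\<^sub>L (ketL q o\<^sub>L b)"
        unfolding Wt_W[symmetric] by (simp add: adj_leg compose_assoc)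
      also have "\<dots> = adj Wt o\<^sub>L (adj (insM p) o\<^sub>L ketL z) o\<^sub>L (W o\<^sub>L ketL q o\<^sub>L b)"
        by (simp add: adj_insM_leg13 leg23_ketL compose_assoc)
      also have "\<dots> = adj Wt o\<^sub>L ketL z o\<^sub>L (x o\<^sub>L b)"
        by (simp add: adj_insM_ketL x coef2_eq compose_assoc)
      finally show "adj Wt o\<^sub>L ketL z o\<^sub>L (x o\<^sub>L b) \<in> tight alg" .
    qed auto
    then show "adj Wt o\<^sub>L ketL z o\<^sub>L s \<in> tight alg" by (simp add: s)
  qed auto
qed auto

end

section \<open>Conjugate operators\<close>

definition conj_op :: "('a::chilbert_space \<Rightarrow>\<^sub>L 'b::chilbert_space) \<Rightarrow> ('a conjugate \<Rightarrow>\<^sub>L 'b conjugate)" where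
  "conj_op T = Blinfun (\<lambda>x. Conj (T (unconj x)))"

lemma bounded_linear_unconj: "bounded_linear unconj"
  by (rule bounded_linear_intro[where K = 1])
    (simp_all add: plus_conjugate_def scaleR_conjugate_def norm_conjugate_def)

lemma conj_op_apply [simp]: "conj_op T (Conj x) = Conj (T x)"
  unfolding conj_op_def
  by (subst bounded_linear_Blinfun_apply[OF bounded_linear_compose[OF bounded_linear_Conj
          bounded_linear_compose[OF blinfun.bounded_linear_right bounded_linear_unconj]]]) simp

lemma conjugate_op_eqI:
  fixes S T :: "'a::chilbert_space conjugate \<Rightarrow>\<^sub>L 'b::real_normed_vector"
  assumes "\<And>x. S (Conj x) = T (Conj x)"
  shows "S = T"
  by (rule blinfun_eqI) (metis assms Conj_unconj)

lemma bop_conj_op [simp, intro]: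
  assumes "T \<in> bop"
  shows "conj_op T \<in> bop"
proof (rule bopI)
  fix c x
  show "conj_op T (c *\<^sub>C x) = c *\<^sub>C conj_op T x"
    by (cases x) (simp add: scaleC_conjugate_def bop_scaleC[OF assms])
qed

lemma conj_op_compose: "conj_op (S o\<^sub>L T) = conj_op S o\<^sub>L conj_op T"
  by (rule conjugate_op_eqI) simp

lemma adj_conj_op: "T \<in> bop \<Longrightarrow> adj (conj_op T) = conj_op (adj T)"
proof (rule adj_eqI)
  fix x y assume "T \<in> bop"
  then show "cinner (conj_op (adj T) y) x = cinner y (conj_op T x)"
    by (cases x; cases y) (simp add: cinner_adj_right)
qed

lemma bounded_linear_conj_op: "bounded_linear conj_op"
proof (rule bounded_linear_intro[where K = 1])
  show "norm (conj_op T) \<le> norm T * 1" for T :: "'a::chilbert_space \<Rightarrow>\<^sub>L 'b::chilbert_space"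
  proof (rule norm_blinfun_bound)
    fix x show "norm (conj_op T x) \<le> norm T * 1 * norm x"
      by (cases x) (simp add: norm_conjugate_def norm_blinfun)
  qed simp
qed (auto intro!: conjugate_op_eqI simp: blinfun.add_left blinfun.scaleR_left plus_conjugate_def scaleR_conjugate_def)

lemma bar_ex: "\<exists>R :: 'a::chilbert_space conjugate \<otimes>\<^sub>H 'b::chilbert_space \<Rightarrow>\<^sub>L ('b conjugate \<otimes>\<^sub>H 'a) conjugate.
    R \<in> bop \<and> (\<forall>x y. R (x \<otimes>\<^sub>v y) = Conj (Conj y \<otimes>\<^sub>v unconj x)) \<and>
    (\<forall>\<xi> \<eta>. cinner (R \<xi>) (R \<eta>) = cinner \<xi> \<eta>)"
  by (rule tensor_isometry)
    (simp_all add: scaleC_conjugate_def tensor_scaleC_right cinner_conjugate_def cinner_tensor mult.commute)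

lemma bar_unitary_ex: "\<exists>R :: 'a::chilbert_space conjugate \<otimes>\<^sub>H 'b::chilbert_space \<Rightarrow>\<^sub>L ('b conjugate \<otimes>\<^sub>H 'a) conjugate.
    unitary R \<and> (\<forall>x y. R (Conj x \<otimes>\<^sub>v y) = Conj (Conj y \<otimes>\<^sub>v x))"
proof -
  obtain R :: "'a conjugate \<otimes>\<^sub>H 'b \<Rightarrow>\<^sub>L ('b conjugate \<otimes>\<^sub>H 'a) conjugate" where
    R: "R \<in> bop" "\<And>x y. R (x \<otimes>\<^sub>v y) = Conj (Conj y \<otimes>\<^sub>v unconj x)"
      "\<And>\<xi> \<eta>. cinner (R \<xi>) (R \<eta>) = cinner \<xi> \<eta>"
    using bar_ex by blast
  obtain R' :: "'b conjugate \<otimes>\<^sub>H 'a \<Rightarrow>\<^sub>L ('a conjugate \<otimes>\<^sub>H 'b) conjugate" where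
    R': "\<And>x y. R' (x \<otimes>\<^sub>v y) = Conj (Conj y \<otimes>\<^sub>v unconj x)"
    using bar_ex by blast
  \<comment> \<open>The same construction with the factors exchanged provides a right inverse, hence
    surjectivity.\<close>
  have "R (unconj (R' \<tau>)) = Conj \<tau>" for \<tau>
    by (rule tensor_linear_eq[of "\<lambda>\<tau>. R (unconj (R' \<tau>))" Conj])
      (auto simp: R R' intro!: bounded_linear_Conj bounded_linear_compose[OF blinfun.bounded_linear_right]
        bounded_linear_compose[OF bounded_linear_unconj] blinfun.bounded_linear_right)
  then have "\<exists>\<xi>. R \<xi> = \<eta>" for \<eta> by (metis Conj_unconj)
  then have "unitary R" by (intro unitaryI R)
  then show ?thesis using R(2) by (intro exI[of _ R]) simp
qed

text \<open>\<open>bar\<close> is the linear incarnation of the antiunitary operator that sends \<open>Conj x \<otimes>\<^sub>v y\<close> to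
  \<open>Conj y \<otimes>\<^sub>v x\<close>.\<close>

definition bar :: "'a::chilbert_space conjugate \<otimes>\<^sub>H 'b::chilbert_space \<Rightarrow>\<^sub>L ('b conjugate \<otimes>\<^sub>H 'a) conjugate" where
  "bar = (SOME R. unitary R \<and> (\<forall>x y. R (Conj x \<otimes>\<^sub>v y) = Conj (Conj y \<otimes>\<^sub>v x)))"

lemma unitary_bar [simp, intro]: "unitary bar"
  and bar_apply [simp]: "bar (Conj x \<otimes>\<^sub>v y) = Conj (Conj y \<otimes>\<^sub>v x)"
  using someI_ex[OF bar_unitary_ex] unfolding bar_def[symmetric] by auto

lemma bop_bar [simp, intro]: "bar \<in> bop"
  using unitaryD(1)[OF unitary_bar] .

lemmas bar_cancel [simp] = unitaryD(2,3)[OF unitary_bar] unitary_apply[OF unitary_bar]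

text \<open>\<open>barred Wt\<close> plays for the dual unitary \<open>flipped (adj W)\<close> the
  part that \<open>Wt\<close> plays for \<open>W\<close>.\<close>

definition barred :: "('b::chilbert_space conjugate \<otimes>\<^sub>H 'a::chilbert_space \<Rightarrow>\<^sub>L 'b conjugate \<otimes>\<^sub>H 'a)
    \<Rightarrow> ('a conjugate \<otimes>\<^sub>H 'b \<Rightarrow>\<^sub>L 'a conjugate \<otimes>\<^sub>H 'b)" where
  "barred T = adj bar o\<^sub>L conj_op T o\<^sub>L bar"

lemma bop_barred [simp, intro]: "T \<in> bop \<Longrightarrow> barred T \<in> bop"
  by (simp add: barred_def)

lemma cinner_barred:
  assumes "T \<in> bop"
  shows "cinner (Conj z \<otimes>\<^sub>v y) (barred T (Conj x \<otimes>\<^sub>v u)) = cnj (cinner (Conj y \<otimes>\<^sub>v z) (T (Conj u \<otimes>\<^sub>v x)))"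
  using cinner_commute[of "T (Conj u \<otimes>\<^sub>v x)"] by (simp add: barred_def cinner_adj_right cinner_conjugate_def)

lemma barred_compose: "barred (S o\<^sub>L T) = barred S o\<^sub>L barred T"
  by (rule blinfun_eqI) (simp add: barred_def conj_op_compose)

lemma adj_barred: "T \<in> bop \<Longrightarrow> adj (barred T) = barred (adj T)"
  by (simp add: barred_def adj_compose adj_conj_op compose_assoc)

lemma conj_op_id [simp]: "conj_op id_blinfun = id_blinfun"
  by (rule conjugate_op_eqI) simp

lemma barred_id: "barred id_blinfun = id_blinfun"
  by (simp add: barred_def)

lemma unitary_barred: "unitary T \<Longrightarrow> unitary (barred T)"
  by (auto simp: unitary_def adj_barred barred_id simp flip: barred_compose)

lemma tensor_conj_op_eqI:
  fixes S T :: "'a::chilbert_space conjugate \<otimes>\<^sub>H 'b::chilbert_space \<Rightarrow>\<^sub>L 'd::real_normed_vector"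
  assumes "\<And>x y. S (Conj x \<otimes>\<^sub>v y) = T (Conj x \<otimes>\<^sub>v y)"
  shows "S = T"
  by (rule tensor_op_eqI) (metis assms Conj_unconj)

lemma tensor_conj_cinner_eqI:
  fixes S T :: "'a::chilbert_space conjugate \<otimes>\<^sub>H 'b::chilbert_space \<Rightarrow>\<^sub>L 'c::chilbert_space conjugate \<otimes>\<^sub>H 'd::chilbert_space"
  assumes "\<And>p q r s. cinner (Conj p \<otimes>\<^sub>v q) (S (Conj r \<otimes>\<^sub>v s)) = cinner (Conj p \<otimes>\<^sub>v q) (T (Conj r \<otimes>\<^sub>v s))"
  shows "S = T"
  by (rule tensor_op_cinner_eqI) (metis assms Conj_unconj)

lemma barred_conj_op:
  assumes "c \<in> bop"
  shows "barred (conj_op c \<otimes>\<^sub>o id_blinfun) = id_blinfun \<otimes>\<^sub>o c"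
proof (rule tensor_conj_op_eqI)
  fix x y
  have "barred (conj_op c \<otimes>\<^sub>o id_blinfun) (Conj x \<otimes>\<^sub>v y) = adj bar (bar (Conj x \<otimes>\<^sub>v c y))"
    by (simp only: barred_def blinfun_apply_blinfun_compose bar_apply conj_op_apply op_tensor_apply
        bop_conj_op bop_id id_blinfun.rep_eq id_apply assms)
  then show "barred (conj_op c \<otimes>\<^sub>o id_blinfun) (Conj x \<otimes>\<^sub>v y) = (id_blinfun \<otimes>\<^sub>o c) (Conj x \<otimes>\<^sub>v y)"
    by (simp add: assms del: bar_apply)
qed

lemma slice_leg23_insR:
  assumes "S \<in> bop"
  shows "adj (insR \<alpha>) o\<^sub>L leg23 S o\<^sub>L insR \<beta> = id_blinfun \<otimes>\<^sub>o coef1 \<alpha> \<beta> S"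
  using assms by (simp add: insR_def leg23_def adj_op_tensor op_tensor_compose coef1_eq)

lemma cinner_leg23_leg13:
  assumes "S \<in> bop" "T \<in> bop" and \<xi>: "\<And>f. cinner \<xi> f = cinner (b \<otimes>\<^sub>v c) (S (b' \<otimes>\<^sub>v f))"
    and \<eta>: "\<And>f. cinner f \<eta> = cinner (a \<otimes>\<^sub>v f) (T (a' \<otimes>\<^sub>v c'))"
  shows "cinner (a \<otimes>\<^sub>v b \<otimes>\<^sub>v c) (leg23 S (leg13 T (a' \<otimes>\<^sub>v b' \<otimes>\<^sub>v c'))) = cinner \<xi> \<eta>"
proof -
  have "cinner (a \<otimes>\<^sub>v b \<otimes>\<^sub>v c) (leg23 S (insM b' \<tau>)) = cinner (a \<otimes>\<^sub>v \<xi>) \<tau>" for \<tau>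
  proof (rule tensor_linear_eq[of "\<lambda>\<tau>. cinner (a \<otimes>\<^sub>v b \<otimes>\<^sub>v c) (leg23 S (insM b' \<tau>))"])
    show "cinner (a \<otimes>\<^sub>v b \<otimes>\<^sub>v c) (leg23 S (insM b' (p \<otimes>\<^sub>v f))) = cinner (a \<otimes>\<^sub>v \<xi>) (p \<otimes>\<^sub>v f)" for p f
      by (simp add: assms(1) cinner_tensor \<xi>)
  qed (intro bounded_linear_compose[OF bounded_linear_cinner_right] bounded_linear_cinner_right
      bounded_linear_compose[OF blinfun.bounded_linear_right] blinfun.bounded_linear_right)+
  then show ?thesis by (simp add: leg13_apply assms(2) \<eta>)
qed

section \<open>Comparison of the coefficients of \<open>W\<close> and \<open>Wt\<close>\<close>

text \<open>The comparison combines the symmetry of \<open>P\<close> with the identity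
  \<open>Wt_W\<close> of the dual unitary, so both halves are assumed together.\<close>

locale modular_pair = half_modular W Wt P + dual: half_modular "flipped (adj W)" "barred Wt" P'
  for W :: "'h::chilbert_space \<otimes>\<^sub>H 'h \<Rightarrow>\<^sub>L 'h \<otimes>\<^sub>H 'h"
    and Wt :: "'h conjugate \<otimes>\<^sub>H 'h \<Rightarrow>\<^sub>L 'h conjugate \<otimes>\<^sub>H 'h" and P P' :: "'h graph"
begin

text \<open>The adjoint of the dual \<open>Wt_W\<close> is sliced in its third leg. One side gives
  the conjugated coefficient, and on the other the two factors share only the third leg, where a row
  of \<open>W\<close> meets a row of \<open>Wt\<close>.\<close>

lemma cinner_barred_slice:
  "cinner (Conj p \<otimes>\<^sub>v q) ((barred Wt o\<^sub>L (id_blinfun \<otimes>\<^sub>o coef2 \<alpha> \<beta> W) o\<^sub>L adj (barred Wt)) (Conj r \<otimes>\<^sub>v s))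
    = cinner (vrow \<alpha> q s) (vrow_t \<beta> p r)"
proof -
  let ?V = "barred Wt" and ?S = "flipped W"
  have "leg12 ?V o\<^sub>L leg23 ?S o\<^sub>L leg12 (adj ?V) = adj (leg12 ?V o\<^sub>L leg23 (flipped (adj W)) o\<^sub>L adj (leg12 ?V))"
    by (simp add: adj_leg adj_compose adj_flipped compose_assoc)
  also have "\<dots> = adj (adj (leg13 ?V) o\<^sub>L leg23 (flipped (adj W)))"
    by (simp only: dual.Wt_W)
  also have "\<dots> = leg23 ?S o\<^sub>L leg13 ?V"
    by (simp add: adj_leg adj_compose adj_flipped)
  finally have *: "leg12 ?V o\<^sub>L leg23 ?S o\<^sub>L leg12 (adj ?V) = leg23 ?S o\<^sub>L leg13 ?V" .
  have "cinner (Conj p \<otimes>\<^sub>v q) ((?V o\<^sub>L (id_blinfun \<otimes>\<^sub>o coef2 \<alpha> \<beta> W) o\<^sub>L adj ?V) (Conj r \<otimes>\<^sub>v s))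
      = cinner (adj ?V (Conj p \<otimes>\<^sub>v q)) ((adj (insR \<alpha>) o\<^sub>L leg23 ?S o\<^sub>L insR \<beta>) (adj ?V (Conj r \<otimes>\<^sub>v s)))"
    by (simp add: slice_leg23_insR coef1_flipped cinner_adj_left)
  also have "\<dots> = cinner (leg12 (adj ?V) (insR \<alpha> (Conj p \<otimes>\<^sub>v q))) (leg23 ?S (leg12 (adj ?V) (insR \<beta> (Conj r \<otimes>\<^sub>v s))))"
    by (simp add: cinner_adj_right del: insR_apply)
  also have "\<dots> = cinner (insR \<alpha> (Conj p \<otimes>\<^sub>v q)) ((leg12 ?V o\<^sub>L leg23 ?S o\<^sub>L leg12 (adj ?V)) (insR \<beta> (Conj r \<otimes>\<^sub>v s)))"
    by (simp add: cinner_adj_left adj_leg(1)[symmetric] del: insR_apply leg12_insR_apply)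
  also have "\<dots> = cinner (Conj p \<otimes>\<^sub>v q \<otimes>\<^sub>v \<alpha>) (leg23 ?S (leg13 ?V (Conj r \<otimes>\<^sub>v s \<otimes>\<^sub>v \<beta>)))"
    unfolding * by simp
  also have "\<dots> = cinner (vrow \<alpha> q s) (vrow_t \<beta> p r)"
  proof (rule cinner_leg23_leg13)
    show "cinner (vrow \<alpha> q s) f = cinner (q \<otimes>\<^sub>v \<alpha>) (?S (s \<otimes>\<^sub>v f))" for f
      using flip_cinner[of "\<alpha> \<otimes>\<^sub>v q" "W (f \<otimes>\<^sub>v s)"] by (simp add: cinner_vrow flipped_def)
    show "cinner f (vrow_t \<beta> p r) = cinner (Conj p \<otimes>\<^sub>v f) (?V (Conj r \<otimes>\<^sub>v \<beta>))" for f
      by (subst cinner_commute) (simp add: cinner_barred cinner_vrow_t)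
  qed auto
  finally show ?thesis .
qed

lemma cinner_Wt_slice:
  "cinner (Conj p \<otimes>\<^sub>v q) ((Wt o\<^sub>L (conj_op (coef2 u v W) \<otimes>\<^sub>o id_blinfun) o\<^sub>L adj Wt) (Conj r \<otimes>\<^sub>v s))
    = cinner (vrow_t v q s) (vrow u p r)"
proof -
  let ?T = "Wt o\<^sub>L (conj_op (coef2 u v W) \<otimes>\<^sub>o id_blinfun) o\<^sub>L adj Wt"
  have "cinner (Conj p \<otimes>\<^sub>v q) (?T (Conj r \<otimes>\<^sub>v s)) = cnj (cinner (Conj q \<otimes>\<^sub>v p) (barred ?T (Conj s \<otimes>\<^sub>v r)))"
    by (subst cinner_barred) auto
  also have "barred ?T = barred Wt o\<^sub>L (id_blinfun \<otimes>\<^sub>o coef2 u v W) o\<^sub>L adj (barred Wt)"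
    by (simp add: barred_compose adj_barred barred_conj_op)
  finally show ?thesis
    unfolding cinner_barred_slice by (simp add: cinner_commute[symmetric])
qed

text \<open>When \<open>u\<close> and \<open>v\<close> belong to pairs in \<open>P\<close>, each
  side is an inner product of a row of \<open>W\<close> with a row of \<open>Wt\<close>, and the
  symmetry of \<open>P\<close> exchanges the two. Real linearity and density give all
  \<open>u\<close> and \<open>v\<close>.\<close>

lemma Wt_conj_coef:
  "Wt o\<^sub>L (conj_op (coef2 u v W) \<otimes>\<^sub>o id_blinfun) o\<^sub>L adj Wt
    = barred Wt o\<^sub>L (id_blinfun \<otimes>\<^sub>o coef2 (Conj u) (Conj v) Wt) o\<^sub>L adj (barred Wt)" (is "?F u v = ?G u v")
proof -
  have bl: "bounded_linear (\<lambda>x. Wt o\<^sub>L (conj_op (f x) \<otimes>\<^sub>o id_blinfun) o\<^sub>L adj Wt)"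
    "bounded_linear (\<lambda>x. barred Wt o\<^sub>L (id_blinfun \<otimes>\<^sub>o f x) o\<^sub>L adj (barred Wt))"
    if "bounded_linear f" "\<And>x. f x \<in> bop" for f :: "'h \<Rightarrow> 'h \<Rightarrow>\<^sub>L 'h"
    using that
    by (intro bounded_linear_compose[OF bounded_linear_compose_left] bounded_linear_compose[OF bounded_linear_compose_right]
        bounded_linear_on_compose[OF bounded_linear_on_tensor_left] bounded_linear_on_compose[OF bounded_linear_on_tensor_right]
        bounded_linear_compose[OF bounded_linear_conj_op]; simp)+
  have 1: "?F u v = ?G u v" if uv: "u \<in> Range P" "v \<in> Domain P" for u v
  proof -
    from uv obtain u' v' where P: "(u', u) \<in> P" "(v, v') \<in> P" by blast
    have ct: "coef2 (Conj u) (Conj v) Wt = coef2 v' u' W" by (rule coef2_Wt[OF P(2,1)])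
    show ?thesis
      by (rule tensor_conj_cinner_eqI)
        (simp only: ct cinner_Wt_slice cinner_barred_slice P_symmetric[OF vrow_P[OF P(2)] vrow_P[OF P(1)]])
  qed
  have 2: "?F u v = ?G u v" if v: "v \<in> Domain P" for u v
  proof (rule closed_span_eq[of u "Range P" "\<lambda>u. ?F u v"])
    show "u \<in> closed_span (Range P)" by (simp add: P_total)
  qed (use 1 v in \<open>auto intro!: bl bounded_linear_coef2_left
      bounded_linear_compose[OF bounded_linear_coef2_left bounded_linear_Conj]\<close>)
  show ?thesis
  proof (rule closed_span_eq[of v "Domain P" "\<lambda>v. ?F u v"])
    show "v \<in> closed_span (Domain P)" by (simp add: P_total)
  qed (use 2 in \<open>auto intro!: bl bounded_linear_coef2_right
      bounded_linear_compose[OF bounded_linear_coef2_right bounded_linear_Conj]\<close>)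
qed

end

section \<open>Tails of columns\<close>

lemma adj_sum:
  assumes "\<And>i. i \<in> I \<Longrightarrow> f i \<in> bop"
  shows "adj (\<Sum>i\<in>I. f i) = (\<Sum>i\<in>I. adj (f i))"
proof -
  have "(\<Sum>i\<in>I. f i) \<in> bop \<and> adj (\<Sum>i\<in>I. f i) = (\<Sum>i\<in>I. adj (f i))"
    using assms by (induction I rule: infinite_finite_induct) (simp_all add: adj_add)
  then show ?thesis ..
qed

lemma bop_proj1 [simp, intro]: "proj1 F \<in> bop"
  unfolding proj1_def by (intro subspace_sum) auto

lemma adj_proj1: "adj (proj1 F) = proj1 F"
  unfolding proj1_def by (subst adj_sum) (auto simp: adj_compose)

lemma adj_ketL_ketL: "adj (ketL x) o\<^sub>L ketL y = op_scale (cinner x y) id_blinfun"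
  by (rule blinfun_eqI) (simp add: op_scale_apply)

lemma proj1_idem:
  assumes F: "orthonormal F"
  shows "proj1 F o\<^sub>L proj1 F = (proj1 F :: 'a::chilbert_space \<otimes>\<^sub>H 'b::chilbert_space \<Rightarrow>\<^sub>L _)"
proof (rule tensor_op_eqI)
  fix x :: 'a and y :: 'b
  have "(\<Sum>e\<in>F. cinner e (\<Sum>f\<in>F. cinner f x *\<^sub>C f) *\<^sub>C e) = (\<Sum>e\<in>F. cinner e x *\<^sub>C e)"
  proof (rule sum.cong[OF refl])
    fix e assume e: "e \<in> F"
    have "cinner e (\<Sum>f\<in>F. cinner f x *\<^sub>C f) = (\<Sum>f\<in>F. if e = f then cinner f x else 0)"
      unfolding cinner_sum_right using F e
      by (intro sum.cong) (auto simp: cinner_scaleC_right orthonormal_def)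
    then show "cinner e (\<Sum>f\<in>F. cinner f x *\<^sub>C f) *\<^sub>C e = cinner e x *\<^sub>C e"
      using e orthonormal_finite[OF F] by simp
  qed
  then show "(proj1 F o\<^sub>L proj1 F) (x \<otimes>\<^sub>v y) = proj1 F (x \<otimes>\<^sub>v y)"
    using orthonormal_finite[OF F] by (simp add: proj1_tensor)
qed

lemma norm_adj_compose_le: "R \<in> bop \<Longrightarrow> norm (adj R o\<^sub>L R) \<le> (norm R)\<^sup>2"
  using norm_blinfun_compose[of "adj R" R] by (simp add: norm_adj power2_eq_square)

lemma norm_power2_le_adj_compose:
  assumes R: "R \<in> bop"
  shows "(norm R)\<^sup>2 \<le> norm (adj R o\<^sub>L R)"
proof -
  have "norm (R x) \<le> sqrt (norm (adj R o\<^sub>L R)) * norm x" for x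
  proof (rule power2_le_imp_le)
    have "(norm (R x))\<^sup>2 = cmod (cinner (R x) (R x))"
      by (simp add: cinner_self norm_power)
    also have "\<dots> = cmod (cinner x ((adj R o\<^sub>L R) x))"
      by (simp add: cinner_adj_right R)
    also have "\<dots> \<le> norm x * norm ((adj R o\<^sub>L R) x)" by (rule cmod_cinner_le)
    also have "\<dots> \<le> norm x * (norm (adj R o\<^sub>L R) * norm x)"
      by (intro mult_left_mono norm_blinfun) simp
    finally show "(norm (R x))\<^sup>2 \<le> (sqrt (norm (adj R o\<^sub>L R)) * norm x)\<^sup>2"
      by (simp add: power_mult_distrib power2_eq_square[of "norm x"] mult.left_commute)
  qed simp
  then have "norm R \<le> sqrt (norm (adj R o\<^sub>L R))" by (intro norm_blinfun_bound) auto
  then show ?thesis by (metis norm_ge_zero power_mono real_sqrt_pow2)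
qed

lemma adj_compose_diff_proj1:
  fixes R :: "'c::chilbert_space \<Rightarrow>\<^sub>L 'a::chilbert_space \<otimes>\<^sub>H 'b::chilbert_space"
  assumes F: "orthonormal F" and R: "R \<in> bop"
  shows "adj (R - (proj1 F o\<^sub>L R)) o\<^sub>L (R - (proj1 F o\<^sub>L R))
    = (adj R o\<^sub>L R) - (\<Sum>e\<in>F. (adj (adj (ketL e) o\<^sub>L R)) o\<^sub>L (adj (ketL e) o\<^sub>L R))"
proof -
  have "adj (R - (proj1 F o\<^sub>L R)) o\<^sub>L (R - (proj1 F o\<^sub>L R)) = (adj R o\<^sub>L R) - (adj R o\<^sub>L proj1 F o\<^sub>L R)
      - ((adj R o\<^sub>L proj1 F o\<^sub>L R) - (adj R o\<^sub>L (proj1 F o\<^sub>L proj1 F) o\<^sub>L R))"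
    by (simp add: adj_diff adj_compose R adj_proj1 compose_assoc
        linear_simps[OF bounded_linear_compose_left] linear_simps[OF bounded_linear_compose_right])
  also have "\<dots> = (adj R o\<^sub>L R) - (adj R o\<^sub>L proj1 F o\<^sub>L R)"
    by (simp add: proj1_idem[OF F])
  also have "adj R o\<^sub>L proj1 F o\<^sub>L R = (\<Sum>e\<in>F. adj (adj (ketL e) o\<^sub>L R) o\<^sub>L (adj (ketL e) o\<^sub>L R))"
    unfolding proj1_def
    by (simp add: linear_sum[OF bounded_linear.linear[OF bounded_linear_compose_right]]
        linear_sum[OF bounded_linear.linear[OF bounded_linear_compose_left]] adj_compose R compose_assoc)
  finally show ?thesis .
qed

text \<open>Unitarity removes the infinite sum over the basis: the squared tail is expressed by
  \<open>a\<close> and finitely many coefficients, using only operations that \<open>corr\<close>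
  respects.\<close>

lemma adj_compose_diff_proj1_unitary:
  fixes T :: "'a::chilbert_space \<otimes>\<^sub>H 'b::chilbert_space \<Rightarrow>\<^sub>L 'a \<otimes>\<^sub>H 'b" and a :: "'b \<Rightarrow>\<^sub>L 'b" and z :: 'a
  assumes F: "orthonormal F" and T: "unitary T" and a: "a \<in> bop"
  defines "R \<equiv> adj T o\<^sub>L ketL z o\<^sub>L a"
  shows "adj (R - (proj1 F o\<^sub>L R)) o\<^sub>L (R - (proj1 F o\<^sub>L R))
    = (norm z)\<^sup>2 *\<^sub>R (adj a o\<^sub>L a)
      - (\<Sum>e\<in>F. (adj a o\<^sub>L coef2 z e T) o\<^sub>L adj (adj a o\<^sub>L coef2 z e T))"
proof -
  note bops = unitaryD(1)[OF T] a
  have "adj R o\<^sub>L R = adj a o\<^sub>L (adj (ketL z) o\<^sub>L (T o\<^sub>L adj T) o\<^sub>L ketL z) o\<^sub>L a"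
    unfolding R_def by (simp add: adj_compose bops compose_assoc del: unitaryD)
  also have "\<dots> = adj a o\<^sub>L (adj (ketL z) o\<^sub>L ketL z) o\<^sub>L a"
    by (simp add: unitaryD[OF T])
  also have "\<dots> = (norm z)\<^sup>2 *\<^sub>R (adj a o\<^sub>L a)"
    by (rule blinfun_eqI) (simp add: adj_ketL_ketL op_scale_apply bop_scaleC a cinner_self
        blinfun.scaleR_left scaleR_scaleC del: of_real_power)
  finally have 1: "adj R o\<^sub>L R = (norm z)\<^sup>2 *\<^sub>R (adj a o\<^sub>L a)" .
  have "adj (ketL e) o\<^sub>L R = adj (adj a o\<^sub>L coef2 z e T)" for e
    by (simp add: R_def adj_compose bops adj_coef2 coef2_eq compose_assoc)
  moreover have "R \<in> bop" using bops by (simp add: R_def)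
  ultimately show ?thesis
    by (simp add: adj_compose_diff_proj1[OF F] 1 bops)
qed

context modular_pair
begin

text \<open>The unitary \<open>adj (barred Wt) o\<^sub>L Wt\<close> carries \<open>conj_op x \<otimes>\<^sub>o id_blinfun\<close> to \<open>id_blinfun \<otimes>\<^sub>o y\<close>, so that
  the norm of \<open>x\<close> is at most that of \<open>y\<close>.\<close>

definition corr :: "('h \<Rightarrow>\<^sub>L 'h) \<Rightarrow> ('h \<Rightarrow>\<^sub>L 'h) \<Rightarrow> bool" where
  "corr x y \<longleftrightarrow> x \<in> bop \<and> y \<in> bop \<and>
     (adj (barred Wt) o\<^sub>L Wt) o\<^sub>L (conj_op x \<otimes>\<^sub>o id_blinfun) = (id_blinfun \<otimes>\<^sub>o y) o\<^sub>L (adj (barred Wt) o\<^sub>L Wt)"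

lemma unitary_intertwiner: "unitary (adj (barred Wt) o\<^sub>L Wt)"
  by (intro unitary_compose unitary_adj dual.unitary_Wt unitary_Wt)

text \<open>The relation between the slices is multiplied by the unitaries on both sides. In terms
  of the unitary antipode R, the second operator is the adjoint of R applied to the first.\<close>

lemma corr_coef: "corr (coef2 u v W) (coef2 (Conj u) (Conj v) Wt)"
proof -
  have "adj (barred Wt) o\<^sub>L (Wt o\<^sub>L (conj_op (coef2 u v W) \<otimes>\<^sub>o id_blinfun) o\<^sub>L adj Wt) o\<^sub>L Wt
      = adj (barred Wt) o\<^sub>L (barred Wt o\<^sub>L (id_blinfun \<otimes>\<^sub>o coef2 (Conj u) (Conj v) Wt) o\<^sub>L adj (barred Wt)) o\<^sub>L Wt"
    by (simp only: Wt_conj_coef)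
  also have "\<dots> = (adj (barred Wt) o\<^sub>L barred Wt) o\<^sub>L (id_blinfun \<otimes>\<^sub>o coef2 (Conj u) (Conj v) Wt) o\<^sub>L adj (barred Wt) o\<^sub>L Wt"
    by (simp only: compose_assoc)
  finally show ?thesis by (simp add: corr_def compose_assoc)
qed

lemma corr_compose:
  assumes "corr x y" "corr x' y'"
  shows "corr (x o\<^sub>L x') (y o\<^sub>L y')"
proof -
  let ?O = "adj (barred Wt) o\<^sub>L Wt"
  have b: "x \<in> bop" "x' \<in> bop" "y \<in> bop" "y' \<in> bop" using assms by (auto simp: corr_def)
  have "?O o\<^sub>L (conj_op (x o\<^sub>L x') \<otimes>\<^sub>o id_blinfun) = (?O o\<^sub>L (conj_op x \<otimes>\<^sub>o id_blinfun)) o\<^sub>L (conj_op x' \<otimes>\<^sub>o id_blinfun)"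
    by (simp add: conj_op_compose b op_tensor_compose compose_assoc)
  also have "\<dots> = (id_blinfun \<otimes>\<^sub>o y) o\<^sub>L (?O o\<^sub>L (conj_op x' \<otimes>\<^sub>o id_blinfun))"
    using assms(1) by (simp add: corr_def compose_assoc)
  also have "\<dots> = ((id_blinfun \<otimes>\<^sub>o y) o\<^sub>L (id_blinfun \<otimes>\<^sub>o y')) o\<^sub>L ?O"
    using assms(2) by (simp add: corr_def compose_assoc)
  also have "(id_blinfun \<otimes>\<^sub>o y) o\<^sub>L (id_blinfun \<otimes>\<^sub>o y') = id_blinfun \<otimes>\<^sub>o (y o\<^sub>L y')"
    by (simp add: b op_tensor_compose)
  finally show ?thesis by (simp add: corr_def b)
qed

lemma corr_adj:
  assumes "corr x y"
  shows "corr (adj x) (adj y)"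
proof -
  let ?O = "adj (barred Wt) o\<^sub>L Wt"
  note O = unitaryD[OF unitary_intertwiner]
  have b: "x \<in> bop" "y \<in> bop" using assms by (auto simp: corr_def)
  have "adj (?O o\<^sub>L (conj_op x \<otimes>\<^sub>o id_blinfun)) = adj ((id_blinfun \<otimes>\<^sub>o y) o\<^sub>L ?O)"
    using assms by (simp add: corr_def)
  then have "(conj_op (adj x) \<otimes>\<^sub>o id_blinfun) o\<^sub>L adj ?O = adj ?O o\<^sub>L (id_blinfun \<otimes>\<^sub>o adj y)"
    by (simp add: b O(1) adj_compose[of ?O] adj_compose[of _ ?O] adj_op_tensor adj_conj_op)
  then have "?O o\<^sub>L ((conj_op (adj x) \<otimes>\<^sub>o id_blinfun) o\<^sub>L adj ?O) o\<^sub>L ?O = ?O o\<^sub>L (adj ?O o\<^sub>L (id_blinfun \<otimes>\<^sub>o adj y)) o\<^sub>L ?O"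
    by (simp only:)
  then have "?O o\<^sub>L (conj_op (adj x) \<otimes>\<^sub>o id_blinfun) o\<^sub>L (adj ?O o\<^sub>L ?O) = (?O o\<^sub>L adj ?O) o\<^sub>L (id_blinfun \<otimes>\<^sub>o adj y) o\<^sub>L ?O"
    by (simp only: compose_assoc)
  then show ?thesis by (simp add: O corr_def b)
qed

lemma corr_zero: "corr 0 0"
proof -
  have "conj_op 0 = (0 :: 'h conjugate \<Rightarrow>\<^sub>L 'h conjugate)" by (rule linear_simps[OF bounded_linear_conj_op])
  moreover have "0 \<otimes>\<^sub>o id_blinfun = (0 :: 'h conjugate \<otimes>\<^sub>H 'h \<Rightarrow>\<^sub>L 'h conjugate \<otimes>\<^sub>H 'h)"
    "id_blinfun \<otimes>\<^sub>o 0 = (0 :: 'h conjugate \<otimes>\<^sub>H 'h \<Rightarrow>\<^sub>L 'h conjugate \<otimes>\<^sub>H 'h)"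
    by (rule tensor_op_eqI; simp)+
  ultimately show ?thesis
    by (simp add: corr_def linear_simps[OF bounded_linear_compose_left] linear_simps[OF bounded_linear_compose_right])
qed

lemma corr_add: "corr x y \<Longrightarrow> corr x' y' \<Longrightarrow> corr (x + x') (y + y')"
  by (simp add: corr_def linear_simps[OF bounded_linear_conj_op] op_tensor_add_left op_tensor_add_right
      linear_simps[OF bounded_linear_compose_left] linear_simps[OF bounded_linear_compose_right])

lemma corr_scaleR: "corr x y \<Longrightarrow> corr (r *\<^sub>R x) (r *\<^sub>R y)"
  by (simp add: corr_def linear_simps[OF bounded_linear_conj_op] op_tensor_scaleR_left op_tensor_scaleR_right
      linear_simps[OF bounded_linear_compose_left] linear_simps[OF bounded_linear_compose_right])

lemma corr_diff: "corr x y \<Longrightarrow> corr x' y' \<Longrightarrow> corr (x - x') (y - y')"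
  using corr_add[of x y "(-1) *\<^sub>R x'" "(-1) *\<^sub>R y'"] corr_scaleR[of x' y' "-1"] by simp

lemma corr_sum: "(\<And>i. i \<in> I \<Longrightarrow> corr (f i) (g i)) \<Longrightarrow> corr (\<Sum>i\<in>I. f i) (\<Sum>i\<in>I. g i)"
  by (induction I rule: infinite_finite_induct) (auto simp: corr_zero corr_add)

lemma corr_norm_le:
  assumes "corr x y"
  shows "norm x \<le> norm y"
proof -
  let ?O = "adj (barred Wt) o\<^sub>L Wt"
  have b: "x \<in> bop" "y \<in> bop" using assms by (auto simp: corr_def)
  have le: "norm ((id_blinfun \<otimes>\<^sub>o y) \<xi>) \<le> norm y * norm \<xi>" for \<xi> :: "'h conjugate \<otimes>\<^sub>H 'h"
  proof -
    have "norm (id_blinfun \<otimes>\<^sub>o y :: 'h conjugate \<otimes>\<^sub>H 'h \<Rightarrow>\<^sub>L 'h conjugate \<otimes>\<^sub>H 'h)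
        \<le> norm (id_blinfun :: 'h conjugate \<Rightarrow>\<^sub>L 'h conjugate) * norm y"
      by (rule norm_op_tensor) (simp_all add: b)
    also have "\<dots> \<le> 1 * norm y"
      by (intro mult_right_mono norm_blinfun_bound) auto
    finally show ?thesis
      using norm_blinfun[of "id_blinfun \<otimes>\<^sub>o y" \<xi>] by (smt (verit) mult_right_mono norm_ge_zero)
  qed
  have "norm (x k) \<le> norm y * norm k" for k
  proof (cases "k = 0")
    case False
    \<comment> \<open>Any nonzero second factor would serve; \<open>k\<close> is at hand.\<close>
    let ?\<xi> = "Conj k \<otimes>\<^sub>v k"
    have "norm (x k) * norm k = norm ((conj_op x \<otimes>\<^sub>o id_blinfun) ?\<xi>)"
      by (simp add: b norm_tensor norm_conjugate_def)
    also have "\<dots> = norm ((?O o\<^sub>L (conj_op x \<otimes>\<^sub>o id_blinfun)) ?\<xi>)"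
      by (simp only: blinfun_apply_blinfun_compose[of ?O] norm_unitary[OF unitary_intertwiner])
    also have "\<dots> = norm ((id_blinfun \<otimes>\<^sub>o y) (?O ?\<xi>))"
      using assms by (simp only: corr_def blinfun_apply_blinfun_compose[of _ ?O])
    also have "\<dots> \<le> norm y * norm (?O ?\<xi>)" by (rule le)
    also have "norm (?O ?\<xi>) = norm k * norm k"
      by (simp only: norm_unitary[OF unitary_intertwiner] norm_tensor) (simp add: norm_conjugate_def)
    finally show ?thesis using False by (simp add: mult.assoc[symmetric])
  qed simp
  then show ?thesis by (intro norm_blinfun_bound) auto
qed

end

lemma orthonormal_Conj: "orthonormal F \<Longrightarrow> orthonormal (Conj ` F)"
  by (auto simp: orthonormal_def)

lemma proj1_ketL:
  assumes "finite F"
  shows "proj1 F o\<^sub>L ketL g = ketL (\<Sum>e\<in>F. cinner e g *\<^sub>C e)"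
  using assms by (intro blinfun_eqI) (simp add: proj1_tensor)

lemma sum_Conj: "(\<Sum>i\<in>I. Conj (f i)) = Conj (\<Sum>i\<in>I. f i :: 'a::chilbert_space)"
  using linear_sum[OF bounded_linear.linear[OF bounded_linear_Conj], of f I] by simp

text \<open>Tails of tight columns tend to 0 in norm. The truncations use \<open>Conj\<close> of the
  finite sets so that one index runs through the tails for \<open>W\<close> and for
  \<open>Wt\<close>.\<close>

lemma tendsto_diff_proj1_Conj:
  fixes R :: "'b::chilbert_space \<Rightarrow>\<^sub>L 'a::chilbert_space conjugate \<otimes>\<^sub>H 'b"
  assumes "R \<in> tight A"
  shows "((\<lambda>F. R - (proj1 (Conj ` F) o\<^sub>L R)) \<longlongrightarrow> 0) (finite_subsets_at_top onb)"
proof (rule tendsto_zero_closed_span[OF _ _ _ assms[unfolded tight_def]])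
  show "bounded_linear (\<lambda>R :: 'b \<Rightarrow>\<^sub>L 'a conjugate \<otimes>\<^sub>H 'b. R - (proj1 (Conj ` F) o\<^sub>L R))" for F
    by (intro bounded_linear_sub bounded_linear_ident bounded_linear_compose_right)
  show "\<forall>\<^sub>F F in finite_subsets_at_top onb.
      \<forall>R :: 'b \<Rightarrow>\<^sub>L 'a conjugate \<otimes>\<^sub>H 'b. norm (R - (proj1 (Conj ` F) o\<^sub>L R)) \<le> norm R"
    using eventually_orthonormal_onb
  proof eventually_elim
    case (elim F)
    show ?case
    proof (intro allI norm_blinfun_bound)
      fix R :: "'b \<Rightarrow>\<^sub>L 'a conjugate \<otimes>\<^sub>H 'b" and x
      have "norm ((R - (proj1 (Conj ` F) o\<^sub>L R)) x) \<le> norm (R x)"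
        using norm_diff_proj1_le[OF orthonormal_Conj[OF elim], of "R x"] by (simp add: blinfun.diff_left)
      also have "\<dots> \<le> norm R * norm x" by (rule norm_blinfun)
      finally show "norm ((R - (proj1 (Conj ` F) o\<^sub>L R)) x) \<le> norm R * norm x" .
    qed simp
  qed
  fix s :: "'b \<Rightarrow>\<^sub>L 'a conjugate \<otimes>\<^sub>H 'b"
  assume "s \<in> {ketL g o\<^sub>L a | g a. a \<in> A}"
  then obtain g a where s: "s = ketL (Conj g) o\<^sub>L a" by clarify (metis Conj_unconj)
  have bl: "bounded_linear (\<lambda>x. ketL (Conj x) o\<^sub>L a :: 'b \<Rightarrow>\<^sub>L 'a conjugate \<otimes>\<^sub>H 'b)"
    by (rule bounded_linear_compose[OF bounded_linear_compose_left
          bounded_linear_compose[OF bounded_linear_ketL bounded_linear_Conj]])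
  have "((\<lambda>F. ketL (Conj (g - (\<Sum>e\<in>F. cinner e g *\<^sub>C e))) o\<^sub>L a :: 'b \<Rightarrow>\<^sub>L 'a conjugate \<otimes>\<^sub>H 'b)
      \<longlongrightarrow> ketL (Conj 0) o\<^sub>L a) (finite_subsets_at_top onb)"
    by (rule bounded_linear.tendsto[OF bl tendsto_onb_sum])
  moreover have "\<forall>\<^sub>F F in finite_subsets_at_top onb.
      ketL (Conj (g - (\<Sum>e\<in>F. cinner e g *\<^sub>C e))) o\<^sub>L a = s - (proj1 (Conj ` F) o\<^sub>L s)"
  proof (rule eventually_finite_subsets_at_top_weakI)
    fix F :: "'a set" assume F: "finite F"
    have "proj1 (Conj ` F) o\<^sub>L s = (proj1 (Conj ` F) o\<^sub>L ketL (Conj g)) o\<^sub>L a"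
      by (simp add: s compose_assoc)
    also have "\<dots> = ketL (Conj (\<Sum>e\<in>F. cinner e g *\<^sub>C e)) o\<^sub>L a"
      using F by (simp add: proj1_ketL sum.reindex inj_on_def scaleC_conjugate_def cinner_commute[symmetric] sum_Conj)
    finally show "ketL (Conj (g - (\<Sum>e\<in>F. cinner e g *\<^sub>C e))) o\<^sub>L a = s - (proj1 (Conj ` F) o\<^sub>L s)"
      by (simp add: s linear_simps[OF bl])
  qed
  ultimately show "((\<lambda>F. s - (proj1 (Conj ` F) o\<^sub>L s)) \<longlongrightarrow> 0) (finite_subsets_at_top onb)"
    using linear_simps(3)[OF bl] by (simp add: tendsto_cong)
qed

context modular_pair
begin

text \<open>By the C*-identity it suffices to compare squared tails. They are the same polynomial in
  corresponding coefficients, so \<open>corr_norm_le\<close> applies.\<close>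

lemma norm_diff_proj1_corr:
  fixes z :: 'h
  assumes F: "orthonormal F" and ab: "corr a b"
  defines "R \<equiv> adj W o\<^sub>L ketL z o\<^sub>L a" and "R' \<equiv> adj Wt o\<^sub>L ketL (Conj z) o\<^sub>L b"
  shows "norm (R - (proj1 F o\<^sub>L R)) \<le> norm (R' - (proj1 (Conj ` F) o\<^sub>L R'))"
proof (rule power2_le_imp_le)
  let ?D = "R - (proj1 F o\<^sub>L R)" and ?D' = "R' - (proj1 (Conj ` F) o\<^sub>L R')"
  have b: "a \<in> bop" "b \<in> bop" using ab by (auto simp: corr_def)
  have "corr (adj ?D o\<^sub>L ?D) (adj ?D' o\<^sub>L ?D')"
  proof -
    have 1: "adj ?D o\<^sub>L ?D = (norm z)\<^sup>2 *\<^sub>R (adj a o\<^sub>L a)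
        - (\<Sum>e\<in>F. (adj a o\<^sub>L coef2 z e W) o\<^sub>L adj (adj a o\<^sub>L coef2 z e W))"
      unfolding R_def by (rule adj_compose_diff_proj1_unitary[OF F unitary_W b(1)])
    have 2: "adj ?D' o\<^sub>L ?D' = (norm z)\<^sup>2 *\<^sub>R (adj b o\<^sub>L b)
        - (\<Sum>e\<in>F. (adj b o\<^sub>L coef2 (Conj z) (Conj e) Wt) o\<^sub>L adj (adj b o\<^sub>L coef2 (Conj z) (Conj e) Wt))"
      using adj_compose_diff_proj1_unitary[OF orthonormal_Conj[OF F] unitary_Wt b(2), of "Conj z"]
      by (simp add: R'_def sum.reindex inj_on_def norm_conjugate_def)
    show ?thesis
      unfolding 1 2 by (intro corr_diff corr_scaleR corr_sum corr_compose corr_adj corr_coef ab)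
  qed
  then have "norm (adj ?D o\<^sub>L ?D) \<le> norm (adj ?D' o\<^sub>L ?D')" by (rule corr_norm_le)
  moreover have "?D \<in> bop" "?D' \<in> bop" by (simp_all add: R_def R'_def b)
  ultimately show "(norm ?D)\<^sup>2 \<le> (norm ?D')\<^sup>2"
    using norm_power2_le_adj_compose[of ?D] norm_adj_compose_le[of ?D'] by linarith
qed simp

text \<open>The column of \<open>adj Wt\<close> is tight, and its vanishing tails dominate those of
  the column of \<open>adj W\<close>. The truncations have entries in \<open>alg\<close>, and so
  does their norm limit.\<close>

lemma adj_W_tight_coef: "adj W o\<^sub>L ketL z o\<^sub>L coef2 u v W \<in> tight alg"
proof -
  let ?R = "adj W o\<^sub>L ketL z o\<^sub>L coef2 u v W"
    and ?R' = "adj Wt o\<^sub>L ketL (Conj z) o\<^sub>L coef2 (Conj u) (Conj v) Wt"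
  have "coef2 (Conj u) (Conj v) Wt \<in> alg"
    unfolding alg_Wt by (rule closed_span_base[OF coefsI])
  then have "?R' \<in> tight alg"
    using tight_mult_adj_Wt by (simp add: tight_mult_def)
  then have "((\<lambda>F. ?R' - (proj1 (Conj ` F) o\<^sub>L ?R')) \<longlongrightarrow> 0) (finite_subsets_at_top onb)"
    by (rule tendsto_diff_proj1_Conj)
  then have "((\<lambda>F. norm (?R' - (proj1 (Conj ` F) o\<^sub>L ?R'))) \<longlongrightarrow> 0) (finite_subsets_at_top onb)"
    by (rule tendsto_norm_zero)
  moreover have "\<forall>\<^sub>F F in finite_subsets_at_top onb.
      norm (?R - (proj1 F o\<^sub>L ?R)) \<le> norm (?R' - (proj1 (Conj ` F) o\<^sub>L ?R'))"
    using eventually_orthonormal_onb by eventually_elim (rule norm_diff_proj1_corr[OF _ corr_coef])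
  ultimately have "((\<lambda>F. ?R - (proj1 F o\<^sub>L ?R)) \<longlongrightarrow> 0) (finite_subsets_at_top onb)"
    by (rule Lim_null_comparison[rotated])
  then have "((\<lambda>F. ?R - (?R - (proj1 F o\<^sub>L ?R))) \<longlongrightarrow> ?R - 0) (finite_subsets_at_top onb)"
    by (intro tendsto_diff tendsto_const)
  then have lim: "((\<lambda>F. proj1 F o\<^sub>L ?R) \<longlongrightarrow> ?R) (finite_subsets_at_top onb)" by simp
  have "proj1 F o\<^sub>L ?R \<in> tight alg" for F
  proof -
    have "proj1 F o\<^sub>L ?R = (\<Sum>e\<in>F. ketL e o\<^sub>L (coef2 e z (adj W) o\<^sub>L coef2 u v W))"
      unfolding proj1_def
      by (simp add: linear_sum[OF bounded_linear.linear[OF bounded_linear_compose_left]] coef2_eq compose_assoc)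
    also have "\<dots> \<in> tight alg"
      by (intro subspace_sum tightI compose_alg subspace_tight)
        (auto simp: adj_alg simp flip: adj_coef2)
    finally show ?thesis .
  qed
  then show ?thesis
    by (intro Lim_in_closed_set[OF closed_tight _ _ lim]) auto
qed

lemma tight_mult_adj_W: "tight_mult alg (adj W)"
  unfolding tight_mult_def
proof (intro conjI allI ballI)
  fix z a assume a: "a \<in> alg"
  show "adj W o\<^sub>L ketL z o\<^sub>L a \<in> tight alg"
    by (rule closed_span_image[OF a[unfolded alg_def] bounded_linear_compose_right])
      (auto simp: coefs_def adj_W_tight_coef)
qed auto

end

section \<open>Modular multiplicative unitaries\<close>

definition rev3 :: "'a::chilbert_space \<otimes>\<^sub>H 'b::chilbert_space \<otimes>\<^sub>H 'c::chilbert_space \<Rightarrow>\<^sub>L 'c \<otimes>\<^sub>H 'b \<otimes>\<^sub>H 'a" where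
  "rev3 = assoc o\<^sub>L flip o\<^sub>L (id_blinfun \<otimes>\<^sub>o flip)"

lemma rev3_apply [simp]: "rev3 (x \<otimes>\<^sub>v y \<otimes>\<^sub>v z) = z \<otimes>\<^sub>v y \<otimes>\<^sub>v x"
  by (simp add: rev3_def)

lemma rev3_rev3 [simp]: "rev3 o\<^sub>L rev3 = id_blinfun"
  by (rule tensor3_op_eqI) simp

lemma rev3_insR: "rev3 o\<^sub>L insR z = ketL z o\<^sub>L flip"
  and rev3_insM: "rev3 o\<^sub>L insM y = insM y o\<^sub>L flip"
  and rev3_ketL: "rev3 o\<^sub>L ketL x = insR x o\<^sub>L flip"
  by (rule tensor_op_eqI; simp)+

lemma rev3_leg:
  assumes T: "T \<in> bop"
  shows "rev3 o\<^sub>L leg12 T = leg23 (flipped T) o\<^sub>L rev3"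
    "rev3 o\<^sub>L leg23 T = leg12 (flipped T) o\<^sub>L rev3"
    "rev3 o\<^sub>L leg13 T = leg13 (flipped T) o\<^sub>L rev3"
proof -
  note r = rev3_insR[THEN fun_cong[of _ _ "\<tau>" for \<tau>, OF arg_cong[of _ _ blinfun_apply]], simplified]
    rev3_insM[THEN fun_cong[of _ _ "\<tau>" for \<tau>, OF arg_cong[of _ _ blinfun_apply]], simplified]
    rev3_ketL[THEN fun_cong[of _ _ "\<tau>" for \<tau>, OF arg_cong[of _ _ blinfun_apply]], simplified]
  show "rev3 o\<^sub>L leg12 T = leg23 (flipped T) o\<^sub>L rev3"
    by (rule tensor3_op_eqI) (simp add: T leg12_apply r flipped_def)
  show "rev3 o\<^sub>L leg23 T = leg12 (flipped T) o\<^sub>L rev3"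
    by (rule tensor3_op_eqI) (simp add: T leg12_apply r flipped_def)
  show "rev3 o\<^sub>L leg13 T = leg13 (flipped T) o\<^sub>L rev3"
    by (rule tensor3_op_eqI) (simp add: T leg13_apply r flipped_def)
qed

text \<open>Taking adjoints reverses the order of the factors, and \<open>rev3\<close> exchanges
  legs 12 with legs 23; the two reversals cancel.\<close>

lemma pentagon_flipped_adj:
  assumes W: "W \<in> bop" and pent: "leg23 W o\<^sub>L leg12 W = leg12 W o\<^sub>L leg13 W o\<^sub>L leg23 W"
  shows "leg23 (flipped (adj W)) o\<^sub>L leg12 (flipped (adj W))
    = leg12 (flipped (adj W)) o\<^sub>L leg13 (flipped (adj W)) o\<^sub>L leg23 (flipped (adj W))"
proof -
  let ?V = "flipped (adj W)"
  note r = rev3_leg[OF bop_adj[OF W]]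
  have "adj (leg23 W o\<^sub>L leg12 W) = adj (leg12 W o\<^sub>L leg13 W o\<^sub>L leg23 W)" by (simp only: pent)
  then have "leg12 (adj W) o\<^sub>L leg23 (adj W) = leg23 (adj W) o\<^sub>L leg13 (adj W) o\<^sub>L leg12 (adj W)"
    by (simp add: adj_compose adj_leg W compose_assoc)
  then have "(rev3 o\<^sub>L leg12 (adj W)) o\<^sub>L leg23 (adj W) o\<^sub>L rev3
      = (rev3 o\<^sub>L leg23 (adj W)) o\<^sub>L leg13 (adj W) o\<^sub>L leg12 (adj W) o\<^sub>L rev3"
    by (simp add: compose_assoc)
  then have "leg23 ?V o\<^sub>L (rev3 o\<^sub>L leg23 (adj W)) o\<^sub>L rev3
      = leg12 ?V o\<^sub>L (rev3 o\<^sub>L leg13 (adj W)) o\<^sub>L leg12 (adj W) o\<^sub>L rev3"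
    by (simp only: r compose_assoc)
  then have "leg23 ?V o\<^sub>L leg12 ?V o\<^sub>L (rev3 o\<^sub>L rev3)
      = leg12 ?V o\<^sub>L leg13 ?V o\<^sub>L (rev3 o\<^sub>L leg12 (adj W)) o\<^sub>L rev3"
    by (simp only: r compose_assoc)
  then have "leg23 ?V o\<^sub>L leg12 ?V o\<^sub>L (rev3 o\<^sub>L rev3)
      = leg12 ?V o\<^sub>L leg13 ?V o\<^sub>L leg23 ?V o\<^sub>L (rev3 o\<^sub>L rev3)"
    by (simp only: r compose_assoc)
  then show ?thesis by simp
qed

section \<open>Symmetric graphs and the extraction of a modular pair\<close>

definition symmetric_graph :: "'a::chilbert_space graph \<Rightarrow> bool" where
  "symmetric_graph G \<longleftrightarrow> (\<forall>(a, b)\<in>G. \<forall>(c, d)\<in>G. cinner b c = cinner a d)"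

lemma symmetric_graphD: "symmetric_graph G \<Longrightarrow> (a, b) \<in> G \<Longrightarrow> (c, d) \<in> G \<Longrightarrow> cinner b c = cinner a d"
  unfolding symmetric_graph_def by blast

text \<open>With one pair fixed, the condition on the other is closed; closing up one argument after
  the other gives the claim.\<close>

lemma symmetric_graph_closure:
  assumes "symmetric_graph G"
  shows "symmetric_graph (closure G)"
proof -
  let ?M = "\<lambda>p. {q. cinner (snd p) (fst q) = cinner (fst p) (snd q)}"
  have cl: "closed (?M p)" for p :: "'a \<times> 'a"
    by (intro closed_Collect_eq continuous_intros linear_continuous_on_compose[OF _ bounded_linear.linear]
        bounded_linear.continuous_on[OF bounded_linear_cinner_right])
  have sym: "q \<in> ?M p \<longleftrightarrow> p \<in> ?M q" for p q :: "'a \<times> 'a"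
    by (auto simp: complex_eq_iff cinner_commute[of "snd p"] cinner_commute[of "fst p"])
  have 1: "closure G \<subseteq> ?M p" if "p \<in> G" for p
    by (intro closure_minimal cl subsetI CollectI symmetric_graphD[OF assms]) (use that in simp_all)
  have "closure G \<subseteq> ?M p" if "p \<in> closure G" for p
  proof (intro closure_minimal cl subsetI)
    fix q assume "q \<in> G"
    then show "q \<in> ?M p" using 1[of q] that sym[of q p] by blast
  qed
  then have "cinner b c = cinner a d" if "(a, b) \<in> closure G" "(c, d) \<in> closure G" for a b c d
    using that by fastforce
  then show ?thesis unfolding symmetric_graph_def by blast
qed

lemma symmetric_graph_tensor:
  assumes "symmetric_graph P" "symmetric_graph Q"
  shows "symmetric_graph (P \<otimes>\<^sub>g Q)"
  unfolding graph_tensor_def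
proof (rule symmetric_graph_closure)
  show "symmetric_graph {(\<Sum>i<n. x i \<otimes>\<^sub>v y i, \<Sum>i<n. x' i \<otimes>\<^sub>v y' i) | (n::nat) x y x' y'.
     \<forall>i<n. (x i, x' i) \<in> P \<and> (y i, y' i) \<in> Q}"
    unfolding symmetric_graph_def
    by (auto simp: cinner_sum_left cinner_sum_right cinner_tensor intro!: sum.cong
        arg_cong2[of _ _ _ _ times] symmetric_graphD[OF assms(1)] symmetric_graphD[OF assms(2)])
qed

lemma graph_tensorI:
  assumes "(x, x') \<in> P" "(y, y') \<in> Q"
  shows "(x \<otimes>\<^sub>v y, x' \<otimes>\<^sub>v y') \<in> P \<otimes>\<^sub>g Q"
proof -
  have "(\<Sum>i<1::nat. x \<otimes>\<^sub>v y, \<Sum>i<1::nat. x' \<otimes>\<^sub>v y') \<in> P \<otimes>\<^sub>g Q"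
    unfolding graph_tensor_def
    by (rule subsetD[OF closure_subset], rule CollectI, intro exI[of _ "1::nat"] exI[of _ "\<lambda>_. x"] exI[of _ "\<lambda>_. y"]
        exI[of _ "\<lambda>_. x'"] exI[of _ "\<lambda>_. y'"]) (use assms in simp)
  then show ?thesis by simp
qed

lemma positive_self_adjoint_symmetric:
  assumes "positive_self_adjoint G"
  shows "symmetric_graph G"
proof -
  have "G = graph_adj G" using assms by (simp add: positive_self_adjoint_def)
  then show ?thesis unfolding symmetric_graph_def graph_adj_def by blast
qed

lemma positive_self_adjoint_Domain:
  assumes "positive_self_adjoint G"
  shows "closed_span (Domain G) = UNIV"
  using assms closure_mono[of "Domain G" "span (Domain G)"]
  by (auto simp: positive_self_adjoint_def closed_span_def span_superset)

text \<open>A vector orthogonal to the range lies in the kernel of the adjoint, which is the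
  operator itself.\<close>

lemma positive_self_adjoint_Range:
  assumes G: "positive_self_adjoint G" "trivial_kernel G"
  shows "closed_span (Range G) = UNIV"
proof (rule closed_span_UNIV)
  fix c s assume "s \<in> Range G"
  then obtain r where "(r, s) \<in> G" by blast
  then have "(c *\<^sub>C r, c *\<^sub>C s) \<in> G"
    using G(1) unfolding positive_self_adjoint_def linear_graph_def by blast
  then show "c *\<^sub>C s \<in> closed_span (Range G)" by (intro closed_span_base) blast
next
  fix z assume "\<And>s. s \<in> Range G \<Longrightarrow> cinner s z = 0"
  then have "cinner z s = 0" if "(r, s) \<in> G" for r s
    using that cinner_commute[of z s] by auto
  then have "(z, 0) \<in> graph_adj G" by (auto simp: graph_adj_def)
  then show "z = 0"
    using G by (auto simp: positive_self_adjoint_def trivial_kernel_def)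
qed

lemma modular_multiplicative_unitary_pair:
  fixes W :: "'h::chilbert_space \<otimes>\<^sub>H 'h \<Rightarrow>\<^sub>L 'h \<otimes>\<^sub>H 'h"
  assumes "modular_multiplicative_unitary W"
  obtains Wt Qh Q where "modular_pair W Wt Qh Q"
proof -
  obtain Qh Q :: "'h graph" and Wt :: "'h conjugate \<otimes>\<^sub>H 'h \<Rightarrow>\<^sub>L 'h conjugate \<otimes>\<^sub>H 'h" where
    Qh: "positive_self_adjoint Qh" "trivial_kernel Qh" and Q: "positive_self_adjoint Q" "trivial_kernel Q"
    and Wt: "unitary Wt"
    and inv: "{(\<xi>, adj W \<eta>) | \<xi> \<eta>. (W \<xi>, \<eta>) \<in> Qh \<otimes>\<^sub>g Q} = Qh \<otimes>\<^sub>g Q"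
    and mod: "\<And>x z y Qy u v. (y, Qy) \<in> Q \<Longrightarrow> (v, u) \<in> Q \<Longrightarrow>
      cinner (x \<otimes>\<^sub>v y) (W (z \<otimes>\<^sub>v u)) = cinner (Conj z \<otimes>\<^sub>v Qy) (Wt (Conj x \<otimes>\<^sub>v v))"
    using assms unfolding modular_multiplicative_unitary_def
    by (elim conjE exE) (rule that; assumption?; fastforce)
  have W: "unitary W" and pent: "leg23 W o\<^sub>L leg12 W = leg12 W o\<^sub>L leg13 W o\<^sub>L leg23 W"
    using assms by (auto simp: modular_multiplicative_unitary_def multiplicative_unitary_def)
  note bW = unitaryD(1)[OF W] and bWt = unitaryD(1)[OF Wt]
  have sym: "symmetric_graph (Qh \<otimes>\<^sub>g Q)"
    by (intro symmetric_graph_tensor positive_self_adjoint_symmetric Qh Q)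
  have inv': "(W \<xi>, W \<eta>) \<in> Qh \<otimes>\<^sub>g Q" if "(\<xi>, \<eta>) \<in> Qh \<otimes>\<^sub>g Q" for \<xi> \<eta>
  proof -
    have "(\<xi>, \<eta>) \<in> {(\<xi>, adj W \<eta>) | \<xi> \<eta>. (W \<xi>, \<eta>) \<in> Qh \<otimes>\<^sub>g Q}" using that by (simp only: inv)
    then show ?thesis using W by auto
  qed
  \<comment> \<open>Invariance and symmetry of \<open>Qh \<otimes>\<^sub>g Q\<close> move both
    operators from one side of the matrix entry to the other. The modular relation then cancels
    \<open>Q\<close>, which leaves \<open>Qh\<close> and vectors from total sets.\<close>
  have "half_modular W Wt Qh"
  proof
    fix x x' z' z y u
    assume x: "(x, x') \<in> Qh" and z: "(z', z) \<in> Qh"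
    let ?l = "\<lambda>y u. cinner (x' \<otimes>\<^sub>v y) (W (z' \<otimes>\<^sub>v u))"
      and ?r = "\<lambda>y u. cinner (Conj z \<otimes>\<^sub>v y) (Wt (Conj x \<otimes>\<^sub>v u))"
    note bl = bounded_linear_compose[OF bounded_linear_cinner_left] bounded_linear_tensor_right
      bounded_linear_compose[OF bounded_linear_cinner_right] bounded_linear_compose[OF blinfun.bounded_linear_right]
    have 1: "?l y u = ?r y u" if yu: "y \<in> Range Q" "u \<in> Domain Q" for y u
    proof -
      from yu obtain y0 u1 where yu: "(y0, y) \<in> Q" "(u, u1) \<in> Q" by blast
      have "?l y u = cinner (x \<otimes>\<^sub>v y0) (W (z \<otimes>\<^sub>v u1))"
        by (rule symmetric_graphD[OF sym graph_tensorI[OF x yu(1)] inv'[OF graph_tensorI[OF z yu(2)]]])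
      then show ?thesis by (simp only: mod[OF yu])
    qed
    have 2: "?l y u = ?r y u" if u: "u \<in> Domain Q" for y u
    proof (rule closed_span_eq[of y "Range Q" "\<lambda>y. ?l y u"])
      show "y \<in> closed_span (Range Q)" by (simp add: positive_self_adjoint_Range[OF Q])
    qed (use 1 u in \<open>auto intro!: bl\<close>)
    show "?l y u = ?r y u"
    proof (rule closed_span_eq[of u "Domain Q" "\<lambda>u. ?l y u"])
      show "u \<in> closed_span (Domain Q)" by (simp add: positive_self_adjoint_Domain[OF Q(1)])
    qed (use 2 in \<open>auto intro!: bl\<close>)
  qed (use Qh in \<open>auto simp: W Wt pent positive_self_adjoint_Domain positive_self_adjoint_Range positive_self_adjoint_def\<close>)
  \<comment> \<open>For the dual, the modular relation is already of the required form after a flip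
    and a complex conjugation.\<close>
  moreover have "half_modular (flipped (adj W)) (barred Wt) Q"
  proof
    fix x x' z' z y u
    assume x: "(x, x') \<in> Q" and z: "(z', z) \<in> Q"
    have "cinner (x' \<otimes>\<^sub>v y) (flipped (adj W) (z' \<otimes>\<^sub>v u)) = cinner (flip (y \<otimes>\<^sub>v x')) (flip (adj W (u \<otimes>\<^sub>v z')))"
      by (simp add: flipped_def)
    also have "\<dots> = cnj (cinner (u \<otimes>\<^sub>v z') (W (y \<otimes>\<^sub>v x')))"
      unfolding flip_cinner cinner_adj_right[OF bW] by (rule cinner_commute)
    also have "cinner (u \<otimes>\<^sub>v z') (W (y \<otimes>\<^sub>v x')) = cinner (Conj y \<otimes>\<^sub>v z) (Wt (Conj u \<otimes>\<^sub>v x))"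
      by (rule mod[OF z x])
    finally show "cinner (x' \<otimes>\<^sub>v y) (flipped (adj W) (z' \<otimes>\<^sub>v u)) = cinner (Conj z \<otimes>\<^sub>v y) (barred Wt (Conj x \<otimes>\<^sub>v u))"
      by (simp add: cinner_barred[OF bWt])
  qed (use Q in \<open>auto simp: W Wt unitary_flipped unitary_adj unitary_barred pentagon_flipped_adj[OF bW pent]
      positive_self_adjoint_Domain positive_self_adjoint_Range positive_self_adjoint_def\<close>)
  ultimately show ?thesis by (intro that[of Wt Qh Q] modular_pair.intro)
qed

section \<open>Multipliers from the pentagon equations\<close>

lemma barred_barred: "T \<in> bop \<Longrightarrow> barred (barred T) = T"
  by (rule tensor_conj_cinner_eqI) (simp add: cinner_barred)

text \<open>Dualising is an involution, as \<open>flipped\<close>, \<open>adj\<close> and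
  \<open>barred\<close> each undo themselves; results for \<open>W\<close> therefore hold for its
  dual.\<close>

lemma modular_pair_dual:
  assumes "modular_pair W Wt P P'"
  shows "modular_pair (flipped (adj W)) (barred Wt) P' P"
proof -
  interpret modular_pair W Wt P P' by fact
  show ?thesis
    by (intro modular_pair.intro dual.half_modular_axioms)
      (simp add: adj_flipped barred_barred half_modular_axioms)
qed

lemma (in half_modular) alg_eq: "alg = qg_algebra W"
  by (simp add: alg_def qg_algebra_eq)

lemma modular_pair_qg_algebra:
  assumes "modular_pair W Wt P P'"
  shows "star_algebra (qg_algebra W)" "nondegenerate (qg_algebra W)"
    "tight_mult (qg_algebra W) W" "tight_mult (qg_algebra W) (adj W)"
proof -
  interpret modular_pair W Wt P P' by fact
  show "star_algebra (qg_algebra W)" "nondegenerate (qg_algebra W)"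
    "tight_mult (qg_algebra W) W" "tight_mult (qg_algebra W) (adj W)"
    using star_algebra_alg nondegenerate_alg tight_mult_W tight_mult_adj_W by (simp_all add: alg_eq)
qed

lemma modular_qg_algebra:
  assumes "modular_multiplicative_unitary W"
  shows "star_algebra (qg_algebra W)" "nondegenerate (qg_algebra W)"
    "tight_mult (qg_algebra W) W" "tight_mult (qg_algebra W) (adj W)"
    "star_algebra (dual_algebra W)" "nondegenerate (dual_algebra W)"
    "tight_mult (dual_algebra W) (flipped W)" "tight_mult (dual_algebra W) (flipped (adj W))"
proof -
  obtain Wt P P' where W: "modular_pair W Wt P P'"
    using modular_multiplicative_unitary_pair[OF assms] .
  have b: "W \<in> bop"
    using assms by (auto simp: modular_multiplicative_unitary_def multiplicative_unitary_def dest: unitaryD)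
  show "star_algebra (qg_algebra W)" "nondegenerate (qg_algebra W)"
    "tight_mult (qg_algebra W) W" "tight_mult (qg_algebra W) (adj W)"
    by (rule modular_pair_qg_algebra[OF W])+
  show "star_algebra (dual_algebra W)" "nondegenerate (dual_algebra W)"
    "tight_mult (dual_algebra W) (flipped W)" "tight_mult (dual_algebra W) (flipped (adj W))"
    using modular_pair_qg_algebra[OF modular_pair_dual[OF W]]
    by (simp_all add: b dual_algebra_eq adj_flipped)
qed

text \<open>\<open>mid C A\<close> is \<open>C \<otimes> H \<otimes> A\<close>, with the vectors of the middle leg as columns.\<close>

definition mid :: "('a::chilbert_space \<Rightarrow>\<^sub>L 'a) set \<Rightarrow> ('c::chilbert_space \<Rightarrow>\<^sub>L 'c) set
    \<Rightarrow> ('a \<otimes>\<^sub>H 'c \<Rightarrow>\<^sub>L 'a \<otimes>\<^sub>H 'b::chilbert_space \<otimes>\<^sub>H 'c) set" where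
  "mid C A = closed_span {insM g o\<^sub>L (c \<otimes>\<^sub>o a) | g c a. c \<in> C \<and> a \<in> A}"

lemma midI: "c \<in> C \<Longrightarrow> a \<in> A \<Longrightarrow> insM g o\<^sub>L (c \<otimes>\<^sub>o a) \<in> mid C A"
  unfolding mid_def by (rule closed_span_base) blast

lemma subspace_mid [simp, intro]: "subspace (mid C A)"
  and closed_mid [simp, intro]: "closed (mid C A)"
  by (auto simp: mid_def)

lemma mid_image:
  fixes f :: "('a::chilbert_space \<otimes>\<^sub>H 'c::chilbert_space \<Rightarrow>\<^sub>L 'a \<otimes>\<^sub>H 'b::chilbert_space \<otimes>\<^sub>H 'c)
      \<Rightarrow> 'd::real_normed_vector"
  assumes R: "R \<in> mid C A" and f: "bounded_linear f"
    and M: "\<And>(g::'b) c a. c \<in> C \<Longrightarrow> a \<in> A \<Longrightarrow> f (insM g o\<^sub>L (c \<otimes>\<^sub>o a)) \<in> M" "subspace M" "closed M"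
  shows "f R \<in> M"
  by (rule closed_span_image[OF R[unfolded mid_def] f]) (use M in auto)

lemma tight_image_on:
  fixes f :: "('c::chilbert_space \<Rightarrow>\<^sub>L 'a::chilbert_space \<otimes>\<^sub>H 'c) \<Rightarrow> 'd::real_normed_vector"
  assumes R: "R \<in> tight A" and A: "A \<subseteq> bop" and f: "bounded_linear_on bop f"
    and M: "\<And>(g::'a) a. a \<in> A \<Longrightarrow> f (ketL g o\<^sub>L a) \<in> M" "subspace M" "closed M"
  shows "f R \<in> M"
  by (rule closed_span_image_on[OF R[unfolded tight_def] _ _ _ f]) (use M A in auto)

lemma leg23_mid:
  assumes T: "tight_mult A T" and CA: "C \<subseteq> bop" "A \<subseteq> bop" and R: "R \<in> mid C A"
  shows "leg23 T o\<^sub>L R \<in> mid C A"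
proof (rule mid_image[OF R bounded_linear_compose_right])
  fix g c a assume c: "c \<in> C" and a: "a \<in> A"
  have b: "T \<in> bop" "c \<in> bop" "a \<in> bop" using tight_multD(1)[OF T] CA c a by auto
  have "leg23 T o\<^sub>L (insM g o\<^sub>L (c \<otimes>\<^sub>o a)) = c \<otimes>\<^sub>o (T o\<^sub>L ketL g o\<^sub>L a)"
    by (rule tensor_op_eqI) (simp add: b)
  moreover have "T o\<^sub>L ketL g o\<^sub>L a \<in> tight A"
    using T a by (simp add: tight_mult_def)
  then have "c \<otimes>\<^sub>o (T o\<^sub>L ketL g o\<^sub>L a) \<in> mid C A"
  proof (rule tight_image_on[OF _ CA(2) bounded_linear_on_tensor_right[OF b(2)]])
    fix g a assume a: "a \<in> A"
    have "c \<otimes>\<^sub>o (ketL g o\<^sub>L a) = insM g o\<^sub>L (c \<otimes>\<^sub>o a)"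
      using a CA(2) b(2) by (intro tensor_op_eqI) (auto simp: subset_iff)
    then show "c \<otimes>\<^sub>o (ketL g o\<^sub>L a) \<in> mid C A" using midI[OF c a] by simp
  qed auto
  ultimately show "leg23 T o\<^sub>L (insM g o\<^sub>L (c \<otimes>\<^sub>o a)) \<in> mid C A" by simp
qed auto

text \<open>Here the algebra sits on the first leg and the vector on the second, so the columns that
  \<open>S\<close> must preserve are those of the flipped operator.\<close>

lemma leg12_mid:
  fixes S :: "'a::chilbert_space \<otimes>\<^sub>H 'b::chilbert_space \<Rightarrow>\<^sub>L 'a \<otimes>\<^sub>H 'b"
  assumes S: "tight_mult C (flipped S)" and CA: "C \<subseteq> bop" "A \<subseteq> bop" and R: "R \<in> mid C A"
  shows "leg12 S o\<^sub>L R \<in> mid C A"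
proof (rule mid_image[OF R bounded_linear_compose_right])
  fix g :: 'b and c a assume c: "c \<in> C" and a: "a \<in> A"
  have "S = flipped (flipped S)" by simp
  then have "S \<in> bop" using tight_multD(1)[OF S] bop_flipped by metis
  then have b: "S \<in> bop" "c \<in> bop" "a \<in> bop" using CA c a by auto
  let ?f = "\<lambda>R :: 'a \<Rightarrow>\<^sub>L 'b \<otimes>\<^sub>H 'a. assoc o\<^sub>L ((flip o\<^sub>L R) \<otimes>\<^sub>o a)"
  have "leg12 S o\<^sub>L (insM g o\<^sub>L (c \<otimes>\<^sub>o a)) = ?f (flipped S o\<^sub>L ketL g o\<^sub>L c)"
    by (rule tensor_op_eqI) (simp add: b flipped_def leg12_apply)
  moreover have "flipped S o\<^sub>L ketL g o\<^sub>L c \<in> tight C"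
    using S c by (simp add: tight_mult_def)
  then have "?f (flipped S o\<^sub>L ketL g o\<^sub>L c) \<in> mid C A"
  proof (rule tight_image_on[OF _ CA(1)])
    show "bounded_linear_on bop ?f"
      by (rule bounded_linear_on_comp[OF bounded_linear_imp_on[OF bounded_linear_compose_right] _
            bounded_linear_on_comp[OF bounded_linear_on_tensor_left[OF b(3)] _
              bounded_linear_imp_on[OF bounded_linear_compose_right, where D = bop]]]) (auto simp: b)
    fix g :: 'b and c assume c: "c \<in> C"
    have "?f (ketL g o\<^sub>L c) = insM g o\<^sub>L (c \<otimes>\<^sub>o a)"
      using c CA(1) b(3) by (intro tensor_op_eqI) (auto simp: subset_iff)
    then show "?f (ketL g o\<^sub>L c) \<in> mid C A" using midI[OF c a] by simp
  qed auto
  ultimately show "leg12 S o\<^sub>L (insM g o\<^sub>L (c \<otimes>\<^sub>o a)) \<in> mid C A" by simp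
qed auto

section \<open>Spatial tensor products and their multipliers\<close>

lemma star_algebraI:
  assumes "subspace A" "closed A" "A \<subseteq> bop" "\<And>c x. x \<in> A \<Longrightarrow> op_scale c x \<in> A"
    "\<And>x. x \<in> A \<Longrightarrow> adj x \<in> A" "\<And>x y. x \<in> A \<Longrightarrow> y \<in> A \<Longrightarrow> x o\<^sub>L y \<in> A"
  shows "star_algebra A"
  using assms by (auto simp: star_algebra_def)

text \<open>Coefficients of a linear combination are absorbed into the first factor, so plain sums
  already form the span.\<close>

lemma spatial_tensor_eq:
  assumes B: "subspace B" "B \<subseteq> bop" and D: "subspace D" "D \<subseteq> bop"
  shows "B \<otimes>\<^sub>s D = closed_span {b \<otimes>\<^sub>o d | b d. b \<in> B \<and> d \<in> D}" (is "_ = closed_span ?G")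
proof -
  have "span ?G = {\<Sum>i<n. b i \<otimes>\<^sub>o d i | (n::nat) b d. \<forall>i<n. b i \<in> B \<and> d i \<in> D}" (is "_ = ?S")
  proof
    show "?S \<subseteq> span ?G"
      by clarify (rule span_sum, rule span_base, blast)
    show "span ?G \<subseteq> ?S"
    proof
      fix x assume "x \<in> span ?G"
      then obtain t r where t: "finite t" "t \<subseteq> ?G" and x: "x = (\<Sum>a\<in>t. r a *\<^sub>R a)"
        by (auto simp: span_explicit)
      obtain h where h: "bij_betw h {0..<card t} t" using ex_bij_betw_nat_finite[OF t(1)] ..
      have h_t: "h i \<in> t" if "i < card t" for i using h that by (auto simp: bij_betw_def)
      have "\<forall>a\<in>t. \<exists>b d. a = b \<otimes>\<^sub>o d \<and> b \<in> B \<and> d \<in> D" using t(2) by blast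
      then obtain b d where bd: "\<And>a. a \<in> t \<Longrightarrow> a = b a \<otimes>\<^sub>o d a \<and> b a \<in> B \<and> d a \<in> D" by metis
      have "x = (\<Sum>i\<in>{0..<card t}. r (h i) *\<^sub>R h i)"
        unfolding x by (rule sum.reindex_bij_betw[OF h, symmetric])
      also have "\<dots> = (\<Sum>i<card t. (r (h i) *\<^sub>R b (h i)) \<otimes>\<^sub>o d (h i))"
      proof (rule sum.cong)
        fix i assume "i \<in> {..<card t}"
        then have "h i \<in> t" using h_t by simp
        note this[THEN bd]
        then have "r (h i) *\<^sub>R h i = r (h i) *\<^sub>R (b (h i) \<otimes>\<^sub>o d (h i))" "b (h i) \<in> bop" "d (h i) \<in> bop"
          using B(2) D(2) by auto
        then show "r (h i) *\<^sub>R h i = (r (h i) *\<^sub>R b (h i)) \<otimes>\<^sub>o d (h i)"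
          by (simp only: op_tensor_scaleR_left)
      qed auto
      finally have "x = (\<Sum>i<card t. (r (h i) *\<^sub>R b (h i)) \<otimes>\<^sub>o d (h i))" .
      moreover have "\<forall>i<card t. r (h i) *\<^sub>R b (h i) \<in> B \<and> d (h i) \<in> D"
        using bd[OF h_t] subspace_scale[OF B(1)] by blast
      ultimately show "x \<in> ?S"
        by (intro CollectI exI[of _ "card t"] exI[of _ "\<lambda>i. r (h i) *\<^sub>R b (h i)"] exI[of _ "\<lambda>i. d (h i)"]) simp
    qed
  qed
  then show ?thesis by (simp add: spatial_tensor_def closed_span_def)
qed

lemma star_algebra_spatial_tensor:
  assumes B: "star_algebra B" and D: "star_algebra D"
  shows "star_algebra (B \<otimes>\<^sub>s D)"
proof -
  note b = star_algebraD[OF B] and d = star_algebraD[OF D]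
  let ?G = "{b \<otimes>\<^sub>o d | b d. b \<in> B \<and> d \<in> D}"
  have G: "?G \<subseteq> bop" using b(4) d(4) by auto
  have "star_algebra (closed_span ?G)"
  proof (rule star_algebraI)
    show "closed_span ?G \<subseteq> bop" by (rule closed_span_bop[OF G])
    fix x y assume x: "x \<in> closed_span ?G" and y: "y \<in> closed_span ?G"
    have G_I: "b \<otimes>\<^sub>o d \<in> closed_span ?G" if "b \<in> B" "d \<in> D" for b d
      using that by (intro closed_span_base) blast
    show "op_scale c x \<in> closed_span ?G" for c
      by (rule closed_span_image[OF x bounded_linear_op_scale])
        (auto simp: b(4,5) d(4) G_I simp flip: op_tensor_op_scale_left)
    show "adj x \<in> closed_span ?G"
      by (rule closed_span_adj[OF x G]) (auto simp: adj_op_tensor b(4,6) d(4,6) G_I)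
    show "x o\<^sub>L y \<in> closed_span ?G"
      by (rule closed_span_bilinear[OF x y bounded_bilinear_compose])
        (auto simp: op_tensor_compose b(4,7) d(4,7) G_I)
  qed auto
  then show ?thesis by (simp only: spatial_tensor_eq b d)
qed

lemma op_tensor_spatial_tensor:
  assumes "star_algebra B" "star_algebra D" "b \<in> B" "d \<in> D"
  shows "b \<otimes>\<^sub>o d \<in> B \<otimes>\<^sub>s D"
proof -
  note B = star_algebraD[OF assms(1)] and D = star_algebraD[OF assms(2)]
  show ?thesis unfolding spatial_tensor_eq[OF B(1,3) D(1,3)] using assms(3,4) by (intro closed_span_base) blast
qed

lemma nondegenerate_spatial_tensor:
  assumes B: "star_algebra B" "nondegenerate B" and D: "star_algebra D" "nondegenerate D"
  shows "nondegenerate (B \<otimes>\<^sub>s D)"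
proof -
  let ?M = "closed_span {blinfun_apply t \<xi> | t \<xi>. t \<in> B \<otimes>\<^sub>s D}"
  have "x \<otimes>\<^sub>v y \<in> ?M" for x y
  proof (rule closed_span_bilinear[OF _ _ bounded_bilinear_tensor])
    show "x \<in> closed_span {blinfun_apply b x | b x. b \<in> B}" "y \<in> closed_span {blinfun_apply d y | d y. d \<in> D}"
      using B(2) D(2) by (auto simp: nondegenerate_def)
    fix s t assume "s \<in> {blinfun_apply b x | b x. b \<in> B}" "t \<in> {blinfun_apply d y | d y. d \<in> D}"
    then obtain b x d y where s: "s = blinfun_apply b x" "t = blinfun_apply d y" "b \<in> B" "d \<in> D" by blast
    then have "s \<otimes>\<^sub>v t = (b \<otimes>\<^sub>o d) (x \<otimes>\<^sub>v y)"
      using star_algebraD(4)[OF B(1)] star_algebraD(4)[OF D(1)] by simp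
    then show "s \<otimes>\<^sub>v t \<in> ?M"
      using op_tensor_spatial_tensor[OF B(1) D(1) s(3,4)] by (auto intro!: closed_span_base)
  qed auto
  then have "\<xi> \<in> ?M" for \<xi>
    using tensor_linear_mem[of "\<lambda>x. x" ?M \<xi>] by (simp add: bounded_linear_ident)
  then show ?thesis by (auto simp: nondegenerate_def)
qed

lemma mid_slice:
  assumes C: "star_algebra C" and A: "star_algebra A" and R: "R \<in> mid C A"
  shows "adj (insM p) o\<^sub>L R \<in> C \<otimes>\<^sub>s A"
proof (rule mid_image[OF R bounded_linear_compose_right])
  note B = star_algebraD[OF star_algebra_spatial_tensor[OF C A]]
  fix g c a assume c: "c \<in> C" and a: "a \<in> A"
  have "adj (insM p) o\<^sub>L (insM g o\<^sub>L (c \<otimes>\<^sub>o a)) = op_scale (cinner p g) (c \<otimes>\<^sub>o a)"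
    using star_algebraD(4)[OF C c] star_algebraD(4)[OF A a]
    by (intro tensor_op_eqI) (simp add: insM_def adj_op_tensor op_scale_apply tensor_scaleC_right)
  then show "adj (insM p) o\<^sub>L (insM g o\<^sub>L (c \<otimes>\<^sub>o a)) \<in> C \<otimes>\<^sub>s A"
    using B(5) op_tensor_spatial_tensor[OF C A c a] by simp
qed (use star_algebraD(1,2)[OF star_algebra_spatial_tensor[OF C A]] in auto)

text \<open>As in \<open>tight_mult_leg13\<close>, a nonzero vector is inserted into the middle leg,
  sliced off again and divided out.\<close>

lemma spatial_tensor_mult_leg13:
  fixes T :: "'a::chilbert_space \<otimes>\<^sub>H 'c::chilbert_space \<Rightarrow>\<^sub>L 'a \<otimes>\<^sub>H 'c"
  assumes C: "star_algebra C" and A: "star_algebra A" and T: "T \<in> bop"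
    and leg: "\<And>R :: 'a \<otimes>\<^sub>H 'c \<Rightarrow>\<^sub>L 'a \<otimes>\<^sub>H 'a \<otimes>\<^sub>H 'c. R \<in> mid C A \<Longrightarrow> leg13 T o\<^sub>L R \<in> mid C A"
    and x: "x \<in> C \<otimes>\<^sub>s A"
  shows "T o\<^sub>L x \<in> C \<otimes>\<^sub>s A"
proof -
  note B = star_algebraD[OF star_algebra_spatial_tensor[OF C A]]
  note c = star_algebraD[OF C] and a = star_algebraD[OF A]
  have "T o\<^sub>L (c \<otimes>\<^sub>o a) \<in> C \<otimes>\<^sub>s A" if ca: "c \<in> C" "a \<in> A" for c a
  proof (cases "\<exists>p :: 'a. p \<noteq> 0")
    case True
    then obtain p :: 'a where p: "p \<noteq> 0" by blast
    let ?R = "insM p o\<^sub>L (c \<otimes>\<^sub>o a) :: 'a \<otimes>\<^sub>H 'c \<Rightarrow>\<^sub>L 'a \<otimes>\<^sub>H 'a \<otimes>\<^sub>H 'c"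
    have "adj (insM p) o\<^sub>L (leg13 T o\<^sub>L ?R) \<in> C \<otimes>\<^sub>s A"
      by (intro mid_slice[OF C A] leg midI ca)
    then have "(1 / (norm p)\<^sup>2) *\<^sub>R ((adj (insM p) o\<^sub>L leg13 T) o\<^sub>L ?R) \<in> C \<otimes>\<^sub>s A"
      by (intro subspace_scale B(1)) (simp add: compose_assoc)
    also have "(1 / (norm p)\<^sup>2) *\<^sub>R ((adj (insM p) o\<^sub>L leg13 T) o\<^sub>L ?R) = T o\<^sub>L (c \<otimes>\<^sub>o a)"
      unfolding adj_insM_leg13[OF T]
      using p c(4)[OF ca(1)] a(4)[OF ca(2)] by (intro tensor_op_eqI)
        (simp add: insM_def adj_op_tensor tensor_scaleC_right bop_scaleC[OF T] blinfun.scaleR_left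
          cinner_self scaleR_scaleC scaleC_scaleC)
    finally show ?thesis .
  next
    case False
    then have "T o\<^sub>L (c \<otimes>\<^sub>o a) = 0"
      by (intro tensor_op_eqI) (metis tensor_zero_left blinfun.zero_right)
    then show ?thesis using subspace_0[OF B(1)] by simp
  qed
  note gen = this
  show ?thesis
    by (rule closed_span_image[OF x[unfolded spatial_tensor_eq[OF c(1,3) a(1,3)]] bounded_linear_compose_right])
      (use gen B in auto)
qed

text \<open>Right multiplication by \<open>U\<close> is the adjoint of left multiplication by
  \<open>adj U\<close>.\<close>

lemma unitary_multipliersI:
  assumes B: "star_algebra B" and U: "unitary U"
    and mult: "\<And>b. b \<in> B \<Longrightarrow> U o\<^sub>L b \<in> B" "\<And>b. b \<in> B \<Longrightarrow> adj U o\<^sub>L b \<in> B"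
  shows "U \<in> unitary_multipliers B"
proof -
  note b = star_algebraD[OF B] and u = unitaryD(1)[OF U]
  have "b o\<^sub>L U \<in> B" if "b \<in> B" for b
  proof -
    have "b o\<^sub>L U = adj (adj U o\<^sub>L adj b)" using b(4)[OF that] u by (simp add: adj_compose)
    then show ?thesis using b(6) mult(2) that by metis
  qed
  then show ?thesis using U u mult by (simp add: unitary_multipliers_def multipliers_def)
qed

text \<open>The order of the two equations matters. The one with \<open>WA\<close> has
  \<open>U\<close> otherwise on legs 12, where boundedness suffices, and yields tightness of
  \<open>U\<close>. The one with \<open>WC\<close> has \<open>U\<close> on legs 23, where this
  tightness is needed.\<close>

lemma pentagon_unitary_multipliers:
  fixes WC :: "'c::chilbert_space \<otimes>\<^sub>H 'c \<Rightarrow>\<^sub>L 'c \<otimes>\<^sub>H 'c"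
    and WA :: "'a::chilbert_space \<otimes>\<^sub>H 'a \<Rightarrow>\<^sub>L 'a \<otimes>\<^sub>H 'a"
  assumes WC: "modular_multiplicative_unitary WC" and WA: "modular_multiplicative_unitary WA"
    and U: "unitary U"
    and eqC: "leg23 U o\<^sub>L leg12 WC = leg12 WC o\<^sub>L leg13 U o\<^sub>L leg23 U"
    and eqA: "leg23 WA o\<^sub>L leg12 U = leg12 U o\<^sub>L leg13 U o\<^sub>L leg23 WA"
  shows "U \<in> unitary_multipliers (dual_algebra WC \<otimes>\<^sub>s qg_algebra WA)"
proof -
  let ?C = "dual_algebra WC" and ?A = "qg_algebra WA"
  note C = modular_qg_algebra(5-8)[OF WC] and A = modular_qg_algebra(1-4)[OF WA]
  have uC: "unitary WC" and uA: "unitary WA"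
    using WC WA by (auto simp: modular_multiplicative_unitary_def multiplicative_unitary_def)
  note b = unitaryD(1)[OF uC] unitaryD(1)[OF uA] unitaryD(1)[OF U]
  have A13: "leg13 U = leg12 (adj U) o\<^sub>L (leg23 WA o\<^sub>L (leg12 U o\<^sub>L leg23 (adj WA)))"
  proof -
    have "leg12 (adj U) o\<^sub>L (leg23 WA o\<^sub>L (leg12 U o\<^sub>L leg23 (adj WA)))
        = leg12 (adj U) o\<^sub>L (leg23 WA o\<^sub>L leg12 U) o\<^sub>L leg23 (adj WA)"
      by (simp only: compose_assoc)
    also have "\<dots> = (leg12 (adj U) o\<^sub>L leg12 U) o\<^sub>L leg13 U o\<^sub>L (leg23 WA o\<^sub>L leg23 (adj WA))"
      unfolding eqA by (simp only: compose_assoc)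
    also have "\<dots> = leg13 U"
      by (simp add: b unitaryD[OF U] unitaryD[OF uA] flip: leg_compose)
    finally show ?thesis by simp
  qed
  have C13: "leg13 U = leg12 (adj WC) o\<^sub>L (leg23 U o\<^sub>L (leg12 WC o\<^sub>L leg23 (adj U)))"
  proof -
    have "leg12 (adj WC) o\<^sub>L (leg23 U o\<^sub>L (leg12 WC o\<^sub>L leg23 (adj U)))
        = leg12 (adj WC) o\<^sub>L (leg23 U o\<^sub>L leg12 WC) o\<^sub>L leg23 (adj U)"
      by (simp only: compose_assoc)
    also have "\<dots> = (leg12 (adj WC) o\<^sub>L leg12 WC) o\<^sub>L leg13 U o\<^sub>L (leg23 U o\<^sub>L leg23 (adj U))"
      unfolding eqC by (simp only: compose_assoc)
    also have "\<dots> = leg13 U"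
      by (simp add: b unitaryD[OF U] unitaryD[OF uC] flip: leg_compose)
    finally show ?thesis by simp
  qed
  have A13': "leg13 (adj U) = leg23 WA o\<^sub>L (leg12 (adj U) o\<^sub>L (leg23 (adj WA) o\<^sub>L leg12 U))"
    using arg_cong[OF A13, of adj] by (simp add: adj_compose adj_leg b compose_assoc)
  have C13': "leg13 (adj U) = leg23 U o\<^sub>L (leg12 (adj WC) o\<^sub>L (leg23 (adj U) o\<^sub>L leg12 WC))"
    using arg_cong[OF C13, of adj] by (simp add: adj_compose adj_leg b compose_assoc)
  have tU: "tight_mult ?A U"
  proof (rule tight_mult_leg13[OF b(3)])
    fix R :: "'a \<Rightarrow>\<^sub>L 'c \<otimes>\<^sub>H 'a \<otimes>\<^sub>H 'a" assume R: "R \<in> tight3 ?A"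
    show "leg13 U o\<^sub>L R \<in> tight3 ?A"
      unfolding A13 compose_assoc
      by (rule leg12_tight3[OF bop_adj[OF b(3)] leg23_tight3[OF A(3)
              leg12_tight3[OF b(3) leg23_tight3[OF A(4) R]]]])
  qed
  have tU': "tight_mult ?A (adj U)"
  proof (rule tight_mult_leg13[OF bop_adj[OF b(3)]])
    fix R :: "'a \<Rightarrow>\<^sub>L 'c \<otimes>\<^sub>H 'a \<otimes>\<^sub>H 'a" assume R: "R \<in> tight3 ?A"
    show "leg13 (adj U) o\<^sub>L R \<in> tight3 ?A"
      unfolding A13' compose_assoc
      by (rule leg23_tight3[OF A(3) leg12_tight3[OF bop_adj[OF b(3)]
              leg23_tight3[OF A(4) leg12_tight3[OF b(3) R]]]])
  qed
  note bops = star_algebraD(3)[OF C(1)] star_algebraD(3)[OF A(1)]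
  note l12 = leg12_mid[OF C(3) bops] leg12_mid[OF C(4) bops]
    and l23 = leg23_mid[OF tU bops] leg23_mid[OF tU' bops]
  show ?thesis
  \<comment> \<open>The factors on legs 12 are now \<open>WC\<close> and its adjoint, preserved by
    tightness for the dual algebra, and \<open>U\<close> on legs 23 is covered by \<open>tU\<close>
    and \<open>tU'\<close>.\<close>
  proof (rule unitary_multipliersI[OF star_algebra_spatial_tensor[OF C(1) A(1)] U])
    show "U o\<^sub>L x \<in> ?C \<otimes>\<^sub>s ?A" if "x \<in> ?C \<otimes>\<^sub>s ?A" for x
    proof (rule spatial_tensor_mult_leg13[OF C(1) A(1) b(3) _ that])
      fix R :: "'c \<otimes>\<^sub>H 'a \<Rightarrow>\<^sub>L 'c \<otimes>\<^sub>H 'c \<otimes>\<^sub>H 'a" assume R: "R \<in> mid ?C ?A"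
      show "leg13 U o\<^sub>L R \<in> mid ?C ?A"
        unfolding C13 compose_assoc by (rule l12(2)[OF l23(1)[OF l12(1)[OF l23(2)[OF R]]]])
    qed
    show "adj U o\<^sub>L x \<in> ?C \<otimes>\<^sub>s ?A" if "x \<in> ?C \<otimes>\<^sub>s ?A" for x
    proof (rule spatial_tensor_mult_leg13[OF C(1) A(1) bop_adj[OF b(3)] _ that])
      fix R :: "'c \<otimes>\<^sub>H 'a \<Rightarrow>\<^sub>L 'c \<otimes>\<^sub>H 'c \<otimes>\<^sub>H 'a" assume R: "R \<in> mid ?C ?A"
      show "leg13 (adj U) o\<^sub>L R \<in> mid ?C ?A"
        unfolding C13' compose_assoc by (rule l23(1)[OF l12(2)[OF l23(2)[OF l12(1)[OF R]]]])
    qed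
  qed
qed

section \<open>Extension of representations to multipliers\<close>

text \<open>Representations are taken on all bounded operators. Those needed here are given by
  conjugations and legs, so extending to multipliers amounts to evaluation.\<close>

definition star_rep :: "(('a::chilbert_space \<Rightarrow>\<^sub>L 'a) \<Rightarrow> ('b::chilbert_space \<Rightarrow>\<^sub>L 'b)) \<Rightarrow> bool" where
  "star_rep \<Phi> \<longleftrightarrow> bounded_linear_on bop \<Phi> \<and> (\<forall>x\<in>bop. \<Phi> x \<in> bop \<and> \<Phi> (adj x) = adj (\<Phi> x) \<and>
     (\<forall>c. \<Phi> (op_scale c x) = op_scale c (\<Phi> x)) \<and> (\<forall>y\<in>bop. \<Phi> (x o\<^sub>L y) = \<Phi> x o\<^sub>L \<Phi> y))"

text \<open>Cancellation is the form of nondegeneracy that makes the operator described in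
  \<open>multiplier_ext\<close> unique.\<close>

definition nondegenerate_on :: "('a::chilbert_space \<Rightarrow>\<^sub>L 'a) set \<Rightarrow>
    (('a \<Rightarrow>\<^sub>L 'a) \<Rightarrow> ('b::chilbert_space \<Rightarrow>\<^sub>L 'b)) \<Rightarrow> bool" where
  "nondegenerate_on B \<Phi> \<longleftrightarrow> (\<forall>S T :: 'b \<Rightarrow>\<^sub>L 'b. (\<forall>b\<in>B. S o\<^sub>L \<Phi> b = T o\<^sub>L \<Phi> b) \<longrightarrow> S = T)"

text \<open>Multiplicativity on all bounded operators makes \<open>\<Phi> V\<close> a solution of
  the defining equations, and nondegeneracy excludes any other.\<close>

lemma multiplier_ext_eq:
  assumes B: "B \<subseteq> bop" and \<Phi>: "star_rep \<Phi>" "nondegenerate_on B \<Phi>" and eq: "\<And>b. b \<in> B \<Longrightarrow> \<Psi> b = \<Phi> b"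
    and V: "V \<in> multipliers B"
  shows "multiplier_ext B \<Psi> V = \<Phi> V"
  unfolding multiplier_ext_def
proof (rule the_equality)
  have "\<Psi> (V o\<^sub>L b) = \<Phi> V o\<^sub>L \<Psi> b" if "b \<in> B" for b
    using that V B eq \<Phi>(1) by (auto simp: multipliers_def star_rep_def)
  then show *: "\<Phi> V \<in> bop \<and> (\<forall>b\<in>B. \<Phi> V o\<^sub>L \<Psi> b = \<Psi> (V o\<^sub>L b))"
    using V \<Phi>(1) by (auto simp: multipliers_def star_rep_def)
  fix S assume "S \<in> bop \<and> (\<forall>b\<in>B. S o\<^sub>L \<Psi> b = \<Psi> (V o\<^sub>L b))"
  then have "\<forall>b\<in>B. S o\<^sub>L \<Phi> b = \<Phi> V o\<^sub>L \<Phi> b" using * eq by simp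
  then show "S = \<Phi> V" using \<Phi>(2) unfolding nondegenerate_on_def by blast
qed

lemma bounded_linear_on_continuous:
  assumes "bounded_linear_on D f" "subspace D" "B \<subseteq> D"
  shows "continuous_on B f"
  unfolding continuous_on_sequentially comp_def
  by (intro allI impI ballI bounded_linear_on_tendsto[OF assms(1,2)]) (use assms(3) in auto)

text \<open>A continuous homomorphism on the spatial tensor product is determined on finite sums of
  elementary tensors, so a representation with the right values there restricts to
  \<open>hom_tensor\<close>.\<close>

lemma hom_tensor_eq:
  assumes B: "star_algebra B" and D: "star_algebra D" and \<Phi>: "star_rep \<Phi>"
    and eq: "\<And>b d. b \<in> B \<Longrightarrow> d \<in> D \<Longrightarrow> \<Phi> (b \<otimes>\<^sub>o d) = \<phi> b \<otimes>\<^sub>o \<psi> d"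
    and x: "x \<in> B \<otimes>\<^sub>s D"
  shows "hom_tensor B D \<phi> \<psi> x = \<Phi> x"
proof -
  let ?T = "B \<otimes>\<^sub>s D"
  note T = star_algebraD[OF star_algebra_spatial_tensor[OF B D]]
  \<comment> \<open>Cut off by 0 to match the convention in \<open>hom_tensor\<close>.\<close>
  define \<Psi> where "\<Psi> x = (if x \<in> ?T then \<Phi> x else 0)" for x
  have lin: "bounded_linear_on bop \<Phi>" using \<Phi> by (simp add: star_rep_def)
  have cont: "continuous_on ?T \<Phi>" by (rule bounded_linear_on_continuous[OF lin subspace_bop T(3)])
  have "star_hom_on ?T \<Psi>"
    unfolding star_hom_on_def
  proof (intro conjI ballI allI)
    show "continuous_on ?T \<Psi>" using cont by (rule continuous_on_eq) (simp add: \<Psi>_def)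
    show "\<Psi> ` ?T \<subseteq> bop" using \<Phi> T(4) by (auto simp: \<Psi>_def star_rep_def)
    fix x y assume x: "x \<in> ?T" and y: "y \<in> ?T"
    show "\<Psi> (x + y) = \<Psi> x + \<Psi> y"
      using x y T(4) lin subspace_add[OF T(1) x y] by (simp add: \<Psi>_def bounded_linear_on_def)
    show "\<Psi> (x o\<^sub>L y) = \<Psi> x o\<^sub>L \<Psi> y"
      using x y T(4,7) \<Phi> by (simp add: \<Psi>_def star_rep_def)
  next
    fix c x assume "x \<in> ?T"
    then show "\<Psi> (op_scale c x) = op_scale c (\<Psi> x)" "\<Psi> (adj x) = adj (\<Psi> x)"
      using T(4,5,6) \<Phi> by (simp_all add: \<Psi>_def star_rep_def)
  qed
  moreover have "\<Psi> (b \<otimes>\<^sub>o d) = \<phi> b \<otimes>\<^sub>o \<psi> d" if "b \<in> B" "d \<in> D" for b d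
    using eq op_tensor_spatial_tensor[OF B D] that by (simp add: \<Psi>_def)
  moreover have "\<Psi>' = \<Psi>" if h: "star_hom_on ?T \<Psi>'"
      and e: "\<forall>b\<in>B. \<forall>d\<in>D. \<Psi>' (b \<otimes>\<^sub>o d) = \<phi> b \<otimes>\<^sub>o \<psi> d" and z: "\<forall>x. x \<notin> ?T \<longrightarrow> \<Psi>' x = 0" for \<Psi>'
  proof
    fix x
    have zero: "\<Psi>' 0 = 0"
    proof -
      have "\<Psi>' (0 + 0) = \<Psi>' 0 + \<Psi>' 0" using h subspace_0[OF T(1)] unfolding star_hom_on_def by blast
      then show ?thesis by simp
    qed
    have zero': "\<Phi> 0 = 0"
    proof -
      have "\<Phi> (0 *\<^sub>R 0) = 0 *\<^sub>R \<Phi> 0" using lin bop_zero unfolding bounded_linear_on_def by blast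
      then show ?thesis by simp
    qed
    have sums: "\<Psi>' (\<Sum>i<n. b i \<otimes>\<^sub>o d i) = \<Phi> (\<Sum>i<n. b i \<otimes>\<^sub>o d i)"
      if "\<forall>i<n. b i \<in> B \<and> d i \<in> D" for n :: nat and b d
      using that
    proof (induction n)
      case 0
      show ?case by (simp add: zero zero')
    next
      case (Suc n)
      have 1: "(\<Sum>i<n. b i \<otimes>\<^sub>o d i) \<in> ?T" "b n \<otimes>\<^sub>o d n \<in> ?T"
        using Suc.prems by (auto intro!: subspace_sum[OF T(1)] op_tensor_spatial_tensor[OF B D])
      then have "\<Psi>' (\<Sum>i<Suc n. b i \<otimes>\<^sub>o d i) = \<Psi>' (\<Sum>i<n. b i \<otimes>\<^sub>o d i) + \<Psi>' (b n \<otimes>\<^sub>o d n)"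
        using h by (simp add: star_hom_on_def)
      also have "\<dots> = \<Phi> (\<Sum>i<n. b i \<otimes>\<^sub>o d i) + \<Phi> (b n \<otimes>\<^sub>o d n)"
        using Suc e eq by simp
      also have "\<dots> = \<Phi> (\<Sum>i<Suc n. b i \<otimes>\<^sub>o d i)"
        using lin 1 T(4) by (simp add: bounded_linear_on_def)
      finally show ?case .
    qed
    show "\<Psi>' x = \<Psi> x"
    proof (cases "x \<in> ?T")
      case True
      let ?S = "{\<Sum>i<n. b i \<otimes>\<^sub>o d i | (n::nat) b d. \<forall>i<n. b i \<in> B \<and> d i \<in> D}"
      obtain f where f: "\<And>n. f n \<in> ?S" "f \<longlonglongrightarrow> x"
        using True unfolding spatial_tensor_def closure_sequential by blast
      have fT: "f n \<in> ?T" for n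
        using f(1)[of n] closure_subset[of ?S] by (auto simp: spatial_tensor_def)
      have "(\<lambda>n. \<Psi>' (f n)) \<longlonglongrightarrow> \<Psi>' x" "(\<lambda>n. \<Phi> (f n)) \<longlonglongrightarrow> \<Phi> x"
        using h cont fT f(2) True unfolding star_hom_on_def continuous_on_sequentially comp_def by blast+
      moreover have "\<Psi>' (f n) = \<Phi> (f n)" for n using f(1)[of n] sums by auto
      ultimately have "\<Psi>' x = \<Phi> x" using LIMSEQ_unique by simp
      then show ?thesis using True by (simp add: \<Psi>_def)
    qed (use z in \<open>simp add: \<Psi>_def\<close>)
  qed
  moreover have "\<forall>x. x \<notin> ?T \<longrightarrow> \<Psi> x = 0" by (simp add: \<Psi>_def)
  ultimately have "hom_tensor B D \<phi> \<psi> = \<Psi>"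
    unfolding hom_tensor_def by (rule_tac the_equality) blast+
  then show ?thesis using x by (simp add: \<Psi>_def)
qed

lemma op_scale_compose:
  "S \<in> bop \<Longrightarrow> S o\<^sub>L op_scale c T = op_scale c (S o\<^sub>L T)" "op_scale c T o\<^sub>L R = op_scale c (T o\<^sub>L R)"
  by (rule blinfun_eqI; simp add: op_scale_apply bop_scaleC)+

lemma star_rep_id: "star_rep (\<lambda>x. x)"
  by (simp add: star_rep_def bounded_linear_imp_on bounded_linear_ident)

lemma star_rep_conj:
  assumes \<Phi>: "star_rep \<Phi>" and X: "unitary X"
  shows "star_rep (\<lambda>x. X o\<^sub>L \<Phi> x o\<^sub>L adj X)"
proof -
  have b: "X \<in> bop" by (rule unitaryD[OF X])
  have "bounded_linear_on bop (\<lambda>x. X o\<^sub>L \<Phi> x o\<^sub>L adj X)"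
  proof (rule bounded_linear_on_comp[where f = \<Phi> and E = UNIV])
    show "bounded_linear_on bop \<Phi>" using \<Phi> by (simp add: star_rep_def)
    show "bounded_linear_on UNIV (\<lambda>y. X o\<^sub>L y o\<^sub>L adj X)"
      by (intro bounded_linear_imp_on bounded_linear_compose[OF bounded_linear_compose_left] bounded_linear_compose_right)
  qed auto
  moreover have "X o\<^sub>L (\<Phi> x o\<^sub>L \<Phi> y) o\<^sub>L adj X = (X o\<^sub>L \<Phi> x o\<^sub>L adj X) o\<^sub>L (X o\<^sub>L \<Phi> y o\<^sub>L adj X)" for x y
    by (rule blinfun_eqI) (simp add: X)
  ultimately show ?thesis
    using \<Phi> by (simp add: star_rep_def b adj_compose op_scale_compose compose_assoc)
qed

lemma star_rep_tensor_left: "star_rep (\<lambda>T. T \<otimes>\<^sub>o id_blinfun)"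
  by (simp add: star_rep_def bounded_linear_on_tensor_left adj_op_tensor op_tensor_op_scale_left op_tensor_compose)

lemma op_tensor_op_scale_right: "S \<in> bop \<Longrightarrow> T \<in> bop \<Longrightarrow> S \<otimes>\<^sub>o op_scale c T = op_scale c (S \<otimes>\<^sub>o T)"
  by (rule tensor_op_eqI) (simp add: op_scale_apply tensor_scaleC_right)

lemma star_rep_leg23: "star_rep leg23"
  unfolding leg23_def[abs_def]
  by (simp add: star_rep_def bounded_linear_on_tensor_right adj_op_tensor op_tensor_op_scale_right op_tensor_compose)

lemma star_rep_leg12: "star_rep leg12"
  unfolding leg12_def[abs_def] by (rule star_rep_conj[OF star_rep_tensor_left unitary_assoc])

lemma nondegenerate_on_conj:
  fixes X :: "'b::chilbert_space \<Rightarrow>\<^sub>L 'c::chilbert_space"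
  assumes \<Phi>: "nondegenerate_on B \<Phi>" and X: "unitary X"
  shows "nondegenerate_on B (\<lambda>x. X o\<^sub>L \<Phi> x o\<^sub>L adj X)"
  unfolding nondegenerate_on_def
proof (intro allI impI)
  fix S T :: "'c \<Rightarrow>\<^sub>L 'c"
  assume eq: "\<forall>b\<in>B. S o\<^sub>L (X o\<^sub>L \<Phi> b o\<^sub>L adj X) = T o\<^sub>L (X o\<^sub>L \<Phi> b o\<^sub>L adj X)"
  have "(adj X o\<^sub>L S o\<^sub>L X) o\<^sub>L \<Phi> b = (adj X o\<^sub>L T o\<^sub>L X) o\<^sub>L \<Phi> b" if "b \<in> B" for b
  proof (rule blinfun_eqI)
    fix \<xi>
    have "(S o\<^sub>L (X o\<^sub>L \<Phi> b o\<^sub>L adj X)) (X \<xi>) = (T o\<^sub>L (X o\<^sub>L \<Phi> b o\<^sub>L adj X)) (X \<xi>)"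
      using eq that by simp
    then show "((adj X o\<^sub>L S o\<^sub>L X) o\<^sub>L \<Phi> b) \<xi> = ((adj X o\<^sub>L T o\<^sub>L X) o\<^sub>L \<Phi> b) \<xi>"
      by (simp add: X)
  qed
  then have *: "adj X o\<^sub>L S o\<^sub>L X = adj X o\<^sub>L T o\<^sub>L X"
    using \<Phi> unfolding nondegenerate_on_def by blast
  have "S \<eta> = T \<eta>" for \<eta>
  proof -
    have "X ((adj X o\<^sub>L S o\<^sub>L X) (adj X \<eta>)) = X ((adj X o\<^sub>L T o\<^sub>L X) (adj X \<eta>))" by (simp only: *)
    then show ?thesis by (simp add: X)
  qed
  then show "S = T" by (rule blinfun_eqI)
qed

lemma nondegenerate_linear_eq:
  assumes "nondegenerate B" "bounded_linear f" "bounded_linear g"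
    and "\<And>b \<xi>. b \<in> B \<Longrightarrow> f (blinfun_apply b \<xi>) = g (b \<xi>)"
  shows "f \<xi> = g \<xi>"
  by (rule closed_span_eq[OF _ assms(2,3), of _ "{blinfun_apply b \<xi> | b \<xi>. b \<in> B}"])
    (use assms(1,4) in \<open>auto simp: nondegenerate_def\<close>)

lemma nondegenerate_on_id:
  fixes B :: "('a::chilbert_space \<Rightarrow>\<^sub>L 'a) set"
  assumes B: "nondegenerate B"
  shows "nondegenerate_on B (\<lambda>x. x)"
  unfolding nondegenerate_on_def
proof (intro allI impI blinfun_eqI)
  fix S T :: "'a \<Rightarrow>\<^sub>L 'a" and \<xi> assume eq: "\<forall>b\<in>B. S o\<^sub>L b = T o\<^sub>L b"
  show "S \<xi> = T \<xi>"
  proof (rule nondegenerate_linear_eq[OF B, of "blinfun_apply S" "blinfun_apply T"])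
    fix b \<xi> assume "b \<in> B"
    then have "(S o\<^sub>L b) \<xi> = (T o\<^sub>L b) \<xi>" using eq by simp
    then show "S (b \<xi>) = T (b \<xi>)" by simp
  qed (rule blinfun.bounded_linear_right)+
qed

lemma nondegenerate_on_leg23:
  fixes B :: "('a::chilbert_space \<otimes>\<^sub>H 'b::chilbert_space \<Rightarrow>\<^sub>L 'a \<otimes>\<^sub>H 'b) set"
  assumes B: "nondegenerate B" "B \<subseteq> bop"
  shows "nondegenerate_on B (leg23 :: _ \<Rightarrow> ('c::chilbert_space \<otimes>\<^sub>H 'a \<otimes>\<^sub>H 'b \<Rightarrow>\<^sub>L 'c \<otimes>\<^sub>H 'a \<otimes>\<^sub>H 'b))"
  unfolding nondegenerate_on_def
proof (intro allI impI tensor_op_eqI)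
  fix S T :: "'c \<otimes>\<^sub>H 'a \<otimes>\<^sub>H 'b \<Rightarrow>\<^sub>L 'c \<otimes>\<^sub>H 'a \<otimes>\<^sub>H 'b" and x \<xi>
  assume eq: "\<forall>b\<in>B. S o\<^sub>L leg23 b = T o\<^sub>L leg23 b"
  show "S (x \<otimes>\<^sub>v \<xi>) = T (x \<otimes>\<^sub>v \<xi>)"
  proof (rule nondegenerate_linear_eq[OF B(1), of "\<lambda>\<xi>. S (x \<otimes>\<^sub>v \<xi>)" "\<lambda>\<xi>. T (x \<otimes>\<^sub>v \<xi>)"])
    fix b \<xi> assume b: "b \<in> B"
    then have "(S o\<^sub>L leg23 b) (x \<otimes>\<^sub>v \<xi>) = (T o\<^sub>L leg23 b) (x \<otimes>\<^sub>v \<xi>)" using eq by simp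
    then show "S (x \<otimes>\<^sub>v b \<xi>) = T (x \<otimes>\<^sub>v b \<xi>)" using b B(2) by (simp add: subset_iff)
  qed (intro bounded_linear_compose[OF blinfun.bounded_linear_right] bounded_linear_tensor_right)+
qed

lemma nondegenerate_on_leg12:
  fixes B :: "('a::chilbert_space \<otimes>\<^sub>H 'b::chilbert_space \<Rightarrow>\<^sub>L 'a \<otimes>\<^sub>H 'b) set"
  assumes B: "nondegenerate B" "B \<subseteq> bop"
  shows "nondegenerate_on B (leg12 :: _ \<Rightarrow> ('a \<otimes>\<^sub>H 'b \<otimes>\<^sub>H 'c::chilbert_space \<Rightarrow>\<^sub>L 'a \<otimes>\<^sub>H 'b \<otimes>\<^sub>H 'c))"
  unfolding nondegenerate_on_def
proof (intro allI impI tensor3_op_eqI)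
  fix S T :: "'a \<otimes>\<^sub>H 'b \<otimes>\<^sub>H 'c \<Rightarrow>\<^sub>L 'a \<otimes>\<^sub>H 'b \<otimes>\<^sub>H 'c" and x y z
  assume eq: "\<forall>b\<in>B. S o\<^sub>L leg12 b = T o\<^sub>L leg12 b"
  have "S (insR z \<xi>) = T (insR z \<xi>)" for \<xi>
  proof (rule nondegenerate_linear_eq[OF B(1), of "\<lambda>\<xi>. S (insR z \<xi>)" "\<lambda>\<xi>. T (insR z \<xi>)"])
    fix b \<xi> assume b: "b \<in> B"
    then have "(S o\<^sub>L leg12 b) (insR z \<xi>) = (T o\<^sub>L leg12 b) (insR z \<xi>)" using eq by simp
    then show "S (insR z (b \<xi>)) = T (insR z (b \<xi>))" using b B(2) by (simp add: subset_iff)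
  qed (intro bounded_linear_compose[OF blinfun.bounded_linear_right] blinfun.bounded_linear_right)+
  from this[of "x \<otimes>\<^sub>v y"] show "S (x \<otimes>\<^sub>v y \<otimes>\<^sub>v z) = T (x \<otimes>\<^sub>v y \<otimes>\<^sub>v z)" by simp
qed

lemma leg12_op_tensor: "S \<in> bop \<Longrightarrow> T \<in> bop \<Longrightarrow> leg12 (S \<otimes>\<^sub>o T) = S \<otimes>\<^sub>o T \<otimes>\<^sub>o id_blinfun"
  by (rule tensor3_op_eqI) (simp add: leg12_apply)

lemma leg23_op_tensor:
  "S \<in> bop \<Longrightarrow> T \<in> bop \<Longrightarrow> leg23 (S \<otimes>\<^sub>o T) = assoc o\<^sub>L ((id_blinfun \<otimes>\<^sub>o S) \<otimes>\<^sub>o T) o\<^sub>L adj assoc"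
  by (rule tensor3_op_eqI) simp

text \<open>With \<open>X = flip o\<^sub>L adj WC\<close>, the inner conjugation is
  \<open>dual_comult WC\<close>; hence its tensor product with the identity is implemented by a
  unitary on all bounded operators.\<close>

lemma leg12_conj_leg23_op_tensor:
  assumes X: "X \<in> bop" and ST: "S \<in> bop" "T \<in> bop"
  shows "adj assoc o\<^sub>L (leg12 X o\<^sub>L leg23 (S \<otimes>\<^sub>o T) o\<^sub>L adj (leg12 X)) o\<^sub>L adj (adj assoc)
    = (X o\<^sub>L (id_blinfun \<otimes>\<^sub>o S) o\<^sub>L adj X) \<otimes>\<^sub>o T"
proof -
  have "adj assoc o\<^sub>L (leg12 X o\<^sub>L leg23 (S \<otimes>\<^sub>o T) o\<^sub>L adj (leg12 X)) o\<^sub>L adj (adj assoc)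
      = (X \<otimes>\<^sub>o id_blinfun) o\<^sub>L ((id_blinfun \<otimes>\<^sub>o S) \<otimes>\<^sub>o T) o\<^sub>L (adj X \<otimes>\<^sub>o id_blinfun)"
    unfolding adj_leg(1)[OF X] unfolding leg12_def leg23_op_tensor[OF ST] by (rule blinfun_eqI) simp
  then show ?thesis by (simp add: op_tensor_compose X ST)
qed

lemma leg12_flip_conj:
  fixes T :: "'c::chilbert_space \<otimes>\<^sub>H 'b::chilbert_space \<Rightarrow>\<^sub>L 'c \<otimes>\<^sub>H 'b"
  assumes T: "T \<in> bop"
  shows "leg12 flip o\<^sub>L leg23 T = leg13 T o\<^sub>L leg12 flip" "leg12 flip o\<^sub>L leg13 T = leg23 T o\<^sub>L leg12 flip"
    "leg12 flip o\<^sub>L leg12 flip = id_blinfun"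
proof -
  have 1: "leg12 flip (x \<otimes>\<^sub>v \<xi>) = insM x \<xi>" for x :: 'c and \<xi> :: "'c \<otimes>\<^sub>H 'b"
    by (rule tensor_linear_eq[of "\<lambda>\<xi>. leg12 flip (x \<otimes>\<^sub>v \<xi>)"])
      (auto simp: leg12_apply intro!: bounded_linear_compose[OF blinfun.bounded_linear_right]
        bounded_linear_tensor_right blinfun.bounded_linear_right)
  have 2: "leg12 flip (insM x \<xi>) = x \<otimes>\<^sub>v \<xi>" for x :: 'c and \<xi> :: "'c \<otimes>\<^sub>H 'b"
    by (rule tensor_linear_eq[of "\<lambda>\<xi>. leg12 flip (insM x \<xi>)"])
      (auto simp: leg12_apply intro!: bounded_linear_compose[OF blinfun.bounded_linear_right]
        bounded_linear_tensor_right blinfun.bounded_linear_right)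
  show "leg12 flip o\<^sub>L leg23 T = leg13 T o\<^sub>L leg12 flip" "leg12 flip o\<^sub>L leg13 T = leg23 T o\<^sub>L leg12 flip"
    by (rule tensor3_op_eqI; simp add: T leg12_apply leg13_apply 1 2)+
  show "leg12 flip o\<^sub>L leg12 flip = id_blinfun"
    by (rule tensor3_op_eqI) (simp add: leg12_apply)
qed

lemma compose_unitary_eq_iff:
  assumes "unitary Y"
  shows "Z o\<^sub>L adj Y = R \<longleftrightarrow> Z = R o\<^sub>L Y" "adj Y o\<^sub>L Z = R \<longleftrightarrow> Z = Y o\<^sub>L R"
  using unitaryD(2,3)[OF assms] by (metis compose_assoc compose_id)+

lemma bicharacter_iff:
  fixes WC :: "'c::chilbert_space \<otimes>\<^sub>H 'c \<Rightarrow>\<^sub>L 'c \<otimes>\<^sub>H 'c"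
    and WA :: "'a::chilbert_space \<otimes>\<^sub>H 'a \<Rightarrow>\<^sub>L 'a \<otimes>\<^sub>H 'a"
  assumes WC: "modular_multiplicative_unitary WC" and WA: "modular_multiplicative_unitary WA"
  shows "bicharacter WC WA V \<longleftrightarrow> V \<in> unitary_multipliers (dual_algebra WC \<otimes>\<^sub>s qg_algebra WA) \<and>
    leg23 V o\<^sub>L leg12 WC = leg12 WC o\<^sub>L leg13 V o\<^sub>L leg23 V \<and>
    leg23 WA o\<^sub>L leg12 V = leg12 V o\<^sub>L leg13 V o\<^sub>L leg23 WA"
proof (cases "V \<in> unitary_multipliers (dual_algebra WC \<otimes>\<^sub>s qg_algebra WA)")
  case True
  let ?C = "dual_algebra WC" and ?A = "qg_algebra WA"
  note C = modular_qg_algebra(5,6)[OF WC] and A = modular_qg_algebra(1,2)[OF WA]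
  note c = star_algebraD(4)[OF C(1)] and a = star_algebraD(4)[OF A(1)]
  note B = star_algebraD(3)[OF star_algebra_spatial_tensor[OF C(1) A(1)]]
    and Bnd = nondegenerate_spatial_tensor[OF C A]
  have uC: "unitary WC" and uA: "unitary WA"
    using WC WA by (auto simp: modular_multiplicative_unitary_def multiplicative_unitary_def)
  have V: "V \<in> multipliers (?C \<otimes>\<^sub>s ?A)" "V \<in> bop"
    using True by (auto simp: unitary_multipliers_def multipliers_def)
  note b = unitaryD(1)[OF uC] unitaryD(1)[OF uA] V(2)
  \<comment> \<open>This unitary implements \<open>dual_comult WC\<close> by conjugation.\<close>
  let ?X = "flip o\<^sub>L adj WC"
  have uX: "unitary ?X" by (intro unitary_compose unitary_flip unitary_adj uC)
  have adjX: "adj ?X = WC o\<^sub>L flip" by (simp add: adj_compose b)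

  let ?\<Phi> = "\<lambda>x :: 'c \<otimes>\<^sub>H 'a \<Rightarrow>\<^sub>L 'c \<otimes>\<^sub>H 'a. leg12 ?X o\<^sub>L leg23 x o\<^sub>L adj (leg12 ?X)"
  let ?\<Phi>' = "\<lambda>x. adj assoc o\<^sub>L ?\<Phi> x o\<^sub>L adj (adj assoc)"
  have rep1: "star_rep ?\<Phi>'" "nondegenerate_on (?C \<otimes>\<^sub>s ?A) ?\<Phi>'"
    by (intro star_rep_conj nondegenerate_on_conj star_rep_leg23 nondegenerate_on_leg23 Bnd B
        unitary_leg unitary_adj unitary_assoc uX)+
  have tensor1: "?\<Phi>' (x \<otimes>\<^sub>o y) = dual_comult WC x \<otimes>\<^sub>o y" if "x \<in> ?C" "y \<in> ?A" for x y
  proof -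
    have xy: "x \<in> bop" "y \<in> bop" using that c a by auto
    have "?\<Phi>' (x \<otimes>\<^sub>o y) = (?X o\<^sub>L (id_blinfun \<otimes>\<^sub>o x) o\<^sub>L adj ?X) \<otimes>\<^sub>o y"
      by (rule leg12_conj_leg23_op_tensor[OF unitaryD(1)[OF uX] xy])
    also have "\<dots> = dual_comult WC x \<otimes>\<^sub>o y"
      unfolding adjX by (simp add: dual_comult_def compose_assoc)
    finally show ?thesis .
  qed
  have ext1: "multiplier_ext (?C \<otimes>\<^sub>s ?A) (hom_tensor ?C ?A (dual_comult WC) (\<lambda>a. a)) V = ?\<Phi>' V"
    by (rule multiplier_ext_eq[OF B rep1 _ V(1)])
      (rule hom_tensor_eq[OF C(1) A(1) rep1(1) tensor1])
  have eq1: "assoc o\<^sub>L ?\<Phi>' V o\<^sub>L adj assoc = ?\<Phi> V"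
    by (rule blinfun_eqI) simp

  let ?\<Psi> = "\<lambda>x :: 'c \<otimes>\<^sub>H 'a \<Rightarrow>\<^sub>L 'c \<otimes>\<^sub>H 'a. leg23 WA o\<^sub>L leg12 x o\<^sub>L adj (leg23 WA)"
  have rep2: "star_rep ?\<Psi>" "nondegenerate_on (?C \<otimes>\<^sub>s ?A) ?\<Psi>"
    by (intro star_rep_conj nondegenerate_on_conj star_rep_leg12 nondegenerate_on_leg12 Bnd B unitary_leg uA)+
  have tensor2: "?\<Psi> (x \<otimes>\<^sub>o y) = x \<otimes>\<^sub>o qg_comult WA y" if "x \<in> ?C" "y \<in> ?A" for x y
    using c[OF that(1)] a[OF that(2)]
    by (simp add: leg12_op_tensor adj_leg b) (simp add: leg23_def op_tensor_compose qg_comult_def b)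
  have ext2: "multiplier_ext (?C \<otimes>\<^sub>s ?A) (hom_tensor ?C ?A (\<lambda>c. c) (qg_comult WA)) V = ?\<Psi> V"
    by (rule multiplier_ext_eq[OF B rep2 _ V(1)])
      (rule hom_tensor_eq[OF C(1) A(1) rep2(1) tensor2])

  \<comment> \<open>The flip in \<open>dual_comult\<close> exchanges legs 13 and 23, which
    reconciles the order in the bicharacter equation with that in the pentagon equation.\<close>
  have flip_V: "leg12 flip o\<^sub>L (leg23 V o\<^sub>L leg13 V) = leg13 V o\<^sub>L leg23 V o\<^sub>L leg12 flip"
    unfolding compose_assoc[symmetric] leg12_flip_conj(1)[OF V(2)]
    unfolding compose_assoc leg12_flip_conj(2)[OF V(2)] ..
  have flip: "adj (leg12 flip) = (leg12 flip :: 'c \<otimes>\<^sub>H 'c \<otimes>\<^sub>H 'a \<Rightarrow>\<^sub>L _)" "unitary (leg12 flip :: 'c \<otimes>\<^sub>H 'c \<otimes>\<^sub>H 'a \<Rightarrow>\<^sub>L _)"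
    by (simp_all add: adj_leg unitary_leg)
  have leg12_X: "adj (leg12 ?X) = (leg12 WC o\<^sub>L leg12 flip :: 'c \<otimes>\<^sub>H 'c \<otimes>\<^sub>H 'a \<Rightarrow>\<^sub>L _)"
    "leg12 ?X = (leg12 flip o\<^sub>L leg12 (adj WC) :: 'c \<otimes>\<^sub>H 'c \<otimes>\<^sub>H 'a \<Rightarrow>\<^sub>L _)"
    unfolding adj_leg(1)[OF unitaryD(1)[OF uX]] adjX by (intro leg_compose bop_flip bop_adj b)+
  have "?\<Phi> V = leg23 V o\<^sub>L leg13 V \<longleftrightarrow>
      leg12 flip o\<^sub>L (leg12 (adj WC) o\<^sub>L leg23 V o\<^sub>L leg12 WC o\<^sub>L leg12 flip) = leg23 V o\<^sub>L leg13 V"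
    unfolding leg12_X(1) by (simp only: leg12_X(2) compose_assoc)
  also have "\<dots> \<longleftrightarrow> leg12 (adj WC) o\<^sub>L leg23 V o\<^sub>L leg12 WC o\<^sub>L leg12 flip = leg13 V o\<^sub>L leg23 V o\<^sub>L leg12 flip"
    using compose_unitary_eq_iff(2)[OF flip(2)] by (simp only: flip(1) flip_V)
  also have "\<dots> \<longleftrightarrow> leg12 (adj WC) o\<^sub>L leg23 V o\<^sub>L leg12 WC = leg13 V o\<^sub>L leg23 V"
    unfolding compose_unitary_eq_iff(1)[OF flip(2), unfolded flip(1)]
    by (simp only: compose_assoc leg12_flip_conj(3)[OF V(2)] compose_id)
  also have "\<dots> \<longleftrightarrow> leg23 V o\<^sub>L leg12 WC = leg12 WC o\<^sub>L leg13 V o\<^sub>L leg23 V"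
    using compose_unitary_eq_iff(2)[OF unitary_leg(1)[OF uC]] by (simp only: adj_leg b compose_assoc)
  finally have iff1: "?\<Phi> V = leg23 V o\<^sub>L leg13 V \<longleftrightarrow> leg23 V o\<^sub>L leg12 WC = leg12 WC o\<^sub>L leg13 V o\<^sub>L leg23 V" .
  have iff2: "?\<Psi> V = leg12 V o\<^sub>L leg13 V \<longleftrightarrow> leg23 WA o\<^sub>L leg12 V = leg12 V o\<^sub>L leg13 V o\<^sub>L leg23 WA"
    by (rule compose_unitary_eq_iff(1)[OF unitary_leg(2)[OF uA]])
  show ?thesis
    unfolding bicharacter_def ext1 ext2 eq1 iff1 iff2 using True by simp
qed (simp add: bicharacter_def)

text \<open>The inclusion is the restriction of the identity representation, so its extension fixes
  every multiplier.\<close>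

lemma comes_from_iff:
  assumes WC: "modular_multiplicative_unitary WC" and WA: "modular_multiplicative_unitary WA"
    and V: "bicharacter WC WA V"
  shows "comes_from WC WA U V \<longleftrightarrow> V = U"
proof -
  note C = modular_qg_algebra(5,6)[OF WC] and A = modular_qg_algebra(1,2)[OF WA]
  have "V \<in> multipliers (dual_algebra WC \<otimes>\<^sub>s qg_algebra WA)"
    using V by (simp add: bicharacter_def unitary_multipliers_def)
  then show ?thesis
    unfolding comes_from_def
    by (subst multiplier_ext_eq[OF star_algebraD(3)[OF star_algebra_spatial_tensor[OF C(1) A(1)]] star_rep_id
          nondegenerate_on_id[OF nondegenerate_spatial_tensor[OF C A]]]) auto
qed

theorem lemma3p4:
  fixes WC :: "'c::chilbert_space \<otimes>\<^sub>H 'c \<Rightarrow>\<^sub>L 'c \<otimes>\<^sub>H 'c"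
    and WA :: "'a::chilbert_space \<otimes>\<^sub>H 'a \<Rightarrow>\<^sub>L 'a \<otimes>\<^sub>H 'a"
    and U :: "'c \<otimes>\<^sub>H 'a \<Rightarrow>\<^sub>L 'c \<otimes>\<^sub>H 'a"
  assumes "modular_multiplicative_unitary WC"
    and "modular_multiplicative_unitary WA"
    and "unitary U"
  shows "((\<exists>V. bicharacter WC WA V \<and> comes_from WC WA U V) \<longleftrightarrow>
           leg23 U o\<^sub>L leg12 WC = leg12 WC o\<^sub>L leg13 U o\<^sub>L leg23 U \<and>
           leg23 WA o\<^sub>L leg12 U = leg12 U o\<^sub>L leg13 U o\<^sub>L leg23 WA) \<and>
         (\<forall>V V'. bicharacter WC WA V \<and> comes_from WC WA U V \<and>
           bicharacter WC WA V' \<and> comes_from WC WA U V' \<longrightarrow> V = V')"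
proof -
  \<comment> \<open>\<open>U\<close> is its own candidate: existence reduces to
    \<open>bicharacter WC WA U\<close>, and uniqueness follows at once.\<close>
  have eq: "V = U" if "bicharacter WC WA V \<and> comes_from WC WA U V" for V
    using that comes_from_iff[OF assms(1,2), of V U] by simp
  have ex: "(\<exists>V. bicharacter WC WA V \<and> comes_from WC WA U V) \<longleftrightarrow> bicharacter WC WA U"
    using eq comes_from_iff[OF assms(1,2), of U U] by metis
  have iff: "bicharacter WC WA U \<longleftrightarrow> leg23 U o\<^sub>L leg12 WC = leg12 WC o\<^sub>L leg13 U o\<^sub>L leg23 U \<and>
      leg23 WA o\<^sub>L leg12 U = leg12 U o\<^sub>L leg13 U o\<^sub>L leg23 WA"
    using bicharacter_iff[OF assms(1,2), of U] pentagon_unitary_multipliers[OF assms] by argo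
  show ?thesis
    unfolding ex iff[symmetric] using eq by (intro conjI refl allI impI) (metis (no_types))
qed

end
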